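(* Let $R$ be a ring with CL-FFRT, let $I_1,\dots,I_r\subseteq R$ be ideals and $i_1,\dots,i_r\ge 0$ be integers. Then the iterated local cohomology module $H^{i_1}_{I_1}\circ\cdots\circ H^{i_r}_{I_r}(R)=H^{i_1}_{I_1}\big(H^{i_2}_{I_2}(\cdots H^{i_r}_{I_r}(R)\cdots)\big)$ has a finite number of associated primes (as an $R$-module).
   Context: Let $p$ be a prime. For a commutative ring $R$ of characteristic $p$, an $R$-module $M$ and $e\ge 0$, $F^e_*M$ denotes the abelian group $M$ with the $R$-module structure $x\cdot u=x^{p^e}u$. A commutative ring $R$ of characteristic $p$ is $F$-finite if it is Noetherian and $F_*R=F^1_*R$ is a finitely generated $R$-module. For a complete Noetherian local ring $S$ and a finitely generated $S$-module $M$, $\mathcal{J}(M)$ denotes the finite set of isomorphism classes of indecomposable $S$-modules occurring in the (Krull–Schmidt) decomposition of $M$ into indecomposables. A complete local $F$-finite ring $S$ has FFRT (finite $F$-representation type) if $\bigcup_{e\ge 0}\mathcal{J}(F^e_*S)$ is finite. A ring $R$ has CL-FFRT (complete local finite $F$-representation type) if it is $F$-finite and for every prime $\mathfrak p\subseteq R$ the completion $\widehat{R}_{\mathfrak p}$ of the local ring $R_{\mathfrak p}$ has FFRT. $H^i_I(-)$ denotes the $i$-th local cohomology functor with support in the ideal $I$. *)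

theory Defs
  imports "HOL-Algebra.Module" "HOL-Algebra.Ideal_Product" "HOL-Algebra.QuotRing"
    "HOL-Algebra.Ring_Divisibility" "HOL-Computational_Algebra.Primes"
begin

section \<open>Rings\<close>

definition has_char :: "('a, 'k) ring_scheme \<Rightarrow> nat \<Rightarrow> bool" where
  "has_char R p \<longleftrightarrow> (\<forall>n::nat. add_pow R n \<one>\<^bsub>R\<^esub> = \<zero>\<^bsub>R\<^esub> \<longleftrightarrow> p dvd n)"

primrec ideal_pow :: "('a, 'k) ring_scheme \<Rightarrow> 'a set \<Rightarrow> nat \<Rightarrow> 'a set" where
  "ideal_pow R I 0 = carrier R"
| "ideal_pow R I (Suc n) = I \<cdot>\<^bsub>R\<^esub> ideal_pow R I n"

definition frac_rel :: "('a, 'k) ring_scheme \<Rightarrow> 'a set \<Rightarrow> (('a \<times> 'a) \<times> ('a \<times> 'a)) set" where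
  "frac_rel R P = {((a, s), (b, t)).
     a \<in> carrier R \<and> b \<in> carrier R \<and> s \<in> carrier R - P \<and> t \<in> carrier R - P \<and>
     (\<exists>u \<in> carrier R - P. u \<otimes>\<^bsub>R\<^esub> (a \<otimes>\<^bsub>R\<^esub> t \<ominus>\<^bsub>R\<^esub> b \<otimes>\<^bsub>R\<^esub> s) = \<zero>\<^bsub>R\<^esub>)}"

definition fraction :: "('a, 'k) ring_scheme \<Rightarrow> 'a set \<Rightarrow> 'a \<Rightarrow> 'a \<Rightarrow> ('a \<times> 'a) set" where
  "fraction R P a s = frac_rel R P `` {(a, s)}"

text \<open>The local ring \<open>R\<^sub>P\<close> for a prime ideal \<open>P\<close>.  Sums and products are computed on
  representatives; each union below is a union of copies of one and the same class.\<close>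

definition localization :: "('a, 'k) ring_scheme \<Rightarrow> 'a set \<Rightarrow> ('a \<times> 'a) set ring" where
  "localization R P = \<lparr>
     carrier = (carrier R \<times> (carrier R - P)) // frac_rel R P,
     monoid.mult = (\<lambda>u v. \<Union>x \<in> u. \<Union>y \<in> v.
              fraction R P (fst x \<otimes>\<^bsub>R\<^esub> fst y) (snd x \<otimes>\<^bsub>R\<^esub> snd y)),
     one = fraction R P \<one>\<^bsub>R\<^esub> \<one>\<^bsub>R\<^esub>,
     zero = fraction R P \<zero>\<^bsub>R\<^esub> \<one>\<^bsub>R\<^esub>,
     add = (\<lambda>u v. \<Union>x \<in> u. \<Union>y \<in> v.
              fraction R P (fst x \<otimes>\<^bsub>R\<^esub> snd y \<oplus>\<^bsub>R\<^esub> fst y \<otimes>\<^bsub>R\<^esub> snd x)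
                (snd x \<otimes>\<^bsub>R\<^esub> snd y))\<rparr>"

definition localization_max :: "('a, 'k) ring_scheme \<Rightarrow> 'a set \<Rightarrow> ('a \<times> 'a) set set" where
  "localization_max R P = {fraction R P a s | a s. a \<in> P \<and> s \<in> carrier R - P}"

text \<open>The \<open>I\<close>-adic completion of \<open>A\<close>, i.e. the inverse limit of the rings \<open>A / I\<^sup>n\<close>: since the
  transition map sends a coset of \<open>I\<^sup>n\<^sup>+\<^sup>1\<close> to the coset of \<open>I\<^sup>n\<close> containing it, compatible
  sequences are exactly the decreasing ones.\<close>

definition completion :: "('a, 'k) ring_scheme \<Rightarrow> 'a set \<Rightarrow> (nat \<Rightarrow> 'a set) ring" where
  "completion A I = \<lparr>
     carrier = {f. \<forall>n. f n \<in> carrier (A Quot ideal_pow A I n) \<and> f (Suc n) \<subseteq> f n},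
     monoid.mult = (\<lambda>f g n. f n \<otimes>\<^bsub>A Quot ideal_pow A I n\<^esub> g n),
     one = (\<lambda>n. \<one>\<^bsub>A Quot ideal_pow A I n\<^esub>),
     zero = (\<lambda>n. \<zero>\<^bsub>A Quot ideal_pow A I n\<^esub>),
     add = (\<lambda>f g n. f n \<oplus>\<^bsub>A Quot ideal_pow A I n\<^esub> g n)\<rparr>"

definition completed_localization ::
  "('a, 'k) ring_scheme \<Rightarrow> 'a set \<Rightarrow> (nat \<Rightarrow> ('a \<times> 'a) set set) ring" where
  "completed_localization R P = completion (localization R P) (localization_max R P)"

section \<open>Modules\<close>

text \<open>The record type \<open>module\<close> also carries the ring fields \<open>mult\<close> and \<open>one\<close>; they play no role
  in the locale \<open>module\<close>, nor in any of the notions below.\<close>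

definition ring_module :: "('a, 'k) ring_scheme \<Rightarrow> ('a, 'a) module" where
  "ring_module R = \<lparr>carrier = carrier R, monoid.mult = monoid.mult R, one = one R, zero = zero R,
     add = add R, smult = monoid.mult R\<rparr>"

definition mod_hom ::
  "('a, 'k) ring_scheme \<Rightarrow> ('a, 'm, 'x) module_scheme \<Rightarrow> ('a, 'n, 'y) module_scheme \<Rightarrow> ('m \<Rightarrow> 'n) set"
  where
  "mod_hom R M N = {h \<in> carrier M \<rightarrow> carrier N.
     (\<forall>x \<in> carrier M. \<forall>y \<in> carrier M. h (x \<oplus>\<^bsub>M\<^esub> y) = h x \<oplus>\<^bsub>N\<^esub> h y) \<and>
     (\<forall>r \<in> carrier R. \<forall>x \<in> carrier M. h (r \<odot>\<^bsub>M\<^esub> x) = r \<odot>\<^bsub>N\<^esub> h x)}"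

definition mod_iso ::
  "('a, 'k) ring_scheme \<Rightarrow> ('a, 'm, 'x) module_scheme \<Rightarrow> ('a, 'n, 'y) module_scheme \<Rightarrow> bool" where
  "mod_iso R M N \<longleftrightarrow> (\<exists>h \<in> mod_hom R M N. bij_betw h (carrier M) (carrier N))"

definition quotient_module ::
  "('a, 'm, 'x) module_scheme \<Rightarrow> 'm set \<Rightarrow> ('a, 'm set) module" where
  "quotient_module M K = \<lparr>
     carrier = a_rcosets\<^bsub>M\<^esub> K, monoid.mult = undefined, one = undefined, zero = K, add = set_add M,
     smult = (\<lambda>r u. \<Union>x \<in> u. K +>\<^bsub>M\<^esub> (r \<odot>\<^bsub>M\<^esub> x))\<rparr>"

definition finitely_generated_module ::
  "('a, 'k) ring_scheme \<Rightarrow> ('a, 'm, 'x) module_scheme \<Rightarrow> bool" where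
  "finitely_generated_module R M \<longleftrightarrow> (\<exists>A \<subseteq> carrier M. finite A \<and>
     (\<forall>x \<in> carrier M. \<exists>c \<in> A \<rightarrow> carrier R. x = (\<Oplus>\<^bsub>M\<^esub>a \<in> A. c a \<odot>\<^bsub>M\<^esub> a)))"

definition associated_primes ::
  "('a, 'k) ring_scheme \<Rightarrow> ('a, 'm, 'x) module_scheme \<Rightarrow> 'a set set" where
  "associated_primes R M = {P. primeideal P R \<and>
     (\<exists>x \<in> carrier M. P = {r \<in> carrier R. r \<odot>\<^bsub>M\<^esub> x = \<zero>\<^bsub>M\<^esub>})}"

section \<open>Finite $F$-representation type\<close>

text \<open>\<open>frobenius_pushforward p e R M\<close> is $F^e_*M$.\<close>

definition frobenius_pushforward ::
  "nat \<Rightarrow> nat \<Rightarrow> ('a, 'k) ring_scheme \<Rightarrow> ('a, 'm) module \<Rightarrow> ('a, 'm) module" where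
  "frobenius_pushforward p e R M = M\<lparr>smult := (\<lambda>x u. (x [^]\<^bsub>R\<^esub> (p ^ e)) \<odot>\<^bsub>M\<^esub> u)\<rparr>"

definition F_finite :: "nat \<Rightarrow> ('a, 'k) ring_scheme \<Rightarrow> bool" where
  "F_finite p R \<longleftrightarrow> noetherian_ring R \<and>
     finitely_generated_module R (frobenius_pushforward p 1 R (ring_module R))"

definition indecomposable_module ::
  "('a, 'k) ring_scheme \<Rightarrow> ('a, 'm, 'x) module_scheme \<Rightarrow> bool" where
  "indecomposable_module R M \<longleftrightarrow> module R M \<and> carrier M \<noteq> {\<zero>\<^bsub>M\<^esub>} \<and>
     (\<forall>A B. submodule A R M \<and> submodule B R M \<and>
        A \<inter> B = {\<zero>\<^bsub>M\<^esub>} \<and> A <+>\<^bsub>M\<^esub> B = carrier M \<longrightarrow>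
        A = {\<zero>\<^bsub>M\<^esub>} \<or> B = {\<zero>\<^bsub>M\<^esub>})"

text \<open>\<open>\<D>\<close> is a finite set of submodules of \<open>M\<close>, each indecomposable, whose internal direct sum
  is \<open>M\<close>.  Nonzero submodules that form a direct sum are pairwise distinct as subsets of \<open>M\<close>
  (even if isomorphic), so nothing is lost by using a set instead of a family.\<close>

definition indecomposable_decomposition ::
  "('a, 'k) ring_scheme \<Rightarrow> ('a, 'm) module \<Rightarrow> 'm set set \<Rightarrow> bool" where
  "indecomposable_decomposition R M \<D> \<longleftrightarrow> finite \<D> \<and>
     (\<forall>N \<in> \<D>. submodule N R M \<and> indecomposable_module R (M\<lparr>carrier := N\<rparr>)) \<and>
     bij_betw (\<lambda>x. \<Oplus>\<^bsub>M\<^esub>N \<in> \<D>. x N) (\<Pi>\<^sub>E N \<in> \<D>. N) (carrier M)"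

definition iso_class ::
  "('a, 'k) ring_scheme \<Rightarrow> ('a, 'm) module \<Rightarrow> ('a, 'm) module set" where
  "iso_class R M = {N. module R N \<and> mod_iso R M N}"

text \<open>The set $\mathcal{J}(M)$.  Isomorphism classes are taken among the modules on the element
  type of \<open>M\<close>, which contain all submodules of \<open>M\<close>.\<close>

definition indecomposable_summands ::
  "('a, 'k) ring_scheme \<Rightarrow> ('a, 'm) module \<Rightarrow> ('a, 'm) module set set" where
  "indecomposable_summands R M = {iso_class R (M\<lparr>carrier := N\<rparr>) | N \<D>.
     indecomposable_decomposition R M \<D> \<and> N \<in> \<D>}"

text \<open>Only meaningful for complete local $F$-finite rings \<open>S\<close>.\<close>

definition FFRT :: "nat \<Rightarrow> ('a, 'k) ring_scheme \<Rightarrow> bool" where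
  "FFRT p S \<longleftrightarrow>
     finite (\<Union>e. indecomposable_summands S (frobenius_pushforward p e S (ring_module S)))"

definition CL_FFRT :: "nat \<Rightarrow> ('a, 'k) ring_scheme \<Rightarrow> bool" where
  "CL_FFRT p R \<longleftrightarrow> F_finite p R \<and>
     (\<forall>P. primeideal P R \<longrightarrow> FFRT p (completed_localization R P))"

section \<open>Local cohomology\<close>

text \<open>Local cohomology is the right derived functor of the torsion functor
  $\Gamma_I(M) = \{x \in M \mid I^n x = 0 \mbox{ for some } n\}$.\<close>

definition torsion_module ::
  "('a, 'k) ring_scheme \<Rightarrow> 'a set \<Rightarrow> ('a, 'm) module \<Rightarrow> ('a, 'm) module" where
  "torsion_module R I M = M\<lparr>carrier :=
     {x \<in> carrier M. \<exists>n. \<forall>a \<in> ideal_pow R I n. a \<odot>\<^bsub>M\<^esub> x = \<zero>\<^bsub>M\<^esub>}\<rparr>"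

text \<open>HOL cannot quantify over modules on all types.  It suffices to let the test modules \<open>A\<close>, \<open>B\<close>
  range over those whose elements have the element type of \<open>R\<close>: the inclusions of ideals into \<open>R\<close>
  are among the resulting embeddings, so by Baer's criterion the extension property then holds for
  all embeddings of modules on arbitrary types.\<close>

definition injective_module :: "('a, 'k) ring_scheme \<Rightarrow> ('a, 'e) module \<Rightarrow> bool" where
  "injective_module R E \<longleftrightarrow> module R E \<and>
     (\<forall>(A :: ('a, 'a) module) (B :: ('a, 'a) module) j f.
        module R A \<and> module R B \<and> j \<in> mod_hom R A B \<and> inj_on j (carrier A) \<and>
        f \<in> mod_hom R A E \<longrightarrow>
        (\<exists>g \<in> mod_hom R B E. \<forall>x \<in> carrier A. g (j x) = f x))"

text \<open>\<open>0 \<rightarrow> M \<rightarrow> E 0 \<rightarrow> E 1 \<rightarrow> \<dots>\<close> is exact, with augmentation \<open>\<epsilon>\<close> and differentials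
  \<open>d n : E n \<rightarrow> E (n + 1)\<close>, and every \<open>E n\<close> is injective.\<close>

definition injective_resolution ::
  "('a, 'k) ring_scheme \<Rightarrow> ('a, 'm) module \<Rightarrow> ('m \<Rightarrow> 'e) \<Rightarrow>
   (nat \<Rightarrow> ('a, 'e) module) \<Rightarrow> (nat \<Rightarrow> 'e \<Rightarrow> 'e) \<Rightarrow> bool" where
  "injective_resolution R M \<epsilon> E d \<longleftrightarrow>
     module R M \<and> (\<forall>n. injective_module R (E n)) \<and>
     \<epsilon> \<in> mod_hom R M (E 0) \<and> (\<forall>n. d n \<in> mod_hom R (E n) (E (Suc n))) \<and>
     inj_on \<epsilon> (carrier M) \<and>
     \<epsilon> ` carrier M = a_kernel (E 0) (E 1) (d 0) \<and>
     (\<forall>n. d n ` carrier (E n) = a_kernel (E (Suc n)) (E (Suc (Suc n))) (d (Suc n)))"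

definition cohomology ::
  "(nat \<Rightarrow> ('a, 'e) module) \<Rightarrow> (nat \<Rightarrow> 'e \<Rightarrow> 'e) \<Rightarrow> nat \<Rightarrow> ('a, 'e set) module" where
  "cohomology C d i = quotient_module
     ((C i)\<lparr>carrier := a_kernel (C i) (C (Suc i)) (d i)\<rparr>)
     (case i of 0 \<Rightarrow> {\<zero>\<^bsub>C 0\<^esub>} | Suc j \<Rightarrow> d j ` carrier (C j))"

text \<open>\<open>N\<close> is a model of $H^i_I(M)$, which is determined only up to isomorphism.  The resolution is
  sought on the element type of \<open>N\<close>; if this type is infinite and at least as large as \<open>M\<close> and
  \<open>R\<close>, and \<open>R\<close> is Noetherian, then a resolution exists there.  As statements about models
  are polymorphic in this type, they cover arbitrary resolutions.\<close>

definition local_cohomology ::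
  "('a, 'k) ring_scheme \<Rightarrow> 'a set \<Rightarrow> nat \<Rightarrow> ('a, 'm) module \<Rightarrow> ('a, 'e) module \<Rightarrow> bool" where
  "local_cohomology R I i M N \<longleftrightarrow> module R N \<and>
     (\<exists>\<epsilon> (E :: nat \<Rightarrow> ('a, 'e) module) d. injective_resolution R M \<epsilon> E d \<and>
        mod_iso R N (cohomology (\<lambda>n. torsion_module R I (E n)) d i))"

text \<open>\<open>N\<close> is a model of $H^{i_1}_{I_1}(H^{i_2}_{I_2}(\cdots H^{i_r}_{I_r}(R)\cdots))$ for the list
  $[(I_1, i_1), \dots, (I_r, i_r)]$.\<close>

fun iterated_local_cohomology ::
  "('a, 'k) ring_scheme \<Rightarrow> ('a set \<times> nat) list \<Rightarrow> ('a, 'e) module \<Rightarrow> bool" where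
  "iterated_local_cohomology R [] N \<longleftrightarrow> module R N \<and> mod_iso R N (ring_module R)"
| "iterated_local_cohomology R ((I, i) # L) N \<longleftrightarrow>
     (\<exists>M :: ('a, 'e) module. iterated_local_cohomology R L M \<and> local_cohomology R I i M N)"

end

theory Submission
  imports Defs
begin

text \<open>Two facts are combined.  First, FFRT of the completions of \<open>R\<close> at its primes implies that, for
  some \<open>e\<close>, the identity of $F^e_*R$ factors through a direct sum of modules $F^{e'}_*R$ with
  \<open>e' < e\<close>.  Over a complete local ring this holds because the finitely many indecomposable
  summands all occur at levels below some \<open>e\<close>.  It descends to \<open>R\<^sub>P\<close> by approximating homomorphisms
  adically, and to \<open>R\<close> because the \<open>s\<close> for which multiplication by $s^{p^e}$ factors in this way
  form an ideal.  The factorization then exists at all higher levels too.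

  Second, every iterated local cohomology module is a colimit of subquotients \<open>Z\<^sub>e / B\<^sub>e\<close> of finite
  powers of $F^e_*R$ which are preserved by all homomorphisms $F^e_*R \to F^{e'}_*R$.  Indeed,
  $H^i_I(M)$ is the colimit over \<open>e\<close> of the cohomology of \<open>M\<close> with respect to the sequences
  $x_1^{p^e},\dots,x_t^{p^e}$ of powers of generators of \<open>I\<close>, and the differentials are linear for
  the module structure of $F^e_*R$ with coefficients \<open>x\<^sub>j\<close>.

  An associated prime of such a colimit is the annihilator of a class in some \<open>Z\<^sub>e / B\<^sub>e\<close>, viewed as a
  module via $F^e_*R$.  If the identity of $F^e_*R$ factors through lower levels, then the same prime
  already occurs at a lower level.  So only finitely many levels matter, each of them Noetherian.\<close>

\<comment> \<open>Local cohomology modules are rarely finitely generated, so the finiteness has to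
  come from a bounded range of levels e. Two points make the descent to lower levels possible. The
  transition maps multiply by powers of the x_j with exponents p^e' - p^e and are in general not
  homomorphisms between pushforwards; the descent therefore never uses them, but only that
  homomorphisms from level e to level e' carry B_e into B_e'. And a prime ideal contains r as soon
  as it contains r^(p^e), so a prime that annihilates a class for the ordinary action of R is also
  its annihilator for the action through F^e_*R.

  All F^e_*R are the set R with different scalar actions, so homomorphisms between them are additive
  functions on R that are semilinear in the Frobenius exponents, and one set of functions serves for
  all levels. The descent from the completion avoids flatness and base change of modules: a
  factorization is approximated P-adically on generators, and Krull's intersection theorem makes the
  approximations exact up to a factor outside P.\<close>
text \<open>\<open>x \<oplus>.M y\<close> is the sum in the structure \<open>M\<close>, and similarly for the other operations.\<close>

syntax "_index" :: "logic => index" (\<open>._\<close> [1000])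

section \<open>Frobenius powers\<close>

lemma (in cring) binomial:
 assumes "a \<in> carrier R" "b \<in> carrier R"
 shows "(a \<oplus> b) [^] (n::nat) = (\<Oplus>k\<in>{..n}. add_pow R (n choose k) (a [^] k \<otimes> b [^] (n - k)))"
proof (induction n)
 case 0
 then show ?case using assms by simp
next
 case (Suc n)
 note ab = assms
 define S where "S = (\<Oplus>k\<in>{..n}. add_pow R (n choose k) (a [^] k \<otimes> b [^] (n - k)))"
 define U where "U = (\<Oplus>k\<in>{..n}. add_pow R (n choose k) (a [^] Suc k \<otimes> b [^] (n - k)))"
 define V where "V = (\<Oplus>k\<in>{..n}. add_pow R (n choose k) (a [^] k \<otimes> b [^] (Suc n - k)))"
 have Sc: "S \<in> carrier R" unfolding S_def using ab by (intro finsum_closed) auto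
 have "a \<otimes> S = (\<Oplus>k\<in>{..n}. a \<otimes> add_pow R (n choose k) (a [^] k \<otimes> b [^] (n - k)))"
  unfolding S_def using ab by (intro finsum_rdistr) auto
 also have "\<dots> = U"
  unfolding U_def
  using ab by (intro finsum_cong') (auto simp: add_pow_rdistr m_ac)
 finally have aS: "a \<otimes> S = U" .
 have "b \<otimes> S = (\<Oplus>k\<in>{..n}. b \<otimes> add_pow R (n choose k) (a [^] k \<otimes> b [^] (n - k)))"
  unfolding S_def using ab by (intro finsum_rdistr) auto
 also have "\<dots> = V"
  unfolding V_def
  using ab by (intro finsum_cong') (auto simp: add_pow_rdistr Suc_diff_le m_lcomm m_comm)
 finally have bS: "b \<otimes> S = V" .
 \<comment> \<open>\<open>V'\<close> is \<open>V\<close> without its term k = 0, reindexed, with a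
   zero term on top. The sum over \<open>{..Suc n}\<close> equals \<open>V\<close> because n choose
   n + 1 is zero; splitting off k = 0 instead shows that it is
   \<open>V' \<oplus> b [^] Suc n\<close>.\<close>
 define V' where "V' = (\<Oplus>k\<in>{..n}. add_pow R (n choose Suc k) (a [^] Suc k \<otimes> b [^] (n - k)))"
 have V1: "(\<Oplus>k\<in>{..Suc n}. add_pow R (n choose k) (a [^] k \<otimes> b [^] (Suc n - k))) = V"
  unfolding V_def using ab by (subst finsum_Suc) (auto intro!: l_zero finsum_closed simp: binomial_eq_0)
 have V2: "(\<Oplus>k\<in>{..Suc n}. add_pow R (n choose k) (a [^] k \<otimes> b [^] (Suc n - k))) = V' \<oplus> b [^] Suc n"
  unfolding V'_def using ab by (subst finsum_Suc2) (auto simp del: nat_pow_Suc)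
 have "(\<Oplus>k\<in>{..Suc n}. add_pow R (Suc n choose k) (a [^] k \<otimes> b [^] (Suc n - k)))
   = (\<Oplus>k\<in>{..n}. add_pow R (Suc n choose Suc k) (a [^] Suc k \<otimes> b [^] (n - k))) \<oplus> b [^] Suc n"
  using ab by (subst finsum_Suc2) (auto simp del: nat_pow_Suc binomial_Suc_Suc)
 also have "(\<Oplus>k\<in>{..n}. add_pow R (Suc n choose Suc k) (a [^] Suc k \<otimes> b [^] (n - k))) = U \<oplus> V'"
  unfolding U_def V'_def
  using ab by (subst finsum_addf[symmetric]) (auto simp: add.nat_pow_mult simp del: nat_pow_Suc intro!: finsum_cong')
 finally have *: "(\<Oplus>k\<in>{..Suc n}. add_pow R (Suc n choose k) (a [^] k \<otimes> b [^] (Suc n - k)))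
   = U \<oplus> V' \<oplus> b [^] Suc n" .
 have c: "U \<in> carrier R" "V' \<in> carrier R"
  unfolding U_def V'_def using ab by (auto intro!: finsum_closed simp del: nat_pow_Suc)
 have "(a \<oplus> b) [^] Suc n = S \<otimes> (a \<oplus> b)" using Suc.IH unfolding S_def by simp
 also have "\<dots> = U \<oplus> V" using aS bS Sc ab by (simp add: r_distr m_comm)
 also have "\<dots> = U \<oplus> V' \<oplus> b [^] Suc n" using V1 V2 c ab by (simp add: a_assoc del: nat_pow_Suc)
 finally show ?case using * by simp
qed

definition frob :: "('a, 'k) ring_scheme => nat => nat => 'a => 'a" where
 "frob R p e x = x [^].R (p ^ e)"

text \<open>Characteristic p enters only as p times 1 being 0, a condition that passes along ring
  homomorphisms and so reaches the completions.\<close>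

locale char_ring = cring R for R (structure) +
 fixes p :: nat
 assumes p_prime: "normalization_semidom_class.prime p" and p_char: "add_pow R p \<one> = \<zero>"
begin

lemma p_pos: "p > 0" using p_prime prime_gt_0_nat by blast

lemma add_pow_dvd:
 assumes "x \<in> carrier R" "p dvd n" shows "add_pow R n x = \<zero>"
proof -
 obtain m where m: "n = p * m" using assms by blast
 have "add_pow R p x = add_pow R p (\<one> \<otimes> x)" using assms by simp
 also have "\<dots> = add_pow R p \<one> \<otimes> x" using assms by (subst add_pow_ldistr) auto
 finally have "add_pow R p x = \<zero>" using p_char assms by simp
 then have "add_pow R m (add_pow R p x) = \<zero>" by simp
 then show ?thesis using assms by (simp add: m add.nat_pow_pow)
qed

text \<open>The inner binomial coefficients are divisible by p; the sum is split at both ends to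
  isolate the two outer terms.\<close>

lemma freshman:
 assumes "a \<in> carrier R" "b \<in> carrier R"
 shows "(a \<oplus> b) [^] p = a [^] p \<oplus> b [^] p"
proof -
 obtain n where n: "p = Suc n" using p_pos by (cases p) auto
 have n0: "n \<noteq> 0" using prime_gt_1_nat[OF p_prime] n by auto
 then obtain m where m: "n = Suc m" by (cases n) auto
 let ?t = "\<lambda>k. add_pow R (p choose k) (a [^] k \<otimes> b [^] (p - k))"
 have z: "?t k = \<zero>" if "0 < k" "k < p" for k
  using that assms p_prime by (intro add_pow_dvd) (auto intro: dvd_choose_prime)
 have "(a \<oplus> b) [^] p = (\<Oplus>k\<in>{..p}. ?t k)" by (rule binomial[OF assms])
 also have "{..p} = {..Suc n}" using n by simp
 finally have "(a \<oplus> b) [^] p = (\<Oplus>k\<in>{..Suc n}. ?t k)" .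
 also have "\<dots> = ?t p \<oplus> (\<Oplus>k\<in>{..Suc m}. ?t k)" using assms by (subst finsum_Suc) (auto simp: n m)
 also have "(\<Oplus>k\<in>{..Suc m}. ?t k) = (\<Oplus>k\<in>{..m}. ?t (Suc k)) \<oplus> ?t 0"
  using assms by (subst finsum_Suc2) auto
 also have "(\<Oplus>k\<in>{..m}. ?t (Suc k)) = (\<Oplus>k\<in>{..m}. \<zero>)"
  using z[of "Suc _"] n m by (intro finsum_cong') (auto simp del: binomial_Suc_Suc nat_pow_Suc)
 finally show ?thesis using assms by simp
qed

abbreviation fr :: "nat => 'a => 'a" where "fr e x \<equiv> frob R p e x"
text \<open>The linear combination of the \<open>v u\<close> in F^e_*R: coefficients act through
  their p^e-th powers.\<close>

abbreviation comb :: "nat => 'i set => ('i => 'a) => ('i => 'a) => 'a" where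
 "comb e U c v \<equiv> (\<Oplus>u\<in>U. fr e (c u) \<otimes> v u)"

lemma fr_closed[simp, intro]: "x \<in> carrier R ==> fr e x \<in> carrier R"
 by (simp add: frob_def)

lemma fr_0[simp]: "x \<in> carrier R ==> fr 0 x = x" by (simp add: frob_def)

lemma fr_mult: "x \<in> carrier R ==> y \<in> carrier R ==> fr e (x \<otimes> y) = fr e x \<otimes> fr e y"
 by (simp add: frob_def nat_pow_distrib)

lemma fr_one[simp]: "fr e \<one> = \<one>" by (simp add: frob_def)

lemma fr_add_exp: "x \<in> carrier R ==> fr (d + e) x = fr d (fr e x)"
 by (simp add: frob_def nat_pow_pow power_add mult.commute)

lemma fr_Suc: "x \<in> carrier R ==> fr (Suc e) x = fr e (fr 1 x)"
 using fr_add_exp[of x e 1] by simp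

lemma fr_Suc': "x \<in> carrier R ==> fr (Suc e) x = fr e x [^] p"
 using fr_add_exp[of x 1 e] by (simp add: frob_def)

lemma fr_add: "x \<in> carrier R ==> y \<in> carrier R ==> fr e (x \<oplus> y) = fr e x \<oplus> fr e y"
 by (induction e) (simp_all add: fr_Suc' freshman)

lemma fr_zero[simp]: "fr e \<zero> = \<zero>"
 using fr_add[of \<zero> \<zero> e] by (metis add.l_cancel_one fr_closed l_zero zero_closed)

lemma fr_minus: "x \<in> carrier R ==> fr e (\<ominus> x) = \<ominus> fr e x"
 using fr_add[of "\<ominus> x" x e] by (simp add: l_neg minus_equality)

lemma fr_finsum:
 "finite A ==> f \<in> A \<rightarrow> carrier R ==> fr e (\<Oplus>i\<in>A. f i) = (\<Oplus>i\<in>A. fr e (f i))"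
 by (induction A rule: finite_induct) (auto simp: fr_add finsum_closed Pi_iff)

text \<open>Holds because p^e is at least 1. It lets a factor s be replaced by s^(p^e) wherever only
  membership in an ideal is at stake.\<close>

lemma fr_multiple:
 assumes "x \<in> carrier R" shows "\<exists>y\<in>carrier R. fr e x = y \<otimes> x"
proof -
 obtain k where "p ^ e = Suc k" using p_pos by (metis gr0_implies_Suc zero_less_power)
 then show ?thesis using assms by (auto simp: frob_def intro!: bexI[of _ "x [^] k"])
qed

end

section \<open>Noetherian modules\<close>

text \<open>The maximal condition is taken instead of finite generation since the arguments below
  are Noetherian inductions on submodules.\<close>

definition noeth_module :: "('a, 'k) ring_scheme => ('a, 'm, 'x) module_scheme => bool" where
 "noeth_module R M \<longleftrightarrow> module R M \<and>
   (\<forall>\<S>. \<S> \<noteq> {} \<and> (\<forall>N\<in>\<S>. submodule N R M) --> (\<exists>N\<in>\<S>. \<forall>N'\<in>\<S>. N \<subseteq> N' --> N' = N))"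

lemma noeth_module_imp_module: "noeth_module R M ==> module R M"
 by (simp add: noeth_module_def)

lemma noeth_module_maximal:
 assumes "noeth_module R M" "i0 \<in> I" "!!i. i \<in> I ==> submodule (F i) R M"
 obtains i where "i \<in> I" "!!j. j \<in> I ==> F i \<subseteq> F j ==> F j = F i"
proof -
 have "F ` I \<noteq> {} \<and> (\<forall>N\<in>F ` I. submodule N R M)" using assms(2,3) by auto
 with assms(1)[unfolded noeth_module_def, THEN conjunct2, THEN spec, of "F ` I"]
 have "\<exists>N\<in>F ` I. \<forall>N'\<in>F ` I. N \<subseteq> N' --> N' = N" by (rule mp)
 then show ?thesis using that by auto
qed

lemma (in module) submodule_simps:
 assumes "submodule N R M"
 shows "x \<in> N ==> x \<in> carrier M" "\<zero>.M \<in> N" "x \<in> N ==> y \<in> N ==> x \<oplus>.M y \<in> N"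
  "a \<in> carrier R ==> x \<in> N ==> a \<odot>.M x \<in> N" "x \<in> N ==> \<ominus>.M x \<in> N"
  "x \<in> N ==> y \<in> N ==> x \<ominus>.M y \<in> N"
 using submoduleE[OF assms] subgroup.one_closed[OF submodule.axioms(1)[OF assms]]
 by (auto simp: a_minus_def)

lemma (in module) submoduleI':
 assumes "N \<subseteq> carrier M" "\<zero>.M \<in> N" "!!x y. x \<in> N ==> y \<in> N ==> x \<oplus>.M y \<in> N"
  "!!a x. a \<in> carrier R ==> x \<in> N ==> a \<odot>.M x \<in> N"
 shows "submodule N R M"
proof (rule submoduleI)
 fix x assume x: "x \<in> N"
 have "\<ominus>.M x = (\<ominus> \<one>) \<odot>.M x" using x assms(1) by (simp add: smult_l_minus subsetD)
 then show "\<ominus>.M x \<in> N" using assms(4)[of "\<ominus> \<one>" x] x by simp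
qed (use assms in auto)

lemma mod_homD:
 assumes "h \<in> mod_hom R M N"
 shows "x \<in> carrier M ==> h x \<in> carrier N"
  "x \<in> carrier M ==> y \<in> carrier M ==> h (x \<oplus>.M y) = h x \<oplus>.N h y"
  "r \<in> carrier R ==> x \<in> carrier M ==> h (r \<odot>.M x) = r \<odot>.N h x"
 using assms unfolding mod_hom_def by auto

lemma mod_hom_zero:
 assumes "h \<in> mod_hom R M N" "module R M" "module R N"
 shows "h \<zero>.M = \<zero>.N"
proof -
 interpret M: module R M by fact
 interpret N: module R N by fact
 have "h (\<zero>.R \<odot>.M \<zero>.M) = \<zero>.R \<odot>.N h \<zero>.M"
  using mod_homD(3)[OF assms(1)] M.R.zero_closed M.M.zero_closed by blast
 then show ?thesis using mod_homD(1)[OF assms(1)] by simp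
qed

lemma mod_hom_minus:
 assumes "h \<in> mod_hom R M N" "module R M" "module R N" "x \<in> carrier M" "y \<in> carrier M"
 shows "h (x \<ominus>.M y) = h x \<ominus>.N h y"
proof -
 interpret M: module R M by fact
 interpret N: module R N by fact
 have "h ((x \<ominus>.M y) \<oplus>.M y) = h (x \<ominus>.M y) \<oplus>.N h y"
  using assms mod_homD(2)[OF assms(1)] by simp
 moreover have "(x \<ominus>.M y) \<oplus>.M y = x" using assms by (simp add: a_minus_def M.M.a_assoc M.M.l_neg)
 ultimately show ?thesis using assms mod_homD(1)[OF assms(1)]
  by (simp add: a_minus_def N.M.a_assoc N.M.r_neg)
qed

lemma submodule_image:
 assumes M: "module R M" and L: "module R L" and h: "h \<in> mod_hom R M L" and N: "submodule N R M"
 shows "submodule (h ` N) R L"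
proof -
 interpret M: module R M by fact
 interpret L: module R L by fact
 note sN = M.submodule_simps[OF N] and hD = mod_homD[OF h]
 show ?thesis
 proof (rule L.submoduleI')
  show "h ` N \<subseteq> carrier L" using hD(1) sN(1) by blast
  show "\<zero>.L \<in> h ` N" using mod_hom_zero[OF h M L] sN(2) by force
  show "x \<oplus>.L y \<in> h ` N" if "x \<in> h ` N" "y \<in> h ` N" for x y
   using that hD(2) sN(1,3) by (smt (verit) image_iff)
  show "a \<odot>.L x \<in> h ` N" if "a \<in> carrier R" "x \<in> h ` N" for a x
   using that hD(3) sN(1,4) by (smt (verit) image_iff)
 qed
qed

lemma submodule_vimage:
 assumes M: "module R M" and L: "module R L" and h: "h \<in> mod_hom R M L" and N: "submodule N R L"
 shows "submodule {x \<in> carrier M. h x \<in> N} R M"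
proof -
 interpret M: module R M by fact
 interpret L: module R L by fact
 show ?thesis
  by (rule M.submoduleI') (use mod_hom_zero[OF h M L] mod_homD[OF h] L.submodule_simps[OF N] in auto)
qed

text \<open>Two maximal choices: first the image under h, then, among the members with this image,
  the intersection with the kernel. Nested submodules that agree in both are equal.\<close>

lemma noeth_module_ext:
 assumes M: "module R M" and L: "noeth_module R L" and h: "h \<in> mod_hom R M L"
  and K: "noeth_module R (M\<lparr>carrier := {x \<in> carrier M. h x = \<zero>.L}\<rparr>)" (is "noeth_module R ?K")
 shows "noeth_module R M"
 unfolding noeth_module_def
proof (intro conjI allI impI M)
 fix \<S> assume S: "\<S> \<noteq> {} \<and> (\<forall>N\<in>\<S>. submodule N R M)"
 interpret M: module R M by fact
 interpret L: module R L using noeth_module_imp_module[OF L] .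
 interpret K: module R ?K using noeth_module_imp_module[OF K] .
 have hN: "submodule (h ` N) R L" if "N \<in> \<S>" for N
  by (rule submodule_image[OF M L.module_axioms h]) (use S that in blast)
 have kN: "submodule (N \<inter> carrier ?K) R ?K" if N: "N \<in> \<S>" for N
 proof (rule K.submoduleI')
  note sN = M.submodule_simps[of N]
  have s: "submodule N R M" using S N by blast
  show "N \<inter> carrier ?K \<subseteq> carrier ?K" by blast
  show "\<zero>.?K \<in> N \<inter> carrier ?K" using K.M.zero_closed sN(2)[OF s] by simp
  show "x \<oplus>.?K y \<in> N \<inter> carrier ?K" if "x \<in> N \<inter> carrier ?K" "y \<in> N \<inter> carrier ?K" for x y
   using K.M.add.m_closed[of x y] sN(3)[OF s] that by simp
  show "a \<odot>.?K x \<in> N \<inter> carrier ?K" if "a \<in> carrier R" "x \<in> N \<inter> carrier ?K" for a x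
   using K.smult_closed[of a x] sN(4)[OF s] that by simp
 qed
 obtain N0 where "N0 \<in> \<S>" using S by blast
 from noeth_module_maximal[of R L N0 \<S> "\<lambda>N. h ` N", OF L this hN]
 obtain N1 where N1: "N1 \<in> \<S>" "!!N'. N' \<in> \<S> ==> h ` N1 \<subseteq> h ` N' ==> h ` N' = h ` N1"
  by auto
 define \<T> where "\<T> = {N \<in> \<S>. h ` N = h ` N1}"
 have "N1 \<in> \<T>" "!!N. N \<in> \<T> ==> submodule (N \<inter> carrier ?K) R ?K" using N1 kN by (auto simp: \<T>_def)
 from noeth_module_maximal[of R ?K N1 \<T> "\<lambda>N. N \<inter> carrier ?K", OF K this]
 obtain N2 where N2: "N2 \<in> \<T>"
  "!!N'. N' \<in> \<T> ==> N2 \<inter> carrier ?K \<subseteq> N' \<inter> carrier ?K ==> N' \<inter> carrier ?K = N2 \<inter> carrier ?K"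
  by auto
 show "\<exists>N\<in>\<S>. \<forall>N'\<in>\<S>. N \<subseteq> N' --> N' = N"
 proof (intro bexI[of _ N2] ballI impI)
  show "N2 \<in> \<S>" using N2 \<T>_def by blast
  fix N' assume N': "N' \<in> \<S>" "N2 \<subseteq> N'"
  have "h ` N' = h ` N1" using N1(2)[OF N'(1)] N' N2(1) unfolding \<T>_def by blast
  then have "N' \<in> \<T>" using N' by (simp add: \<T>_def)
  then have k: "N' \<inter> carrier ?K = N2 \<inter> carrier ?K" by (rule N2(2)) (use N'(2) in blast)
  have hh: "h ` N' = h ` N2" using N2(1) \<open>h ` N' = h ` N1\<close> by (simp add: \<T>_def)
  have s2: "submodule N2 R M" and s': "submodule N' R M" using S N' \<open>N2 \<in> \<S>\<close> by auto
  have "N' \<subseteq> N2"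
  proof
   fix x assume x: "x \<in> N'"
   then have "h x \<in> h ` N2" unfolding hh[symmetric] by (rule imageI)
   then obtain y where y: "h x = h y" "y \<in> N2" by (rule imageE)
   have xy: "x \<in> carrier M" "y \<in> carrier M" using M.submodule_simps(1)[OF s'] M.submodule_simps(1)[OF s2] x y by auto
   have "x \<ominus>.M y \<in> N'" using M.submodule_simps(6)[OF s'] x y N' by blast
   moreover have "h (x \<ominus>.M y) = \<zero>.L"
    using mod_hom_minus[OF h M L.module_axioms xy] y mod_homD(1)[OF h xy(2)] by (simp add: a_minus_def L.M.r_neg)
   ultimately have "x \<ominus>.M y \<in> N2" using k xy by auto
   then have "(x \<ominus>.M y) \<oplus>.M y \<in> N2" using M.submodule_simps(3)[OF s2] y by blast
   then show "x \<in> N2" using xy by (simp add: a_minus_def M.M.a_assoc M.M.l_neg)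
  qed
  then show "N' = N2" using N' by blast
 qed
qed

text \<open>Surjectivity gives h(h^-1(N)) = N, so a member with maximal preimage is itself
  maximal.\<close>

lemma noeth_module_image:
 assumes M: "noeth_module R M" and L: "module R L" and h: "h \<in> mod_hom R M L"
  and surj: "h ` carrier M = carrier L"
 shows "noeth_module R L"
 unfolding noeth_module_def
proof (intro conjI allI impI L)
 fix \<S> assume S: "\<S> \<noteq> {} \<and> (\<forall>N\<in>\<S>. submodule N R L)"
 interpret M: module R M using noeth_module_imp_module[OF M] .
 interpret L: module R L by fact
 define v where "v N = {x \<in> carrier M. h x \<in> N}" for N
 have vN: "submodule (v N) R M" if "N \<in> \<S>" for N
  unfolding v_def by (rule submodule_vimage[OF M.module_axioms L h]) (use S that in blast)
 obtain N0 where "N0 \<in> \<S>" using S by blast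
 from noeth_module_maximal[of R M N0 \<S> v, OF M this vN]
 obtain N where N: "N \<in> \<S>" "!!N'. N' \<in> \<S> ==> v N \<subseteq> v N' ==> v N' = v N"
  by auto
 have hv: "h ` v N' = N'" if "N' \<in> \<S>" for N'
 proof -
  have "N' \<subseteq> h ` carrier M" using S that L.submodule_simps(1)[of N'] surj by blast
  then show ?thesis by (auto simp: v_def)
 qed
 show "\<exists>N\<in>\<S>. \<forall>N'\<in>\<S>. N \<subseteq> N' --> N' = N"
 proof (intro bexI[of _ N] ballI impI N(1))
  fix N' assume N': "N' \<in> \<S>" "N \<subseteq> N'"
  then have "v N \<subseteq> v N'" by (auto simp: v_def)
  then show "N' = N" using N N' hv by metis
 qed
qed

lemma (in cring) ring_module_is_module: "module R (ring_module R)"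
proof (rule moduleI)
 show "abelian_group (ring_module R)"
  by (rule abelian_groupI) (auto simp: ring_module_def a_ac intro!: bexI[of _ "\<ominus> _"] l_neg)
qed (auto simp: ring_module_def cring_axioms m_assoc l_distr r_distr)

lemma (in cring) ideal_iff_submodule: "ideal I R \<longleftrightarrow> submodule I R (ring_module R)"
proof -
 interpret M: module R "ring_module R" by (rule ring_module_is_module)
 have eq: "subgroup I (add_monoid (ring_module R)) \<longleftrightarrow> subgroup I (add_monoid R)"
  by (simp add: subgroup_def ring_module_def m_inv_def)
 show ?thesis
 proof
  assume I: "ideal I R"
  show "submodule I R (ring_module R)"
   using ideal.axioms(1)[OF I] ideal.I_l_closed[OF I]
   unfolding submodule_def submodule_axioms_def eq additive_subgroup_def
   by (auto simp: ring_module_def)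
 next
  assume I: "submodule I R (ring_module R)"
  have s: "subgroup I (add_monoid R)" using submodule.axioms(1)[OF I] by (simp add: eq)
  have "I \<subseteq> carrier R" using subgroup.subset[OF s] by simp
  have cl: "x \<otimes> a \<in> I" if "a \<in> I" "x \<in> carrier R" for a x
   using M.submodule_simps(4)[OF I that(2,1)] by (simp add: ring_module_def)
  show "ideal I R"
  proof (rule idealI[OF ring_axioms s])
   fix a x assume "a \<in> I" "x \<in> carrier R"
   then show "x \<otimes> a \<in> I" "a \<otimes> x \<in> I" using cl[of a x] \<open>I \<subseteq> carrier R\<close> m_comm[of a x] by auto
  qed
 qed
qed

text \<open>In a Noetherian ring a nonempty chain of ideals contains its union, which is the upper
  bound required by Zorn's lemma.\<close>

lemma (in cring) noeth_ring_module:
 assumes "noetherian_ring R"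
 shows "noeth_module R (ring_module R)"
 unfolding noeth_module_def
proof (intro conjI ring_module_is_module allI impI)
 interpret noetherian_ring R by fact
 fix \<S> assume S: "\<S> \<noteq> {} \<and> (\<forall>N\<in>\<S>. submodule N R (ring_module R))"
 show "\<exists>N\<in>\<S>. \<forall>N'\<in>\<S>. N \<subseteq> N' --> N' = N"
 proof (rule subset_Zorn)
  fix C assume C: "subset.chain \<S> C"
  show "\<exists>U\<in>\<S>. \<forall>X\<in>C. X \<subseteq> U"
  proof (cases "C = {}")
   case True
   then show ?thesis using S by auto
  next
   case False
   have "subset.chain {I. ideal I R} C"
    using C S ideal_iff_submodule unfolding pred_on.chain_def by blast
   from ideal_chain_is_trivial[OF False this] show ?thesis
    using C unfolding pred_on.chain_def by (metis Union_upper subsetD)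
  qed
 qed
qed

section \<open>Powers of ideals\<close>

context cring
begin

lemma ideal_pow_ideal: "ideal I R ==> ideal (ideal_pow R I n) R"
 by (induction n) (simp_all add: oneideal ideal_prod_is_ideal)

lemma ideal_pow_1: "ideal I R ==> ideal_pow R I (Suc 0) = I"
 by (simp add: ideal_prod_one)

lemma ideal_pow_add:
 assumes "ideal I R"
 shows "ideal_pow R I (m + n) = ideal_pow R I m \<cdot> ideal_pow R I n"
proof (induction m)
 case 0
 then show ?case using ideal_prod_one[OF ideal_pow_ideal[OF assms, of n]] ideal_prod_commute[OF ideal_pow_ideal[OF assms, of n] oneideal] by simp
next
 case (Suc m)
 then show ?case using ideal_prod_assoc[OF assms ideal_pow_ideal[OF assms, of m] ideal_pow_ideal[OF assms, of n]] by simp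
qed

lemma ideal_pow_mult_mem:
 "ideal I R ==> x \<in> ideal_pow R I m ==> y \<in> ideal_pow R I n ==> x \<otimes> y \<in> ideal_pow R I (m + n)"
 by (simp add: ideal_pow_add ideal_prod.prod)

lemma ideal_pow_antimono:
 assumes "ideal I R" "m \<le> n"
 shows "ideal_pow R I n \<subseteq> ideal_pow R I m"
proof -
 obtain k where "n = m + k" using assms le_Suc_ex by blast
 then show ?thesis using ideal_prod_inter[OF ideal_pow_ideal[OF assms(1), of m] ideal_pow_ideal[OF assms(1), of k]]
  by (simp add: ideal_pow_add[OF assms(1)])
qed

lemma power_mem_ideal_pow:
 "ideal I R ==> x \<in> I ==> x [^] (n::nat) \<in> ideal_pow R I n"
proof (induction n)
 case (Suc n)
 then have "x \<otimes> x [^] n \<in> I \<cdot> ideal_pow R I n" by (intro ideal_prod.prod) auto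
 then show ?case using ideal.Icarr[OF Suc.prems] by (simp add: m_comm)
qed simp

lemma prime_pow_notin:
 assumes "primeideal P R" "s \<in> carrier R" "s \<notin> P"
 shows "s [^] (n::nat) \<in> carrier R - P"
proof (induction n)
 case 0
 have "\<one> \<notin> P" using assms by (metis primeideal.I_notcarr ideal.one_imp_carrier primeideal.axioms(1))
 then show ?case by simp
next
 case (Suc n)
 then show ?case using primeideal.I_prime[OF assms(1), of "s [^] n" s] assms by auto
qed

lemma prime_mult_notin:
 assumes "primeideal P R" "s \<in> carrier R - P" "t \<in> carrier R - P"
 shows "s \<otimes> t \<in> carrier R - P"
 using primeideal.I_prime[OF assms(1), of s t] assms by auto

lemma prime_one_notin:
 assumes "primeideal P R" shows "\<one> \<in> carrier R - P"
 using assms by (metis DiffI ideal.one_imp_carrier one_closed primeideal.I_notcarr primeideal.axioms(1))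

lemma set_add_principal:
 assumes K: "ideal K R" and x: "x \<in> carrier R"
 defines "L \<equiv> {k \<oplus> r \<otimes> x | k r. k \<in> K \<and> r \<in> carrier R}"
 shows "ideal L R" "K \<subseteq> L" "x \<in> L"
proof -
 have L: "L = set_add R K (PIdl x)" unfolding L_def cgenideal_def set_add_def' by auto
 show "ideal L R" unfolding L by (intro add_ideals K cgenideal_ideal x)
 have z: "\<zero> \<in> K" using K by (simp add: additive_subgroup.zero_closed ideal.axioms(1))
 show "K \<subseteq> L"
 proof
  fix k assume k: "k \<in> K"
  then have "k = k \<oplus> \<zero> \<otimes> x" using x ideal.Icarr[OF K] by simp
  then show "k \<in> L" using k L_def by blast
 qed
 have "x = \<zero> \<oplus> \<one> \<otimes> x" using x by simp
 then show "x \<in> L" using z L_def by blast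
qed

text \<open>By Noetherian induction: a maximal counterexample \<open>K\<close> admits some \<open>x \<notin> K\<close> with
 \<open>x\<^sup>2 \<in> K\<close>, and then \<open>I\<^sup>N \<subseteq> K + (x)\<close> gives \<open>I\<^sup>2\<^sup>N \<subseteq> K\<close>.\<close>

lemma ideal_pow_subset_of_nilpotent:
 assumes noeth: "noetherian_ring R" and A: "A \<subseteq> carrier R" and K: "ideal K R"
  and nil: "!!x. x \<in> A ==> \<exists>k::nat. x [^] k \<in> K"
 shows "\<exists>N. ideal_pow R (Idl A) N \<subseteq> K"
proof (rule ccontr)
 let ?I = "Idl A"
 note I = genideal_ideal[OF A]
 assume neg: "\<not> ?thesis"
 define \<S> where "\<S> = {J. ideal J R \<and> K \<subseteq> J \<and> (\<forall>N. \<not> ideal_pow R ?I N \<subseteq> J)}"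
 have "K \<in> \<S>" using K neg by (auto simp: \<S>_def)
 from noeth_module_maximal[of R "ring_module R" K \<S> id, OF noeth_ring_module[OF noeth] this]
 obtain J where J: "J \<in> \<S>" "!!J'. J' \<in> \<S> ==> J \<subseteq> J' ==> J' = J"
  by (auto simp: \<S>_def ideal_iff_submodule)
 then have iJ: "ideal J R" and KJ: "K \<subseteq> J" and nJ: "!!N. \<not> ideal_pow R ?I N \<subseteq> J" by (auto simp: \<S>_def)
 have "\<not> A \<subseteq> J" using nJ[of 1] Idl_subset_ideal[OF iJ A] ideal_pow_1[OF I] by auto
 then obtain a where a: "a \<in> A" "a \<notin> J" by blast
 have ac: "a \<in> carrier R" using a A by blast
 define k where "k = (LEAST k::nat. a [^] k \<in> J)"
 have k: "a [^] k \<in> J" unfolding k_def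
  by (rule LeastI_ex[of "\<lambda>k. a [^] k \<in> J"]) (use nil[OF a(1)] KJ in blast)
 have "k \<noteq> 0"
 proof
  assume "k = 0"
  then have "\<one> \<in> J" using k by simp
  then have "J = carrier R" by (rule ideal.one_imp_carrier[OF iJ])
  then show False using nJ[of 0] by simp
 qed
 then obtain m where m: "k = Suc m" by (cases k) auto
 define x where "x = a [^] m"
 have xJ: "x \<notin> J" using not_less_Least[of m "\<lambda>k. a [^] k \<in> J"] m unfolding k_def x_def by auto
 have xc: "x \<in> carrier R" using ac by (simp add: x_def)
 have "m \<noteq> 0"
 proof
  assume "m = 0"
  then show False using k m a ac by simp
 qed
 \<comment> \<open>With k = m + 1 the least exponent such that a^k lies in J, the element x = a^m is
   outside J, while x^2 = a^(m-1) a^k lies in J.\<close>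
 then have "m + m = (m - 1) + k" using m by simp
 then have "x \<otimes> x = a [^] (m - 1) \<otimes> a [^] k" using ac by (simp add: x_def nat_pow_mult)
 then have xx: "x \<otimes> x \<in> J" using ideal.I_l_closed[OF iJ k] ac by simp
 define L where "L = {j \<oplus> r \<otimes> x | j r. j \<in> J \<and> r \<in> carrier R}"
 note L = set_add_principal[OF iJ xc, folded L_def]
 have "L \<notin> \<S>" using J(2)[of L] L xJ by blast
 then obtain N where N: "ideal_pow R ?I N \<subseteq> L" using L KJ by (auto simp: \<S>_def)
 have LL: "u \<otimes> v \<in> J" if uvL: "u \<in> L" "v \<in> L" for u v
 proof -
  obtain j r j' r' where uv: "u = j \<oplus> r \<otimes> x" "v = j' \<oplus> r' \<otimes> x" "j \<in> J" "j' \<in> J" "r \<in> carrier R" "r' \<in> carrier R"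
   using uvL by (auto simp: L_def)
  have jc: "j \<in> carrier R" "j' \<in> carrier R" using uv ideal.Icarr[OF iJ] by auto
  have "u \<otimes> v = (j' \<oplus> r' \<otimes> x) \<otimes> j \<oplus> ((r \<otimes> x) \<otimes> j' \<oplus> (r \<otimes> r') \<otimes> (x \<otimes> x))"
   unfolding uv using jc uv xc by algebra
  then show ?thesis using uv jc xc xx
   by (simp add: additive_subgroup.a_closed[OF ideal.axioms(1)[OF iJ]] ideal.I_l_closed[OF iJ])
 qed
 have "ideal_pow R ?I N \<cdot> ideal_pow R ?I N \<subseteq> J"
 proof
  fix z assume "z \<in> ideal_pow R ?I N \<cdot> ideal_pow R ?I N"
  then show "z \<in> J"
   by induction (use N LL additive_subgroup.a_closed[OF ideal.axioms(1)[OF iJ]] in blast)+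
 qed
 then show False using nJ[of "N + N"] ideal_pow_add[OF I, of N N] by simp
qed

lemma ideal_pow_nilpotent:
 assumes noeth: "noetherian_ring R" and I: "ideal I R" and K: "ideal K R"
  and nil: "!!x. x \<in> I ==> \<exists>k::nat. x [^] k \<in> K"
 shows "\<exists>N. ideal_pow R I N \<subseteq> K"
proof -
 have c: "I \<subseteq> carrier R" using ideal.Icarr[OF I] by blast
 have "Idl I = I" using genideal_minimal[OF I, of I] genideal_self[OF c] by blast
 then show ?thesis using ideal_pow_subset_of_nilpotent[OF noeth c K nil] by simp
qed

end

section \<open>Submodules of Noetherian modules\<close>

text \<open>The product I M. There is no rule for scalars, since an ideal I absorbs them into the
  coefficients; proofs by induction then meet only generators and sums.\<close>

inductive_set ideal_smult :: "('a, 'k) ring_scheme => 'a set => ('a, 'm, 'x) module_scheme => 'm set"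
 for R I M where
  prod: "a \<in> I ==> x \<in> carrier M ==> a \<odot>.M x \<in> ideal_smult R I M"
 | sum: "x \<in> ideal_smult R I M ==> y \<in> ideal_smult R I M ==> x \<oplus>.M y \<in> ideal_smult R I M"

context module
begin

lemma ideal_smult_subset:
 assumes "submodule N R M" "!!a x. a \<in> I ==> x \<in> carrier M ==> a \<odot>.M x \<in> N"
 shows "ideal_smult R I M \<subseteq> N"
proof
 fix x assume "x \<in> ideal_smult R I M"
 then show "x \<in> N" by induction (auto intro: assms submodule_simps(3)[OF assms(1)])
qed

lemma ideal_smult_submodule:
 assumes "ideal I R"
 shows "submodule (ideal_smult R I M) R M"
proof (rule submoduleI')
 note Ic = ideal.Icarr[OF assms]
 have z: "\<zero> \<in> I" using assms by (simp add: additive_subgroup.zero_closed ideal.axioms(1))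
 show s: "ideal_smult R I M \<subseteq> carrier M"
  by (rule ideal_smult_subset[OF carrier_is_submodule]) (use Ic in auto)
 have "\<zero> \<odot>.M \<zero>.M \<in> ideal_smult R I M" by (rule ideal_smult.prod[OF z]) simp
 then show "\<zero>.M \<in> ideal_smult R I M" by simp
 show "x \<oplus>.M y \<in> ideal_smult R I M" if "x \<in> ideal_smult R I M" "y \<in> ideal_smult R I M" for x y
  using that by (rule ideal_smult.sum)
 show "a \<odot>.M x \<in> ideal_smult R I M" if a: "a \<in> carrier R" and x: "x \<in> ideal_smult R I M" for a x
  using x
 proof induction
  case (prod b x)
  have "(a \<otimes> b) \<odot>.M x \<in> ideal_smult R I M"
   by (rule ideal_smult.prod[OF ideal.I_l_closed[OF assms prod(1) a] prod(2)])
  then show ?case using prod a Ic by (simp add: smult_assoc1)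
 next
  case (sum x y)
  then show ?case using ideal_smult.sum s a by (simp add: smult_r_distr subsetD)
 qed
qed

lemma submodule_trans:
 assumes "submodule N R M" "submodule A R (M\<lparr>carrier := N\<rparr>)"
 shows "submodule A R M"
proof -
 interpret N: module R "M\<lparr>carrier := N\<rparr>" by (rule submodule.submodule_is_module[OF assms(1) module_axioms])
 note sA = N.submodule_simps[OF assms(2), simplified]
 show ?thesis by (rule submoduleI') (use sA submodule_simps(1)[OF assms(1)] in auto)
qed

lemma smult_mod_hom: "r \<in> carrier R ==> (\<lambda>x. r \<odot>.M x) \<in> mod_hom R M M"
 by (auto simp: mod_hom_def smult_r_distr smult_assoc1[symmetric] R.m_comm)

lemma submodule_sum:
 assumes N: "submodule N R M" and K: "submodule K R M"
 shows "submodule {n \<oplus>.M k | n k. n \<in> N \<and> k \<in> K} R M" (is "submodule ?L R M")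
  "N \<subseteq> {n \<oplus>.M k | n k. n \<in> N \<and> k \<in> K}" "K \<subseteq> {n \<oplus>.M k | n k. n \<in> N \<and> k \<in> K}"
proof -
 note sN = submodule_simps[OF N] and sK = submodule_simps[OF K]
 have LI: "n \<oplus>.M k \<in> ?L" if "n \<in> N" "k \<in> K" for n k using that by blast
 show "submodule ?L R M"
 proof (rule submoduleI')
  show "?L \<subseteq> carrier M" using sN(1) sK(1) by auto
  show "\<zero>.M \<in> ?L" using LI[OF sN(2) sK(2)] by simp
 next
  fix x y assume "x \<in> ?L" "y \<in> ?L"
  then obtain n u m v where *: "x = n \<oplus>.M u" "y = m \<oplus>.M v" "n \<in> N" "m \<in> N" "u \<in> K" "v \<in> K" by blast
  then have "x \<oplus>.M y = (n \<oplus>.M m) \<oplus>.M (u \<oplus>.M v)" using sN(1) sK(1) by (simp add: M.a_ac)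
  then show "x \<oplus>.M y \<in> ?L" using LI[OF sN(3)[OF *(3,4)] sK(3)[OF *(5,6)]] by simp
 next
  fix a x assume a: "a \<in> carrier R" and "x \<in> ?L"
  then obtain n u where *: "x = n \<oplus>.M u" "n \<in> N" "u \<in> K" by blast
  then have "a \<odot>.M x = a \<odot>.M n \<oplus>.M a \<odot>.M u" using sN(1) sK(1) a by (simp add: smult_r_distr)
  then show "a \<odot>.M x \<in> ?L" using LI[OF sN(4)[OF a *(2)] sK(4)[OF a *(3)]] by simp
 qed
 show "N \<subseteq> ?L"
 proof
  fix n assume "n \<in> N"
  then show "n \<in> ?L" using LI[OF _ sK(2), of n] sN(1) by simp
 qed
 show "K \<subseteq> ?L"
 proof
  fix k assume "k \<in> K"
  then show "k \<in> ?L" using LI[OF sN(2), of k] sK(1) by simp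
 qed
qed

lemma submodule_smult_image:
 assumes r: "r \<in> carrier R" and N: "submodule N R M"
 defines "L \<equiv> {n \<oplus>.M r \<odot>.M x | n x. n \<in> N \<and> x \<in> carrier M}"
 shows "submodule L R M" "N \<subseteq> L" "x \<in> carrier M ==> r \<odot>.M x \<in> L"
proof -
 have K: "submodule ((\<lambda>x. r \<odot>.M x) ` carrier M) R M"
  by (rule submodule_image[OF module_axioms module_axioms smult_mod_hom[OF r] carrier_is_submodule])
 have "L = {n \<oplus>.M k | n k. n \<in> N \<and> k \<in> (\<lambda>x. r \<odot>.M x) ` carrier M}" unfolding L_def by blast
 note L = submodule_sum[OF N K, folded this]
 show "submodule L R M" "N \<subseteq> L" "x \<in> carrier M ==> r \<odot>.M x \<in> L" using L by auto
qed

lemma submodule_adjoin: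
 assumes y: "y \<in> carrier M" and N: "submodule N R M"
 defines "L \<equiv> {n \<oplus>.M r \<odot>.M y | n r. n \<in> N \<and> r \<in> carrier R}"
 shows "submodule L R M" "N \<subseteq> L" "y \<in> L"
proof -
 interpret RM: module R "ring_module R" by (rule R.ring_module_is_module)
 have c: "carrier (ring_module R) = carrier R" by (simp add: ring_module_def)
 have "(\<lambda>r. r \<odot>.M y) \<in> mod_hom R (ring_module R) M"
  using y by (auto simp: mod_hom_def ring_module_def smult_l_distr smult_assoc1)
 then have K: "submodule ((\<lambda>r. r \<odot>.M y) ` carrier R) R M"
  using submodule_image[OF RM.module_axioms module_axioms _ RM.carrier_is_submodule] unfolding c by blast
 have "L = {n \<oplus>.M k | n k. n \<in> N \<and> k \<in> (\<lambda>r. r \<odot>.M y) ` carrier R}" unfolding L_def by blast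
 note L = submodule_sum[OF N K, folded this]
 have "\<one> \<odot>.M y \<in> L" by (rule subsetD[OF L(3)]) blast
 then show "submodule L R M" "N \<subseteq> L" "y \<in> L" using L(1,2) y by auto
qed

text \<open>The submodules (N : r^k) ascend and become stationary. For such k the enlargement N +
  r^k M is the one tested against a maximal N in the two theorems below.\<close>

lemma colon_power_stable:
 assumes noeth: "noeth_module R M" and N: "submodule N R M" and r: "r \<in> carrier R"
 shows "\<exists>k::nat. \<forall>x\<in>carrier M. \<forall>j. r [^] (k + j) \<odot>.M x \<in> N --> r [^] k \<odot>.M x \<in> N"
proof -
 define F where "F k = {x \<in> carrier M. r [^] (k::nat) \<odot>.M x \<in> N}" for k
 note sN = submodule_simps[OF N]
 have F: "submodule (F k) R M" for k
  unfolding F_def using submodule_vimage[OF module_axioms module_axioms smult_mod_hom N] r by simp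
 have mono: "F k \<subseteq> F (k + j)" for k j
 proof
  fix x assume x: "x \<in> F k"
  then have "r [^] (k + j) \<odot>.M x = r [^] j \<odot>.M (r [^] k \<odot>.M x)"
   using r by (simp add: F_def smult_assoc1[symmetric] R.nat_pow_mult add.commute)
  then show "x \<in> F (k + j)" using x sN r by (simp add: F_def)
 qed
 from noeth_module_maximal[OF noeth, of 0 UNIV F] F
 obtain k where "!!j. F k \<subseteq> F j ==> F j = F k" by auto
 then have "F (k + j) = F k" for j using mono by blast
 then show ?thesis by (intro exI[of _ k]) (auto simp: F_def)
qed

text \<open>Krull's intersection theorem for \<open>M/T\<close> localized at \<open>P\<close>: a submodule \<open>N \<supseteq> T\<close> maximal among
 those containing no multiple \<open>s y\<close>, \<open>s \<notin> P\<close>, contains \<open>P\<^sup>N M\<close> for some \<open>N\<close>.\<close>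

lemma krull_intersection:
 assumes noethR: "noetherian_ring R" and noeth: "noeth_module R M" and P: "primeideal P R"
  and T: "submodule T R M" and y: "y \<in> carrier M"
  and app: "!!n. \<exists>s\<in>carrier R - P. \<exists>t\<in>T. \<exists>z\<in>ideal_smult R (ideal_pow R P n) M. s \<odot>.M y = t \<oplus>.M z"
 shows "\<exists>s\<in>carrier R - P. s \<odot>.M y \<in> T"
proof (rule ccontr)
 assume neg: "\<not> ?thesis"
 interpret P: primeideal P R by fact
 define \<S> where "\<S> = {N. submodule N R M \<and> T \<subseteq> N \<and> (\<forall>s\<in>carrier R - P. s \<odot>.M y \<notin> N)}"
 have "T \<in> \<S>" using T neg by (auto simp: \<S>_def)
 from noeth_module_maximal[of R M T \<S> "\<lambda>N. N", OF noeth this]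
 obtain N where N: "N \<in> \<S>" "!!N'. N' \<in> \<S> ==> N \<subseteq> N' ==> N' = N"
  by (auto simp: \<S>_def)
 then have sub: "submodule N R M" and TN: "T \<subseteq> N" and ns: "!!s. s \<in> carrier R - P ==> s \<odot>.M y \<notin> N"
  by (auto simp: \<S>_def)
 note sN = submodule_simps[OF sub]
 \<comment> \<open>If N + R x y contained a multiple s y with s outside P, then (s - r x) y would
   lie in N for some r, and s - r x is still outside P. So this enlargement belongs to the family,
   and maximality gives x y in N.\<close>
 have xy: "x \<odot>.M y \<in> N" if x: "x \<in> P" for x
 proof -
  have xc: "x \<in> carrier R" using x by (rule P.Icarr)
  define L where "L = {n \<oplus>.M r \<odot>.M (x \<odot>.M y) | n r. n \<in> N \<and> r \<in> carrier R}"
  have xyc: "x \<odot>.M y \<in> carrier M" using xc y by simp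
  note L = submodule_adjoin[OF xyc sub, folded L_def]
  have "s \<odot>.M y \<notin> L" if s: "s \<in> carrier R - P" for s
  proof
   assume "s \<odot>.M y \<in> L"
   then obtain n r where n: "n \<in> N" "r \<in> carrier R" "s \<odot>.M y = n \<oplus>.M r \<odot>.M (x \<odot>.M y)" by (auto simp: L_def)
   have "(s \<ominus> r \<otimes> x) \<odot>.M y = s \<odot>.M y \<ominus>.M r \<odot>.M (x \<odot>.M y)"
    using s n xc y by (simp add: a_minus_def smult_l_distr smult_l_minus smult_assoc1)
   also have "\<dots> = n" using n sN(1)[OF n(1)] xyc by (simp add: a_minus_def M.a_assoc M.r_neg)
   finally have "(s \<ominus> r \<otimes> x) \<odot>.M y \<in> N" using n by simp
   moreover have "s \<ominus> r \<otimes> x \<notin> P"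
   proof
    assume "s \<ominus> r \<otimes> x \<in> P"
    then have "(s \<ominus> r \<otimes> x) \<oplus> r \<otimes> x \<in> P" using x n by (simp add: P.I_l_closed)
    then show False using s n xc by (simp add: a_minus_def R.a_assoc R.l_neg)
   qed
   ultimately show False using ns[of "s \<ominus> r \<otimes> x"] s n xc by auto
  qed
  then have "L \<in> \<S>" using L TN by (auto simp: \<S>_def)
  then show ?thesis using N(2) L by blast
 qed
 \<comment> \<open>If s y = n + x^k u with n in N, then multiplying by x and using x y in N gives
   x^(k+1) u in N, hence x^k u in N by the choice of k, and s y in N. So N + x^k M is no proper
   enlargement, and x^k M lies in N.\<close>
 have "\<exists>k::nat. x [^] k \<in> {r \<in> carrier R. \<forall>u\<in>carrier M. r \<odot>.M u \<in> N}" if x: "x \<in> P" for x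
 proof -
  have xc: "x \<in> carrier R" using x by (rule P.Icarr)
  obtain k :: nat where k: "!!u j. u \<in> carrier M ==> x [^] (k + j) \<odot>.M u \<in> N ==> x [^] k \<odot>.M u \<in> N"
   using colon_power_stable[OF noeth sub xc] by blast
  define L where "L = {n \<oplus>.M x [^] k \<odot>.M u | n u. n \<in> N \<and> u \<in> carrier M}"
  have xk: "x [^] k \<in> carrier R" using xc by simp
  note L = submodule_smult_image[OF xk sub, folded L_def]
  have "s \<odot>.M y \<notin> L" if s: "s \<in> carrier R - P" for s
  proof
   assume "s \<odot>.M y \<in> L"
   then obtain n u where n: "n \<in> N" "u \<in> carrier M" "s \<odot>.M y = n \<oplus>.M x [^] k \<odot>.M u" by (auto simp: L_def)
   have "x \<odot>.M (s \<odot>.M y) = s \<odot>.M (x \<odot>.M y)" using s xc y by (simp add: smult_assoc1[symmetric] R.m_comm)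
   then have a: "x \<odot>.M (s \<odot>.M y) \<in> N" using sN(4)[OF _ xy[OF x], of s] s by simp
   have nc: "n \<in> carrier M" by (rule sN(1)[OF n(1)])
   have "x \<odot>.M (s \<odot>.M y) \<ominus>.M x \<odot>.M n = x [^] (k + 1) \<odot>.M u"
    unfolding n(3) using n(2) nc xc
    by (simp add: smult_r_distr a_minus_def M.a_comm[of "x \<odot>.M n"] M.a_assoc M.r_neg smult_assoc1[symmetric] R.m_comm)
   moreover have "x \<odot>.M (s \<odot>.M y) \<ominus>.M x \<odot>.M n \<in> N"
    by (rule sN(6)[OF a sN(4)[OF xc n(1)]])
   ultimately have "x [^] k \<odot>.M u \<in> N" using k[of u 1] n by simp
   then have "s \<odot>.M y \<in> N" using n sN(3) by simp
   then show False using ns s by blast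
  qed
  then have "L \<in> \<S>" using L TN by (auto simp: \<S>_def)
  then have "L = N" using N(2) L by blast
  then show ?thesis using L(3) xk by blast
 qed
 moreover have "ideal {r \<in> carrier R. \<forall>u\<in>carrier M. r \<odot>.M u \<in> N} R"
  unfolding R.ideal_iff_submodule
  by (rule module.submoduleI'[OF R.ring_module_is_module])
   (auto simp: ring_module_def smult_l_distr smult_assoc1 sN(2,3,4))
 ultimately obtain n where n: "ideal_pow R P n \<subseteq> {r \<in> carrier R. \<forall>u\<in>carrier M. r \<odot>.M u \<in> N}"
  using R.ideal_pow_nilpotent[OF noethR P.is_ideal] by blast
 obtain s t z where "s \<in> carrier R - P" "t \<in> T" "z \<in> ideal_smult R (ideal_pow R P n) M" "s \<odot>.M y = t \<oplus>.M z"
  using app by blast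
 moreover have "ideal_smult R (ideal_pow R P n) M \<subseteq> N" using n by (intro ideal_smult_subset sub) auto
 ultimately show False using ns sN(3) TN by (metis subsetD)
qed

text \<open>The weak form of the Artin--Rees lemma: take \<open>C\<close> maximal with \<open>C \<inter> B \<subseteq> I\<^sup>n B\<close>.\<close>

lemma artin_rees:
 assumes noethR: "noetherian_ring R" and noeth: "noeth_module R M" and I: "ideal I R"
  and B: "submodule B R M"
 shows "\<exists>N. ideal_smult R (ideal_pow R I N) M \<inter> B \<subseteq> ideal_smult R (ideal_pow R I n) (M\<lparr>carrier := B\<rparr>)"
proof -
 let ?D = "ideal_smult R (ideal_pow R I n) (M\<lparr>carrier := B\<rparr>)"
 note sB = submodule_simps[OF B]
 interpret B: module R "M\<lparr>carrier := B\<rparr>" by (rule submodule.submodule_is_module[OF B module_axioms])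
 have D: "submodule ?D R (M\<lparr>carrier := B\<rparr>)"
  by (rule B.ideal_smult_submodule[OF R.ideal_pow_ideal[OF I]])
 note sD = B.submodule_simps[OF D, simplified]
 define \<S> where "\<S> = {C. submodule C R M \<and> C \<inter> B \<subseteq> ?D}"
 have "{\<zero>.M} \<in> \<S>"
  using sD(2) by (auto simp: \<S>_def intro!: submoduleI')
 from noeth_module_maximal[of R M _ \<S> "\<lambda>N. N", OF noeth this]
 obtain C0 where C0: "C0 \<in> \<S>" "!!N'. N' \<in> \<S> ==> C0 \<subseteq> N' ==> N' = C0"
  by (auto simp: \<S>_def)
 have sC0: "submodule C0 R M" and C0B: "C0 \<inter> B \<subseteq> ?D" using C0 by (auto simp: \<S>_def)
 \<comment> \<open>The modular law: as D lies in B, the intersection of C0 + D with B is (C0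
   \<inter> B) + D, which is contained in D. Maximality then absorbs D into C0.\<close>
 have DC0: "?D \<subseteq> C0"
 proof -
  define L where "L = {c \<oplus>.M d | c d. c \<in> C0 \<and> d \<in> ?D}"
  note s0 = submodule_simps[OF sC0]
  note L = submodule_sum[OF sC0 submodule_trans[OF B D], folded L_def]
  have dc: "d \<in> carrier M" if "d \<in> ?D" for d using sD(1)[OF that] sB by blast
  have "L \<inter> B \<subseteq> ?D"
  proof
   fix b assume b: "b \<in> L \<inter> B"
   then obtain c d where cd: "b = c \<oplus>.M d" "c \<in> C0" "d \<in> ?D" by (auto simp: L_def)
   have "c = b \<ominus>.M d" using cd s0(1) dc by (simp add: a_minus_def M.a_assoc M.r_neg)
   then have "c \<in> B" using b sB(6) sD(1)[OF cd(3)] by auto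
   then have "c \<in> ?D" using C0B cd by blast
   then show "b \<in> ?D" using cd sD(3) by blast
  qed
  then have "L \<in> \<S>" using L(1) by (simp add: \<S>_def)
  then have "L = C0" by (rule C0(2)[OF _ L(2)])
  then show ?thesis using L(3) by simp
 qed
 note s0 = submodule_simps[OF sC0]
 \<comment> \<open>For b = c + x^k u in B the element x^n b lies in I^n B = D, which is inside C0.
   Hence x^(k+n) u lies in C0, so does x^k u by the choice of k, and b lies in C0 \<inter> B. Thus
   C0 + x^k M still belongs to the family.\<close>
 have "\<exists>k::nat. x [^] k \<in> {r \<in> carrier R. \<forall>u\<in>carrier M. r \<odot>.M u \<in> C0}" if x: "x \<in> I" for x
 proof -
  have xc: "x \<in> carrier R" using x by (rule ideal.Icarr[OF I])
  obtain k :: nat where k: "!!u j. u \<in> carrier M ==> x [^] (k + j) \<odot>.M u \<in> C0 ==> x [^] k \<odot>.M u \<in> C0"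
   using colon_power_stable[OF noeth sC0 xc] by blast
  define L where "L = {n \<oplus>.M x [^] k \<odot>.M u | n u. n \<in> C0 \<and> u \<in> carrier M}"
  have xk: "x [^] k \<in> carrier R" using xc by simp
  note L = submodule_smult_image[OF xk sC0, folded L_def]
  have "L \<inter> B \<subseteq> ?D"
  proof
   fix b assume b: "b \<in> L \<inter> B"
   then obtain c u where cu: "c \<in> C0" "u \<in> carrier M" "b = c \<oplus>.M x [^] k \<odot>.M u" by (auto simp: L_def)
   have cc: "c \<in> carrier M" by (rule s0(1)[OF cu(1)])
   have xn: "x [^] n \<in> carrier R" using xc by simp
   have "x [^] n \<odot>.M b \<in> ?D"
    using ideal_smult.prod[OF R.power_mem_ideal_pow[OF I x, of n], of b "M\<lparr>carrier := B\<rparr>" R] b by simp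
   then have "x [^] n \<odot>.M b \<in> C0" using DC0 by blast
   moreover have "x [^] n \<odot>.M c \<in> C0" by (rule s0(4)[OF xn cu(1)])
   ultimately have "x [^] n \<odot>.M b \<ominus>.M x [^] n \<odot>.M c \<in> C0" by (rule s0(6))
   moreover have "x [^] n \<odot>.M b \<ominus>.M x [^] n \<odot>.M c = x [^] (k + n) \<odot>.M u"
    unfolding cu(3) using cu(2) cc xc
    by (simp add: smult_r_distr a_minus_def M.a_comm[of "x [^] n \<odot>.M c"] M.a_assoc M.r_neg smult_assoc1[symmetric] R.nat_pow_mult add.commute)
   ultimately have "x [^] k \<odot>.M u \<in> C0" using k cu by metis
   then have "b \<in> C0" using cu s0(3) by simp
   then show "b \<in> ?D" using b C0B by blast
  qed
  then have "L \<in> \<S>" using L by (auto simp: \<S>_def)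
  then have "L = C0" using C0(2) L by blast
  then show ?thesis using L(3) xk by blast
 qed
 moreover have "ideal {r \<in> carrier R. \<forall>u\<in>carrier M. r \<odot>.M u \<in> C0} R"
  unfolding R.ideal_iff_submodule
  by (rule module.submoduleI'[OF R.ring_module_is_module])
   (auto simp: ring_module_def smult_l_distr smult_assoc1 s0(2,3,4))
 ultimately obtain N where N: "ideal_pow R I N \<subseteq> {r \<in> carrier R. \<forall>u\<in>carrier M. r \<odot>.M u \<in> C0}"
  using R.ideal_pow_nilpotent[OF noethR I] by blast
 have "ideal_smult R (ideal_pow R I N) M \<subseteq> C0" using N by (intro ideal_smult_subset sC0) auto
 then show ?thesis using C0B by blast
qed

text \<open>Generation is phrased without sums: a submodule that contains C contains N. Among the
  spans \<open>F C\<close> of finite subsets of N, a maximal one cannot grow by adjoining any x in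
  N.\<close>

lemma noeth_submodule_fg:
 assumes noeth: "noeth_module R M" and N: "submodule N R M"
 shows "\<exists>C. finite C \<and> C \<subseteq> N \<and> (\<forall>K. submodule K R M \<and> C \<subseteq> K --> N \<subseteq> K)"
proof -
 define F where "F C = \<Inter>{K. submodule K R M \<and> C \<subseteq> K}" for C
 have F: "submodule (F C) R M" if "C \<subseteq> carrier M" for C
 proof (rule submoduleI')
  show "F C \<subseteq> carrier M" using carrier_is_submodule that unfolding F_def by blast
 qed (auto simp: F_def submodule_simps)
 define \<C> where "\<C> = {C. finite C \<and> C \<subseteq> N}"
 have Nc: "N \<subseteq> carrier M" using submodule_simps(1)[OF N] by blast
 have "{} \<in> \<C>" by (simp add: \<C>_def)
 moreover have "submodule (F C) R M" if "C \<in> \<C>" for C using F that Nc by (auto simp: \<C>_def)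
 ultimately obtain C where C: "C \<in> \<C>" "!!C'. C' \<in> \<C> ==> F C \<subseteq> F C' ==> F C' = F C"
  using noeth_module_maximal[of R M "{}" \<C> F, OF noeth] by auto
 have "N \<subseteq> F C"
 proof
  fix x assume x: "x \<in> N"
  have "insert x C \<in> \<C>" using x C by (auto simp: \<C>_def)
  moreover have "F C \<subseteq> F (insert x C)" unfolding F_def by blast
  ultimately have "F (insert x C) = F C" by (rule C(2))
  moreover have "x \<in> F (insert x C)" unfolding F_def by blast
  ultimately show "x \<in> F C" by simp
 qed
 then show ?thesis using C by (intro exI[of _ C]) (auto simp: \<C>_def F_def)
qed

text \<open>Finiteness of Ass(M/N), with M/N never formed. A maximal counterexample N0 is enlarged
  to L = N0 + R x with P = (N0 : x). Only P can be lost in this way, since L / N0 is R / P.\<close>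

lemma finite_primes_colon:
 assumes noeth: "noeth_module R M" and N: "submodule N R M"
 shows "finite {P. primeideal P R \<and> (\<exists>x\<in>carrier M. P = {r \<in> carrier R. r \<odot>.M x \<in> N})}" (is "finite (?A N)")
proof (rule ccontr)
 assume inf: "infinite (?A N)"
 define \<S> where "\<S> = {N. submodule N R M \<and> infinite (?A N)}"
 have "N \<in> \<S>" using inf N by (auto simp: \<S>_def)
 from noeth_module_maximal[of R M N \<S> "\<lambda>N. N", OF noeth this]
 obtain N0 where N0: "N0 \<in> \<S>" "!!N'. N' \<in> \<S> ==> N0 \<subseteq> N' ==> N' = N0"
  by (auto simp: \<S>_def)
 have sub: "submodule N0 R M" and inf0: "infinite (?A N0)" using N0 by (auto simp: \<S>_def)
 note s0 = submodule_simps[OF sub]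
 obtain P where P: "P \<in> ?A N0" using inf0 by (metis (lifting) ex_in_conv finite.emptyI)
 then obtain x where pP: "primeideal P R" and x: "x \<in> carrier M" "P = {r \<in> carrier R. r \<odot>.M x \<in> N0}" by blast
 define L where "L = {n \<oplus>.M r \<odot>.M x | n r. n \<in> N0 \<and> r \<in> carrier R}"
 note L = submodule_adjoin[OF x(1) sub, folded L_def]
 have "\<one> \<notin> P" using R.prime_one_notin[OF pP] by blast
 then have "x \<notin> N0" using x by auto
 then have "L \<notin> \<S>" using N0(2) L by blast
 then have fin: "finite (?A L)" using L by (auto simp: \<S>_def)
 have "?A N0 \<subseteq> insert P (?A L)"
 proof
  fix Q assume Q: "Q \<in> ?A N0"
  then obtain y where pQ: "primeideal Q R" and y: "y \<in> carrier M" "Q = {r \<in> carrier R. r \<odot>.M y \<in> N0}" by blast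
  show "Q \<in> insert P (?A L)"
  \<comment> \<open>If r y in L forces r in Q, then Q is also (L : y). Otherwise some r outside Q
    has r y congruent to s x modulo N0 with s outside P. Passing from y to r y does not change the
    annihilator Q, nor passing from x to s x the annihilator P, so Q = P.\<close>
  proof (cases "\<forall>r\<in>carrier R. r \<odot>.M y \<in> L --> r \<in> Q")
   case True
   then have "Q = {r \<in> carrier R. r \<odot>.M y \<in> L}" using y L(2) by blast
   then show ?thesis using pQ y(1) by blast
  next
   case False
   then obtain r where r: "r \<in> carrier R" "r \<odot>.M y \<in> L" "r \<notin> Q" by blast
   then obtain n s where n: "n \<in> N0" "s \<in> carrier R" "r \<odot>.M y = n \<oplus>.M s \<odot>.M x" by (auto simp: L_def)
   have eq: "(t \<otimes> r) \<odot>.M y \<in> N0 \<longleftrightarrow> (t \<otimes> s) \<odot>.M x \<in> N0" if t: "t \<in> carrier R" for t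
   proof -
    have nc: "n \<in> carrier M" by (rule s0(1)[OF n(1)])
    have e: "(t \<otimes> r) \<odot>.M y = t \<odot>.M n \<oplus>.M (t \<otimes> s) \<odot>.M x"
     using t r n nc x y by (simp add: smult_assoc1 smult_r_distr)
    have tn: "t \<odot>.M n \<in> N0" by (rule s0(4)[OF t n(1)])
    have "(t \<otimes> s) \<odot>.M x = (t \<otimes> r) \<odot>.M y \<ominus>.M t \<odot>.M n"
     unfolding e using t n nc x
     by (simp add: a_minus_def M.a_comm[of "t \<odot>.M n"] M.a_assoc M.r_neg)
    then show ?thesis using e tn s0(3,6) by metis
   qed
   have "s \<notin> P"
   proof
    assume "s \<in> P"
    then have "(\<one> \<otimes> r) \<odot>.M y \<in> N0" using eq[of \<one>] x n by simp
    then show False using r y by simp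
   qed
   have "t \<in> Q \<longleftrightarrow> t \<in> P" if t: "t \<in> carrier R" for t
   proof -
    have "t \<in> Q \<longleftrightarrow> t \<otimes> r \<in> Q"
     using primeideal.I_prime[OF pQ t r(1)] r(3) ideal.I_r_closed[OF primeideal.axioms(1)[OF pQ] _ r(1)] by blast
    also have "\<dots> \<longleftrightarrow> (t \<otimes> r) \<odot>.M y \<in> N0" using y t r by simp
    also have "\<dots> \<longleftrightarrow> t \<otimes> s \<in> P" using eq[OF t] x t n by simp
    also have "\<dots> \<longleftrightarrow> t \<in> P"
     using primeideal.I_prime[OF pP t n(2)] \<open>s \<notin> P\<close> ideal.I_r_closed[OF primeideal.axioms(1)[OF pP] _ n(2)] by blast
    finally show ?thesis .
   qed
   then have "Q = P" using x y by blast
   then show ?thesis by simp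
  qed
 qed
 then show False using fin inf0 finite_subset by blast
qed

end

section \<open>Frobenius pushforwards of free modules\<close>

text \<open>The module (F^e_*R)^X. Only the scalar action depends on e, so the same functions can be
  viewed at every level. Values off X are zero, so that a function is determined by its values on
  X.\<close>

definition power_module :: "('a, 'k) ring_scheme => nat => nat => 'i set => ('a, 'i => 'a) module" where
 "power_module R p e X = \<lparr>carrier = {f. (\<forall>i\<in>X. f i \<in> carrier R) \<and> (\<forall>i. i \<notin> X --> f i = \<zero>.R)},
   monoid.mult = undefined, one = undefined, zero = (\<lambda>_. \<zero>.R),
   add = (\<lambda>f g i. f i \<oplus>.R g i), smult = (\<lambda>r f i. frob R p e r \<otimes>.R f i)\<rparr>"

context char_ring
begin

lemma power_module_simps:
 "f \<in> carrier (power_module R p e X) \<longleftrightarrow> (\<forall>i\<in>X. f i \<in> carrier R) \<and> (\<forall>i. i \<notin> X --> f i = \<zero>)"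
 "\<zero>\<^bsub>power_module R p e X\<^esub> = (\<lambda>_. \<zero>)"
 "f \<oplus>\<^bsub>power_module R p e X\<^esub> g = (\<lambda>i. f i \<oplus> g i)"
 "r \<odot>\<^bsub>power_module R p e X\<^esub> f = (\<lambda>i. fr e r \<otimes> f i)"
 by (simp_all add: power_module_def)

lemma power_module_closed:
 "f \<in> carrier (power_module R p e X) ==> f i \<in> carrier R"
 by (cases "i \<in> X") (auto simp: power_module_simps)

lemma power_module_module: "module R (power_module R p e X)"
proof (rule moduleI)
 show "abelian_group (power_module R p e X)"
 proof (rule abelian_groupI)
  fix f assume f: "f \<in> carrier (power_module R p e X)"
  show "\<exists>g\<in>carrier (power_module R p e X). g \<oplus>\<^bsub>power_module R p e X\<^esub> f = \<zero>\<^bsub>power_module R p e X\<^esub>"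
   using f power_module_closed[OF f]
   by (intro bexI[of _ "\<lambda>i. \<ominus> f i"]) (auto simp: power_module_simps l_neg)
  show "\<zero>\<^bsub>power_module R p e X\<^esub> \<oplus>\<^bsub>power_module R p e X\<^esub> f = f"
   using power_module_closed[OF f] by (simp add: power_module_simps)
 next
  fix f g assume *: "f \<in> carrier (power_module R p e X)" "g \<in> carrier (power_module R p e X)"
  note c = power_module_closed[OF *(1)] power_module_closed[OF *(2)]
  show "f \<oplus>\<^bsub>power_module R p e X\<^esub> g = g \<oplus>\<^bsub>power_module R p e X\<^esub> f"
   using c by (simp add: power_module_simps a_comm)
  fix h assume "h \<in> carrier (power_module R p e X)"
  then show "f \<oplus>\<^bsub>power_module R p e X\<^esub> g \<oplus>\<^bsub>power_module R p e X\<^esub> h =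
    f \<oplus>\<^bsub>power_module R p e X\<^esub> (g \<oplus>\<^bsub>power_module R p e X\<^esub> h)"
   using c power_module_closed[of h e X] by (simp add: power_module_simps a_assoc)
 qed (auto simp: power_module_simps)
next
 fix a f g assume *: "a \<in> carrier R" "f \<in> carrier (power_module R p e X)" "g \<in> carrier (power_module R p e X)"
 then show "a \<odot>\<^bsub>power_module R p e X\<^esub> (f \<oplus>\<^bsub>power_module R p e X\<^esub> g) =
   a \<odot>\<^bsub>power_module R p e X\<^esub> f \<oplus>\<^bsub>power_module R p e X\<^esub> a \<odot>\<^bsub>power_module R p e X\<^esub> g"
  using power_module_closed[OF *(2)] power_module_closed[OF *(3)] by (simp add: power_module_simps r_distr)
next
 fix a b f assume *: "a \<in> carrier R" "b \<in> carrier R" "f \<in> carrier (power_module R p e X)"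
 note c = power_module_closed[OF *(3)]
 show "(a \<oplus> b) \<odot>\<^bsub>power_module R p e X\<^esub> f =
   a \<odot>\<^bsub>power_module R p e X\<^esub> f \<oplus>\<^bsub>power_module R p e X\<^esub> b \<odot>\<^bsub>power_module R p e X\<^esub> f"
  using * c by (simp add: power_module_simps l_distr fr_add)
 show "a \<otimes> b \<odot>\<^bsub>power_module R p e X\<^esub> f = a \<odot>\<^bsub>power_module R p e X\<^esub> (b \<odot>\<^bsub>power_module R p e X\<^esub> f)"
  using * c by (simp add: power_module_simps m_assoc fr_mult)
qed (auto simp: power_module_simps cring_axioms power_module_closed intro!: ext)

lemma finsum_in_submodule_like:
 assumes "finite A" "\<zero> \<in> N" "N \<subseteq> carrier R" "!!x y. x \<in> N ==> y \<in> N ==> x \<oplus> y \<in> N" "!!a. a \<in> A ==> f a \<in> N"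
 shows "(\<Oplus>a\<in>A. f a) \<in> N"
 using assms(1,5)
proof (induction A rule: finite_induct)
 case (insert a A)
 have "(\<Oplus>a\<in>insert a A. f a) = f a \<oplus> (\<Oplus>a\<in>A. f a)"
  using insert assms(3) by (subst finsum_insert) auto
 then show ?case using insert assms(4) by auto
qed (simp add: assms)

text \<open>Evaluation at the new index is a map to R whose kernel is literally the free module on
  the remaining indices, thanks to the zero values off the index set.\<close>

lemma noeth_free_module:
 assumes noeth: "noetherian_ring R" and "finite X"
 shows "noeth_module R (power_module R p 0 X)"
 using assms(2)
proof (induction X rule: finite_induct)
 case empty
 interpret M: module R "power_module R p 0 {}" by (rule power_module_module)
 have c: "carrier (power_module R p 0 {}) = {\<zero>\<^bsub>power_module R p 0 {}\<^esub>}" by (auto simp: power_module_def)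
 have "N = {\<zero>\<^bsub>power_module R p 0 {}\<^esub>}" if "submodule N R (power_module R p 0 {})" for N
  using M.submodule_simps(1,2)[OF that] c by blast
 then show ?case unfolding noeth_module_def using M.module_axioms by blast
next
 case (insert i X)
 let ?M = "power_module R p 0 (insert i X)"
 let ?h = "\<lambda>f. f i"
 have h: "?h \<in> mod_hom R ?M (ring_module R)"
  by (auto simp: mod_hom_def power_module_simps ring_module_def)
 have "?M\<lparr>carrier := {x \<in> carrier ?M. ?h x = \<zero>\<^bsub>ring_module R\<^esub>}\<rparr> = power_module R p 0 X"
  using insert.hyps by (auto simp: power_module_def ring_module_def)
 then show ?case
  using noeth_module_ext[OF power_module_module noeth_ring_module[OF noeth] h] insert.IH by simp
qed

end

text \<open>\<open>U\<close> is a finite generating set of the R-module F^e_*R.\<close>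

definition frob_gens :: "('a, 'k) ring_scheme => nat => nat => 'a set => bool" where
 "frob_gens R p e U \<longleftrightarrow> finite U \<and> U \<subseteq> carrier R \<and>
   (\<forall>r\<in>carrier R. \<exists>c\<in>U \<rightarrow> carrier R. r = (\<Oplus>.R u\<in>U. frob R p e (c u) \<otimes>.R u))"

locale ffin_ring = char_ring +
 assumes ffin: "F_finite p R"
begin

lemma noeth: "noetherian_ring R" using ffin by (simp add: F_finite_def)

lemma frob_gens_1: "\<exists>U. frob_gens R p 1 U"
proof -
 let ?M = "frobenius_pushforward p 1 R (ring_module R)"
 interpret M: abelian_monoid ?M
  by (rule abelian_monoidI) (auto simp: frobenius_pushforward_def ring_module_def a_ac)
 have fs: "finsum ?M f A = finsum R f A" if "f \<in> A \<rightarrow> carrier R" "finite A" for f and A :: "'a set"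
  using that(2,1)
 proof (induction A rule: finite_induct)
  case empty
  then show ?case using M.finsum_empty[of f] by (simp add: frobenius_pushforward_def ring_module_def)
 next
  case (insert a A)
  have "finsum ?M f (insert a A) = f a \<oplus>.?M finsum ?M f A"
   using insert by (intro M.finsum_insert) (auto simp: frobenius_pushforward_def ring_module_def)
  then show ?case using insert by (auto simp: frobenius_pushforward_def ring_module_def)
 qed
 obtain A where A: "A \<subseteq> carrier R" "finite A"
  "!!x. x \<in> carrier R ==> \<exists>c\<in>A \<rightarrow> carrier R. x = (\<Oplus>.?M a\<in>A. c a \<odot>.?M a)"
  using ffin unfolding F_finite_def finitely_generated_module_def
  by (auto simp: frobenius_pushforward_def ring_module_def)
 have "frob_gens R p 1 A"
  unfolding frob_gens_def
 proof (intro conjI ballI A)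
  fix r assume "r \<in> carrier R"
  then obtain c where c: "c \<in> A \<rightarrow> carrier R" "r = (\<Oplus>.?M a\<in>A. c a \<odot>.?M a)" using A(3) by blast
  have e: "c a \<odot>.?M a = fr 1 (c a) \<otimes> a" for a by (simp add: frobenius_pushforward_def ring_module_def frob_def)
  have "(\<Oplus>.?M a\<in>A. c a \<odot>.?M a) = (comb 1 A c (\<lambda>a. a))"
   unfolding e using c A by (intro fs) auto
  then show "\<exists>c\<in>A \<rightarrow> carrier R. r = (comb 1 A c (\<lambda>a. a))" using c by auto
 qed
 then show ?thesis by blast
qed

text \<open>If the a generate F_*R and the u generate F^e_*R, then the elements u^p a generate
  F^(e+1)_*R: the coefficients with respect to the a are expanded in the u, and Frobenius is applied
  to these expansions.\<close>

lemma frob_gens_ex: "\<exists>U. frob_gens R p e U"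
proof (induction e)
 case 0
 have "frob_gens R p 0 {\<one>}"
  unfolding frob_gens_def by (auto intro!: bexI[of _ "\<lambda>_. _"])
 then show ?case by blast
next
 case (Suc e)
 obtain A where A: "frob_gens R p 1 A" using frob_gens_1 by blast
 obtain U where U: "frob_gens R p e U" using Suc by blast
 define V where "V = (\<lambda>(a, u). fr 1 u \<otimes> a) ` (A \<times> U)"
 define N where "N = {(\<Oplus>v\<in>V. fr (Suc e) (c v) \<otimes> v) | c. c \<in> V \<rightarrow> carrier R}"
 have V: "finite V" "V \<subseteq> carrier R" using A U by (auto simp: V_def frob_gens_def subsetD)
 have Nc: "N \<subseteq> carrier R" using V by (auto simp: N_def intro!: finsum_closed)
 have Nz: "\<zero> \<in> N"
 proof -
  have "(\<Oplus>v\<in>V. fr (Suc e) \<zero> \<otimes> v) = (\<Oplus>v\<in>V. \<zero>)" using V by (intro finsum_cong') auto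
  then have "\<zero> = (\<Oplus>v\<in>V. fr (Suc e) ((\<lambda>_. \<zero>) v) \<otimes> v)" by simp
  then show ?thesis unfolding N_def by (intro CollectI exI[of _ "\<lambda>_. \<zero>"]) auto
 qed
 have Na: "x \<oplus> y \<in> N" if "x \<in> N" "y \<in> N" for x y
 proof -
  obtain c d where cd: "c \<in> V \<rightarrow> carrier R" "d \<in> V \<rightarrow> carrier R"
   "x = (\<Oplus>v\<in>V. fr (Suc e) (c v) \<otimes> v)" "y = (\<Oplus>v\<in>V. fr (Suc e) (d v) \<otimes> v)"
   using \<open>x \<in> N\<close> \<open>y \<in> N\<close> by (auto simp: N_def)
  have "x \<oplus> y = (\<Oplus>v\<in>V. fr (Suc e) (c v) \<otimes> v \<oplus> fr (Suc e) (d v) \<otimes> v)"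
   unfolding cd using V cd by (intro finsum_addf[symmetric]) (auto simp: Pi_iff subsetD)
  also have "\<dots> = (\<Oplus>v\<in>V. fr (Suc e) (c v \<oplus> d v) \<otimes> v)"
   using V cd by (intro finsum_cong') (auto simp: fr_add l_distr Pi_iff subsetD)
  finally show ?thesis unfolding N_def using cd by (intro CollectI exI[of _ "\<lambda>v. c v \<oplus> d v"]) auto
 qed
 have Nm: "fr (Suc e) r \<otimes> v \<in> N" if v: "v \<in> V" and r: "r \<in> carrier R" for r v
 proof -
  have "(\<Oplus>w\<in>V. fr (Suc e) (if w = v then r else \<zero>) \<otimes> w) = (\<Oplus>w\<in>V. if v = w then fr (Suc e) r \<otimes> w else \<zero>)"
   using V r v by (intro finsum_cong') auto
  also have "\<dots> = fr (Suc e) r \<otimes> v"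
   using V r v by (subst add.finprod_singleton) auto
  finally have "fr (Suc e) r \<otimes> v = (\<Oplus>w\<in>V. fr (Suc e) (if w = v then r else \<zero>) \<otimes> w)" by simp
  then show ?thesis unfolding N_def using r by (intro CollectI exI[of _ "\<lambda>w. if w = v then r else \<zero>"]) auto
 qed
 have "r \<in> N" if r: "r \<in> carrier R" for r
 proof -
  obtain c where c: "c \<in> A \<rightarrow> carrier R" "r = (comb 1 A c (\<lambda>a. a))"
   using A r unfolding frob_gens_def by blast
  have "fr 1 (c a) \<otimes> a \<in> N" if a: "a \<in> A" for a
  proof -
   have ac: "a \<in> carrier R" "c a \<in> carrier R" using A a c by (auto simp: frob_gens_def)
   obtain d where d: "d \<in> U \<rightarrow> carrier R" "c a = (comb e U d (\<lambda>u. u))"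
    using U ac(2) unfolding frob_gens_def by blast
   have Uc: "finite U" "U \<subseteq> carrier R" using U by (auto simp: frob_gens_def)
   have "fr 1 (c a) = (\<Oplus>u\<in>U. fr 1 (fr e (d u) \<otimes> u))" unfolding d(2) using Uc d by (intro fr_finsum) auto
   then have "fr 1 (c a) \<otimes> a = (\<Oplus>u\<in>U. fr 1 (fr e (d u) \<otimes> u) \<otimes> a)"
    using Uc d ac by (simp, intro finsum_ldistr) (auto simp: Pi_iff subsetD)
   moreover have "fr 1 (fr e (d u) \<otimes> u) \<otimes> a \<in> N" if u: "u \<in> U" for u
   proof -
    have uc: "u \<in> carrier R" "d u \<in> carrier R" using Uc d u by auto
    have "fr 1 (fr e (d u) \<otimes> u) \<otimes> a = fr (Suc e) (d u) \<otimes> (fr 1 u \<otimes> a)"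
     using uc ac fr_add_exp[of "d u" 1 e] by (simp add: fr_mult m_assoc)
    moreover have "fr 1 u \<otimes> a \<in> V" using a u unfolding V_def by (intro image_eqI[of _ _ "(a, u)"]) auto
    ultimately show ?thesis using Nm uc by simp
   qed
   ultimately show ?thesis using finsum_in_submodule_like[OF Uc(1) Nz Nc Na, of "\<lambda>u. fr 1 (fr e (d u) \<otimes> u) \<otimes> a"] by auto
  qed
  then show ?thesis unfolding c(2)
   using A finsum_in_submodule_like[of A N "\<lambda>a. fr 1 (c a) \<otimes> a", OF _ Nz Nc Na] by (auto simp: frob_gens_def)
 qed
 then have "frob_gens R p (Suc e) V" unfolding frob_gens_def N_def using V by blast
 then show ?case by blast
qed

text \<open>A finite generating set U presents F^e_*R as a quotient of the free module on U, so a
  power of it is an image of the free module on \<open>X \<times> U\<close>.\<close>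

lemma noeth_power_module:
 fixes X :: "'i set"
 assumes "finite X"
 shows "noeth_module R (power_module R p e X)"
proof -
 obtain U where U: "frob_gens R p e U" using frob_gens_ex by blast
 then have Uc: "finite U" "U \<subseteq> carrier R" by (auto simp: frob_gens_def)
 let ?M = "power_module R p 0 (X \<times> U)" and ?L = "power_module R p e X"
 define h where "h f i = (if i \<in> X then (\<Oplus>u\<in>U. fr e (f (i, u)) \<otimes> u) else \<zero>)" for f and i :: 'i
 have h: "h \<in> mod_hom R ?M ?L"
  unfolding mod_hom_def
 proof (intro CollectI conjI ballI)
  show "h \<in> carrier ?M \<rightarrow> carrier ?L"
   using Uc by (auto simp: power_module_simps h_def subsetD intro!: finsum_closed)
 next
  fix x y assume xy: "x \<in> carrier ?M" "y \<in> carrier ?M"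
  note c = power_module_closed[OF xy(1)] power_module_closed[OF xy(2)]
  have "h (x \<oplus>.?M y) i = h x i \<oplus> h y i" for i
  proof (cases "i \<in> X")
   case True
   have "h (x \<oplus>.?M y) i = (\<Oplus>u\<in>U. fr e (x (i, u)) \<otimes> u \<oplus> fr e (y (i, u)) \<otimes> u)"
    unfolding h_def if_P[OF True] power_module_simps
    using c Uc by (intro finsum_cong') (simp_all add: fr_add l_distr subsetD Pi_iff)
   also have "\<dots> = h x i \<oplus> h y i"
    unfolding h_def if_P[OF True] using c Uc by (intro finsum_addf) (auto simp: subsetD)
   finally show ?thesis .
  qed (simp add: h_def)
  then show "h (x \<oplus>.?M y) = h x \<oplus>.?L h y" unfolding power_module_simps(3)[of e X] by (rule ext)
 next
  fix r x assume xy: "r \<in> carrier R" "x \<in> carrier ?M"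
  note c = power_module_closed[OF xy(2)]
  have "h (r \<odot>.?M x) i = fr e r \<otimes> h x i" for i
  proof (cases "i \<in> X")
   case True
   have "h (r \<odot>.?M x) i = (\<Oplus>u\<in>U. fr e r \<otimes> (fr e (x (i, u)) \<otimes> u))"
    unfolding h_def if_P[OF True] power_module_simps
    using c Uc xy by (intro finsum_cong') (simp_all add: fr_mult m_assoc subsetD Pi_iff)
   also have "\<dots> = fr e r \<otimes> h x i"
    unfolding h_def if_P[OF True] using c Uc xy by (intro finsum_rdistr[symmetric]) (auto simp: subsetD)
   finally show ?thesis .
  qed (simp add: h_def xy)
  then show "h (r \<odot>.?M x) = r \<odot>.?L h x" unfolding power_module_simps(4)[of e X] by (rule ext)
 qed
 have "carrier ?L \<subseteq> h ` carrier ?M"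
 proof
  fix g assume g: "g \<in> carrier ?L"
  have "\<forall>i. \<exists>c\<in>U \<rightarrow> carrier R. g i = (comb e U c (\<lambda>u. u))"
   using U power_module_closed[OF g] unfolding frob_gens_def by blast
  then obtain c where c: "!!i. c i \<in> U \<rightarrow> carrier R" "!!i. g i = (comb e U (c i) (\<lambda>u. u))"
   by metis
  define f where "f = (\<lambda>(i, u). if i \<in> X \<and> u \<in> U then c i u else \<zero>)"
  have "f \<in> carrier ?M" using c(1) by (auto simp: power_module_simps f_def)
  moreover have "h f = g"
  proof
   fix i
   show "h f i = g i"
   proof (cases "i \<in> X")
    case True
    then show ?thesis unfolding h_def c(2)[of i] using c(1)[of i] Uc by (auto simp: f_def intro!: finsum_cong')
   next
    case False
    then show ?thesis using g by (simp add: h_def power_module_simps)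
   qed
  qed
  ultimately show "g \<in> h ` carrier ?M" by blast
 qed
 moreover have "h ` carrier ?M \<subseteq> carrier ?L" using mod_homD(1)[OF h] by blast
 ultimately have "h ` carrier ?M = carrier ?L" by blast
 with noeth_module_image[OF noeth_free_module[OF noeth] power_module_module h] assms Uc
 show ?thesis by simp
qed

end

section \<open>Homomorphisms between Frobenius pushforwards\<close>

text \<open>The R-linear maps from F^e_*R to F^e'_*R, as functions on R. Values outside the carrier
  are unconstrained, which is why equality of such maps is only ever asserted on the
  carrier.\<close>

definition frob_hom :: "('a, 'k) ring_scheme => nat => nat => nat => ('a => 'a) set" where
 "frob_hom R p e e' = {f \<in> carrier R \<rightarrow> carrier R.
   (\<forall>u\<in>carrier R. \<forall>v\<in>carrier R. f (u \<oplus>.R v) = f u \<oplus>.R f v) \<and>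
   (\<forall>r\<in>carrier R. \<forall>u\<in>carrier R. f (frob R p e r \<otimes>.R u) = frob R p e' r \<otimes>.R f u)}"

text \<open>The endomorphisms of $F^e_*R$ that factor through a direct sum of modules $F^{e'}_*R$ with
 \<open>e' < e\<close>.\<close>

inductive_set lower_factoring :: "('a, 'k) ring_scheme => nat => nat => ('a => 'a) set"
 for R p e where
  zero: "(!!u. u \<in> carrier R ==> f u = \<zero>.R) ==> f \<in> lower_factoring R p e"
 | add_comp: "f' \<in> lower_factoring R p e ==> e' < e ==> h \<in> frob_hom R p e e' ==>
   g \<in> frob_hom R p e' e ==> (!!u. u \<in> carrier R ==> f u = f' u \<oplus>.R g (h u)) ==>
   f \<in> lower_factoring R p e"

lemma frob_homD:
 assumes "f \<in> frob_hom R p e e'"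
 shows "u \<in> carrier R ==> f u \<in> carrier R"
  "u \<in> carrier R ==> v \<in> carrier R ==> f (u \<oplus>.R v) = f u \<oplus>.R f v"
  "r \<in> carrier R ==> u \<in> carrier R ==> f (frob R p e r \<otimes>.R u) = frob R p e' r \<otimes>.R f u"
 using assms by (auto simp: frob_hom_def)

lemma frob_homI:
 assumes "!!u. u \<in> carrier R ==> f u \<in> carrier R"
  "!!u v. u \<in> carrier R ==> v \<in> carrier R ==> f (u \<oplus>.R v) = f u \<oplus>.R f v"
  "!!r u. r \<in> carrier R ==> u \<in> carrier R ==> f (frob R p e r \<otimes>.R u) = frob R p e' r \<otimes>.R f u"
 shows "f \<in> frob_hom R p e e'"
 using assms by (auto simp: frob_hom_def)

context char_ring
begin

lemma frob_hom_zero: "f \<in> frob_hom R p e e' ==> f \<zero> = \<zero>"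
 using frob_homD(3)[of f R p e e' \<zero> \<zero>] frob_homD(1)[of f R p e e' \<zero>] by simp

lemma frob_hom_minus:
 assumes f: "f \<in> frob_hom R p e e'" and "u \<in> carrier R" "v \<in> carrier R"
 shows "f (u \<ominus> v) = f u \<ominus> f v"
proof -
 have "f (u \<ominus> v) \<oplus> f v = f u"
  using assms frob_homD(2)[OF f, of "u \<ominus> v" v] by (simp add: a_minus_def a_assoc l_neg)
 then show ?thesis using assms frob_homD(1)[OF f] by (metis a_minus_def add.inv_solve_right minus_closed a_inv_def)
qed

lemma frob_hom_finsum:
 assumes f: "f \<in> frob_hom R p e e'" and "finite A" "g \<in> A \<rightarrow> carrier R"
 shows "f (\<Oplus>a\<in>A. g a) = (\<Oplus>a\<in>A. f (g a))"
 using assms(2,3)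
proof (induction A rule: finite_induct)
 case (insert a A)
 have "(\<lambda>a. f (g a)) \<in> A \<rightarrow> carrier R" "f (g a) \<in> carrier R" using insert frob_homD(1)[OF f] by (auto simp: Pi_iff)
 then show ?case using insert frob_homD(2)[OF f] by (simp add: Pi_iff)
qed (simp add: frob_hom_zero[OF f])

text \<open>Restriction of scalars along Frobenius: the scalar r is replaced by r^p on both
  sides.\<close>

lemma frob_hom_Suc: "frob_hom R p e e' \<subseteq> frob_hom R p (Suc e) (Suc e')"
proof
 fix f assume f: "f \<in> frob_hom R p e e'"
 show "f \<in> frob_hom R p (Suc e) (Suc e')"
  using frob_homD[OF f] by (intro frob_homI) (auto simp: fr_Suc[where e = e] fr_Suc[where e = e'])
qed

text \<open>Here r acts through the ring multiplication of R, not through its p^e'-th power; both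
  actions commute with the scalars.\<close>

lemma frob_hom_smult: "f \<in> frob_hom R p e e' ==> r \<in> carrier R ==> (\<lambda>u. r \<otimes> f u) \<in> frob_hom R p e e'"
 using frob_homD[of f R p e e'] by (intro frob_homI) (auto simp: r_distr m_lcomm)

lemma lower_factoring_frob_hom: "f \<in> lower_factoring R p e ==> f \<in> frob_hom R p e e"
proof (induction rule: lower_factoring.induct)
 case (zero f)
 then show ?case by (intro frob_homI) auto
next
 case (add_comp f' e' h g f)
 note hh = frob_homD[OF add_comp(3)] frob_homD[OF add_comp(4)] frob_homD[OF add_comp(6)]
 show ?case
  by (rule frob_homI) (use hh in \<open>auto simp: add_comp(5) a_ac r_distr\<close>)
qed

lemma lower_factoring_cong:
 assumes "f \<in> lower_factoring R p e" "!!u. u \<in> carrier R ==> f' u = f u"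
 shows "f' \<in> lower_factoring R p e"
 using assms by (cases rule: lower_factoring.cases) (auto intro: lower_factoring.intros)

lemma lower_factoring_add:
 assumes "f \<in> lower_factoring R p e" "g \<in> lower_factoring R p e"
 shows "(\<lambda>u. f u \<oplus> g u) \<in> lower_factoring R p e"
 using assms(1)
proof (induction rule: lower_factoring.induct)
 case (zero f)
 show ?case
  by (rule lower_factoring_cong[OF assms(2)])
   (use zero frob_homD(1)[OF lower_factoring_frob_hom[OF assms(2)]] in auto)
next
 case (add_comp f' e' h g' f)
 note c = frob_homD(1)[OF lower_factoring_frob_hom[OF assms(2)]] frob_homD(1)[OF lower_factoring_frob_hom[OF add_comp(1)]]
  frob_homD(1)[OF add_comp(3)] frob_homD(1)[OF add_comp(4)]
 show ?case
  by (rule lower_factoring.add_comp[OF add_comp(6,2,3,4)]) (use c in \<open>auto simp: add_comp(5) a_ac\<close>)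
qed

lemma lower_factoring_smult:
 assumes "f \<in> lower_factoring R p e" "r \<in> carrier R"
 shows "(\<lambda>u. r \<otimes> f u) \<in> lower_factoring R p e"
 using assms(1)
proof (induction rule: lower_factoring.induct)
 case (zero f)
 then show ?case using assms by (intro lower_factoring.zero) auto
next
 case (add_comp f' e' h g f)
 note c = frob_homD(1)[OF lower_factoring_frob_hom[OF add_comp(1)]]
  frob_homD(1)[OF add_comp(3)] frob_homD(1)[OF add_comp(4)]
 show ?case
  by (rule lower_factoring.add_comp[OF add_comp(6,2,3) frob_hom_smult[OF add_comp(4) assms(2)]])
   (use c assms in \<open>auto simp: add_comp(5) r_distr\<close>)
qed

lemma lower_factoring_comp:
 assumes "e' < e" "h \<in> frob_hom R p e e'" "g \<in> frob_hom R p e' e"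
 shows "(\<lambda>u. g (h u)) \<in> lower_factoring R p e"
 by (rule lower_factoring.add_comp[OF lower_factoring.zero[of R "\<lambda>_. \<zero>"] assms])
  (use frob_homD(1)[OF assms(2)] frob_homD(1)[OF assms(3)] in auto)

text \<open>Restriction of scalars raises all levels of a factorization by one, so the levels in the
  middle stay below the outer one.\<close>

lemma lower_factoring_Suc: "f \<in> lower_factoring R p e ==> f \<in> lower_factoring R p (Suc e)"
proof (induction rule: lower_factoring.induct)
 case (zero f)
 then show ?case by (intro lower_factoring.zero)
next
 case (add_comp f' e' h g f)
 show ?case
  by (rule lower_factoring.add_comp[OF add_comp(6), of "Suc e'" h g])
   (use add_comp frob_hom_Suc in auto)
qed

text \<open>An s in this set outside a prime P means that the identity of F^e_*R factors through
  lower levels after localization at P.\<close>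

definition lower_ideal :: "nat => 'a set" where
 "lower_ideal e = {s \<in> carrier R. (\<lambda>u. fr e s \<otimes> u) \<in> lower_factoring R p e}"

lemma lower_ideal_ideal: "ideal (lower_ideal e) R"
 unfolding ideal_iff_submodule
proof (rule module.submoduleI'[OF ring_module_is_module])
 show "lower_ideal e \<subseteq> carrier (ring_module R)" by (auto simp: lower_ideal_def ring_module_def)
 show "\<zero>\<^bsub>ring_module R\<^esub> \<in> lower_ideal e" by (auto simp: lower_ideal_def ring_module_def intro: lower_factoring.zero)
 show "x \<oplus>\<^bsub>ring_module R\<^esub> y \<in> lower_ideal e" if "x \<in> lower_ideal e" "y \<in> lower_ideal e" for x y
  using that lower_factoring_add[of "\<lambda>u. fr e x \<otimes> u" e "\<lambda>u. fr e y \<otimes> u"]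
  by (auto simp: lower_ideal_def ring_module_def fr_add l_distr intro: lower_factoring_cong)
 show "a \<odot>\<^bsub>ring_module R\<^esub> x \<in> lower_ideal e" if "a \<in> carrier R" "x \<in> lower_ideal e" for a x
  using that lower_factoring_smult[of "\<lambda>u. fr e x \<otimes> u" e "fr e a"]
  by (auto simp: lower_ideal_def ring_module_def fr_mult m_assoc intro: lower_factoring_cong)
qed

text \<open>The factorization is raised by one level and then scaled, since s^(p^(e+1)) is a
  multiple of s^(p^e).\<close>

lemma lower_ideal_Suc: "lower_ideal e \<subseteq> lower_ideal (Suc e)"
proof
 fix s assume s: "s \<in> lower_ideal e"
 then have sc: "s \<in> carrier R" and f: "(\<lambda>u. fr e s \<otimes> u) \<in> lower_factoring R p e" by (auto simp: lower_ideal_def)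
 have "\<exists>y\<in>carrier R. fr (Suc e) s = y \<otimes> fr e s"
 proof -
  obtain y where "y \<in> carrier R" "fr 1 (fr e s) = y \<otimes> fr e s" using fr_multiple[of "fr e s" 1] sc by auto
  then show ?thesis using fr_add_exp[OF sc, of 1 e] by auto
 qed
 then obtain y where y: "y \<in> carrier R" "fr (Suc e) s = y \<otimes> fr e s" by blast
 have "(\<lambda>u. y \<otimes> (fr e s \<otimes> u)) \<in> lower_factoring R p (Suc e)"
  by (rule lower_factoring_smult[OF lower_factoring_Suc[OF f] y(1)])
 then have "(\<lambda>u. fr (Suc e) s \<otimes> u) \<in> lower_factoring R p (Suc e)"
  by (rule lower_factoring_cong) (use y sc in \<open>auto simp: m_assoc\<close>)
 then show "s \<in> lower_ideal (Suc e)" using sc by (simp add: lower_ideal_def)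
qed

lemma id_lower_factoring_mono:
 assumes "(\<lambda>u. u) \<in> lower_factoring R p e0" "e0 \<le> e"
 shows "(\<lambda>u. u) \<in> lower_factoring R p e"
 using assms(2,1) by (induction rule: dec_induct) (auto intro: lower_factoring_Suc)

text \<open>The ideals \<open>lower_ideal e\<close> form a chain; if no prime contains all of them, then their union
 is \<open>R\<close>.\<close>

lemma id_lower_factoring_of_local:
 assumes noeth: "noetherian_ring R"
  and loc: "!!P. primeideal P R ==> \<exists>e. \<not> lower_ideal e \<subseteq> P"
 shows "\<exists>e. (\<lambda>u. u) \<in> lower_factoring R p e"
proof (rule ccontr)
 assume neg: "\<not> ?thesis"
 have mono: "lower_ideal e \<subseteq> lower_ideal e'" if "e \<le> e'" for e e'
  using that by (induction rule: dec_induct) (use lower_ideal_Suc in auto)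
 have nR: "\<one> \<notin> lower_ideal e" for e
 proof
  assume "\<one> \<in> lower_ideal e"
  then have "(\<lambda>u. \<one> \<otimes> u) \<in> lower_factoring R p e" by (simp add: lower_ideal_def)
  then have "(\<lambda>u. u) \<in> lower_factoring R p e" by (rule lower_factoring_cong) simp
  then show False using neg by blast
 qed
 note NR = noeth_ring_module[OF noeth]
 from noeth_module_maximal[of R "ring_module R" 0 UNIV lower_ideal, OF NR] lower_ideal_ideal
 obtain e0 where e0: "!!e. lower_ideal e0 \<subseteq> lower_ideal e ==> lower_ideal e = lower_ideal e0"
  by (auto simp: ideal_iff_submodule)
 have le: "lower_ideal e \<subseteq> lower_ideal e0" for e
  using e0[of "max e e0"] mono[of e "max e e0"] mono[of e0 "max e e0"] by auto
 define \<S> where "\<S> = {I. ideal I R \<and> lower_ideal e0 \<subseteq> I \<and> \<one> \<notin> I}"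
 have "lower_ideal e0 \<in> \<S>" using nR lower_ideal_ideal by (auto simp: \<S>_def)
 from noeth_module_maximal[of R "ring_module R" _ \<S> id, OF NR this]
 obtain I where I: "I \<in> \<S>" "!!J. J \<in> \<S> ==> I \<subseteq> J ==> J = I"
  by (auto simp: \<S>_def ideal_iff_submodule)
 have "maximalideal I R"
 proof (rule maximalidealI)
  show "ideal I R" "carrier R \<noteq> I" using I by (auto simp: \<S>_def)
  fix J assume J: "ideal J R" "I \<subseteq> J" "J \<subseteq> carrier R"
  show "J = I \<or> J = carrier R"
  proof (cases "\<one> \<in> J")
   case True
   then show ?thesis using ideal.one_imp_carrier[OF J(1)] by simp
  next
   case False
   then have "J \<in> \<S>" using J I by (auto simp: \<S>_def)
   then show ?thesis using I(2) J by simp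
  qed
 qed
 then have "primeideal I R" by (rule maximalideal_prime)
 then obtain e where "\<not> lower_ideal e \<subseteq> I" using loc by blast
 then show False using le[of e] I by (auto simp: \<S>_def)
qed

end

section \<open>Combinations over generators of F^e_*R and maps defined by them\<close>

context char_ring
begin

lemma ideal_finsum:
 assumes "ideal I R" "finite A" "!!a. a \<in> A ==> f a \<in> I"
 shows "(\<Oplus>a\<in>A. f a) \<in> I"
 using assms ideal.Icarr[OF assms(1)]
 by (intro finsum_in_submodule_like)
  (auto intro: additive_subgroup.a_closed[OF ideal.axioms(1)] additive_subgroup.zero_closed[OF ideal.axioms(1)])

lemma frob_gens_hom_eq:
 assumes U: "frob_gens R p e U" and f: "f \<in> frob_hom R p e e'" "g \<in> frob_hom R p e e'"
  and eq: "!!u. u \<in> U ==> f u = g u" and x: "x \<in> carrier R"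
 shows "f x = g x"
proof -
 have Uc: "finite U" "U \<subseteq> carrier R" using U by (auto simp: frob_gens_def)
 obtain c where c: "c \<in> U \<rightarrow> carrier R" "x = (comb e U c (\<lambda>u. u))"
  using U x unfolding frob_gens_def by blast
 have *: "k x = (comb e' U c k)" if k: "k \<in> frob_hom R p e e'" for k
 proof -
  have "k x = (\<Oplus>u\<in>U. k (fr e (c u) \<otimes> u))"
   unfolding c(2) using c(1) Uc by (intro frob_hom_finsum[OF k]) (auto simp: Pi_iff subsetD)
  also have "\<dots> = (comb e' U c k)"
   using c(1) Uc frob_homD[OF k] by (intro finsum_cong') (auto simp: Pi_iff subsetD)
  finally show ?thesis .
 qed
 have "(comb e' U c f) = (comb e' U c g)"
  using c(1) Uc frob_homD(1)[OF f(1)] frob_homD(1)[OF f(2)] eq by (intro finsum_cong') (auto simp: Pi_iff subsetD)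
 then show ?thesis using * f by simp
qed

lemma frob_comb_add:
 assumes "finite U" "v \<in> U \<rightarrow> carrier R" "c \<in> U \<rightarrow> carrier R" "d \<in> U \<rightarrow> carrier R"
 shows "(comb e U (\<lambda>u. c u \<oplus> d u) v) = (comb e U c v) \<oplus> (comb e U d v)"
proof -
 have "(comb e U (\<lambda>u. c u \<oplus> d u) v) = (\<Oplus>u\<in>U. fr e (c u) \<otimes> v u \<oplus> fr e (d u) \<otimes> v u)"
  using assms by (intro finsum_cong') (auto simp: Pi_iff fr_add l_distr)
 also have "\<dots> = (comb e U c v) \<oplus> (comb e U d v)"
  using assms by (intro finsum_addf) (auto simp: Pi_iff)
 finally show ?thesis .
qed

lemma frob_comb_smult:
 assumes "finite U" "v \<in> U \<rightarrow> carrier R" "c \<in> U \<rightarrow> carrier R" "r \<in> carrier R"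
 shows "(comb e U (\<lambda>u. r \<otimes> c u) v) = fr e r \<otimes> (comb e U c v)"
proof -
 have "(comb e U (\<lambda>u. r \<otimes> c u) v) = (\<Oplus>u\<in>U. fr e r \<otimes> (fr e (c u) \<otimes> v u))"
  using assms by (intro finsum_cong') (auto simp: Pi_iff fr_mult m_assoc)
 also have "\<dots> = fr e r \<otimes> (comb e U c v)"
  using assms by (intro finsum_rdistr[symmetric]) (auto simp: Pi_iff)
 finally show ?thesis .
qed

lemma frob_comb_closed:
 "finite U ==> v \<in> U \<rightarrow> carrier R ==> c \<in> U \<rightarrow> carrier R ==> (comb e U c v) \<in> carrier R"
 by (intro finsum_closed) (auto simp: Pi_iff)

text \<open>The map is defined by a fixed choice of coefficients for each element. Two expressions
  of the same element differ by a relation, and relations are respected by assumption, so the choice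
  does not matter.\<close>

lemma frob_hom_extend:
 assumes U: "frob_gens R p e U" and v: "v \<in> U \<rightarrow> carrier R"
  and rel: "!!c. c \<in> U \<rightarrow> carrier R ==> (comb e U c (\<lambda>u. u)) = \<zero> ==> (comb e' U c v) = \<zero>"
 obtains f where "f \<in> frob_hom R p e e'"
  "!!c. c \<in> U \<rightarrow> carrier R ==> f (comb e U c (\<lambda>u. u)) = (comb e' U c v)"
proof -
 have Uc: "finite U" "(\<lambda>u. u) \<in> U \<rightarrow> carrier R" using U by (auto simp: frob_gens_def)
 have "\<forall>x\<in>carrier R. \<exists>c\<in>U \<rightarrow> carrier R. x = (comb e U c (\<lambda>u. u))" using U by (simp add: frob_gens_def)
 then obtain c where c: "!!x. x \<in> carrier R ==> c x \<in> U \<rightarrow> carrier R"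
  "!!x. x \<in> carrier R ==> x = (comb e U (c x) (\<lambda>u. u))" by metis
 define f where "f x = (comb e' U (c x) v)" for x
 have fc: "f (comb e U d (\<lambda>u. u)) = (comb e' U d v)" if d: "d \<in> U \<rightarrow> carrier R" for d
 proof -
  define x where "x = (comb e U d (\<lambda>u. u))"
  have x: "x \<in> carrier R" unfolding x_def by (rule frob_comb_closed[OF Uc d])
  define d' where "d' u = \<ominus> \<one> \<otimes> d u" for u
  have d': "d' \<in> U \<rightarrow> carrier R" using d by (auto simp: d'_def Pi_iff)
  \<comment> \<open>Frobenius fixes -1, so a difference of combinations can be formed as c + (-1) d
    with the same factor at both levels.\<close>
  have mo: "fr k (\<ominus> \<one>) = \<ominus> \<one>" for k by (simp add: fr_minus)
  have "(\<Oplus>u\<in>U. fr e (c x u \<oplus> d' u) \<otimes> u) = x \<oplus> fr e (\<ominus> \<one>) \<otimes> x"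
   unfolding frob_comb_add[OF Uc c(1)[OF x] d'] c(2)[OF x, symmetric]
   unfolding d'_def using frob_comb_smult[OF Uc d, of "\<ominus> \<one>" e] by (simp add: x_def)
  then have "(\<Oplus>u\<in>U. fr e (c x u \<oplus> d' u) \<otimes> u) = \<zero>" using x by (simp add: mo l_minus r_neg)
  then have "(comb e' U (\<lambda>u. c x u \<oplus> d' u) v) = \<zero>"
   by (rule rel[rotated]) (use c(1)[OF x] d' in auto)
  then have "f x \<oplus> \<ominus> \<one> \<otimes> (comb e' U d v) = \<zero>"
   unfolding frob_comb_add[OF Uc(1) v c(1)[OF x] d'] unfolding d'_def
   using frob_comb_smult[OF Uc(1) v d, of "\<ominus> \<one>" e'] by (simp add: f_def mo)
  then show ?thesis
   using frob_comb_closed[OF Uc(1) v d, of e'] frob_comb_closed[OF Uc(1) v c(1)[OF x], of e']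
   unfolding x_def[symmetric] f_def
   by (metis (no_types, lifting) a_inv_closed add.inv_solve_right l_minus l_one l_zero minus_minus one_closed zero_closed r_neg add.inv_unique minus_equality)
 qed
 have "f \<in> frob_hom R p e e'"
 proof (rule frob_homI)
  fix x y assume xy: "x \<in> carrier R" "y \<in> carrier R"
  show "f x \<in> carrier R" unfolding f_def by (rule frob_comb_closed[OF Uc(1) v c(1)[OF xy(1)]])
  have "x \<oplus> y = (\<Oplus>u\<in>U. fr e (c x u \<oplus> c y u) \<otimes> u)"
   unfolding frob_comb_add[OF Uc c(1)[OF xy(1)] c(1)[OF xy(2)]] c(2)[OF xy(1), symmetric] c(2)[OF xy(2), symmetric] ..
  then have "f (x \<oplus> y) = (comb e' U (\<lambda>u. c x u \<oplus> c y u) v)"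
   using fc[of "\<lambda>u. c x u \<oplus> c y u"] c(1)[OF xy(1)] c(1)[OF xy(2)] by (auto simp: Pi_iff)
  then show "f (x \<oplus> y) = f x \<oplus> f y"
   unfolding frob_comb_add[OF Uc(1) v c(1)[OF xy(1)] c(1)[OF xy(2)]] by (simp add: f_def)
 next
  fix r x assume rx: "r \<in> carrier R" "x \<in> carrier R"
  have "fr e r \<otimes> x = (\<Oplus>u\<in>U. fr e (r \<otimes> c x u) \<otimes> u)"
   unfolding frob_comb_smult[OF Uc c(1)[OF rx(2)] rx(1)] c(2)[OF rx(2), symmetric] ..
  then have "f (fr e r \<otimes> x) = (comb e' U (\<lambda>u. r \<otimes> c x u) v)"
   using fc[of "\<lambda>u. r \<otimes> c x u"] c(1)[OF rx(2)] rx(1) by (auto simp: Pi_iff)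
  then show "f (fr e r \<otimes> x) = fr e' r \<otimes> f x"
   unfolding frob_comb_smult[OF Uc(1) v c(1)[OF rx(2)] rx(1)] by (simp add: f_def)
 qed
 then show ?thesis using that fc by blast
qed

text \<open>Membership in I (F^e_*R)^X is checked coordinatewise: z is the sum of its coordinates,
  and each of these is a sum of elements of F^e_*R scaled by elements of I.\<close>

lemma power_module_ideal_smult:
 assumes I: "ideal I R" and X: "finite X" and z: "z \<in> carrier (power_module R p e X)"
  and zi: "!!i. i \<in> X ==> \<exists>W d. finite W \<and> W \<subseteq> carrier R \<and> d \<in> W \<rightarrow> I \<and> z i = (comb e W d (\<lambda>w. w))"
 shows "z \<in> ideal_smult R I (power_module R p e X)"
proof -
 let ?M = "power_module R p e X"
 interpret M: module R ?M by (rule power_module_module)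
 let ?N = "ideal_smult R I ?M"
 have N: "submodule ?N R ?M" by (rule M.ideal_smult_submodule[OF I])
 note sN = M.submodule_simps[OF N]
 have single: "(\<lambda>j. if j = i then (comb e W d (\<lambda>w. w)) else \<zero>) \<in> ?N"
  if i: "i \<in> X" and W: "finite W" "W \<subseteq> carrier R" "d \<in> W \<rightarrow> I" for i W d
  using W
 proof (induction W rule: finite_induct)
  case empty
  then show ?case using sN(2) by (simp add: power_module_simps cong: if_cong)
 next
  case (insert w W)
  have dw: "d w \<in> I" "d w \<in> carrier R" using insert ideal.Icarr[OF I] by auto
  have "d w \<odot>.?M (\<lambda>j. if j = i then w else \<zero>) \<in> ?N"
   using dw insert i by (intro ideal_smult.prod) (auto simp: power_module_simps)
  then have *: "(\<lambda>j. if j = i then fr e (d w) \<otimes> w else \<zero>) \<in> ?N"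
   using dw by (simp add: power_module_simps if_distrib cong: if_cong)
  have c: "(\<lambda>w. fr e (d w) \<otimes> w) \<in> insert w W \<rightarrow> carrier R"
   using insert ideal.Icarr[OF I] by (auto simp: Pi_iff subsetD)
  have "(\<lambda>j. if j = i then (\<Oplus>w\<in>insert w W. fr e (d w) \<otimes> w) else \<zero>) =
    (\<lambda>j. if j = i then fr e (d w) \<otimes> w else \<zero>) \<oplus>.?M (\<lambda>j. if j = i then (comb e W d (\<lambda>w. w)) else \<zero>)"
   using insert c by (auto simp: power_module_simps)
  then show ?case using sN(3)[OF *] insert by simp
 qed
 have "(\<lambda>i. if i \<in> D then z i else \<zero>) \<in> ?N" if "finite D" "D \<subseteq> X" for D
  using that
 proof (induction D rule: finite_induct)
  case empty
  then show ?case using sN(2) by (simp add: power_module_simps)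
 next
  case (insert i D)
  obtain W d where W: "finite W" "W \<subseteq> carrier R" "d \<in> W \<rightarrow> I" "z i = (comb e W d (\<lambda>w. w))"
   using zi[of i] insert by blast
  have *: "(\<lambda>j. if j = i then z i else \<zero>) \<in> ?N" using single[OF _ W(1-3), of i] insert unfolding W(4) by simp
  have "(\<lambda>j. if j \<in> insert i D then z j else \<zero>) =
    (\<lambda>j. if j = i then z i else \<zero>) \<oplus>.?M (\<lambda>j. if j \<in> D then z j else \<zero>)"
   using insert power_module_closed[OF z] by (auto simp: power_module_simps)
  then show ?case using sN(3)[OF *] insert by simp
 qed
 moreover have "(\<lambda>i. if i \<in> X then z i else \<zero>) = z" using z by (auto simp: power_module_simps)
 ultimately show ?thesis using X by fastforce
qed

end

context ffin_ring
begin

text \<open>Compares the P-adic topology of the ring R with that of the module F^e_*R. The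
  combinations with coefficients in P^n form an ideal K of R, namely P^n F^e_*R; it contains x^(n
  p^e) for every x in P and therefore a power of P.\<close>

lemma ideal_pow_frob_gens:
 assumes P: "ideal P R" and U: "frob_gens R p e U"
 shows "\<exists>N. \<forall>a\<in>ideal_pow R P N. \<exists>d\<in>U \<rightarrow> ideal_pow R P n. a = (comb e U d (\<lambda>u. u))"
proof -
 let ?I = "ideal_pow R P n"
 have I: "ideal ?I R" by (rule ideal_pow_ideal[OF P])
 note Ic = ideal.Icarr[OF I]
 have Uc: "finite U" "(\<lambda>u. u) \<in> U \<rightarrow> carrier R" using U by (auto simp: frob_gens_def)
 define K where "K = {(comb e U d (\<lambda>u. u)) | d. d \<in> U \<rightarrow> ?I}"
 have KI: "(comb e U d (\<lambda>u. u)) \<in> K" if "d \<in> U \<rightarrow> ?I" for d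
  unfolding K_def using that by blast
 have Kc: "K \<subseteq> carrier R" using Ic by (auto simp: K_def intro!: frob_comb_closed[OF Uc])
 have Ka: "x \<oplus> y \<in> K" if xy: "x \<in> K" "y \<in> K" for x y
 proof -
  obtain c d where cd: "c \<in> U \<rightarrow> ?I" "d \<in> U \<rightarrow> ?I" "x = (comb e U c (\<lambda>u. u))" "y = (comb e U d (\<lambda>u. u))"
   using xy by (auto simp: K_def)
  have "x \<oplus> y = (\<Oplus>u\<in>U. fr e (c u \<oplus> d u) \<otimes> u)"
   unfolding cd using cd Ic by (intro frob_comb_add[OF Uc, symmetric]) auto
  moreover have "(\<lambda>u. c u \<oplus> d u) \<in> U \<rightarrow> ?I"
   using cd by (auto intro: additive_subgroup.a_closed[OF ideal.axioms(1)[OF I]])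
  ultimately show ?thesis using KI[of "\<lambda>u. c u \<oplus> d u"] by simp
 qed
 have Km: "fr e d \<otimes> z \<in> K" if d: "d \<in> ?I" and z: "z \<in> carrier R" for d z
 proof -
  obtain c where c: "c \<in> U \<rightarrow> carrier R" "z = (comb e U c (\<lambda>u. u))"
   using U z unfolding frob_gens_def by blast
  have "fr e d \<otimes> z = (\<Oplus>u\<in>U. fr e (d \<otimes> c u) \<otimes> u)"
   unfolding c(2) by (rule frob_comb_smult[OF Uc c(1) Ic[OF d], symmetric])
  moreover have "(\<lambda>u. d \<otimes> c u) \<in> U \<rightarrow> ?I" using c d by (auto intro: ideal.I_r_closed[OF I])
  ultimately show ?thesis using KI[of "\<lambda>u. d \<otimes> c u"] by simp
 qed
 have zI: "\<zero> \<in> ?I" by (rule additive_subgroup.zero_closed[OF ideal.axioms(1)[OF I]])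
 have Kz: "\<zero> \<in> K" using Km[OF zI zero_closed] by simp
 have Kr: "r \<otimes> x \<in> K" if r: "r \<in> carrier R" and x: "x \<in> K" for r x
 proof -
  obtain d where d: "d \<in> U \<rightarrow> ?I" "x = (comb e U d (\<lambda>u. u))" using x by (auto simp: K_def)
  have "r \<otimes> x = (\<Oplus>u\<in>U. r \<otimes> (fr e (d u) \<otimes> u))"
   unfolding d(2) using d Uc r Ic by (intro finsum_rdistr) (auto simp: Pi_iff)
  also have "\<dots> \<in> K"
  proof (rule finsum_in_submodule_like[OF Uc(1) Kz Kc Ka])
   fix u assume u: "u \<in> U"
   have "r \<otimes> (fr e (d u) \<otimes> u) = fr e (d u) \<otimes> (r \<otimes> u)" using d u Uc r Ic by (auto simp: m_lcomm Pi_iff)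
   then show "r \<otimes> (fr e (d u) \<otimes> u) \<in> K" using Km[of "d u" "r \<otimes> u"] d u Uc r by (auto simp: Pi_iff)
  qed
  finally show ?thesis .
 qed
 have "ideal K R"
  unfolding ideal_iff_submodule
  by (rule module.submoduleI'[OF ring_module_is_module]) (use Kc Ka Kz Kr in \<open>auto simp: ring_module_def\<close>)
 moreover have "\<exists>k::nat. x [^] k \<in> K" if x: "x \<in> P" for x
 proof -
  have xc: "x \<in> carrier R" by (rule ideal.Icarr[OF P x])
  have "fr e (x [^] n) \<otimes> \<one> \<in> K" by (rule Km[OF power_mem_ideal_pow[OF P x] one_closed])
  then show ?thesis using xc by (auto simp: frob_def nat_pow_pow)
 qed
 ultimately obtain N where "ideal_pow R P N \<subseteq> K" using ideal_pow_nilpotent[OF noeth P] by blast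
 then show ?thesis unfolding K_def by blast
qed

end

section \<open>Descent from the completion of a localization\<close>

text \<open>An axiomatic description of the canonical map from \<open>R\<close> to the completion \<open>S\<close> of \<open>R\<^sub>P\<close>;
 \<open>F n\<close> is the kernel of the projection from \<open>S\<close> to \<open>R\<^sub>P / P\<^sup>n R\<^sub>P\<close>.\<close>

locale completion_data = ffin_ring R p + S: char_ring S p + q: ring_hom_cring R S q
 for R (structure) and S (structure) and p and q +
 fixes P :: "'a set" and F :: "nat => 'c set"
 assumes prime: "primeideal P R"
  and F_ideal: "ideal (F n) S"
  and F_0: "F 0 = carrier S"
  and F_Suc: "F (Suc n) \<subseteq> F n"
  and F_sep: "(!!n. x \<in> F n) ==> x = \<zero>.S"
  and F_mult: "x \<in> F m ==> y \<in> F n ==> x \<otimes>.S y \<in> F (m + n)"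
  and complete: "(!!n. w n \<in> carrier S) ==> (!!n. w (Suc n) \<ominus>.S w n \<in> F n) ==>
   \<exists>l\<in>carrier S. \<forall>n. l \<ominus>.S w n \<in> F n"
  and dense: "x \<in> carrier S ==> \<exists>a\<in>carrier R. \<exists>s\<in>carrier R - P. q s \<otimes>.S x \<ominus>.S q a \<in> F n"
  and F_iota: "r \<in> carrier R ==> q r \<in> F n \<longleftrightarrow> (\<exists>s\<in>carrier R - P. s \<otimes> r \<in> ideal_pow R P n)"
  and unit: "s \<in> carrier R - P ==> q s \<in> Units S"
begin

abbreviation frS :: "nat => 'c => 'c" where "frS e x \<equiv> frob S p e x"

lemma P_ideal: "ideal P R" by (rule primeideal.axioms(1)[OF prime])

lemma iota_fr[simp]: "x \<in> carrier R ==> q (fr e x) = frS e (q x)"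
 by (simp add: frob_def)

lemma F_carrier: "x \<in> F n ==> x \<in> carrier S" by (rule ideal.Icarr[OF F_ideal])

lemma F_antimono: "m \<le> n ==> F n \<subseteq> F m"
 by (induction rule: dec_induct) (use F_Suc in auto)

lemma F_add: "x \<in> F n ==> y \<in> F n ==> x \<oplus>.S y \<in> F n"
 by (rule additive_subgroup.a_closed[OF ideal.axioms(1)[OF F_ideal]])

lemma F_zero: "\<zero>.S \<in> F n"
 by (rule additive_subgroup.zero_closed[OF ideal.axioms(1)[OF F_ideal]])

lemma F_uminus: "x \<in> F n ==> \<ominus>.S x \<in> F n"
 by (rule additive_subgroup.a_inv_closed[OF ideal.axioms(1)[OF F_ideal]])

lemma F_minus: "x \<in> F n ==> y \<in> F n ==> x \<ominus>.S y \<in> F n"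
 unfolding a_minus_def by (intro F_add F_uminus)

lemma F_lmult: "x \<in> F n ==> r \<in> carrier S ==> r \<otimes>.S x \<in> F n"
 by (rule ideal.I_l_closed[OF F_ideal])

lemma F_rmult: "x \<in> F n ==> r \<in> carrier S ==> x \<otimes>.S r \<in> F n"
 by (rule ideal.I_r_closed[OF F_ideal])

lemma F_finsum: "finite A ==> (!!a. a \<in> A ==> f a \<in> F n) ==> (\<Oplus>.S a\<in>A. f a) \<in> F n"
 by (rule S.ideal_finsum[OF F_ideal])

lemma F_frob: "x \<in> F n ==> frS e x \<in> F n"
 using S.fr_multiple[OF F_carrier, of x n e] F_lmult[of x n] by auto

lemma F_diff_trans:
 assumes "x \<ominus>.S y \<in> F n" "y \<ominus>.S z \<in> F n" "x \<in> carrier S" "y \<in> carrier S" "z \<in> carrier S"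
 shows "x \<ominus>.S z \<in> F n"
proof -
 have "x \<ominus>.S z = (x \<ominus>.S y) \<oplus>.S (y \<ominus>.S z)" using assms(3-5) by algebra
 then show ?thesis using F_add assms by simp
qed

lemma F_iota_pow: "r \<in> ideal_pow R P n ==> q r \<in> F n"
proof -
 assume r: "r \<in> ideal_pow R P n"
 have rc: "r \<in> carrier R" by (rule ideal.Icarr[OF ideal_pow_ideal[OF P_ideal] r])
 then have "\<one> \<otimes> r \<in> ideal_pow R P n" using r by simp
 then show ?thesis unfolding F_iota[OF rc] using prime_one_notin[OF prime] by blast
qed

lemma frS_comb_iota:
 assumes "finite U" "U \<subseteq> carrier R" "y \<in> U \<rightarrow> carrier S"
 shows "(S.comb e U y q) \<in> carrier S"
 using assms by (intro S.finsum_closed) (auto simp: Pi_iff subsetD)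

text \<open>Density replaces z by a fraction a / s, where a lies in \<open>P^M\<close> after
  multiplication by some s1 outside P. The generators expand this multiple of a, and the
  denominators are then divided out of the coefficients in S.\<close>

lemma approx_step:
 assumes U: "frob_gens R p e U" and z: "z \<in> F M"
  and M: "!!a. a \<in> ideal_pow R P M ==> \<exists>d\<in>U \<rightarrow> ideal_pow R P n. a = (comb e U d (\<lambda>u. u))"
  and MN: "M \<le> N"
 shows "\<exists>d\<in>U \<rightarrow> F n. z \<ominus>.S (S.comb e U d q) \<in> F N"
proof -
 have Uc: "finite U" "U \<subseteq> carrier R" using U by (auto simp: frob_gens_def)
 have zc: "z \<in> carrier S" by (rule F_carrier[OF z])
 obtain a s where a: "a \<in> carrier R" "s \<in> carrier R - P" "q s \<otimes>.S z \<ominus>.S q a \<in> F N"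
  using dense[OF zc] by blast
 have sc: "s \<in> carrier R" "q s \<in> carrier S" using a by auto
 have "q s \<otimes>.S z \<ominus>.S (q s \<otimes>.S z \<ominus>.S q a) \<in> F M"
  by (rule F_minus[OF F_lmult[OF z sc(2)]]) (use a(3) F_antimono[OF MN] in blast)
 moreover have "q s \<otimes>.S z \<ominus>.S (q s \<otimes>.S z \<ominus>.S q a) = q a"
 proof -
  have "x \<ominus>.S (x \<ominus>.S y) = y" if "x \<in> carrier S" "y \<in> carrier S" for x y
   using that by algebra
  then show ?thesis using sc zc a(1) by simp
 qed
 ultimately have "q a \<in> F M" by simp
 then obtain s1 where s1: "s1 \<in> carrier R - P" "s1 \<otimes> a \<in> ideal_pow R P M" using F_iota a(1) by blast
 define t where "t = s1 \<otimes> s"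
 have t: "t \<in> carrier R - P" unfolding t_def by (rule prime_mult_notin[OF prime s1(1) a(2)])
 then have tc: "t \<in> carrier R" by blast
 \<comment> \<open>Coefficients act through p^e-th powers, so a denominator t in front of z can be
   absorbed by them only as t^(p^e); y supplies the missing factor.\<close>
 obtain y where y: "y \<in> carrier R" "fr e t = y \<otimes> t" using fr_multiple[OF tc] by blast
 have "y \<otimes> (s1 \<otimes> a) \<in> ideal_pow R P M"
  by (rule ideal.I_l_closed[OF ideal_pow_ideal[OF P_ideal] s1(2) y(1)])
 from M[OF this] obtain d where d: "d \<in> U \<rightarrow> ideal_pow R P n" "y \<otimes> (s1 \<otimes> a) = (comb e U d (\<lambda>u. u))"
  by blast
 have dc: "d \<in> U \<rightarrow> carrier R" using d(1) ideal.Icarr[OF ideal_pow_ideal[OF P_ideal]] by blast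
 define w where "w = inv\<^bsub>S\<^esub> (q t)"
 have w: "w \<in> carrier S" "w \<otimes>.S q t = \<one>.S" using unit[OF t] by (auto simp: w_def)
 define d' where "d' u = w \<otimes>.S q (d u)" for u
 have d'F: "d' \<in> U \<rightarrow> F n" unfolding d'_def
  using d(1) by (intro Pi_I F_lmult F_iota_pow w(1)) auto
 have wy: "frS e w \<otimes>.S (q y \<otimes>.S q t) = \<one>.S"
 proof -
  have "q y \<otimes>.S q t = frS e (q t)" using y tc by (metis q.hom_mult iota_fr)
  then show ?thesis using S.fr_mult[OF w(1), of "q t" e] w tc by simp
 qed
 have "(S.comb e U d' q) = frS e w \<otimes>.S (S.comb e U (\<lambda>u. q (d u)) q)"
  unfolding d'_def using Uc dc w by (intro S.frob_comb_smult) auto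
 also have "(S.comb e U (\<lambda>u. q (d u)) q) = q (comb e U d (\<lambda>u. u))"
  using Uc dc by (subst q.hom_finsum) (auto simp: Pi_iff subsetD intro!: S.finsum_cong')
 also have "\<dots> = q y \<otimes>.S (q s1 \<otimes>.S q a)" using d(2)[symmetric] y s1 a by simp
 finally have eq: "(S.comb e U d' q) = frS e w \<otimes>.S (q y \<otimes>.S (q s1 \<otimes>.S q a))" .
 have c: "frS e w \<in> carrier S" "q y \<in> carrier S" "q s1 \<in> carrier S" "q a \<in> carrier S" "q t = q s1 \<otimes>.S q s"
  using w y s1 a by (auto simp: t_def)
 have "z = (frS e w \<otimes>.S (q y \<otimes>.S q t)) \<otimes>.S z" using wy zc by simp
 then have "z \<ominus>.S (S.comb e U d' q) =
   (frS e w \<otimes>.S (q y \<otimes>.S q t)) \<otimes>.S z \<ominus>.S frS e w \<otimes>.S (q y \<otimes>.S (q s1 \<otimes>.S q a))"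
  using eq by simp
 also have "\<dots> = (frS e w \<otimes>.S (q y \<otimes>.S q s1)) \<otimes>.S (q s \<otimes>.S z \<ominus>.S q a)"
  unfolding c(5) using c(1-4) sc(2) zc by algebra
 also have "\<dots> \<in> F N" using a(3) c sc by (intro F_lmult) auto
 finally show ?thesis using d'F by blast
qed

text \<open>The coefficients are built by successive approximation: \<open>N i\<close> is such that
 \<open>P\<^sup>N\<^sup>(\<^sup>i\<^sup>)\<close> consists of combinations of the generators with coefficients in the \<open>p\<^sup>e\<close>-th powers
 of elements of \<open>P\<^sup>i\<close>.\<close>

lemma approx_series:
 assumes U: "frob_gens R p e U" and x: "x \<in> F (N n)"
  and N: "!!i a. a \<in> ideal_pow R P (N i) ==> \<exists>d\<in>U \<rightarrow> ideal_pow R P i. a = (comb e U d (\<lambda>u. u))"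
  and mono: "!!i. N i \<le> N (Suc i)" and ge: "!!i. i \<le> N i"
 shows "\<exists>y\<in>U \<rightarrow> F n. x = (S.comb e U y q)"
proof -
 have Uc: "finite U" "U \<subseteq> carrier R" using U by (auto simp: frob_gens_def)
 have Ui: "q \<in> U \<rightarrow> carrier S" using Uc by auto
 have xc: "x \<in> carrier S" by (rule F_carrier[OF x])
 let ?c = "\<lambda>y. (S.comb e U y q)"
 have cc: "?c y \<in> carrier S" if "y \<in> U \<rightarrow> carrier S" for y by (rule frS_comb_iota[OF Uc that])
 have FS: "y \<in> U \<rightarrow> carrier S" if "y \<in> U \<rightarrow> F k" for y k using that F_carrier by blast
 have "\<exists>f. \<forall>i. (f i \<in> U \<rightarrow> F n \<and> x \<ominus>.S ?c (f i) \<in> F (N (n + i))) \<and>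
   (\<forall>u\<in>U. f (Suc i) u \<ominus>.S f i u \<in> F (n + i))"
 proof (rule dependent_nat_choice)
  have "?c (\<lambda>_. \<zero>.S) = (\<Oplus>.S u\<in>U. \<zero>.S)" using Uc by (intro S.finsum_cong') (auto simp: subsetD)
  then have "x \<ominus>.S ?c (\<lambda>_. \<zero>.S) = x" using xc by (simp add: a_minus_def)
  then show "\<exists>y. y \<in> U \<rightarrow> F n \<and> x \<ominus>.S ?c y \<in> F (N (n + 0))"
   using x F_zero by (intro exI[of _ "\<lambda>_. \<zero>.S"]) auto
 next
  fix y i assume y: "y \<in> U \<rightarrow> F n \<and> x \<ominus>.S ?c y \<in> F (N (n + i))"
  obtain d where d: "d \<in> U \<rightarrow> F (n + i)" "(x \<ominus>.S ?c y) \<ominus>.S ?c d \<in> F (N (Suc (n + i)))"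
   using approx_step[OF U conjunct2[OF y] N mono] by blast
  have yd: "y \<in> U \<rightarrow> carrier S" "d \<in> U \<rightarrow> carrier S" using y d(1) FS by blast+
  have "?c (\<lambda>u. y u \<oplus>.S d u) = ?c y \<oplus>.S ?c d" by (rule S.frob_comb_add[OF Uc(1) Ui yd])
  then have "x \<ominus>.S ?c (\<lambda>u. y u \<oplus>.S d u) = (x \<ominus>.S ?c y) \<ominus>.S ?c d"
  proof -
   have "a \<ominus>.S (b \<oplus>.S c) = (a \<ominus>.S b) \<ominus>.S c" if "a \<in> carrier S" "b \<in> carrier S" "c \<in> carrier S" for a b c
    using that by algebra
   then show ?thesis using \<open>?c (\<lambda>u. y u \<oplus>.S d u) = ?c y \<oplus>.S ?c d\<close> cc[OF yd(1)] cc[OF yd(2)] xc by simp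
  qed
  moreover have "(y u \<oplus>.S d u) \<ominus>.S y u \<in> F (n + i)" if u: "u \<in> U" for u
  proof -
   have "y u \<in> carrier S" "d u \<in> carrier S" using yd u by auto
   then have "(y u \<oplus>.S d u) \<ominus>.S y u = d u" by algebra
   then show ?thesis using d(1) u by auto
  qed
  moreover have "(\<lambda>u. y u \<oplus>.S d u) \<in> U \<rightarrow> F n"
   using y d(1) F_antimono[of n "n + i"] F_add by (auto simp: Pi_iff subset_iff)
  ultimately show "\<exists>y'. (y' \<in> U \<rightarrow> F n \<and> x \<ominus>.S ?c y' \<in> F (N (n + Suc i))) \<and> (\<forall>u\<in>U. y' u \<ominus>.S y u \<in> F (n + i))"
   using d(2) by (intro exI[of _ "\<lambda>u. y u \<oplus>.S d u"]) auto
 qed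
 then obtain f where f: "!!i. f i \<in> U \<rightarrow> F n" "!!i. x \<ominus>.S ?c (f i) \<in> F (N (n + i))"
  "!!i u. u \<in> U ==> f (Suc i) u \<ominus>.S f i u \<in> F (n + i)" by blast
 have fS: "f i u \<in> carrier S" if "u \<in> U" for i u using f(1) that F_carrier by (auto simp: Pi_iff)
 have "\<exists>l\<in>carrier S. \<forall>i. l \<ominus>.S f i u \<in> F i" if u: "u \<in> U" for u
  by (rule complete) (use fS[OF u] f(3)[OF u] F_antimono[of i "n + i" for i] in \<open>auto simp: subset_iff\<close>)
 then obtain l where l: "!!u. u \<in> U ==> l u \<in> carrier S" "!!u i. u \<in> U ==> l u \<ominus>.S f i u \<in> F i"
  by metis
 have lF: "l \<in> U \<rightarrow> F n"
 proof
  fix u assume u: "u \<in> U"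
  have "l u = (l u \<ominus>.S f n u) \<oplus>.S f n u" using l(1)[OF u] fS[OF u, of n] by algebra
  then show "l u \<in> F n" using F_add[OF l(2)[OF u]] f(1) u by (metis PiE)
 qed
 have lc: "l \<in> U \<rightarrow> carrier S" using l(1) by blast
 have "x \<ominus>.S ?c l \<in> F i" for i
 proof (rule F_diff_trans[OF _ _ xc cc cc[OF lc]])
  show fi: "f i \<in> U \<rightarrow> carrier S" using fS by blast
  have "i \<le> N (n + i)" using ge[of "n + i"] by simp
  then show "x \<ominus>.S ?c (f i) \<in> F i" using f(2)[of i] F_antimono by blast
  have "?c (f i) = ?c (\<lambda>u. (f i u \<ominus>.S l u) \<oplus>.S l u)"
  proof (intro S.finsum_cong')
   fix u assume u: "u \<in> U"
   have "(f i u \<ominus>.S l u) \<oplus>.S l u = f i u" using fS[OF u, of i] l(1)[OF u] by algebra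
   then show "frS e (f i u) \<otimes>.S q u = frS e ((f i u \<ominus>.S l u) \<oplus>.S l u) \<otimes>.S q u" by simp
  qed (use fS l(1) Ui in auto)
  also have "\<dots> = ?c (\<lambda>u. f i u \<ominus>.S l u) \<oplus>.S ?c l"
   using fS l(1) by (intro S.frob_comb_add[OF Uc(1) Ui]) auto
  finally have "?c (f i) = ?c (\<lambda>u. f i u \<ominus>.S l u) \<oplus>.S ?c l" .
  moreover have "?c (\<lambda>u. f i u \<ominus>.S l u) \<in> F i"
  proof (rule F_finsum[OF Uc(1)])
   fix u assume u: "u \<in> U"
   have "f i u \<ominus>.S l u = \<ominus>.S (l u \<ominus>.S f i u)" using fS[OF u, of i] l(1)[OF u] by algebra
   then have "f i u \<ominus>.S l u \<in> F i" using F_uminus l(2)[OF u] by simp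
   then show "frS e (f i u \<ominus>.S l u) \<otimes>.S q u \<in> F i" using F_rmult F_frob Ui u by blast
  qed
  moreover have "(a \<oplus>.S b) \<ominus>.S b = a" if "a \<in> carrier S" "b \<in> carrier S" for a b using that by algebra
  ultimately show "?c (f i) \<ominus>.S ?c l \<in> F i" using cc[OF lc] F_carrier by simp
 qed
 then have "x \<ominus>.S ?c l = \<zero>.S" by (rule F_sep)
 then have "x = ?c l" using xc cc[OF lc] by (metis S.r_right_minus_eq)
 then show ?thesis using lF by blast
qed

lemma approx_index:
 assumes U: "frob_gens R p e U"
 obtains N :: "nat => nat" where "N 0 = 0"
  "!!i a. a \<in> ideal_pow R P (N i) ==> \<exists>d\<in>U \<rightarrow> ideal_pow R P i. a = (comb e U d (\<lambda>u. u))"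
  "!!i. N i \<le> N (Suc i)" "!!i. i \<le> N i"
proof -
 obtain N0 where N0: "!!i a. a \<in> ideal_pow R P (N0 i) ==> \<exists>d\<in>U \<rightarrow> ideal_pow R P i. a = (comb e U d (\<lambda>u. u))"
  using ideal_pow_frob_gens[OF P_ideal U] by metis
 \<comment> \<open>The sum makes N monotone and dominates \<open>N0 i\<close>, the summand i gives i
   <= N i, and N 0 = 0 allows a series to start from an arbitrary element of S = F 0.\<close>
 define N where "N i = (if i = 0 then 0 else i + (\<Sum>j\<le>i. N0 j))" for i
 show ?thesis
 proof (rule that[of N])
  show "\<exists>d\<in>U \<rightarrow> ideal_pow R P i. a = (comb e U d (\<lambda>u. u))" if a: "a \<in> ideal_pow R P (N i)" for i a
  proof (cases "i = 0")
   case True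
   then show ?thesis using U a by (simp add: frob_gens_def N_def)
  next
   case False
   have "N0 i \<le> (\<Sum>j\<le>i. N0 j)" by (rule member_le_sum) auto
   then have "N0 i \<le> N i" using False by (simp add: N_def)
   then show ?thesis using N0 a ideal_pow_antimono[OF P_ideal] by blast
  qed
 qed (auto simp: N_def)
qed

text \<open>The series with n = 0: the images of generators of F^e_*R generate F^e_*S over
  S.\<close>

lemma frob_gens_S:
 assumes U: "frob_gens R p e U" and x: "x \<in> carrier S"
 shows "\<exists>y\<in>U \<rightarrow> carrier S. x = (S.comb e U y q)"
proof -
 obtain N :: "nat => nat" where N: "N 0 = 0"
  "!!i a. a \<in> ideal_pow R P (N i) ==> \<exists>d\<in>U \<rightarrow> ideal_pow R P i. a = (comb e U d (\<lambda>u. u))"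
  "!!i. N i \<le> N (Suc i)" "!!i. i \<le> N i"
  by (rule approx_index[OF U], rule that)
 have "x \<in> F (N 0)" using x N(1) F_0 by simp
 from approx_series[OF U this N(2-4)] show ?thesis using F_0 by simp
qed

text \<open>Elements deep in the filtration are combinations of the fixed generators with
  coefficients in F n; linearity of f moves these coefficients outside, where they keep the value in
  F n.\<close>

lemma frob_hom_S_continuous:
 assumes f: "f \<in> frob_hom S p e e'"
 shows "\<exists>N. \<forall>x\<in>F N. f x \<in> F n"
proof -
 obtain U where U: "frob_gens R p e U" using frob_gens_ex by blast
 have Uc: "finite U" "U \<subseteq> carrier R" using U by (auto simp: frob_gens_def)
 have Ui: "q \<in> U \<rightarrow> carrier S" using Uc by auto
 obtain N :: "nat => nat" where N: "N 0 = 0"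
  "!!i a. a \<in> ideal_pow R P (N i) ==> \<exists>d\<in>U \<rightarrow> ideal_pow R P i. a = (comb e U d (\<lambda>u. u))"
  "!!i. N i \<le> N (Suc i)" "!!i. i \<le> N i"
  by (rule approx_index[OF U], rule that)
 have "f x \<in> F n" if x: "x \<in> F (N n)" for x
 proof -
  obtain y where y: "y \<in> U \<rightarrow> F n" "x = (S.comb e U y q)"
   using approx_series[OF U x N(2-4)] by blast
  have yc: "y \<in> U \<rightarrow> carrier S" using y(1) F_carrier by blast
  have "f x = (\<Oplus>.S u\<in>U. f (frS e (y u) \<otimes>.S q u))"
   unfolding y(2) using yc Ui by (intro S.frob_hom_finsum[OF f Uc(1)]) (auto simp: Pi_iff)
  also have "\<dots> \<in> F n"
  proof (rule F_finsum[OF Uc(1)])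
   fix u assume u: "u \<in> U"
   have "f (frS e (y u) \<otimes>.S q u) = frS e' (y u) \<otimes>.S f (q u)"
    using yc Ui u by (intro frob_homD(3)[OF f]) auto
   then show "f (frS e (y u) \<otimes>.S q u) \<in> F n"
    using F_rmult[OF F_frob] y(1) u frob_homD(1)[OF f] Ui by (auto simp: Pi_iff)
  qed
  finally show ?thesis .
 qed
 then show ?thesis by blast
qed

end

section \<open>Approximating homomorphisms over the completion by homomorphisms over R\<close>

context completion_data
begin

lemma finite_common_denominator:
 assumes "finite X"
  and "!!i. i \<in> X ==> \<exists>s\<in>carrier R - P. Q i s"
  and "!!i s t. i \<in> X ==> Q i s ==> s \<in> carrier R - P ==> t \<in> carrier R - P ==> Q i (t \<otimes> s)"
 shows "\<exists>s\<in>carrier R - P. \<forall>i\<in>X. Q i s"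
 using assms
proof (induction X rule: finite_induct)
 case empty
 then show ?case using prime_one_notin[OF prime] by blast
next
 case (insert i X)
 obtain s where s: "s \<in> carrier R - P" "\<forall>i\<in>X. Q i s" using insert by blast
 obtain t where t: "t \<in> carrier R - P" "Q i t" using insert by blast
 have "Q i (s \<otimes> t)" using insert.prems(2)[of i t s] s t by blast
 moreover have "Q j (s \<otimes> t)" if "j \<in> X" for j
  using insert.prems(2)[of j s t] s t that m_comm[of s t] by auto
 ultimately show ?case using prime_mult_notin[OF prime s(1) t(1)] by blast
qed

lemma smult_ideal_pow:
 "x \<in> ideal_pow R P n ==> r \<in> carrier R ==> r \<otimes> x \<in> ideal_pow R P n"
 by (rule ideal.I_l_closed[OF ideal_pow_ideal[OF P_ideal]])

lemma iota_comb:
 assumes "finite U" "v \<in> U \<rightarrow> carrier R" "c \<in> U \<rightarrow> carrier R"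
 shows "q (comb e U c v) = (\<Oplus>.S u\<in>U. frS e (q (c u)) \<otimes>.S q (v u))"
 using assms by (subst q.hom_finsum) (auto simp: Pi_iff intro!: S.finsum_cong')

lemma frob_hom_S_comb:
 assumes f: "f \<in> frob_hom S p e e'" and "finite U" "U \<subseteq> carrier R" "c \<in> U \<rightarrow> carrier R"
 shows "f (q (comb e U c (\<lambda>u. u))) = (\<Oplus>.S u\<in>U. frS e' (q (c u)) \<otimes>.S f (q u))"
proof -
 have "f (q (comb e U c (\<lambda>u. u))) = (\<Oplus>.S u\<in>U. f (frS e (q (c u)) \<otimes>.S q u))"
  using assms by (subst iota_comb) (auto intro!: S.frob_hom_finsum[OF f] simp: Pi_iff subsetD)
 also have "\<dots> = (\<Oplus>.S u\<in>U. frS e' (q (c u)) \<otimes>.S f (q u))"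
  using assms frob_homD[OF f] by (intro S.finsum_cong') (auto simp: Pi_iff subsetD)
 finally show ?thesis .
qed

lemma comb_approx:
 assumes "finite U" "c \<in> U \<rightarrow> carrier S" "w \<in> U \<rightarrow> carrier S" "z \<in> U \<rightarrow> carrier S" "s \<in> carrier S"
  and F: "!!u. u \<in> U ==> w u \<ominus>.S s \<otimes>.S z u \<in> F n"
 shows "S.comb e U c w \<ominus>.S s \<otimes>.S S.comb e U c z \<in> F n"
proof -
 have c: "!!u. u \<in> U ==> frS e (c u) \<in> carrier S" "!!u. u \<in> U ==> w u \<in> carrier S"
  "!!u. u \<in> U ==> z u \<in> carrier S" using assms by auto
 let ?d = "S.comb e U c (\<lambda>u. w u \<ominus>.S s \<otimes>.S z u)"
 have D: "?d \<in> F n" by (intro F_finsum[OF assms(1)] F_lmult F c(1))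
 have E: "s \<otimes>.S S.comb e U c z \<in> carrier S" using assms(5) c by (intro S.m_closed S.finsum_closed) auto
 have "S.comb e U c w = (\<Oplus>.S u\<in>U. frS e (c u) \<otimes>.S (w u \<ominus>.S s \<otimes>.S z u) \<oplus>.S s \<otimes>.S (frS e (c u) \<otimes>.S z u))"
 proof (intro S.finsum_cong')
  fix u assume "u \<in> U"
  then show "frS e (c u) \<otimes>.S w u = frS e (c u) \<otimes>.S (w u \<ominus>.S s \<otimes>.S z u) \<oplus>.S s \<otimes>.S (frS e (c u) \<otimes>.S z u)"
   using c[of u] assms(5) by algebra
 qed (use c assms(5) in auto)
 also have "\<dots> = ?d \<oplus>.S (\<Oplus>.S u\<in>U. s \<otimes>.S (frS e (c u) \<otimes>.S z u))"
  using c assms(5) by (intro S.finsum_addf) auto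
 also have "(\<Oplus>.S u\<in>U. s \<otimes>.S (frS e (c u) \<otimes>.S z u)) = s \<otimes>.S S.comb e U c z"
  using c assms(1,5) by (intro S.finsum_rdistr[symmetric]) auto
 finally have "S.comb e U c w \<ominus>.S s \<otimes>.S S.comb e U c z = ?d"
  using F_carrier[OF D] E by (simp add: a_minus_def S.a_assoc S.r_neg)
 then show ?thesis using D by simp
qed

text \<open>The images of the generators under a homomorphism solve a linear system with coefficients
 in \<open>R\<close>; by density and the Artin--Rees lemma, every solution in \<open>S\<close> is approximated by solutions
 in \<open>R\<close>, up to denominators.\<close>

lemma frob_hom_approx:
 assumes f: "f \<in> frob_hom S p e e'"
 shows "\<exists>g\<in>frob_hom R p e e'. \<exists>s\<in>carrier R - P.
  \<forall>x\<in>carrier R. q (g x) \<ominus>.S q (fr e' s) \<otimes>.S f (q x) \<in> F n"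
proof -
 obtain U where U: "frob_gens R p e U" using frob_gens_ex by blast
 have Uc: "finite U" "U \<subseteq> carrier R" "(\<lambda>u. u) \<in> U \<rightarrow> carrier R" using U by (auto simp: frob_gens_def)
 let ?V = "power_module R p 0 U"
 interpret V: module R ?V by (rule power_module_module)
 have Vn: "noeth_module R ?V" by (rule noeth_power_module[OF Uc(1)])
 have Vf: "c \<in> U \<rightarrow> carrier R" if "c \<in> carrier ?V" for c using that by (auto simp: power_module_simps)
 define Rel where "Rel = {c \<in> carrier ?V. (comb e U c (\<lambda>u. u)) = \<zero>}"
 let ?K = "\<lambda>k v. {c \<in> carrier ?V. comb k U c v = \<zero>}"
 have ker: "submodule (?K k v) R ?V" if v: "v \<in> U \<rightarrow> carrier R" for k v
 proof (rule V.submoduleI')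
  have "(comb k U (\<lambda>u. \<zero>) v) = (\<Oplus>u\<in>U. \<zero>)" using v by (intro finsum_cong') (auto simp: Pi_iff)
  then show "\<zero>.?V \<in> ?K k v"
   by (simp add: power_module_simps)
  show "x \<oplus>.?V y \<in> ?K k v"
   if x: "x \<in> ?K k v"
    and y: "y \<in> ?K k v" for x y
  proof -
   have "x \<in> carrier ?V" "y \<in> carrier ?V" using x y by auto
   moreover have "(comb k U (\<lambda>u. x u \<oplus> y u) v) = \<zero>"
    using x y by (subst frob_comb_add[OF Uc(1) v Vf Vf]) auto
   ultimately show ?thesis using V.M.a_closed[of x y] by (simp add: power_module_simps(3))
  qed
  show "a \<odot>.?V x \<in> ?K k v"
   if a: "a \<in> carrier R" and x: "x \<in> ?K k v" for a x
  proof -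
   have xc: "x \<in> carrier ?V" using x by auto
   have "(comb k U (\<lambda>u. a \<otimes> x u) v) = \<zero>"
    unfolding frob_comb_smult[OF Uc(1) v Vf[OF xc] a] using x a by simp
   then show ?thesis using V.smult_closed[OF a xc] a by (simp add: power_module_simps(4))
  qed
 qed auto
 have Rel: "submodule Rel R ?V" unfolding Rel_def by (rule ker[OF Uc(3)])
 from V.noeth_submodule_fg[OF Vn Rel]
 obtain C where C: "finite C" "C \<subseteq> Rel" and C': "\<forall>K. submodule K R ?V \<and> C \<subseteq> K --> Rel \<subseteq> K"
  by (elim exE conjE)
 have Cc: "c \<in> U \<rightarrow> carrier R" "(comb e U c (\<lambda>u. u)) = \<zero>" if "c \<in> C" for c
  using that C(2) Vf by (auto simp: Rel_def)
 let ?M = "power_module R p 0 C"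
 interpret M: module R ?M by (rule power_module_module)
 have Mn: "noeth_module R ?M" by (rule noeth_power_module[OF C(1)])
 \<comment> \<open>For prospective images v u of the generators u, \<open>L v\<close> lists the
   resulting values on the finitely many relations in C, with the exponent e' of the target level.
   The images define a homomorphism as soon as \<open>L v\<close> is zero.\<close>
 define L where "L v = (\<lambda>c. if c \<in> C then (comb e' U c v) else \<zero>)" for v
 have Lc: "L v \<in> carrier ?M" if v: "v \<in> U \<rightarrow> carrier R" for v
  using frob_comb_closed[OF Uc(1) v Cc(1)] by (auto simp: L_def power_module_simps)
 have La: "L (\<lambda>u. v u \<oplus> w u) = L v \<oplus>.?M L w" if v: "v \<in> U \<rightarrow> carrier R" "w \<in> U \<rightarrow> carrier R" for v w
 proof
  fix c
  show "L (\<lambda>u. v u \<oplus> w u) c = (L v \<oplus>.?M L w) c"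
  proof (cases "c \<in> C")
   case True
   have "(\<Oplus>u\<in>U. fr e' (c u) \<otimes> (v u \<oplus> w u)) = (\<Oplus>u\<in>U. fr e' (c u) \<otimes> v u \<oplus> fr e' (c u) \<otimes> w u)"
    using v Cc(1)[OF True] by (intro finsum_cong') (auto simp: Pi_iff r_distr)
   also have "\<dots> = (comb e' U c v) \<oplus> (comb e' U c w)"
    using v Cc(1)[OF True] by (intro finsum_addf) (auto simp: Pi_iff)
   finally show ?thesis using True by (simp add: L_def power_module_simps)
  qed (simp add: L_def power_module_simps)
 qed
 have Ls: "L (\<lambda>u. r \<otimes> v u) = r \<odot>.?M L v" if v: "v \<in> U \<rightarrow> carrier R" and r: "r \<in> carrier R" for v r
 proof
  fix c
  show "L (\<lambda>u. r \<otimes> v u) c = (r \<odot>.?M L v) c"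
  proof (cases "c \<in> C")
   case True
   have "(\<Oplus>u\<in>U. fr e' (c u) \<otimes> (r \<otimes> v u)) = (\<Oplus>u\<in>U. r \<otimes> (fr e' (c u) \<otimes> v u))"
    using v r Cc(1)[OF True] by (intro finsum_cong') (auto simp: Pi_iff m_lcomm)
   also have "\<dots> = r \<otimes> (comb e' U c v)"
    using v r Cc(1)[OF True] by (intro finsum_rdistr[symmetric]) (auto simp: Pi_iff Uc(1))
   finally show ?thesis using True r by (simp add: L_def power_module_simps)
  qed (use r in \<open>simp add: L_def power_module_simps\<close>)
 qed
 define B where "B = L ` (U \<rightarrow> carrier R)"
 have B: "submodule B R ?M"
 proof (rule M.submoduleI')
  show "B \<subseteq> carrier ?M" using Lc by (auto simp: B_def)
  have "L (\<lambda>u. \<zero> \<otimes> \<zero>) = \<zero> \<odot>.?M L (\<lambda>u. \<zero>)" by (rule Ls) auto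
  also have "\<dots> = \<zero>.?M" using Lc[of "\<lambda>u. \<zero>"] by (intro M.smult_l_null) auto
  finally show "\<zero>.?M \<in> B" unfolding B_def by (metis Pi_I m_closed image_eqI zero_closed)
  show "x \<oplus>.?M y \<in> B" if xy: "x \<in> B" "y \<in> B" for x y
  proof -
   obtain v w where v: "v \<in> U \<rightarrow> carrier R" "w \<in> U \<rightarrow> carrier R" "x = L v" "y = L w" using xy by (auto simp: B_def)
   have "(\<lambda>u. v u \<oplus> w u) \<in> U \<rightarrow> carrier R" using v by (auto simp: Pi_iff)
   then show ?thesis unfolding v(3,4) B_def La[OF v(1,2), symmetric] by (rule imageI)
  qed
  show "a \<odot>.?M x \<in> B" if a: "a \<in> carrier R" and x: "x \<in> B" for a x
  proof -
   obtain v where v: "v \<in> U \<rightarrow> carrier R" "x = L v" using x by (auto simp: B_def)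
   have "(\<lambda>u. a \<otimes> v u) \<in> U \<rightarrow> carrier R" using v a by (auto simp: Pi_iff)
   then show ?thesis unfolding v(2) B_def Ls[OF v(1) a, symmetric] by (rule imageI)
  qed
 qed
 have Bn: "\<exists>y\<in>U \<rightarrow> ideal_pow R P n. L y = b"
  if "b \<in> ideal_smult R (ideal_pow R P n) (?M\<lparr>carrier := B\<rparr>)" for b
  using that
 proof induction
  case (prod a x)
  then obtain v where v: "v \<in> U \<rightarrow> carrier R" "x = L v" by (auto simp: B_def)
  have ac: "a \<in> carrier R" using prod(1) ideal.Icarr[OF ideal_pow_ideal[OF P_ideal]] by blast
  have "(\<lambda>u. a \<otimes> v u) \<in> U \<rightarrow> ideal_pow R P n"
   using v prod(1) by (auto simp: Pi_iff intro: ideal.I_r_closed[OF ideal_pow_ideal[OF P_ideal]])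
  then show ?case using Ls[OF v(1) ac] v(2) by (intro bexI[of _ "\<lambda>u. a \<otimes> v u"]) auto
 next
  case (sum x y)
  then obtain v w where v: "v \<in> U \<rightarrow> ideal_pow R P n" "w \<in> U \<rightarrow> ideal_pow R P n" "L v = x" "L w = y" by blast
  have vc: "v \<in> U \<rightarrow> carrier R" "w \<in> U \<rightarrow> carrier R"
   using v ideal.Icarr[OF ideal_pow_ideal[OF P_ideal]] by blast+
  have "(\<lambda>u. v u \<oplus> w u) \<in> U \<rightarrow> ideal_pow R P n"
   using v by (auto simp: Pi_iff intro: additive_subgroup.a_closed[OF ideal.axioms(1)[OF ideal_pow_ideal[OF P_ideal]]])
  then show ?case using La[OF vc] v by (intro bexI[of _ "\<lambda>u. v u \<oplus> w u"]) auto
 qed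
 \<comment> \<open>Artin--Rees in the image B of L: a value of L that lies deep enough in the free
   module comes from an argument y with entries in P^n. An approximate solution can thus be
   corrected to an exact one by a small change.\<close>
 obtain N where N: "ideal_smult R (ideal_pow R P N) ?M \<inter> B \<subseteq> ideal_smult R (ideal_pow R P n) (?M\<lparr>carrier := B\<rparr>)"
  using M.artin_rees[OF noeth Mn P_ideal B] by blast
 \<comment> \<open>Precision N serves the correction by Artin--Rees, precision n the final
   estimate.\<close>
 define N' where "N' = max N n"
 have fi: "f (q u) \<in> carrier S" if "u \<in> U" for u using that Uc frob_homD(1)[OF f] by auto
 have "\<exists>s\<in>carrier R - P. \<forall>u\<in>U. \<exists>a\<in>carrier R. q s \<otimes>.S f (q u) \<ominus>.S q a \<in> F N'"
 proof (rule finite_common_denominator[OF Uc(1)])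
  show "\<exists>s\<in>carrier R - P. \<exists>a\<in>carrier R. q s \<otimes>.S f (q u) \<ominus>.S q a \<in> F N'" if "u \<in> U" for u
   using dense[OF fi[OF that]] by blast
 next
  fix u s t assume u: "u \<in> U" and s: "s \<in> carrier R - P" and t: "t \<in> carrier R - P"
   and "\<exists>a\<in>carrier R. q s \<otimes>.S f (q u) \<ominus>.S q a \<in> F N'"
  then obtain a where a: "a \<in> carrier R" "q s \<otimes>.S f (q u) \<ominus>.S q a \<in> F N'" by blast
  have c: "q s \<in> carrier S" "q t \<in> carrier S" "q a \<in> carrier S" using s t a by auto
  have "q (t \<otimes> s) \<otimes>.S f (q u) \<ominus>.S q (t \<otimes> a) = q t \<otimes>.S (q s \<otimes>.S f (q u) \<ominus>.S q a)"
   using s t a c fi[OF u] by (simp, algebra)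
  then show "\<exists>a\<in>carrier R. q (t \<otimes> s) \<otimes>.S f (q u) \<ominus>.S q a \<in> F N'"
   using F_lmult[OF a(2) c(2)] t a by (intro bexI[of _ "t \<otimes> a"]) auto
 qed
 then obtain s a0 where s: "s \<in> carrier R - P" and a0: "!!u. u \<in> U ==> a0 u \<in> carrier R"
  "!!u. u \<in> U ==> q s \<otimes>.S f (q u) \<ominus>.S q (a0 u) \<in> F N'" by metis
 have sc: "s \<in> carrier R" using s by blast
 \<comment> \<open>The claim asks for the factor s^(p^e'), not s, so the approximation is scaled
   once more.\<close>
 obtain y0 where y0: "y0 \<in> carrier R" "fr e' s = y0 \<otimes> s" using fr_multiple[OF sc] by blast
 define a where "a u = y0 \<otimes> a0 u" for u
 have ac: "a \<in> U \<rightarrow> carrier R" using y0 a0 by (auto simp: a_def)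
 have aF: "q (a u) \<ominus>.S q (fr e' s) \<otimes>.S f (q u) \<in> F N'" if u: "u \<in> U" for u
 proof -
  have c: "q y0 \<in> carrier S" "q s \<in> carrier S" "q (a0 u) \<in> carrier S" using y0 sc a0(1)[OF u] by auto
  have "q (a u) \<ominus>.S q (fr e' s) \<otimes>.S f (q u) =
    \<ominus>.S (q y0 \<otimes>.S (q s \<otimes>.S f (q u) \<ominus>.S q (a0 u)))"
   unfolding a_def y0(2) q.hom_mult[OF y0(1) a0(1)[OF u]] q.hom_mult[OF y0(1) sc]
   using c fi[OF u] by algebra
  then show ?thesis using F_uminus[OF F_lmult[OF a0(2)[OF u] c(1)]] by simp
 qed
 \<comment> \<open>The exact images f(q u) satisfy the relation c because f is linear, so their
   approximations a u satisfy it up to F N.\<close>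
 have "q (L a c) \<in> F N" if c: "c \<in> C" for c
 proof -
  have "q (L a c) = S.comb e' U (\<lambda>u. q (c u)) (\<lambda>u. q (a u))"
   using c iota_comb[OF Uc(1) ac Cc(1)[OF c]] by (simp add: L_def)
  moreover have "S.comb e' U (\<lambda>u. q (c u)) (\<lambda>u. f (q u)) = \<zero>.S"
   using frob_hom_S_comb[OF f Uc(1,2) Cc(1)[OF c]] Cc(2)[OF c] S.frob_hom_zero[OF f] by simp
  moreover have "S.comb e' U (\<lambda>u. q (c u)) (\<lambda>u. q (a u)) \<ominus>.S q (fr e' s) \<otimes>.S
    S.comb e' U (\<lambda>u. q (c u)) (\<lambda>u. f (q u)) \<in> F N'"
   using ac sc fi Cc(1)[OF c] by (intro comb_approx[OF Uc(1)] aF) auto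
  ultimately have "q (L a c) \<in> F N'"
   using sc q.hom_closed[OF power_module_closed[OF Lc[OF ac], of c]] by (simp add: a_minus_def)
  then show ?thesis using F_antimono[of N N'] by (auto simp: N'_def)
 qed
 then have "\<exists>s\<in>carrier R - P. \<forall>c\<in>C. s \<otimes> L a c \<in> ideal_pow R P N"
 proof (intro finite_common_denominator[OF C(1)])
  fix c s t assume c: "c \<in> C" "s \<otimes> L a c \<in> ideal_pow R P N" "s \<in> carrier R - P" "t \<in> carrier R - P"
  have "L a c \<in> carrier R" using power_module_closed[OF Lc[OF ac]] .
  then have "(t \<otimes> s) \<otimes> L a c = t \<otimes> (s \<otimes> L a c)" using c by (simp add: m_assoc)
  then show "(t \<otimes> s) \<otimes> L a c \<in> ideal_pow R P N" using smult_ideal_pow[OF c(2)] c by simp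
 qed (use F_iota power_module_closed[OF Lc[OF ac]] in blast)
 then obtain s1 where s1: "s1 \<in> carrier R - P" "!!c. c \<in> C ==> s1 \<otimes> L a c \<in> ideal_pow R P N" by blast
 have s1c: "s1 \<in> carrier R" using s1 by blast
 \<comment> \<open>Again the denominator s1 has to appear as a p^e'-th power, to become part of
   \<open>fr e' \<sigma>\<close> at the end.\<close>
 define t where "t = fr e' s1"
 have tc: "t \<in> carrier R" using s1c by (simp add: t_def)
 have tL: "t \<otimes> L a c \<in> ideal_pow R P N" if c: "c \<in> C" for c
 proof -
  obtain y where y: "y \<in> carrier R" "fr e' s1 = y \<otimes> s1" using fr_multiple[OF s1c] by blast
  have "t \<otimes> L a c = y \<otimes> (s1 \<otimes> L a c)"
   using y s1c power_module_closed[OF Lc[OF ac], of c] by (simp add: t_def m_assoc)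
  then show ?thesis using smult_ideal_pow[OF s1(2)[OF c] y(1)] by simp
 qed
 have tLeq: "t \<odot>.?M L a = (\<lambda>c. t \<otimes> L a c)" using tc by (simp add: power_module_simps)
 have "t \<odot>.?M L a \<in> ideal_smult R (ideal_pow R P N) ?M"
 proof (rule power_module_ideal_smult[OF ideal_pow_ideal[OF P_ideal] C(1)])
  show "t \<odot>.?M L a \<in> carrier ?M" by (rule M.smult_closed[OF tc Lc[OF ac]])
  fix c assume c: "c \<in> C"
  have "(t \<odot>.?M L a) c \<in> ideal_pow R P N" using tL[OF c] by (simp add: tLeq)
  moreover have "(t \<odot>.?M L a) c \<in> carrier R" by (rule power_module_closed[OF M.smult_closed[OF tc Lc[OF ac]]])
  ultimately show "\<exists>W d. finite W \<and> W \<subseteq> carrier R \<and> d \<in> W \<rightarrow> ideal_pow R P N \<and> (t \<odot>.?M L a) c = (comb 0 W d (\<lambda>w. w))"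
   by (intro exI[of _ "{\<one>}"] exI[of _ "\<lambda>_. (t \<odot>.?M L a) c"]) auto
 qed
 moreover have "t \<odot>.?M L a \<in> B"
  by (rule M.submodule_simps(4)[OF B tc]) (use ac in \<open>simp add: B_def\<close>)
 ultimately obtain y where y: "y \<in> U \<rightarrow> ideal_pow R P n" "L y = t \<odot>.?M L a" using N Bn by blast
 have yc: "y \<in> U \<rightarrow> carrier R" using y(1) ideal.Icarr[OF ideal_pow_ideal[OF P_ideal]] by blast
 \<comment> \<open>As \<open>L y\<close> equals the scaled value of \<open>L a\<close>, this v
   satisfies all relations exactly; it differs from t a only by y, whose entries lie in P^n.\<close>
 define v where "v u = t \<otimes> a u \<oplus> (\<ominus> \<one>) \<otimes> y u" for u
 have vc: "v \<in> U \<rightarrow> carrier R" using ac yc tc by (auto simp: v_def Pi_iff)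
 have "L v = L (\<lambda>u. t \<otimes> a u) \<oplus>.?M L (\<lambda>u. (\<ominus> \<one>) \<otimes> y u)"
  unfolding v_def using ac yc tc by (intro La) (auto simp: Pi_iff)
 also have "\<dots> = t \<odot>.?M L a \<oplus>.?M (\<ominus> \<one>) \<odot>.?M (t \<odot>.?M L a)"
  using Ls[OF ac tc] Ls[OF yc, of "\<ominus> \<one>"] y(2) by simp
 also have "\<dots> = \<zero>.?M"
  using M.smult_closed[OF tc Lc[OF ac]] by (simp add: M.smult_l_minus M.M.r_neg)
 finally have Lv: "L v = \<zero>.?M" .
 have rel: "(comb e' U c v) = \<zero>" if c: "c \<in> U \<rightarrow> carrier R" "(comb e U c (\<lambda>u. u)) = \<zero>" for c
 proof -
  have "C \<subseteq> ?K e' v"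
  proof
   fix c assume cC: "c \<in> C"
   have "L v c = \<zero>" using Lv by (simp add: power_module_simps)
   then show "c \<in> ?K e' v" using cC C(2) by (auto simp: L_def Rel_def)
  qed
  then have RK: "Rel \<subseteq> ?K e' v" using C' ker[OF vc, of e'] by simp
  define c' where "c' u = (if u \<in> U then c u else \<zero>)" for u
  have e1: "(comb k U c' w) = (comb k U c w)" if "w \<in> U \<rightarrow> carrier R" for w k
   using c(1) that by (intro finsum_cong') (auto simp: c'_def Pi_iff)
  have "c' \<in> Rel" using c e1[OF Uc(3), of e] by (auto simp: Rel_def power_module_simps c'_def)
  then have "c' \<in> ?K e' v" using RK by blast
  then show ?thesis using e1[OF vc, of e'] by simp
 qed
 obtain g where g: "g \<in> frob_hom R p e e'"
  "!!c. c \<in> U \<rightarrow> carrier R ==> g (comb e U c (\<lambda>u. u)) = (comb e' U c v)"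
  by (rule frob_hom_extend[OF U vc rel], assumption+, rule that)
 define \<sigma> where "\<sigma> = s1 \<otimes> s"
 have \<sigma>: "\<sigma> \<in> carrier R - P" unfolding \<sigma>_def by (rule prime_mult_notin[OF prime s1(1) s])
 have \<sigma>eq: "q (fr e' \<sigma>) = q t \<otimes>.S q (fr e' s)" using s1c sc by (simp add: \<sigma>_def t_def fr_mult S.fr_mult)
 have vF: "q (v u) \<ominus>.S q (fr e' \<sigma>) \<otimes>.S f (q u) \<in> F n" if u: "u \<in> U" for u
 proof -
  have c: "q t \<in> carrier S" "q (a u) \<in> carrier S" "q (y u) \<in> carrier S" "q (fr e' s) \<in> carrier S"
   using tc ac yc u sc by auto
  have "q (v u) = q t \<otimes>.S q (a u) \<ominus>.S q (y u)"
   using tc ac yc u by (auto simp: v_def Pi_iff a_minus_def S.l_minus)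
  then have "q (v u) \<ominus>.S q (fr e' \<sigma>) \<otimes>.S f (q u) =
    q t \<otimes>.S (q (a u) \<ominus>.S q (fr e' s) \<otimes>.S f (q u)) \<ominus>.S q (y u)"
   unfolding \<sigma>eq using c fi[OF u] by (simp, algebra)
  moreover have "q (a u) \<ominus>.S q (fr e' s) \<otimes>.S f (q u) \<in> F n"
   using aF[OF u] F_antimono[of n N'] by (auto simp: N'_def)
  moreover have "q (y u) \<in> F n" using y(1) u by (intro F_iota_pow) auto
  ultimately show ?thesis using F_minus[OF F_lmult[OF _ c(1)]] by simp
 qed
 have "q (g x) \<ominus>.S q (fr e' \<sigma>) \<otimes>.S f (q x) \<in> F n" if x: "x \<in> carrier R" for x
 proof -
  obtain c where c: "c \<in> U \<rightarrow> carrier R" "x = (comb e U c (\<lambda>u. u))"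
   using U x unfolding frob_gens_def by blast
  show ?thesis
   unfolding c(2) g(2)[OF c(1)] iota_comb[OF Uc(1) vc c(1)] frob_hom_S_comb[OF f Uc(1,2) c(1)]
   using vc c(1) fi \<sigma> by (intro comb_approx[OF Uc(1)] vF) auto
 qed
 then show ?thesis using g(1) \<sigma> by blast
qed

end

section \<open>Descending the factorization from the completion to R\<close>

context completion_data
begin

text \<open>Each composite of g and h is replaced by a composite of approximations over R. The
  precision N for h is dictated by the continuity of g, because the error of h is mapped by
  g.\<close>

lemma lower_factoring_approx:
 assumes "f \<in> lower_factoring S p e"
 shows "\<exists>g\<in>lower_factoring R p e. \<exists>s\<in>carrier R - P.
  \<forall>x\<in>carrier R. q (g x) \<ominus>.S q (fr e s) \<otimes>.S f (q x) \<in> F n"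
 using assms
proof (induction rule: lower_factoring.induct)
 case (zero f)
 have "q \<zero> \<ominus>.S q (fr e \<one>) \<otimes>.S f (q x) \<in> F n" if "x \<in> carrier R" for x
  using zero[of "q x"] that by (simp add: a_minus_def F_zero)
 then show ?case
  using prime_one_notin[OF prime] by (intro bexI[of _ "\<lambda>_. \<zero>"] bexI[of _ \<one>]) (auto intro: lower_factoring.zero)
next
 case (add_comp f' e' h g f)
 obtain f0 s0 where f0: "f0 \<in> lower_factoring R p e" "s0 \<in> carrier R - P"
  "!!x. x \<in> carrier R ==> q (f0 x) \<ominus>.S q (fr e s0) \<otimes>.S f' (q x) \<in> F n" using add_comp.IH by blast
 obtain N where N: "!!x. x \<in> F N ==> g x \<in> F n" using frob_hom_S_continuous[OF add_comp(4)] by blast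
 obtain h0 s where h0: "h0 \<in> frob_hom R p e e'" "s \<in> carrier R - P"
  "!!x. x \<in> carrier R ==> q (h0 x) \<ominus>.S q (fr e' s) \<otimes>.S h (q x) \<in> F N"
  using frob_hom_approx[OF add_comp(3), of N] by blast
 obtain g0 t where g0: "g0 \<in> frob_hom R p e' e" "t \<in> carrier R - P"
  "!!x. x \<in> carrier R ==> q (g0 x) \<ominus>.S q (fr e t) \<otimes>.S g (q x) \<in> F n"
  using frob_hom_approx[OF add_comp(4), of n] by blast
 have sc: "s0 \<in> carrier R" "s \<in> carrier R" "t \<in> carrier R" using f0 h0 g0 by auto
 \<comment> \<open>The two summands carry different denominators, s0 and t s; each is scaled by the
   denominator of the other to reach the common one
   \<open>(t \<otimes> s) \<otimes> s0\<close>.\<close>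
 define k where "k x = fr e (t \<otimes> s) \<otimes> f0 x \<oplus> fr e s0 \<otimes> g0 (h0 x)" for x
 have k: "k \<in> lower_factoring R p e"
  unfolding k_def using sc
  by (intro lower_factoring_add lower_factoring_smult f0(1) lower_factoring_comp[OF add_comp(2) h0(1) g0(1)]) auto
 define \<sigma> where "\<sigma> = (t \<otimes> s) \<otimes> s0"
 have \<sigma>: "\<sigma> \<in> carrier R - P"
  unfolding \<sigma>_def by (intro prime_mult_notin[OF prime] f0(2) h0(2) g0(2))
 have "q (k x) \<ominus>.S q (fr e \<sigma>) \<otimes>.S f (q x) \<in> F n" if x: "x \<in> carrier R" for x
 proof -
  have ix: "q x \<in> carrier S" using x by simp
  define A where "A = q (fr e (t \<otimes> s))"
  define B where "B = q (fr e s0)"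
  have h0x: "h0 x \<in> carrier R" by (rule frob_homD(1)[OF h0(1) x])
  have c: "A \<in> carrier S" "B \<in> carrier S" "q (f0 x) \<in> carrier S" "f' (q x) \<in> carrier S"
   "q (g0 (h0 x)) \<in> carrier S" "g (h (q x)) \<in> carrier S" "h (q x) \<in> carrier S" "g (q (h0 x)) \<in> carrier S"
   using sc x frob_homD(1)[OF lower_factoring_frob_hom[OF f0(1)]] frob_homD(1)[OF g0(1)] h0x
    frob_homD(1)[OF S.lower_factoring_frob_hom[OF add_comp(1)]] frob_homD(1)[OF add_comp(3)] frob_homD(1)[OF add_comp(4)]
   by (auto simp: A_def B_def)
  have A: "A = q (fr e t) \<otimes>.S q (fr e s)" using sc by (simp add: A_def fr_mult S.fr_mult)
  have tS: "q (fr e t) \<in> carrier S" "q (fr e s) \<in> carrier S" using sc by auto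
  \<comment> \<open>Two comparisons: g0 with g at the point h0 x of R, then g at h0 x with g at the
    scaled h x, whose difference lies in F N and is sent into F n.\<close>
  have ghx: "q (g0 (h0 x)) \<ominus>.S A \<otimes>.S g (h (q x)) \<in> F n"
  proof (rule F_diff_trans)
   show "q (g0 (h0 x)) \<ominus>.S q (fr e t) \<otimes>.S g (q (h0 x)) \<in> F n" by (rule g0(3)[OF h0x])
   have e': "frS e' (q s) \<otimes>.S h (q x) \<in> carrier S" using c sc by simp
   have "g (q (h0 x) \<ominus>.S q (fr e' s) \<otimes>.S h (q x)) \<in> F n" by (rule N[OF h0(3)[OF x]])
   also have "g (q (h0 x) \<ominus>.S q (fr e' s) \<otimes>.S h (q x)) = g (q (h0 x)) \<ominus>.S q (fr e s) \<otimes>.S g (h (q x))"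
    using S.frob_hom_minus[OF add_comp(4), of "q (h0 x)" "frS e' (q s) \<otimes>.S h (q x)"] e' h0x sc c
     frob_homD(3)[OF add_comp(4), of "q s" "h (q x)"] by simp
   finally have *: "g (q (h0 x)) \<ominus>.S q (fr e s) \<otimes>.S g (h (q x)) \<in> F n" .
   have "q (fr e t) \<otimes>.S g (q (h0 x)) \<ominus>.S A \<otimes>.S g (h (q x)) =
     q (fr e t) \<otimes>.S (g (q (h0 x)) \<ominus>.S q (fr e s) \<otimes>.S g (h (q x)))"
    unfolding A using tS c(6,8) by algebra
   then show "q (fr e t) \<otimes>.S g (q (h0 x)) \<ominus>.S A \<otimes>.S g (h (q x)) \<in> F n"
    using F_lmult[OF * tS(1)] by simp
  qed (use c tS in auto)
  have "q (k x) = A \<otimes>.S q (f0 x) \<oplus>.S B \<otimes>.S q (g0 (h0 x))"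
   using sc frob_homD(1)[OF lower_factoring_frob_hom[OF f0(1)] x] frob_homD(1)[OF g0(1) h0x]
   unfolding k_def A_def B_def by (subst q.hom_add) auto
  moreover have "q (fr e \<sigma>) = A \<otimes>.S B" using sc by (simp add: \<sigma>_def A_def B_def fr_mult S.fr_mult)
  moreover have "f (q x) = f' (q x) \<oplus>.S g (h (q x))" by (rule add_comp(5)[OF ix])
  ultimately have "q (k x) \<ominus>.S q (fr e \<sigma>) \<otimes>.S f (q x) =
    (A \<otimes>.S q (f0 x) \<oplus>.S B \<otimes>.S q (g0 (h0 x))) \<ominus>.S (A \<otimes>.S B) \<otimes>.S (f' (q x) \<oplus>.S g (h (q x)))"
   by simp
  also have "\<dots> = A \<otimes>.S (q (f0 x) \<ominus>.S B \<otimes>.S f' (q x)) \<oplus>.S B \<otimes>.S (q (g0 (h0 x)) \<ominus>.S A \<otimes>.S g (h (q x)))"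
   using c(1-6) by algebra
  also have "\<dots> \<in> F n"
   using f0(3)[OF x] ghx c by (intro F_add F_lmult) (auto simp: B_def)
  finally show ?thesis .
 qed
 then show ?case using k \<sigma> by blast
qed

text \<open>Endomorphisms are compared on a finite generating set U, that is, as vectors in
  (F^e_*R)^U. There the maps that factor through lower levels form a submodule T, and the
  approximations place a multiple of the identity vector y in T up to P^n, for every n. Krull's
  theorem then gives an s outside P with s y in T.\<close>

lemma lower_ideal_not_subset:
 assumes id: "(\<lambda>u. u) \<in> lower_factoring S p e"
 shows "\<not> lower_ideal e \<subseteq> P"
proof -
 obtain U where U: "frob_gens R p e U" using frob_gens_ex by blast
 have Uc: "finite U" "U \<subseteq> carrier R" using U by (auto simp: frob_gens_def)
 let ?M = "power_module R p e U"
 interpret M: module R ?M by (rule power_module_module)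
 define res where "res f = (\<lambda>u. if u \<in> U then f u else \<zero>)" for f :: "'a => 'a"
 have resM: "res f \<in> carrier ?M" if "!!u. u \<in> carrier R ==> f u \<in> carrier R" for f
  using that Uc by (auto simp: res_def power_module_simps)
 note lfc = frob_homD(1)[OF lower_factoring_frob_hom]
 define T where "T = res ` lower_factoring R p e"
 have T: "submodule T R ?M"
 proof (rule M.submoduleI')
  show "T \<subseteq> carrier ?M" using resM lfc by (auto simp: T_def)
  have "res (\<lambda>_. \<zero>) \<in> T" unfolding T_def by (intro imageI lower_factoring.zero) simp
  moreover have "res (\<lambda>_. \<zero>) = \<zero>.?M" by (auto simp: res_def power_module_simps)
  ultimately show "\<zero>.?M \<in> T" by simp
  show "x \<oplus>.?M y \<in> T" if xy: "x \<in> T" "y \<in> T" for x y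
  proof -
   obtain f g where fg: "f \<in> lower_factoring R p e" "g \<in> lower_factoring R p e" "x = res f" "y = res g"
    using xy by (auto simp: T_def)
   have "x \<oplus>.?M y = res (\<lambda>u. f u \<oplus> g u)" by (auto simp: fg(3,4) res_def power_module_simps)
   then show ?thesis using lower_factoring_add[OF fg(1,2)] by (simp add: T_def)
  qed
  show "a \<odot>.?M x \<in> T" if a: "a \<in> carrier R" and x: "x \<in> T" for a x
  proof -
   obtain f where f: "f \<in> lower_factoring R p e" "x = res f" using x by (auto simp: T_def)
   have "a \<odot>.?M x = res (\<lambda>u. fr e a \<otimes> f u)" using a by (auto simp: f(2) res_def power_module_simps)
   then show ?thesis using lower_factoring_smult[OF f(1), of "fr e a"] a by (simp add: T_def)
  qed
 qed
 define y where "y = res (\<lambda>u. u)"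
 have y: "y \<in> carrier ?M" unfolding y_def by (rule resM)
 have app: "\<exists>s\<in>carrier R - P. \<exists>t\<in>T. \<exists>z\<in>ideal_smult R (ideal_pow R P n) ?M. s \<odot>.?M y = t \<oplus>.?M z" for n
 proof -
  \<comment> \<open>Entries in the ideal P^N of R are converted into a vector in P^n times the
    module F^e_*R, as Krull's theorem requires.\<close>
  from ideal_pow_frob_gens[OF P_ideal U, of n]
  obtain N where N: "\<forall>a\<in>ideal_pow R P N. \<exists>d\<in>U \<rightarrow> ideal_pow R P n. a = (comb e U d (\<lambda>u. u))" ..
  obtain g s where g: "g \<in> lower_factoring R p e" "s \<in> carrier R - P"
   "!!x. x \<in> carrier R ==> q (g x) \<ominus>.S q (fr e s) \<otimes>.S q x \<in> F N"
   using lower_factoring_approx[OF id, of N] by blast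
  have sc: "s \<in> carrier R" using g by blast
  define w where "w u = g u \<ominus> fr e s \<otimes> u" for u
  have wc: "w u \<in> carrier R" if "u \<in> U" for u using that Uc lfc[OF g(1)] sc by (auto simp: w_def)
  have wF: "q (w u) \<in> F N" if "u \<in> U" for u
   using g(3)[of u] that Uc lfc[OF g(1), of u] sc by (auto simp: w_def subsetD)
  have "\<exists>s\<in>carrier R - P. \<forall>u\<in>U. s \<otimes> w u \<in> ideal_pow R P N"
  proof (rule finite_common_denominator[OF Uc(1)])
   fix u s t assume u: "u \<in> U" and c: "s \<otimes> w u \<in> ideal_pow R P N" "s \<in> carrier R - P" "t \<in> carrier R - P"
   then have "(t \<otimes> s) \<otimes> w u = t \<otimes> (s \<otimes> w u)" using wc[OF u] by (simp add: m_assoc)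
   then show "(t \<otimes> s) \<otimes> w u \<in> ideal_pow R P N" using smult_ideal_pow[OF c(1)] c by simp
  qed (use F_iota wF wc in blast)
  then obtain s2 where s2: "s2 \<in> carrier R - P" "!!u. u \<in> U ==> s2 \<otimes> w u \<in> ideal_pow R P N" by blast
  have s2c: "s2 \<in> carrier R" using s2 by blast
  obtain y' where y': "y' \<in> carrier R" "fr e s2 = y' \<otimes> s2" using fr_multiple[OF s2c] by blast
  have frw: "fr e s2 \<otimes> w u \<in> ideal_pow R P N" if u: "u \<in> U" for u
  proof -
   have "fr e s2 \<otimes> w u = y' \<otimes> (s2 \<otimes> w u)" using y' s2c wc[OF u] by (simp add: m_assoc)
   then show ?thesis using smult_ideal_pow[OF s2(2)[OF u] y'(1)] by simp
  qed
  define z where "z = res (\<lambda>u. \<ominus> \<one> \<otimes> (fr e s2 \<otimes> w u))"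
  have zU: "z u = \<ominus> \<one> \<otimes> (fr e s2 \<otimes> w u)" if "u \<in> U" for u using that by (simp add: z_def res_def)
  have "z \<in> ideal_smult R (ideal_pow R P n) ?M"
  proof (rule power_module_ideal_smult[OF ideal_pow_ideal[OF P_ideal] Uc(1)])
   show "z \<in> carrier ?M" using wc s2c zU by (auto simp: power_module_simps) (simp add: z_def res_def)
   fix u assume u: "u \<in> U"
   have "z u \<in> ideal_pow R P N" unfolding zU[OF u] by (rule smult_ideal_pow[OF frw[OF u]]) simp
   with N obtain d where "d \<in> U \<rightarrow> ideal_pow R P n" "z u = (comb e U d (\<lambda>u. u))" by blast
   then show "\<exists>W d. finite W \<and> W \<subseteq> carrier R \<and> d \<in> W \<rightarrow> ideal_pow R P n \<and> z u = (comb e W d (\<lambda>w. w))"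
    using Uc by blast
  qed
  moreover have "res (\<lambda>u. fr e s2 \<otimes> g u) \<in> T"
   unfolding T_def using s2c by (intro imageI lower_factoring_smult g(1)) auto
  moreover have "(s2 \<otimes> s) \<odot>.?M y = res (\<lambda>u. fr e s2 \<otimes> g u) \<oplus>.?M z"
  proof
   fix u
   show "((s2 \<otimes> s) \<odot>.?M y) u = (res (\<lambda>u. fr e s2 \<otimes> g u) \<oplus>.?M z) u"
   proof (cases "u \<in> U")
    case True
    define a where "a = fr e s2"
    define b where "b = fr e s"
    define c where "c = g u"
    have abc: "a \<in> carrier R" "b \<in> carrier R" "c \<in> carrier R" "u \<in> carrier R"
     using True Uc sc s2c lfc[OF g(1), of u] by (auto simp: a_def b_def c_def)
    have "(a \<otimes> b) \<otimes> u = a \<otimes> c \<oplus> \<ominus> \<one> \<otimes> (a \<otimes> (c \<ominus> b \<otimes> u))"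
     using abc by algebra
    then show ?thesis using True sc s2c zU[OF True]
     by (simp add: power_module_simps y_def res_def fr_mult w_def a_def b_def c_def)
   next
    case False
    then show ?thesis using sc s2c by (simp add: power_module_simps y_def res_def z_def)
   qed
  qed
  moreover have "s2 \<otimes> s \<in> carrier R - P" by (rule prime_mult_notin[OF prime s2(1) g(2)])
  ultimately show ?thesis by blast
 qed
 from M.krull_intersection[OF noeth noeth_power_module[OF Uc(1)] prime T y app]
 obtain s where s: "s \<in> carrier R - P" "s \<odot>.?M y \<in> T" by blast
 then obtain f where f: "f \<in> lower_factoring R p e" "s \<odot>.?M y = res f" by (auto simp: T_def)
 have sc: "s \<in> carrier R" using s by blast
 have m: "(\<lambda>u. fr e s \<otimes> u) \<in> frob_hom R p e e"
  using sc by (intro frob_homI) (auto simp: r_distr m_lcomm)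
 have "fr e s \<otimes> u = f u" if u: "u \<in> U" for u
  using fun_cong[OF f(2), of u] u by (simp add: power_module_simps y_def res_def)
 then have "fr e s \<otimes> x = f x" if "x \<in> carrier R" for x
  using frob_gens_hom_eq[OF U m lower_factoring_frob_hom[OF f(1)] _ that] by blast
 then have "(\<lambda>u. fr e s \<otimes> u) \<in> lower_factoring R p e" by (rule lower_factoring_cong[OF f(1)])
 then show ?thesis using s sc by (auto simp: lower_ideal_def)
qed

end

section \<open>Decompositions into indecomposable modules\<close>

context module
begin

definition mod_span :: "'c set => 'c set" where
 "mod_span X = \<Inter>{K. submodule K R M \<and> X \<subseteq> K}"

lemma mod_span_minimal: "submodule K R M ==> X \<subseteq> K ==> mod_span X \<subseteq> K"
 unfolding mod_span_def by blast

lemma mod_span_superset: "X \<subseteq> mod_span X"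
 unfolding mod_span_def by blast

lemma mod_span_submodule:
 assumes "X \<subseteq> carrier M"
 shows "submodule (mod_span X) R M"
proof (rule submoduleI')
 show "mod_span X \<subseteq> carrier M" by (rule mod_span_minimal[OF carrier_is_submodule assms])
qed (auto simp: mod_span_def submodule_simps)

lemma mod_span_insert:
 assumes X: "X \<subseteq> carrier M" and w: "w \<in> carrier M" and x: "x \<in> mod_span (insert w X)"
 shows "\<exists>y r. y \<in> mod_span X \<and> r \<in> carrier R \<and> x = y \<oplus>.M r \<odot>.M w"
proof -
 let ?L = "{n \<oplus>.M r \<odot>.M w | n r. n \<in> mod_span X \<and> r \<in> carrier R}"
 note L = submodule_adjoin[OF w mod_span_submodule[OF X]]
 have "insert w X \<subseteq> ?L" using L(2,3) mod_span_superset[of X] by (simp only: insert_subset) (metis (no_types, lifting) order_trans)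
 then have "mod_span (insert w X) \<subseteq> ?L" by (rule mod_span_minimal[OF L(1)])
 then show ?thesis using x by blast
qed

text \<open>Summands are nonzero, so that their number can be bounded. Families are unconstrained
  off the index set, which makes it easy to change single components.\<close>

definition direct_sum :: "'c set set => bool" where
 "direct_sum \<D> \<longleftrightarrow> finite \<D> \<and> (\<forall>N\<in>\<D>. submodule N R M \<and> N \<noteq> {\<zero>.M}) \<and>
   (\<forall>x\<in>carrier M. \<exists>y\<in>(\<Pi> N\<in>\<D>. N). x = (\<Oplus>.M N\<in>\<D>. y N)) \<and>
   (\<forall>y\<in>(\<Pi> N\<in>\<D>. N). (\<Oplus>.M N\<in>\<D>. y N) = \<zero>.M --> (\<forall>N\<in>\<D>. y N = \<zero>.M))"

lemma family_closed:
 assumes "!!N. N \<in> \<D> ==> submodule N R M" "y \<in> (\<Pi> N\<in>\<D>. N)"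
 shows "y \<in> \<D> \<rightarrow> carrier M"
 using assms submodule_simps(1) by (auto simp: Pi_iff)

text \<open>Injectivity is independence applied to the difference of two families, and restriction
  to the index set turns a family into an extensional one.\<close>

lemma direct_sum_imp_bij:
 assumes "direct_sum \<D>"
 shows "bij_betw (\<lambda>x. \<Oplus>.M N\<in>\<D>. x N) (\<Pi>\<^sub>E N\<in>\<D>. N) (carrier M)"
proof -
 have fin: "finite \<D>" and sub: "!!N. N \<in> \<D> ==> submodule N R M"
  and span: "!!x. x \<in> carrier M ==> \<exists>y\<in>(\<Pi> N\<in>\<D>. N). x = (\<Oplus>.M N\<in>\<D>. y N)"
  and ind: "!!y N. y \<in> (\<Pi> N\<in>\<D>. N) ==> (\<Oplus>.M N\<in>\<D>. y N) = \<zero>.M ==> N \<in> \<D> ==> y N = \<zero>.M"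
  using assms by (auto simp: direct_sum_def)
 note fc = family_closed[of \<D>, OF sub]
 show ?thesis
  unfolding bij_betw_def
 proof
  show "inj_on (\<lambda>x. \<Oplus>.M N\<in>\<D>. x N) (\<Pi>\<^sub>E N\<in>\<D>. N)"
  proof (rule inj_onI)
   fix x y assume x: "x \<in> (\<Pi>\<^sub>E N\<in>\<D>. N)" and y: "y \<in> (\<Pi>\<^sub>E N\<in>\<D>. N)"
    and eq: "(\<Oplus>.M N\<in>\<D>. x N) = (\<Oplus>.M N\<in>\<D>. y N)"
   have xc: "x \<in> \<D> \<rightarrow> carrier M" "y \<in> \<D> \<rightarrow> carrier M" using x y fc by (auto simp: PiE_def)
   let ?z = "\<lambda>N. x N \<oplus>.M (\<ominus> \<one>) \<odot>.M y N"
   have z: "?z \<in> (\<Pi> N\<in>\<D>. N)"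
    using x y sub by (auto simp: PiE_def Pi_iff intro!: submodule_simps(3,4))
   have yc': "(\<Oplus>.M N\<in>\<D>. y N) \<in> carrier M" using xc by (intro M.finsum_closed)
   have "(\<Oplus>.M N\<in>\<D>. ?z N) = (\<Oplus>.M N\<in>\<D>. x N) \<oplus>.M (\<Oplus>.M N\<in>\<D>. (\<ominus> \<one>) \<odot>.M y N)"
    using xc by (intro M.finsum_addf) (auto simp: Pi_iff)
   also have "(\<Oplus>.M N\<in>\<D>. (\<ominus> \<one>) \<odot>.M y N) = (\<ominus> \<one>) \<odot>.M (\<Oplus>.M N\<in>\<D>. y N)"
    using xc fin by (intro finsum_smult_ldistr[symmetric]) auto
   also have "(\<Oplus>.M N\<in>\<D>. x N) \<oplus>.M (\<ominus> \<one>) \<odot>.M (\<Oplus>.M N\<in>\<D>. y N) = \<zero>.M"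
    using yc' by (simp add: eq smult_l_minus M.r_neg)
   finally have z0: "?z N = \<zero>.M" if "N \<in> \<D>" for N using ind[OF z] that by blast
   have "x N = y N" if N: "N \<in> \<D>" for N
   proof -
    have c: "x N \<in> carrier M" "y N \<in> carrier M" using xc N by auto
    then have "x N \<ominus>.M y N = \<zero>.M" using z0[OF N] by (simp add: smult_l_minus a_minus_def)
    moreover have "x N = (x N \<ominus>.M y N) \<oplus>.M y N" using c by (simp add: a_minus_def M.a_assoc M.l_neg)
    ultimately show ?thesis using c by simp
   qed
   then show "x = y" using x y by (intro PiE_ext)
  qed
  show "(\<lambda>x. \<Oplus>.M N\<in>\<D>. x N) ` (\<Pi>\<^sub>E N\<in>\<D>. N) = carrier M"
  proof (intro equalityI subsetI)
   fix z assume "z \<in> (\<lambda>x. \<Oplus>.M N\<in>\<D>. x N) ` (\<Pi>\<^sub>E N\<in>\<D>. N)"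
   then show "z \<in> carrier M" using fc by (auto simp: PiE_def intro!: M.finsum_closed)
  next
   fix z assume "z \<in> carrier M"
   then obtain y where y: "y \<in> (\<Pi> N\<in>\<D>. N)" "z = (\<Oplus>.M N\<in>\<D>. y N)" using span by blast
   have "(\<Oplus>.M N\<in>\<D>. restrict y \<D> N) = z"
    unfolding y(2) using fc[OF _ y(1)] by (intro M.finsum_cong') auto
   moreover have "restrict y \<D> \<in> (\<Pi>\<^sub>E N\<in>\<D>. N)" using y(1) by auto
   ultimately show "z \<in> (\<lambda>x. \<Oplus>.M N\<in>\<D>. x N) ` (\<Pi>\<^sub>E N\<in>\<D>. N)" by blast
  qed
 qed
qed

lemma finsum_single:
 assumes "finite \<D>" "N \<in> \<D>" "y \<in> carrier M"
 shows "(\<Oplus>.M K\<in>\<D>. if K = N then y else \<zero>.M) = y"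
 using M.add.finprod_singleton[of N \<D> "\<lambda>_. y"] assms by (simp add: eq_commute[of _ N])

text \<open>The component maps are linear because the components of an element are unique: sums and
  multiples of families have the right total.\<close>

lemma bij_projections:
 assumes fin: "finite \<D>" and sub: "!!N. N \<in> \<D> ==> submodule N R M"
  and bij: "bij_betw (\<lambda>x. \<Oplus>.M N\<in>\<D>. x N) (\<Pi>\<^sub>E N\<in>\<D>. N) (carrier M)"
 obtains \<pi> where "!!N. N \<in> \<D> ==> \<pi> N \<in> mod_hom R M (M\<lparr>carrier := N\<rparr>)"
  "!!N x. N \<in> \<D> ==> x \<in> N ==> \<pi> N x = x"
  "!!N K x. N \<in> \<D> ==> K \<in> \<D> ==> N \<noteq> K ==> x \<in> K ==> \<pi> N x = \<zero>.M"
  "!!x. x \<in> carrier M ==> x = (\<Oplus>.M N\<in>\<D>. \<pi> N x)"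
proof -
 let ?s = "\<lambda>x. \<Oplus>.M N\<in>\<D>. x N"
 define c where "c = inv_into (\<Pi>\<^sub>E N\<in>\<D>. N) ?s"
 have inj: "inj_on ?s (\<Pi>\<^sub>E N\<in>\<D>. N)" and im: "?s ` (\<Pi>\<^sub>E N\<in>\<D>. N) = carrier M"
  using bij by (auto simp: bij_betw_def)
 have c: "c x \<in> (\<Pi>\<^sub>E N\<in>\<D>. N)" "?s (c x) = x" if "x \<in> carrier M" for x
 proof -
  have "x \<in> ?s ` (\<Pi>\<^sub>E N\<in>\<D>. N)" using that im by simp
  then show "c x \<in> (\<Pi>\<^sub>E N\<in>\<D>. N)" "?s (c x) = x"
   unfolding c_def by (rule inv_into_into, rule f_inv_into_f)
 qed
 have cc: "c x \<in> \<D> \<rightarrow> carrier M" if "x \<in> carrier M" for x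
  using c(1)[OF that] family_closed[OF sub] by (auto simp: PiE_def)
 have un: "c x N = y N" if "y \<in> (\<Pi> N\<in>\<D>. N)" "?s y = x" "N \<in> \<D>" for x y N
 proof -
  have yc: "y \<in> \<D> \<rightarrow> carrier M" using that family_closed[OF sub] by blast
  have "?s (restrict y \<D>) = ?s y" using yc by (intro M.finsum_cong') auto
  then have "c x = restrict y \<D>"
   unfolding c_def using that by (intro inv_into_f_eq[OF inj]) auto
  then show ?thesis using that by simp
 qed
 show ?thesis
 proof (rule that[of "\<lambda>N x. c x N"])
  fix N assume N: "N \<in> \<D>"
  show "(\<lambda>x. c x N) \<in> mod_hom R M (M\<lparr>carrier := N\<rparr>)"
   unfolding mod_hom_def
  proof (intro CollectI conjI ballI)
   show "(\<lambda>x. c x N) \<in> carrier M \<rightarrow> carrier (M\<lparr>carrier := N\<rparr>)" using c(1) N by (auto simp: PiE_def)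
  next
   fix x y assume xy: "x \<in> carrier M" "y \<in> carrier M"
   have "c (x \<oplus>.M y) N = (\<lambda>N. c x N \<oplus>.M c y N) N"
   proof (rule un[OF _ _ N])
    show "(\<lambda>N. c x N \<oplus>.M c y N) \<in> (\<Pi> N\<in>\<D>. N)"
     using c(1)[OF xy(1)] c(1)[OF xy(2)] by (auto simp: PiE_def Pi_iff intro!: submodule_simps(3)[OF sub])
    show "(\<Oplus>.M N\<in>\<D>. c x N \<oplus>.M c y N) = x \<oplus>.M y"
     using cc[OF xy(1)] cc[OF xy(2)] c(2)[OF xy(1)] c(2)[OF xy(2)] by (subst M.finsum_addf) auto
   qed
   then show "c (x \<oplus>.M y) N = c x N \<oplus>\<^bsub>M\<lparr>carrier := N\<rparr>\<^esub> c y N" by simp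
  next
   fix r x assume rx: "r \<in> carrier R" "x \<in> carrier M"
   have "c (r \<odot>.M x) N = (\<lambda>N. r \<odot>.M c x N) N"
   proof (rule un[OF _ _ N])
    show "(\<lambda>N. r \<odot>.M c x N) \<in> (\<Pi> N\<in>\<D>. N)"
     using c(1)[OF rx(2)] rx(1) by (auto simp: PiE_def Pi_iff intro!: submodule_simps(4)[OF sub])
    show "(\<Oplus>.M N\<in>\<D>. r \<odot>.M c x N) = r \<odot>.M x"
     using cc[OF rx(2)] c(2)[OF rx(2)] rx(1) fin by (subst finsum_smult_ldistr[symmetric]) auto
   qed
   then show "c (r \<odot>.M x) N = r \<odot>\<^bsub>M\<lparr>carrier := N\<rparr>\<^esub> c x N" by simp
  qed
 next
  have zN: "\<zero>.M \<in> N" if "N \<in> \<D>" for N using submodule_simps(2)[OF sub[OF that]] .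
  have *: "c x N = (if N = K then x else \<zero>.M)" if "N \<in> \<D>" "K \<in> \<D>" "x \<in> K" for N K x
   by (rule un[where y = "\<lambda>N. if N = K then x else \<zero>.M"])
    (use that zN finsum_single[OF fin that(2) submodule_simps(1)[OF sub[OF that(2)] that(3)]] in auto)
  show "c x N = x" if "N \<in> \<D>" "x \<in> N" for N x using *[OF that(1,1,2)] by simp
  show "c x N = \<zero>.M" if "N \<in> \<D>" "K \<in> \<D>" "N \<noteq> K" "x \<in> K" for N K x using *[OF that(1,2,4)] that(3) by simp
  show "x = (\<Oplus>.M N\<in>\<D>. c x N)" if "x \<in> carrier M" for x using c(2)[OF that] by simp
 qed
qed

text \<open>Steinitz exchange over a local ring: the number of nonzero summands is at most the number of
 generators.\<close>

lemma exchange_step: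
 assumes loc: "!!r. r \<in> carrier R ==> r \<notin> \<mm> ==> r \<in> Units R"
  and W: "finite W" "W \<subseteq> carrier M" and V: "V \<subseteq> carrier M" and x: "x \<in> mod_span (W \<union> V)"
  and I: "ideal \<mm> R"
 shows "(\<exists>y\<in>ideal_smult R \<mm> M. \<exists>z\<in>mod_span V. x = y \<oplus>.M z) \<or>
  (\<exists>w\<in>W. w \<in> mod_span (W - {w} \<union> insert x V))"
 using W x
proof (induction W arbitrary: x rule: finite_induct)
 case empty
 have x: "x \<in> mod_span V" using empty by simp
 have "x \<in> carrier M" using submodule_simps(1)[OF mod_span_submodule[OF V] x] .
 moreover have "\<zero>.M \<in> ideal_smult R \<mm> M" by (rule submodule_simps(2)[OF ideal_smult_submodule[OF I]])
 ultimately show ?case using x by (intro disjI1 bexI[of _ "\<zero>.M"] bexI[of _ x]) auto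
next
 case (insert w W)
 have wc: "w \<in> carrier M" and Wc: "W \<subseteq> carrier M" using insert by auto
 have "W \<union> V \<subseteq> carrier M" "x \<in> mod_span (insert w (W \<union> V))" using Wc V insert by auto
 from mod_span_insert[OF this(1) wc this(2)]
 obtain y r where yr: "y \<in> mod_span (W \<union> V)" "r \<in> carrier R" "x = y \<oplus>.M r \<odot>.M w" by blast
 have yc: "y \<in> carrier M" using submodule_simps(1)[OF mod_span_submodule yr(1)] Wc V by blast
 have xc: "x \<in> carrier M" using yr yc wc by simp
 show ?case
 \<comment> \<open>A unit coefficient r allows solving for w, which is then exchanged. Otherwise r w
   lies in the maximal ideal times M, and the induction continues with x - r w.\<close>
 proof (cases "r \<in> \<mm>")
  case False
  then have u: "r \<in> Units R" using loc yr by blast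
  let ?H = "mod_span (W \<union> insert x V)"
  have Hs: "submodule ?H R M" using Wc V xc by (intro mod_span_submodule) auto
  have "x \<ominus>.M y = r \<odot>.M w" using yr yc wc by (simp add: a_minus_def M.a_comm[of y] M.a_assoc M.r_neg)
  then have "inv r \<odot>.M (x \<ominus>.M y) = w"
   using u yr wc by (simp add: smult_assoc1[symmetric])
  moreover have "x \<in> ?H" using mod_span_superset[of "W \<union> insert x V"] by blast
  moreover have "y \<in> ?H"
  proof -
   have "mod_span (W \<union> V) \<subseteq> ?H" using mod_span_superset[of "W \<union> insert x V"] by (intro mod_span_minimal[OF Hs]) blast
   then show ?thesis using yr by blast
  qed
  ultimately have "w \<in> ?H" using submodule_simps(4,6)[OF Hs] u by (metis Units_inv_closed)
  then show ?thesis using insert.hyps by (intro disjI2 bexI[of _ w]) auto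
 next
  case True
  have rw: "r \<odot>.M w \<in> ideal_smult R \<mm> M" by (rule ideal_smult.prod[OF True wc])
  from insert.IH[OF Wc yr(1)] show ?thesis
  proof
   assume "\<exists>u\<in>ideal_smult R \<mm> M. \<exists>z\<in>mod_span V. y = u \<oplus>.M z"
   then obtain u z where uz: "u \<in> ideal_smult R \<mm> M" "z \<in> mod_span V" "y = u \<oplus>.M z" by blast
   have c: "u \<in> carrier M" "z \<in> carrier M"
    using submodule_simps(1)[OF ideal_smult_submodule[OF I] uz(1)] submodule_simps(1)[OF mod_span_submodule[OF V] uz(2)] by auto
   have "x = (u \<oplus>.M r \<odot>.M w) \<oplus>.M z" using yr uz c wc by (simp add: M.a_ac)
   then show ?thesis using ideal_smult.sum[OF uz(1) rw] uz(2) by blast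
  next
   assume "\<exists>v\<in>W. v \<in> mod_span (W - {v} \<union> insert y V)"
   then obtain v where v: "v \<in> W" "v \<in> mod_span (W - {v} \<union> insert y V)" by blast
   let ?H = "mod_span (insert w W - {v} \<union> insert x V)"
   have Hs: "submodule ?H R M" using Wc wc V xc by (intro mod_span_submodule) auto
   have sup: "insert w W - {v} \<union> insert x V \<subseteq> ?H" by (rule mod_span_superset)
   have "w \<noteq> v" using v insert.hyps by blast
   then have "w \<in> ?H" "x \<in> ?H" using sup by auto
   then have "x \<ominus>.M r \<odot>.M w \<in> ?H" using submodule_simps(4,6)[OF Hs] yr(2) by blast
   moreover have "x \<ominus>.M r \<odot>.M w = y" using yr yc wc by (simp add: a_minus_def M.a_assoc M.r_neg)
   ultimately have "y \<in> ?H" by simp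
   then have "W - {v} \<union> insert y V \<subseteq> ?H" using sup by blast
   then have "v \<in> ?H" using mod_span_minimal[OF Hs] v(2) by blast
   then show ?thesis using v(1) by blast
  qed
 qed
qed

text \<open>Each summand N contributes an element v N outside \<open>\<mm>\<close> N;
  \<open>sep\<close> stands in for Nakayama's lemma here. These elements are exchanged for
  generators one by one. The exchange cannot fail, since projecting to N kills the elements already
  inserted and would put v N into \<open>\<mm>\<close> N.\<close>

lemma direct_sum_card_le:
 assumes loc: "!!r. r \<in> carrier R ==> r \<notin> \<mm> ==> r \<in> Units R" and I: "ideal \<mm> R"
  and sep: "!!N. submodule N R M ==> N \<subseteq> ideal_smult R \<mm> (M\<lparr>carrier := N\<rparr>) ==> N = {\<zero>.M}"
  and U: "finite U" "U \<subseteq> carrier M" "mod_span U = carrier M"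
  and D: "direct_sum \<D>"
 shows "card \<D> \<le> card U"
proof -
 have fin: "finite \<D>" and sub: "!!N. N \<in> \<D> ==> submodule N R M" and nz: "!!N. N \<in> \<D> ==> N \<noteq> {\<zero>.M}"
  using D by (auto simp: direct_sum_def)
 obtain \<pi> where \<pi>: "!!N. N \<in> \<D> ==> \<pi> N \<in> mod_hom R M (M\<lparr>carrier := N\<rparr>)"
  "!!N x. N \<in> \<D> ==> x \<in> N ==> \<pi> N x = x"
  "!!N K x. N \<in> \<D> ==> K \<in> \<D> ==> N \<noteq> K ==> x \<in> K ==> \<pi> N x = \<zero>.M"
  "!!x. x \<in> carrier M ==> x = (\<Oplus>.M N\<in>\<D>. \<pi> N x)"
  by (rule bij_projections[OF fin sub direct_sum_imp_bij[OF D]], assumption, rule that)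
 have "\<forall>N\<in>\<D>. \<exists>v. v \<in> N \<and> v \<notin> ideal_smult R \<mm> (M\<lparr>carrier := N\<rparr>)"
  using sep[OF sub] nz by blast
 then obtain v where v: "!!N. N \<in> \<D> ==> v N \<in> N" "!!N. N \<in> \<D> ==> v N \<notin> ideal_smult R \<mm> (M\<lparr>carrier := N\<rparr>)"
  by metis
 have vc: "v N \<in> carrier M" if "N \<in> \<D>" for N using v(1)[OF that] submodule_simps(1)[OF sub[OF that]] by blast
 have "\<exists>W. W \<subseteq> U \<and> card W + card \<A> \<le> card U \<and> mod_span (W \<union> v ` \<A>) = carrier M" if "finite \<A>" "\<A> \<subseteq> \<D>" for \<A>
  using that
 proof (induction \<A> rule: finite_induct)
  case empty
  then show ?case using U by (intro exI[of _ U]) auto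
 next
  case (insert N \<A>)
  then obtain W where W: "W \<subseteq> U" "card W + card \<A> \<le> card U" "mod_span (W \<union> v ` \<A>) = carrier M" by auto
  have N: "N \<in> \<D>" "\<A> \<subseteq> \<D>" using insert by auto
  have Wc: "finite W" "W \<subseteq> carrier M" using W U finite_subset by auto
  have Vc: "v ` \<A> \<subseteq> carrier M" using vc N by blast
  have sN: "submodule N R M" by (rule sub[OF N(1)])
  interpret N: module R "M\<lparr>carrier := N\<rparr>" by (rule submodule.submodule_is_module[OF sN module_axioms])
  have "v N \<in> mod_span (W \<union> v ` \<A>)" using W(3) vc[OF N(1)] by simp
  from exchange_step[OF loc Wc Vc this I]
  have "\<exists>w\<in>W. w \<in> mod_span (W - {w} \<union> insert (v N) (v ` \<A>))"
  proof
   assume "\<exists>y\<in>ideal_smult R \<mm> M. \<exists>z\<in>mod_span (v ` \<A>). v N = y \<oplus>.M z"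
   then obtain y z where yz: "y \<in> ideal_smult R \<mm> M" "z \<in> mod_span (v ` \<A>)" "v N = y \<oplus>.M z" by blast
   have c: "y \<in> carrier M" "z \<in> carrier M"
    using submodule_simps(1)[OF ideal_smult_submodule[OF I] yz(1)] submodule_simps(1)[OF mod_span_submodule[OF Vc] yz(2)] by auto
   note h = mod_homD[OF \<pi>(1)[OF N(1)]]
   have "\<pi> N y \<in> ideal_smult R \<mm> (M\<lparr>carrier := N\<rparr>)"
    using yz(1)
   proof induction
    case (prod a x)
    have "a \<odot>\<^bsub>M\<lparr>carrier := N\<rparr>\<^esub> \<pi> N x \<in> ideal_smult R \<mm> (M\<lparr>carrier := N\<rparr>)"
     by (rule ideal_smult.prod[OF prod(1) h(1)[OF prod(2)]])
    then show ?case using h(3)[OF ideal.Icarr[OF I prod(1)] prod(2)] by simp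
   next
    case (sum x y)
    have "x \<in> carrier M" "y \<in> carrier M"
     using submodule_simps(1)[OF ideal_smult_submodule[OF I]] sum by auto
    then show ?case using ideal_smult.sum[OF sum(3,4)] h(2) by simp
   qed
   moreover have "\<pi> N z = \<zero>.M"
   proof -
    have "submodule {x \<in> carrier M. \<pi> N x = \<zero>.M} R M"
    proof (rule submoduleI')
     show "\<zero>.M \<in> {x \<in> carrier M. \<pi> N x = \<zero>.M}"
      using mod_hom_zero[OF \<pi>(1)[OF N(1)] module_axioms N.module_axioms] by simp
     show "x \<oplus>.M y \<in> {x \<in> carrier M. \<pi> N x = \<zero>.M}"
      if "x \<in> {x \<in> carrier M. \<pi> N x = \<zero>.M}" "y \<in> {x \<in> carrier M. \<pi> N x = \<zero>.M}" for x y
      using that h(2)[of x y] by simp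
     show "a \<odot>.M x \<in> {x \<in> carrier M. \<pi> N x = \<zero>.M}"
      if "a \<in> carrier R" "x \<in> {x \<in> carrier M. \<pi> N x = \<zero>.M}" for a x
      using that h(3)[of a x] by simp
    qed auto
    moreover have "v ` \<A> \<subseteq> {x \<in> carrier M. \<pi> N x = \<zero>.M}"
    proof
     fix x assume "x \<in> v ` \<A>"
     then obtain A where A: "A \<in> \<A>" "x = v A" by blast
     then have "A \<in> \<D>" "N \<noteq> A" using insert by auto
     then show "x \<in> {x \<in> carrier M. \<pi> N x = \<zero>.M}" using \<pi>(3)[OF N(1) _ _ v(1)] A vc by simp
    qed
    ultimately have "mod_span (v ` \<A>) \<subseteq> {x \<in> carrier M. \<pi> N x = \<zero>.M}" by (rule mod_span_minimal)
    then show ?thesis using yz(2) by blast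
   qed
   moreover have "v N = \<pi> N y \<oplus>.M \<pi> N z"
    using h(2)[OF c] \<pi>(2)[OF N(1) v(1)[OF N(1)]] yz(3) by simp
   moreover have "\<pi> N y \<in> carrier M" using h(1)[OF c(1)] submodule_simps(1)[OF sN] by simp
   ultimately have "v N \<in> ideal_smult R \<mm> (M\<lparr>carrier := N\<rparr>)" by simp
   then show ?thesis using v(2)[OF N(1)] by blast
  qed
  then obtain w where w: "w \<in> W" "w \<in> mod_span (W - {w} \<union> v ` insert N \<A>)" by auto
  let ?H = "mod_span (W - {w} \<union> v ` insert N \<A>)"
  have Hs: "submodule ?H R M" using Wc Vc vc[OF N(1)] by (intro mod_span_submodule) auto
  have "W \<union> v ` \<A> \<subseteq> ?H" using mod_span_superset[of "W - {w} \<union> v ` insert N \<A>"] w by blast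
  then have "carrier M \<subseteq> ?H" using mod_span_minimal[OF Hs] W(3) by metis
  then have "?H = carrier M" using submodule_simps(1)[OF Hs] by blast
  moreover have "card (W - {w}) + card (insert N \<A>) \<le> card U"
   using W(2) card_Suc_Diff1[OF Wc(1) w(1)] insert.hyps by simp
  ultimately show ?case using W(1) by (intro exI[of _ "W - {w}"]) auto
 qed
 from this[OF fin subset_refl] show ?thesis by auto
qed

end

section \<open>Refining direct sums to indecomposable summands\<close>

context module
begin

lemma direct_sum_refine:
 assumes D: "direct_sum \<D>" and N: "N \<in> \<D>"
  and A: "submodule A R M" "A \<subseteq> N" "A \<noteq> {\<zero>.M}" and B: "submodule B R M" "B \<subseteq> N" "B \<noteq> {\<zero>.M}"
  and AB: "A \<inter> B = {\<zero>.M}" and span: "!!x. x \<in> N ==> \<exists>a\<in>A. \<exists>b\<in>B. x = a \<oplus>.M b"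
 shows "\<exists>\<D>'. direct_sum \<D>' \<and> card \<D>' = Suc (card \<D>)"
proof -
 have fin: "finite \<D>" and sub: "!!N. N \<in> \<D> ==> submodule N R M" and nz: "!!N. N \<in> \<D> ==> N \<noteq> {\<zero>.M}"
  and Dspan: "!!x. x \<in> carrier M ==> \<exists>y\<in>(\<Pi> N\<in>\<D>. N). x = (\<Oplus>.M N\<in>\<D>. y N)"
  and Dind: "!!y N. y \<in> (\<Pi> N\<in>\<D>. N) ==> (\<Oplus>.M N\<in>\<D>. y N) = \<zero>.M ==> N \<in> \<D> ==> y N = \<zero>.M"
  using D by (auto simp: direct_sum_def)
 obtain \<pi> where \<pi>: "!!N x. N \<in> \<D> ==> x \<in> N ==> \<pi> N x = x"
  "!!N K x. N \<in> \<D> ==> K \<in> \<D> ==> N \<noteq> K ==> x \<in> K ==> \<pi> N x = \<zero>.M"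
  by (rule bij_projections[OF fin sub direct_sum_imp_bij[OF D]], assumption, rule that)
 define \<D>0 where "\<D>0 = \<D> - {N}"
 have DN: "\<D> = insert N \<D>0" "N \<notin> \<D>0" "finite \<D>0" using N fin by (auto simp: \<D>0_def)
 \<comment> \<open>The summands form a set, so A and B must differ from the remaining ones for the
   cardinality to grow. On a nonzero submodule of N the projection to N is the identity, on any
   other summand it is zero.\<close>
 have notin: "C \<notin> \<D>0" if C: "submodule C R M" "C \<subseteq> N" "C \<noteq> {\<zero>.M}" for C
 proof
  assume C0: "C \<in> \<D>0"
  have CD: "C \<in> \<D>" "N \<noteq> C" using C0 DN by auto
  have "x = \<zero>.M" if x: "x \<in> C" for x
  proof -
   have "\<pi> N x = x" by (rule \<pi>(1)[OF N]) (use C(2) x in blast)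
   moreover have "\<pi> N x = \<zero>.M" by (rule \<pi>(2)[OF N CD x])
   ultimately show ?thesis by simp
  qed
  then show False using C(3) submodule_simps(2)[OF C(1)] by blast
 qed
 have An: "A \<notin> \<D>0" and Bn: "B \<notin> \<D>0" using notin A B by auto
 have AnB: "A \<noteq> B" using AB A(3) by auto
 note cA = submodule_simps(1)[OF A(1)] and cB = submodule_simps(1)[OF B(1)]
 define \<D>' where "\<D>' = insert A (insert B \<D>0)"
 have sum': "(\<Oplus>.M K\<in>\<D>'. y K) = (y A \<oplus>.M y B) \<oplus>.M (\<Oplus>.M K\<in>\<D>0. y K)"
  if "y \<in> \<D>0 \<rightarrow> carrier M" "y A \<in> carrier M" "y B \<in> carrier M" for y
  unfolding \<D>'_def using that An Bn AnB DN by (simp add: M.a_assoc Pi_iff)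
 have sum: "(\<Oplus>.M K\<in>\<D>. y K) = y N \<oplus>.M (\<Oplus>.M K\<in>\<D>0. y K)"
  if "y \<in> \<D>0 \<rightarrow> carrier M" "y N \<in> carrier M" for y
  unfolding DN(1) using that DN by (simp add: Pi_iff)
 have "direct_sum \<D>'"
  unfolding direct_sum_def
 proof (intro conjI ballI impI)
  show "finite \<D>'" using DN by (simp add: \<D>'_def)
  show "submodule K R M" "K \<noteq> {\<zero>.M}" if "K \<in> \<D>'" for K
   using that sub nz A B DN by (auto simp: \<D>'_def)
 next
  fix x assume "x \<in> carrier M"
  then obtain y where y: "y \<in> (\<Pi> N\<in>\<D>. N)" "x = (\<Oplus>.M N\<in>\<D>. y N)" using Dspan by blast
  have yK: "y K \<in> K" if "K \<in> \<D>" for K by (rule Pi_mem[OF y(1) that])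
  have yN: "y N \<in> N" "y N \<in> carrier M" using yK[OF N] submodule_simps(1)[OF sub[OF N]] by auto
  have y0: "y \<in> \<D>0 \<rightarrow> carrier M"
  proof (rule Pi_I)
   fix K assume "K \<in> \<D>0"
   then have "K \<in> \<D>" using DN(1) by simp
   then show "y K \<in> carrier M" using submodule_simps(1)[OF sub yK] by blast
  qed
  obtain a b where ab: "a \<in> A" "b \<in> B" "y N = a \<oplus>.M b" using span[OF yN(1)] by blast
  let ?y = "y(A := a, B := b)"
  have "?y \<in> (\<Pi> K\<in>\<D>'. K)"
  proof (rule Pi_I)
   fix K assume "K \<in> \<D>'"
   then consider "K = A" | "K = B" | "K \<in> \<D>0" "K \<noteq> A" "K \<noteq> B" using An Bn by (auto simp: \<D>'_def)
   then show "?y K \<in> K"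
   proof cases
    case 3
    then show ?thesis using yK[of K] DN(1) by simp
   qed (use ab AnB in simp_all)
  qed
  moreover have "x = (\<Oplus>.M K\<in>\<D>'. ?y K)"
  proof -
   have "?y \<in> \<D>0 \<rightarrow> carrier M" using y0 cA[OF ab(1)] cB[OF ab(2)] by auto
   then have "(\<Oplus>.M K\<in>\<D>'. ?y K) = (a \<oplus>.M b) \<oplus>.M (\<Oplus>.M K\<in>\<D>0. ?y K)"
    using sum'[of ?y] AnB cA[OF ab(1)] cB[OF ab(2)] by simp
   also have "(\<Oplus>.M K\<in>\<D>0. ?y K) = (\<Oplus>.M K\<in>\<D>0. y K)"
    using y0 An Bn by (intro M.finsum_cong') auto
   finally have fs: "(\<Oplus>.M K\<in>\<D>'. ?y K) = (a \<oplus>.M b) \<oplus>.M (\<Oplus>.M K\<in>\<D>0. y K)" .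
   show ?thesis unfolding fs y(2) sum[OF y0 yN(2)] ab(3) ..
  qed
  ultimately show "\<exists>y\<in>(\<Pi> K\<in>\<D>'. K). x = (\<Oplus>.M K\<in>\<D>'. y K)" by blast
 next
  fix y K assume y: "y \<in> (\<Pi> K\<in>\<D>'. K)" "(\<Oplus>.M K\<in>\<D>'. y K) = \<zero>.M" and K: "K \<in> \<D>'"
  have yK: "y K \<in> K" if "K \<in> \<D>'" for K by (rule Pi_mem[OF y(1) that])
  have ab: "y A \<in> A" "y B \<in> B" using yK[of A] yK[of B] by (simp_all add: \<D>'_def)
  have y0K: "y K \<in> K" if "K \<in> \<D>0" for K using yK[of K] that by (simp add: \<D>'_def)
  have y0: "y \<in> \<D>0 \<rightarrow> carrier M"
  proof (rule Pi_I)
   fix K assume K: "K \<in> \<D>0"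
   then have "K \<in> \<D>" using DN(1) by simp
   then show "y K \<in> carrier M" using submodule_simps(1)[OF sub y0K[OF K]] by blast
  qed
  let ?y = "y(N := y A \<oplus>.M y B)"
  have yN: "y A \<oplus>.M y B \<in> N" using submodule_simps(3)[OF sub[OF N]] ab A(2) B(2) by blast
  have "?y \<in> (\<Pi> K\<in>\<D>. K)"
  proof (rule Pi_I)
   fix K assume "K \<in> \<D>"
   then consider "K = N" | "K \<in> \<D>0" "K \<noteq> N" using DN by auto
   then show "?y K \<in> K" by cases (use yN y0K in simp_all)
  qed
  moreover have "(\<Oplus>.M K\<in>\<D>. ?y K) = \<zero>.M"
  proof -
   have "?y \<in> \<D>0 \<rightarrow> carrier M" using y0 cA[OF ab(1)] cB[OF ab(2)] by auto
   then have "(\<Oplus>.M K\<in>\<D>. ?y K) = (y A \<oplus>.M y B) \<oplus>.M (\<Oplus>.M K\<in>\<D>0. ?y K)"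
    using sum[of ?y] cA[OF ab(1)] cB[OF ab(2)] by simp
   also have "(\<Oplus>.M K\<in>\<D>0. ?y K) = (\<Oplus>.M K\<in>\<D>0. y K)"
    using y0 DN by (intro M.finsum_cong') auto
   finally have fs: "(\<Oplus>.M K\<in>\<D>. ?y K) = (y A \<oplus>.M y B) \<oplus>.M (\<Oplus>.M K\<in>\<D>0. y K)" .
   show ?thesis unfolding fs sum'[OF y0 cA[OF ab(1)] cB[OF ab(2)], symmetric] by (rule y(2))
  qed
  ultimately have z: "?y K = \<zero>.M" if "K \<in> \<D>" for K by (rule Dind) (use that in auto)
  have s0: "y A \<oplus>.M y B = \<zero>.M" using z[OF N] by simp
  then have e: "y A = \<ominus>.M y B" using cA[OF ab(1)] cB[OF ab(2)] by (simp add: M.minus_equality)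
  then have "y A \<in> A \<inter> B" using ab submodule_simps(5)[OF B(1)] by auto
  then have "y A = \<zero>.M" using AB by blast
  moreover from this have "y B = \<zero>.M" using s0 cB[OF ab(2)] by simp
  moreover have "y K = \<zero>.M" if "K \<in> \<D>0" for K
  proof -
   have "K \<noteq> N" using that DN by auto
   then show ?thesis using z[of K] that DN(1) by simp
  qed
  ultimately show "y K = \<zero>.M" using K by (auto simp: \<D>'_def)
 qed
 moreover have "card \<D>' = Suc (card \<D>)" using DN An Bn AnB by (simp add: \<D>'_def)
 ultimately show ?thesis by blast
qed

lemma direct_sum_exists: "\<exists>\<D>. direct_sum \<D>"
proof (cases "carrier M = {\<zero>.M}")
 case True
 then have "direct_sum {}" by (auto simp: direct_sum_def)
 then show ?thesis by blast
next
 case False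
 then have "direct_sum {carrier M}"
  using carrier_is_submodule by (auto simp: direct_sum_def intro!: bexI[of _ "\<lambda>_. _"])
 then show ?thesis by blast
qed

end

text \<open>A direct sum with the largest possible number of summands exists by the bound; a
  decomposable summand would allow one more.\<close>

lemma indecomposable_decomposition_exists:
 fixes M :: "('a, 'm) module"
 assumes M: "module R M"
  and bound: "!!\<D>. module.direct_sum R M \<D> ==> card \<D> \<le> n"
 shows "\<exists>\<D>. indecomposable_decomposition R M \<D>"
proof -
 interpret module R M by fact
 obtain \<D>0 where D0: "direct_sum \<D>0" using direct_sum_exists by blast
 have "\<forall>\<D>. direct_sum \<D> --> card \<D> < Suc n" using bound by (simp add: less_Suc_eq_le)
 from ex_has_greatest_nat[of direct_sum, OF D0 this]
 obtain \<D> where D: "direct_sum \<D>" "!!\<D>'. direct_sum \<D>' ==> card \<D>' \<le> card \<D>" by blast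
 have fin: "finite \<D>" and sub: "!!N. N \<in> \<D> ==> submodule N R M" and nz: "!!N. N \<in> \<D> ==> N \<noteq> {\<zero>.M}"
  using D(1) by (auto simp: direct_sum_def)
 have "indecomposable_module R (M\<lparr>carrier := N\<rparr>)" if N: "N \<in> \<D>" for N
  unfolding indecomposable_module_def
 proof (intro conjI allI impI)
  show "module R (M\<lparr>carrier := N\<rparr>)" by (rule submodule.submodule_is_module[OF sub[OF N] M])
  show "carrier (M\<lparr>carrier := N\<rparr>) \<noteq> {\<zero>\<^bsub>M\<lparr>carrier := N\<rparr>\<^esub>}" using nz[OF N] by simp
  fix A B
  assume AB: "submodule A R (M\<lparr>carrier := N\<rparr>) \<and> submodule B R (M\<lparr>carrier := N\<rparr>) \<and>
   A \<inter> B = {\<zero>\<^bsub>M\<lparr>carrier := N\<rparr>\<^esub>} \<and> A <+>\<^bsub>M\<lparr>carrier := N\<rparr>\<^esub> B = carrier (M\<lparr>carrier := N\<rparr>)"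
  interpret N: module R "M\<lparr>carrier := N\<rparr>" by (rule submodule.submodule_is_module[OF sub[OF N] M])
  have s: "submodule A R M" "submodule B R M" "A \<subseteq> N" "B \<subseteq> N"
   using AB submodule_trans[OF sub[OF N]] N.submodule_simps(1) by auto
  have sp: "\<exists>a\<in>A. \<exists>b\<in>B. x = a \<oplus>.M b" if "x \<in> N" for x
  proof -
   have "x \<in> A <+>\<^bsub>M\<lparr>carrier := N\<rparr>\<^esub> B" using AB that by simp
   then show ?thesis by (auto simp: set_add_def')
  qed
  show "A = {\<zero>\<^bsub>M\<lparr>carrier := N\<rparr>\<^esub>} \<or> B = {\<zero>\<^bsub>M\<lparr>carrier := N\<rparr>\<^esub>}"
  proof (rule ccontr)
   assume "\<not> ?thesis"
   then have "\<exists>\<D>'. direct_sum \<D>' \<and> card \<D>' = Suc (card \<D>)"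
    using AB s sp by (intro direct_sum_refine[OF D(1) N, of A B]) auto
   then show False using D(2) by fastforce
  qed
 qed
 then show ?thesis
  unfolding indecomposable_decomposition_def using fin sub direct_sum_imp_bij[OF D(1)] by blast
qed

section \<open>The completion is local, and its pushforwards decompose\<close>

context completion_data
begin

text \<open>S is local with maximal ideal F 1. Some multiple of x by a unit differs from an image q
  a by an element of F 1, and a is outside P, so x is a unit times 1 + z with z in F 1. Completeness
  inverts 1 + z.\<close>

lemma F1_Units:
 assumes x: "x \<in> carrier S" "x \<notin> F 1"
 shows "x \<in> Units S"
proof -
 obtain a s where a: "a \<in> carrier R" "s \<in> carrier R - P" "q s \<otimes>.S x \<ominus>.S q a \<in> F 1"
  using dense[OF x(1)] by blast
 have sU: "q s \<in> Units S" by (rule unit[OF a(2)])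
 then have sc: "q s \<in> carrier S" by auto
 have iac: "q a \<in> carrier S" using a by simp
 have sx: "q s \<otimes>.S x \<notin> F 1"
 proof
  assume *: "q s \<otimes>.S x \<in> F 1"
  have "inv\<^bsub>S\<^esub> (q s) \<otimes>.S (q s \<otimes>.S x) \<in> F 1" by (rule F_lmult[OF *]) (use sU in simp)
  then show False using x sU sc by (simp add: S.m_assoc[symmetric])
 qed
 have "a \<notin> P"
 proof
  assume "a \<in> P"
  then have "q a \<in> F 1" using F_iota_pow[of a 1] ideal_pow_1[OF P_ideal] by simp
  then have "(q s \<otimes>.S x \<ominus>.S q a) \<oplus>.S q a \<in> F 1" using a(3) by (intro F_add)
  moreover have "(q s \<otimes>.S x \<ominus>.S q a) \<oplus>.S q a = q s \<otimes>.S x"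
   using sc x iac by (simp add: a_minus_def S.a_assoc S.l_neg)
  ultimately show False using sx by simp
 qed
 then have aU: "q a \<in> Units S" using unit a(1) by blast
 define z where "z = inv\<^bsub>S\<^esub> (q a) \<otimes>.S (q s \<otimes>.S x \<ominus>.S q a)"
 have z: "z \<in> F 1" unfolding z_def by (rule F_lmult[OF a(3)]) (use aU in simp)
 have zc: "z \<in> carrier S" by (rule F_carrier[OF z])
 \<comment> \<open>The partial sums of the geometric series for the inverse of 1 + z.\<close>
 define w where "w = rec_nat \<zero>.S (\<lambda>_ v. \<one>.S \<ominus>.S z \<otimes>.S v)"
 have w0: "w 0 = \<zero>.S" and wS: "w (Suc n) = \<one>.S \<ominus>.S z \<otimes>.S w n" for n by (simp_all add: w_def)
 have wc: "w n \<in> carrier S" for n by (induction n) (use zc w0 wS in auto)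
 have wF: "w (Suc n) \<ominus>.S w n \<in> F n" for n
 proof (induction n)
  case 0
  then show ?case using F_0 wc by simp
 next
  case (Suc n)
  have "w (Suc (Suc n)) \<ominus>.S w (Suc n) =
    (\<one>.S \<ominus>.S z \<otimes>.S w (Suc n)) \<ominus>.S (\<one>.S \<ominus>.S z \<otimes>.S w n)" by (simp only: wS)
  also have "\<dots> = \<ominus>.S (z \<otimes>.S (w (Suc n) \<ominus>.S w n))"
   using wc[of n] wc[of "Suc n"] zc S.one_closed by algebra
  finally have "w (Suc (Suc n)) \<ominus>.S w (Suc n) = \<ominus>.S (z \<otimes>.S (w (Suc n) \<ominus>.S w n))" .
  then show ?case using F_uminus[OF F_mult[OF z Suc.IH]] by simp
 qed
 obtain l where l: "l \<in> carrier S" "!!n. l \<ominus>.S w n \<in> F n" using complete[OF wc wF] by blast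
 have "l \<ominus>.S (\<one>.S \<ominus>.S z \<otimes>.S l) \<in> F n" for n
 proof -
  have "l \<ominus>.S (\<one>.S \<ominus>.S z \<otimes>.S l) = (l \<ominus>.S (\<one>.S \<ominus>.S z \<otimes>.S w n)) \<oplus>.S z \<otimes>.S (l \<ominus>.S w n)"
   using l(1) zc wc[of n] S.one_closed by algebra
  moreover have "l \<ominus>.S (\<one>.S \<ominus>.S z \<otimes>.S w n) \<in> F n" using l(2)[of "Suc n"] F_Suc wS[of n] by auto
  ultimately show ?thesis using F_add F_lmult[OF l(2) zc] by simp
 qed
 then have "l \<ominus>.S (\<one>.S \<ominus>.S z \<otimes>.S l) = \<zero>.S" by (rule F_sep)
 moreover have "(\<one>.S \<oplus>.S z) \<otimes>.S l = (l \<ominus>.S (\<one>.S \<ominus>.S z \<otimes>.S l)) \<oplus>.S \<one>.S"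
  using l(1) zc S.one_closed by algebra
 ultimately have zl: "(\<one>.S \<oplus>.S z) \<otimes>.S l = \<one>.S" by simp
 have "q a \<otimes>.S (\<one>.S \<oplus>.S z) = q a \<oplus>.S (q a \<otimes>.S inv\<^bsub>S\<^esub> (q a)) \<otimes>.S (q s \<otimes>.S x \<ominus>.S q a)"
  unfolding z_def using aU iac sc x S.one_closed S.Units_inv_closed[OF aU] by algebra
 also have "\<dots> = q s \<otimes>.S x"
 proof -
  have "q s \<otimes>.S x \<in> carrier S" using sc x by simp
  then have "q a \<oplus>.S (q s \<otimes>.S x \<ominus>.S q a) = q s \<otimes>.S x" using iac by algebra
  then show ?thesis using aU sc x iac by simp
 qed
 finally have e: "q a \<otimes>.S (\<one>.S \<oplus>.S z) = q s \<otimes>.S x" .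
 have "x \<otimes>.S (q s \<otimes>.S (l \<otimes>.S inv\<^bsub>S\<^esub> (q a))) = (q s \<otimes>.S x) \<otimes>.S (l \<otimes>.S inv\<^bsub>S\<^esub> (q a))"
  using x sc l(1) S.Units_inv_closed[OF aU] by algebra
 also have "\<dots> = (q a \<otimes>.S inv\<^bsub>S\<^esub> (q a)) \<otimes>.S ((\<one>.S \<oplus>.S z) \<otimes>.S l)"
  unfolding e[symmetric] using iac l(1) zc S.one_closed S.Units_inv_closed[OF aU] by algebra
 also have "\<dots> = \<one>.S" using zl aU by simp
 finally have "x \<otimes>.S (q s \<otimes>.S (l \<otimes>.S inv\<^bsub>S\<^esub> (q a))) = \<one>.S" .
 moreover have "q s \<otimes>.S (l \<otimes>.S inv\<^bsub>S\<^esub> (q a)) \<in> carrier S" using sc l(1) aU by simp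
 ultimately show ?thesis using x(1) S.m_comm unfolding Units_def by fastforce
qed

abbreviation push :: "nat => ('c, 'c) module" where
 "push e \<equiv> frobenius_pushforward p e S (ring_module S)"

lemma push_simps:
 "carrier (push e) = carrier S" "\<zero>\<^bsub>push e\<^esub> = \<zero>.S" "x \<oplus>\<^bsub>push e\<^esub> y = x \<oplus>.S y" "r \<odot>\<^bsub>push e\<^esub> x = frS e r \<otimes>.S x"
 by (simp_all add: frobenius_pushforward_def ring_module_def frob_def)

lemma push_module: "module S (push e)"
proof (rule moduleI)
 show "abelian_group (push e)"
  by (rule abelian_groupI) (auto simp: push_simps S.a_ac intro!: bexI[of _ "\<ominus>.S _"] S.l_neg)
qed (auto simp: push_simps S.cring_axioms S.fr_add S.fr_mult S.l_distr S.r_distr S.m_assoc)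

lemma push_finsum:
 assumes "finite A" "f \<in> A \<rightarrow> carrier S"
 shows "(\<Oplus>\<^bsub>push e\<^esub>a\<in>A. f a) = (\<Oplus>.S a\<in>A. f a)"
 using assms
proof (induction A rule: finite_induct)
 interpret M: module S "push e" by (rule push_module)
 case empty
 then show ?case using M.finsum_empty[of f] by (simp add: push_simps)
next
 interpret M: module S "push e" by (rule push_module)
 case (insert a A)
 have "(\<Oplus>\<^bsub>push e\<^esub>a\<in>insert a A. f a) = f a \<oplus>\<^bsub>push e\<^esub> (\<Oplus>\<^bsub>push e\<^esub>a\<in>A. f a)"
  using insert by (intro M.finsum_insert) (auto simp: push_simps)
 then show ?case using insert by (simp add: push_simps Pi_iff)
qed

text \<open>The number of summands of F^e_*S is bounded by the number of generators coming from
  F^e_*R, so refinement terminates.\<close>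

lemma push_decomposition: "\<exists>\<D>. indecomposable_decomposition S (push e) \<D>"
proof -
 interpret M: module S "push e" by (rule push_module)
 obtain U where U: "frob_gens R p e U" using frob_gens_ex by blast
 have Uc: "finite U" "U \<subseteq> carrier R" using U by (auto simp: frob_gens_def)
 have iU: "q ` U \<subseteq> carrier (push e)" using Uc by (auto simp: push_simps)
 have sp: "M.mod_span (q ` U) = carrier (push e)"
 proof
  show "M.mod_span (q ` U) \<subseteq> carrier (push e)"
   using M.submodule_simps(1)[OF M.mod_span_submodule[OF iU]] by blast
  show "carrier (push e) \<subseteq> M.mod_span (q ` U)"
  proof
   fix x assume "x \<in> carrier (push e)"
   then obtain y where y: "y \<in> U \<rightarrow> carrier S" "x = (S.comb e U y q)"
    using frob_gens_S[OF U] by (auto simp: push_simps)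
   note sm = M.submodule_simps[OF M.mod_span_submodule[OF iU], unfolded push_simps]
   show "x \<in> M.mod_span (q ` U)"
    unfolding y(2)
   proof (rule S.finsum_in_submodule_like[OF Uc(1)])
    fix u assume u: "u \<in> U"
    have "q u \<in> M.mod_span (q ` U)" using M.mod_span_superset[of "q ` U"] u by blast
    then show "frS e (y u) \<otimes>.S q u \<in> M.mod_span (q ` U)" using sm(4) y(1) u by blast
   qed (use sm(1,2,3) in auto)
  qed
 qed
 \<comment> \<open>Nakayama's lemma from separatedness: if N is contained in F 1 times N, then by
   induction N lies in every F n, because the p^e-th power of an element of F 1 is again in F 1. The
   submodule N need not be known to be finitely generated.\<close>
 have sep: "N = {\<zero>\<^bsub>push e\<^esub>}"
  if N: "submodule N S (push e)" "N \<subseteq> ideal_smult S (F 1) (push e\<lparr>carrier := N\<rparr>)" for N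
 proof -
  note sN = M.submodule_simps[OF N(1), unfolded push_simps]
  have "N \<subseteq> F n" for n
  proof (induction n)
   case 0
   then show ?case using sN(1) F_0 by blast
  next
   case (Suc n)
   have "x \<in> F (Suc n)" if "x \<in> ideal_smult S (F 1) (push e\<lparr>carrier := N\<rparr>)" for x
    using that
   proof induction
    case (prod a x)
    then have "frS e a \<otimes>.S x \<in> F (1 + n)" using Suc.IH by (intro F_mult F_frob) auto
    then show ?case by (simp add: push_simps)
   next
    case (sum x y)
    then show ?case using F_add by (simp add: push_simps)
   qed
   then show ?case using N(2) by blast
  qed
  then have "x = \<zero>.S" if "x \<in> N" for x using that by (intro F_sep) (rule subsetD)
  then show ?thesis unfolding push_simps using sN(2) by blast
 qed
 have "card \<D> \<le> card (q ` U)" if "M.direct_sum \<D>" for \<D>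
  by (rule M.direct_sum_card_le[OF F1_Units F_ideal sep _ iU sp that]) (use Uc in auto)
 then show ?thesis by (rule indecomposable_decomposition_exists[OF push_module])
qed

lemma mod_iso_inverse:
 assumes "module S M" "module S N" "k \<in> mod_hom S M N" "bij_betw k (carrier M) (carrier N)"
 shows "inv_into (carrier M) k \<in> mod_hom S N M"
  and "!!y. y \<in> carrier N ==> k (inv_into (carrier M) k y) = y"
proof -
 let ?i = "inv_into (carrier M) k"
 interpret M: module S M by fact
 note h = mod_homD[OF assms(3)]
 have inj: "inj_on k (carrier M)" and im: "k ` carrier M = carrier N" using assms(4) by (auto simp: bij_betw_def)
 have i: "?i y \<in> carrier M" "k (?i y) = y" if "y \<in> carrier N" for y
  using that inv_into_into[of y k "carrier M"] f_inv_into_f[of y k "carrier M"] im by auto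
 then show "!!y. y \<in> carrier N ==> k (?i y) = y" by blast
 show "?i \<in> mod_hom S N M"
  unfolding mod_hom_def
 proof (intro CollectI conjI ballI)
  show "?i \<in> carrier N \<rightarrow> carrier M" using i by blast
  show "?i (x \<oplus>.N y) = ?i x \<oplus>.M ?i y" if "x \<in> carrier N" "y \<in> carrier N" for x y
   using that i h(2)[of "?i x" "?i y"] by (intro inv_into_f_eq[OF inj]) auto
  show "?i (r \<odot>.N x) = r \<odot>.M ?i x" if "r \<in> carrier S" "x \<in> carrier N" for r x
   using that i h(3)[of r "?i x"] by (intro inv_into_f_eq[OF inj]) auto
 qed
qed

text \<open>If a summand N of F^e_*S is isomorphic to a summand N' of a lower F^e'_*S, the
  projection to N factors as the projection followed by N = N' into F^e'_*S, and then the projection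
  to N' = N. The identity is the sum of these projections.\<close>

lemma id_lower_factoring_of_FFRT:
 assumes "FFRT p S"
 shows "\<exists>e. (\<lambda>u. u) \<in> lower_factoring S p e"
proof -
 let ?J = "\<lambda>e. indecomposable_summands S (push e)"
 have fin: "finite (\<Union>e. ?J e)" using assms by (simp add: FFRT_def)
 have "\<forall>c\<in>(\<Union>e. ?J e). \<exists>e. c \<in> ?J e" by blast
 then obtain k where k: "!!c. c \<in> (\<Union>e. ?J e) ==> c \<in> ?J (k c)" by metis
 \<comment> \<open>One more than every level chosen for a class; the element 0 keeps the maximum
   meaningful when there are no classes.\<close>
 define e where "e = Suc (Max (insert 0 (k ` (\<Union>e. ?J e))))"
 have ke: "k c < e" if "c \<in> (\<Union>e. ?J e)" for c
  unfolding e_def using that fin by (intro le_imp_less_Suc Max_ge) auto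
 obtain \<D> where D: "indecomposable_decomposition S (push e) \<D>" using push_decomposition by blast
 interpret M: module S "push e" by (rule push_module)
 have fD: "finite \<D>" and sD: "!!N. N \<in> \<D> ==> submodule N S (push e)"
  and bD: "bij_betw (\<lambda>x. \<Oplus>\<^bsub>push e\<^esub>N\<in>\<D>. x N) (\<Pi>\<^sub>E N\<in>\<D>. N) (carrier (push e))"
  using D by (auto simp: indecomposable_decomposition_def)
 obtain \<pi> where \<pi>: "!!N. N \<in> \<D> ==> \<pi> N \<in> mod_hom S (push e) (push e\<lparr>carrier := N\<rparr>)"
  "!!x. x \<in> carrier (push e) ==> x = (\<Oplus>\<^bsub>push e\<^esub>N\<in>\<D>. \<pi> N x)"
  by (rule M.bij_projections[OF fD sD bD], assumption, rule that)
 have lf: "\<pi> N \<in> lower_factoring S p e" if N: "N \<in> \<D>" for N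
 proof -
  let ?N = "push e\<lparr>carrier := N\<rparr>"
  have mN: "module S ?N" by (rule submodule.submodule_is_module[OF sD[OF N] push_module])
  have "iso_class S ?N \<in> ?J e" using D N by (auto simp: indecomposable_summands_def)
  then have "iso_class S ?N \<in> ?J (k (iso_class S ?N))" "k (iso_class S ?N) < e"
   using k ke by blast+
  then obtain e' where e': "e' < e" "iso_class S ?N \<in> ?J e'" by blast
  then obtain N' \<D>' where D': "indecomposable_decomposition S (push e') \<D>'" "N' \<in> \<D>'"
   "iso_class S ?N = iso_class S (push e'\<lparr>carrier := N'\<rparr>)"
   unfolding indecomposable_summands_def by blast
  let ?N' = "push e'\<lparr>carrier := N'\<rparr>"
  interpret M': module S "push e'" by (rule push_module)
  have fD': "finite \<D>'" and sD': "!!N. N \<in> \<D>' ==> submodule N S (push e')"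
   and bD': "bij_betw (\<lambda>x. \<Oplus>\<^bsub>push e'\<^esub>N\<in>\<D>'. x N) (\<Pi>\<^sub>E N\<in>\<D>'. N) (carrier (push e'))"
   using D'(1) by (auto simp: indecomposable_decomposition_def)
  obtain \<pi>' where \<pi>': "!!N. N \<in> \<D>' ==> \<pi>' N \<in> mod_hom S (push e') (push e'\<lparr>carrier := N\<rparr>)"
   "!!N x. N \<in> \<D>' ==> x \<in> N ==> \<pi>' N x = x"
   by (rule M'.bij_projections[OF fD' sD' bD'], assumption, rule that)
  have mN': "module S ?N'" by (rule submodule.submodule_is_module[OF sD'[OF D'(2)] push_module])
  have "mod_iso S ?N ?N"
   unfolding mod_iso_def by (intro bexI[of _ "\<lambda>x. x"]) (auto simp: mod_hom_def bij_betw_def)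
  then have "?N \<in> iso_class S ?N" using mN by (simp add: iso_class_def)
  then have "mod_iso S ?N' ?N" unfolding D'(3) by (simp add: iso_class_def)
  then obtain j where j: "j \<in> mod_hom S ?N' ?N" "bij_betw j (carrier ?N') (carrier ?N)"
   by (auto simp: mod_iso_def)
  let ?i = "inv_into (carrier ?N') j"
  note i = mod_iso_inverse[OF mN' mN j]
  note hp = mod_homD[OF \<pi>(1)[OF N], unfolded push_simps] and hi = mod_homD[OF i(1)]
   and hp' = mod_homD[OF \<pi>'(1)[OF D'(2)], unfolded push_simps] and hj = mod_homD[OF j(1)]
  have Nc: "x \<in> carrier S" if "x \<in> N" for x using M.submodule_simps(1)[OF sD[OF N] that] by (simp add: push_simps)
  have N'c: "x \<in> carrier S" if "x \<in> N'" for x using M'.submodule_simps(1)[OF sD'[OF D'(2)] that] by (simp add: push_simps)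
  have h: "(\<lambda>u. ?i (\<pi> N u)) \<in> frob_hom S p e e'"
  proof (rule frob_homI)
   show "?i (\<pi> N u) \<in> carrier S" if "u \<in> carrier S" for u
    using hp(1)[OF that] hi(1)[of "\<pi> N u"] N'c by simp
   show "?i (\<pi> N (u \<oplus>.S v)) = ?i (\<pi> N u) \<oplus>.S ?i (\<pi> N v)" if "u \<in> carrier S" "v \<in> carrier S" for u v
    using hp(1)[OF that(1)] hp(1)[OF that(2)] hp(2)[OF that] hi(2)[of "\<pi> N u" "\<pi> N v"] by (simp add: push_simps)
   show "?i (\<pi> N (frS e r \<otimes>.S u)) = frS e' r \<otimes>.S ?i (\<pi> N u)" if "r \<in> carrier S" "u \<in> carrier S" for r u
    using hp(1)[OF that(2)] hp(3)[OF that] hi(3)[of r "\<pi> N u"] that by (simp add: push_simps)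
  qed
  have g: "(\<lambda>u. j (\<pi>' N' u)) \<in> frob_hom S p e' e"
  proof (rule frob_homI)
   show "j (\<pi>' N' u) \<in> carrier S" if "u \<in> carrier S" for u
    using hp'(1)[OF that] hj(1)[of "\<pi>' N' u"] Nc by simp
   show "j (\<pi>' N' (u \<oplus>.S v)) = j (\<pi>' N' u) \<oplus>.S j (\<pi>' N' v)" if "u \<in> carrier S" "v \<in> carrier S" for u v
    using hp'(1)[OF that(1)] hp'(1)[OF that(2)] hp'(2)[OF that] hj(2)[of "\<pi>' N' u" "\<pi>' N' v"] by (simp add: push_simps)
   show "j (\<pi>' N' (frS e' r \<otimes>.S u)) = frS e r \<otimes>.S j (\<pi>' N' u)" if "r \<in> carrier S" "u \<in> carrier S" for r u
    using hp'(1)[OF that(2)] hp'(3)[OF that] hj(3)[of r "\<pi>' N' u"] that by (simp add: push_simps)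
  qed
  have "\<pi> N u = j (\<pi>' N' (?i (\<pi> N u)))" if u: "u \<in> carrier S" for u
  proof -
   have pN: "\<pi> N u \<in> carrier ?N" using hp(1)[OF u] by simp
   then have "?i (\<pi> N u) \<in> N'" using hi(1)[OF pN] by simp
   then show ?thesis using \<pi>'(2)[OF D'(2)] i(2)[OF pN] by simp
  qed
  then show ?thesis by (rule S.lower_factoring_cong[OF S.lower_factoring_comp[OF e'(1) h g]])
 qed
 have "(\<lambda>u. \<Oplus>.S N\<in>\<A>. \<pi> N u) \<in> lower_factoring S p e" if "finite \<A>" "\<A> \<subseteq> \<D>" for \<A>
  using that
 proof (induction \<A> rule: finite_induct)
  case empty
  then show ?case by (intro lower_factoring.zero) simp
 next
  case (insert N \<A>)
  have "(\<lambda>u. \<pi> N u \<oplus>.S (\<Oplus>.S N\<in>\<A>. \<pi> N u)) \<in> lower_factoring S p e"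
   using insert lf by (intro S.lower_factoring_add) auto
  then show ?case
  proof (rule S.lower_factoring_cong)
   fix u assume u: "u \<in> carrier S"
   have "\<pi> K u \<in> carrier S" if "K \<in> \<D>" for K
    by (rule frob_homD(1)[OF S.lower_factoring_frob_hom[OF lf[OF that]] u])
   then show "(\<Oplus>.S N\<in>insert N \<A>. \<pi> N u) = \<pi> N u \<oplus>.S (\<Oplus>.S N\<in>\<A>. \<pi> N u)"
    using insert by (intro S.finsum_insert) auto
  qed
 qed
 from this[OF fD subset_refl] have "(\<lambda>u. u) \<in> lower_factoring S p e"
 proof (rule S.lower_factoring_cong)
  fix u assume u: "u \<in> carrier S"
  have "\<pi> K u \<in> carrier S" if "K \<in> \<D>" for K
   by (rule frob_homD(1)[OF S.lower_factoring_frob_hom[OF lf[OF that]] u])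
  then show "u = (\<Oplus>.S N\<in>\<D>. \<pi> N u)"
   using \<pi>(2)[of u] u push_finsum[OF fD, of "\<lambda>N. \<pi> N u" e] by (simp add: push_simps)
 qed
 then show ?thesis by blast
qed

end

section \<open>Localization at a prime ideal\<close>

locale prime_localization = cring R for R (structure) +
 fixes P :: "'a set"
 assumes prime: "primeideal P R"
begin

abbreviation A :: "('a \<times> 'a) set ring" where "A \<equiv> localization R P"
abbreviation fr' :: "'a => 'a => ('a \<times> 'a) set" where "fr' a s \<equiv> fraction R P a s"
abbreviation D :: "'a set" where "D \<equiv> carrier R - P"

lemma D_mult: "s \<in> D ==> t \<in> D ==> s \<otimes> t \<in> D" by (rule prime_mult_notin[OF prime])
lemma D_one: "\<one> \<in> D" by (rule prime_one_notin[OF prime])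
lemma D_carrier: "s \<in> D ==> s \<in> carrier R" by blast

lemma frac_rel_iff:
 "((a, s), (b, t)) \<in> frac_rel R P \<longleftrightarrow>
   a \<in> carrier R \<and> b \<in> carrier R \<and> s \<in> D \<and> t \<in> D \<and> (\<exists>u\<in>D. u \<otimes> (a \<otimes> t \<ominus> b \<otimes> s) = \<zero>)"
 by (auto simp: frac_rel_def)

lemma frac_rel_equiv: "equiv (carrier R \<times> D) (frac_rel R P)"
proof (rule equivI)
 show "frac_rel R P \<subseteq> (carrier R \<times> D) \<times> (carrier R \<times> D)" by (auto simp: frac_rel_def)
 show "refl_on (carrier R \<times> D) (frac_rel R P)"
 proof (rule refl_onI)
  fix x assume x: "x \<in> carrier R \<times> D"
  then obtain a s where [simp]: "x = (a, s)" and as: "a \<in> carrier R" "s \<in> D" by blast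
  have "\<one> \<otimes> (a \<otimes> s \<ominus> a \<otimes> s) = \<zero>" using as by (simp add: a_minus_def r_neg)
  then have "\<exists>u\<in>D. u \<otimes> (a \<otimes> s \<ominus> a \<otimes> s) = \<zero>" using D_one by blast
  then show "(x, x) \<in> frac_rel R P" using as by (simp add: frac_rel_iff)
 qed
 show "sym (frac_rel R P)"
 proof (rule symI)
  fix x y assume xy: "(x, y) \<in> frac_rel R P"
  obtain a s b t where [simp]: "x = (a, s)" "y = (b, t)" by fastforce
  obtain u where u: "a \<in> carrier R" "b \<in> carrier R" "s \<in> D" "t \<in> D" "u \<in> D" "u \<otimes> (a \<otimes> t \<ominus> b \<otimes> s) = \<zero>"
   using xy by (auto simp: frac_rel_iff)
  have c: "s \<in> carrier R" "t \<in> carrier R" "u \<in> carrier R" using u by auto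
  have "u \<otimes> (b \<otimes> s \<ominus> a \<otimes> t) = \<ominus> (u \<otimes> (a \<otimes> t \<ominus> b \<otimes> s))" using u(1,2) c by algebra
  then have "u \<otimes> (b \<otimes> s \<ominus> a \<otimes> t) = \<zero>" using u(6) by simp
  then show "(y, x) \<in> frac_rel R P" using u by (auto simp: frac_rel_iff)
 qed
 show "trans (frac_rel R P)"
 proof (rule transI)
  fix x y z assume xy: "(x, y) \<in> frac_rel R P" and yz: "(y, z) \<in> frac_rel R P"
  obtain a s b t c w where [simp]: "x = (a, s)" "y = (b, t)" "z = (c, w)" by (metis surj_pair)
  obtain u where u: "a \<in> carrier R" "b \<in> carrier R" "s \<in> D" "t \<in> D" "u \<in> D" "u \<otimes> (a \<otimes> t \<ominus> b \<otimes> s) = \<zero>"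
   using xy by (auto simp: frac_rel_iff)
  obtain v where v: "c \<in> carrier R" "w \<in> D" "v \<in> D" "v \<otimes> (b \<otimes> w \<ominus> c \<otimes> t) = \<zero>"
   using yz by (auto simp: frac_rel_iff)
  have d: "s \<in> carrier R" "t \<in> carrier R" "u \<in> carrier R" "w \<in> carrier R" "v \<in> carrier R" using u v by auto
  have "(u \<otimes> v \<otimes> t) \<otimes> (a \<otimes> w \<ominus> c \<otimes> s) = (v \<otimes> w) \<otimes> (u \<otimes> (a \<otimes> t \<ominus> b \<otimes> s)) \<oplus> (u \<otimes> s) \<otimes> (v \<otimes> (b \<otimes> w \<ominus> c \<otimes> t))"
   using u(1,2) v(1) d by algebra
  then have "(u \<otimes> v \<otimes> t) \<otimes> (a \<otimes> w \<ominus> c \<otimes> s) = \<zero>" using u(6) v(4) d by simp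
  moreover have "u \<otimes> v \<otimes> t \<in> D" using u v by (intro D_mult)
  ultimately show "(x, z) \<in> frac_rel R P" using u v by (auto simp: frac_rel_iff)
 qed
qed

lemma fraction_eq_iff:
 assumes "a \<in> carrier R" "s \<in> D" "b \<in> carrier R" "t \<in> D"
 shows "fr' a s = fr' b t \<longleftrightarrow> (\<exists>u\<in>D. u \<otimes> (a \<otimes> t \<ominus> b \<otimes> s) = \<zero>)"
proof -
 have "fr' a s = fr' b t \<longleftrightarrow> ((a, s), (b, t)) \<in> frac_rel R P"
  unfolding fraction_def using assms by (intro eq_equiv_class_iff[OF frac_rel_equiv]) auto
 then show ?thesis using assms by (simp add: frac_rel_iff)
qed

lemma fraction_eqI:
 assumes "a \<in> carrier R" "s \<in> D" "b \<in> carrier R" "t \<in> D" "a \<otimes> t = b \<otimes> s"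
 shows "fr' a s = fr' b t"
 unfolding fraction_eq_iff[OF assms(1-4)] using assms D_one by (intro bexI[of _ \<one>]) (auto simp: a_minus_def r_neg)

lemma fraction_cancel:
 assumes "a \<in> carrier R" "s \<in> D" "u \<in> D"
 shows "fr' (u \<otimes> a) (u \<otimes> s) = fr' a s"
 using assms by (intro fraction_eqI D_mult) (auto simp: m_ac)

lemma mem_fraction:
 assumes "a \<in> carrier R" "s \<in> D"
 shows "x \<in> fr' a s \<longleftrightarrow> fst x \<in> carrier R \<and> snd x \<in> D \<and> fr' (fst x) (snd x) = fr' a s"
proof -
 obtain b t where [simp]: "x = (b, t)" by fastforce
 show ?thesis
 proof
  assume "x \<in> fr' a s"
  then have r: "((a, s), (b, t)) \<in> frac_rel R P" by (simp add: fraction_def)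
  then have "fr' a s = fr' b t" unfolding fraction_def by (rule equiv_class_eq[OF frac_rel_equiv])
  then show "fst x \<in> carrier R \<and> snd x \<in> D \<and> fr' (fst x) (snd x) = fr' a s" using r by (simp add: frac_rel_iff)
 next
  assume *: "fst x \<in> carrier R \<and> snd x \<in> D \<and> fr' (fst x) (snd x) = fr' a s"
  then have "(b, t) \<in> fr' b t" unfolding fraction_def using equiv_class_self[OF frac_rel_equiv] by auto
  then show "x \<in> fr' a s" using * by simp
 qed
qed

lemma self_mem_fraction: "a \<in> carrier R ==> s \<in> D ==> (a, s) \<in> fr' a s"
 by (simp add: mem_fraction)

lemma A_carrier: "x \<in> carrier A \<longleftrightarrow> (\<exists>a\<in>carrier R. \<exists>s\<in>D. x = fr' a s)"
 by (auto simp: localization_def quotient_def fraction_def)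

lemma A_carrierE:
 assumes "x \<in> carrier A" obtains a s where "a \<in> carrier R" "s \<in> D" "x = fr' a s"
 using assms A_carrier by blast

lemma fraction_closed[simp, intro]: "a \<in> carrier R ==> s \<in> D ==> fr' a s \<in> carrier A"
 using A_carrier by blast

lemma A_one: "\<one>.A = fr' \<one> \<one>" and A_zero: "\<zero>.A = fr' \<zero> \<one>"
 by (simp_all add: localization_def)

lemma A_mult:
 assumes "a \<in> carrier R" "s \<in> D" "b \<in> carrier R" "t \<in> D"
 shows "fr' a s \<otimes>.A fr' b t = fr' (a \<otimes> b) (s \<otimes> t)"
proof -
 have "fr' (fst x \<otimes> fst y) (snd x \<otimes> snd y) = fr' (a \<otimes> b) (s \<otimes> t)" if x: "x \<in> fr' a s" and y: "y \<in> fr' b t" for x y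
 proof -
  obtain a' s' b' t' where [simp]: "x = (a', s')" "y = (b', t')" by fastforce
  have c: "a' \<in> carrier R" "s' \<in> D" "b' \<in> carrier R" "t' \<in> D" "fr' a' s' = fr' a s" "fr' b' t' = fr' b t"
   using x[unfolded mem_fraction[OF assms(1,2)]] y[unfolded mem_fraction[OF assms(3,4)]] by simp_all
  obtain u v where u: "u \<in> D" "u \<otimes> (a' \<otimes> s \<ominus> a \<otimes> s') = \<zero>" and v: "v \<in> D" "v \<otimes> (b' \<otimes> t \<ominus> b \<otimes> t') = \<zero>"
   using c(5,6) fraction_eq_iff assms c(1-4) by metis
  have d: "s \<in> carrier R" "t \<in> carrier R" "s' \<in> carrier R" "t' \<in> carrier R" "u \<in> carrier R" "v \<in> carrier R"
   using u v c assms by auto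
  have "(u \<otimes> v) \<otimes> ((a' \<otimes> b') \<otimes> (s \<otimes> t) \<ominus> (a \<otimes> b) \<otimes> (s' \<otimes> t')) =
    (v \<otimes> b' \<otimes> t) \<otimes> (u \<otimes> (a' \<otimes> s \<ominus> a \<otimes> s')) \<oplus> (u \<otimes> a \<otimes> s') \<otimes> (v \<otimes> (b' \<otimes> t \<ominus> b \<otimes> t'))"
   using c(1,3) assms(1,3) d by algebra
  also have "\<dots> = \<zero>" using u v c(1,3) assms(1,3) d by simp
  finally have "\<exists>u\<in>D. u \<otimes> ((a' \<otimes> b') \<otimes> (s \<otimes> t) \<ominus> (a \<otimes> b) \<otimes> (s' \<otimes> t')) = \<zero>"
   using D_mult[OF u(1) v(1)] by blast
  then show ?thesis using c assms D_mult by (subst fraction_eq_iff) auto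
 qed
 then have "(\<Union>x \<in> fr' a s. \<Union>y \<in> fr' b t. fr' (fst x \<otimes> fst y) (snd x \<otimes> snd y)) = fr' (a \<otimes> b) (s \<otimes> t)"
  using self_mem_fraction[OF assms(1,2)] self_mem_fraction[OF assms(3,4)] by auto
 then show ?thesis by (simp add: localization_def)
qed

lemma A_add:
 assumes "a \<in> carrier R" "s \<in> D" "b \<in> carrier R" "t \<in> D"
 shows "fr' a s \<oplus>.A fr' b t = fr' (a \<otimes> t \<oplus> b \<otimes> s) (s \<otimes> t)"
proof -
 have "fr' (fst x \<otimes> snd y \<oplus> fst y \<otimes> snd x) (snd x \<otimes> snd y) = fr' (a \<otimes> t \<oplus> b \<otimes> s) (s \<otimes> t)"
  if x: "x \<in> fr' a s" and y: "y \<in> fr' b t" for x y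
 proof -
  obtain a' s' b' t' where [simp]: "x = (a', s')" "y = (b', t')" by fastforce
  have c: "a' \<in> carrier R" "s' \<in> D" "b' \<in> carrier R" "t' \<in> D" "fr' a' s' = fr' a s" "fr' b' t' = fr' b t"
   using x[unfolded mem_fraction[OF assms(1,2)]] y[unfolded mem_fraction[OF assms(3,4)]] by simp_all
  obtain u v where u: "u \<in> D" "u \<otimes> (a' \<otimes> s \<ominus> a \<otimes> s') = \<zero>" and v: "v \<in> D" "v \<otimes> (b' \<otimes> t \<ominus> b \<otimes> t') = \<zero>"
   using c(5,6) fraction_eq_iff assms c(1-4) by metis
  have d: "s \<in> carrier R" "t \<in> carrier R" "s' \<in> carrier R" "t' \<in> carrier R" "u \<in> carrier R" "v \<in> carrier R"
   using u v c assms by auto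
  have "(u \<otimes> v) \<otimes> ((a' \<otimes> t' \<oplus> b' \<otimes> s') \<otimes> (s \<otimes> t) \<ominus> (a \<otimes> t \<oplus> b \<otimes> s) \<otimes> (s' \<otimes> t')) =
    (v \<otimes> t' \<otimes> t) \<otimes> (u \<otimes> (a' \<otimes> s \<ominus> a \<otimes> s')) \<oplus> (u \<otimes> s' \<otimes> s) \<otimes> (v \<otimes> (b' \<otimes> t \<ominus> b \<otimes> t'))"
   using c(1,3) assms(1,3) d by algebra
  also have "\<dots> = \<zero>" using u v c(1,3) assms(1,3) d by simp
  finally have "\<exists>u\<in>D. u \<otimes> ((a' \<otimes> t' \<oplus> b' \<otimes> s') \<otimes> (s \<otimes> t) \<ominus> (a \<otimes> t \<oplus> b \<otimes> s) \<otimes> (s' \<otimes> t')) = \<zero>"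
   using D_mult[OF u(1) v(1)] by blast
  then show ?thesis using c assms D_mult by (subst fraction_eq_iff) auto
 qed
 then have "(\<Union>x \<in> fr' a s. \<Union>y \<in> fr' b t. fr' (fst x \<otimes> snd y \<oplus> fst y \<otimes> snd x) (snd x \<otimes> snd y)) =
   fr' (a \<otimes> t \<oplus> b \<otimes> s) (s \<otimes> t)"
  using self_mem_fraction[OF assms(1,2)] self_mem_fraction[OF assms(3,4)] by auto
 then show ?thesis by (simp add: localization_def)
qed

lemma A_cring: "cring A"
proof (rule cringI)
 show "abelian_group A"
 proof (rule abelian_groupI)
  fix x y assume x: "x \<in> carrier A" and y: "y \<in> carrier A"
  obtain a s where a: "a \<in> carrier R" "s \<in> D" "x = fr' a s" using x by (rule A_carrierE)
  obtain b t where b: "b \<in> carrier R" "t \<in> D" "y = fr' b t" using y by (rule A_carrierE)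
  have d: "s \<in> carrier R" "t \<in> carrier R" using a b by auto
  have st: "s \<otimes> t \<in> D" "t \<otimes> s \<in> D" using a b D_mult by auto
  show "x \<oplus>.A y \<in> carrier A" using a b d st by (auto simp: A_add)
  show "x \<oplus>.A y = y \<oplus>.A x" using a b d by (simp add: A_add a_comm m_comm)
  show "\<zero>.A \<oplus>.A x = x" using a d D_one by (simp add: A_add A_zero)
  have "fr' (\<ominus> a) s \<oplus>.A x = fr' (\<ominus> a \<otimes> s \<oplus> a \<otimes> s) (s \<otimes> s)" using a by (simp add: A_add)
  also have "\<ominus> a \<otimes> s \<oplus> a \<otimes> s = \<zero>" using a(1) d by algebra
  also have "fr' \<zero> (s \<otimes> s) = \<zero>.A"
   unfolding A_zero using a d D_one D_mult by (intro fraction_eqI) auto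
  finally show "\<exists>y\<in>carrier A. y \<oplus>.A x = \<zero>.A" using a by (intro bexI[of _ "fr' (\<ominus> a) s"]) auto
  fix z assume z: "z \<in> carrier A"
  obtain c w where c: "c \<in> carrier R" "w \<in> D" "z = fr' c w" using z by (rule A_carrierE)
  have wc: "w \<in> carrier R" using c by auto
  have "(a \<otimes> t \<oplus> b \<otimes> s) \<otimes> w \<oplus> c \<otimes> (s \<otimes> t) = a \<otimes> (t \<otimes> w) \<oplus> (b \<otimes> w \<oplus> c \<otimes> t) \<otimes> s"
   using a(1) b(1) c(1) d wc by algebra
  then show "x \<oplus>.A y \<oplus>.A z = x \<oplus>.A (y \<oplus>.A z)"
   using a b c d wc D_mult by (simp add: A_add m_assoc)
 qed (use D_one in \<open>auto simp: A_zero\<close>)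
 show "comm_monoid A"
 proof (rule comm_monoidI)
  fix x y assume x: "x \<in> carrier A" and y: "y \<in> carrier A"
  obtain a s where a: "a \<in> carrier R" "s \<in> D" "x = fr' a s" using x by (rule A_carrierE)
  obtain b t where b: "b \<in> carrier R" "t \<in> D" "y = fr' b t" using y by (rule A_carrierE)
  have d: "s \<in> carrier R" "t \<in> carrier R" using a b by auto
  have st: "s \<otimes> t \<in> D" using a b D_mult by auto
  show "x \<otimes>.A y \<in> carrier A" using a b d st by (auto simp: A_mult)
  show "x \<otimes>.A y = y \<otimes>.A x" using a b d by (simp add: A_mult m_comm)
  show "\<one>.A \<otimes>.A x = x" using a d D_one by (simp add: A_mult A_one)
  fix z assume z: "z \<in> carrier A"
  obtain c w where c: "c \<in> carrier R" "w \<in> D" "z = fr' c w" using z by (rule A_carrierE)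
  show "x \<otimes>.A y \<otimes>.A z = x \<otimes>.A (y \<otimes>.A z)"
   using a b c d D_mult by (simp add: A_mult m_assoc D_carrier)
 qed (use D_one in \<open>auto simp: A_one\<close>)
 fix x y z assume x: "x \<in> carrier A" and y: "y \<in> carrier A" and z: "z \<in> carrier A"
 obtain a s where a: "a \<in> carrier R" "s \<in> D" "x = fr' a s" using x by (rule A_carrierE)
 obtain b t where b: "b \<in> carrier R" "t \<in> D" "y = fr' b t" using y by (rule A_carrierE)
 obtain c w where c: "c \<in> carrier R" "w \<in> D" "z = fr' c w" using z by (rule A_carrierE)
 have d: "s \<in> carrier R" "t \<in> carrier R" "w \<in> carrier R" using a b c by auto
 have "(x \<oplus>.A y) \<otimes>.A z = fr' ((a \<otimes> t \<oplus> b \<otimes> s) \<otimes> c) ((s \<otimes> t) \<otimes> w)"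
  using a b c d D_mult by (simp add: A_mult A_add)
 also have "\<dots> = fr' ((a \<otimes> c) \<otimes> (t \<otimes> w) \<oplus> (b \<otimes> c) \<otimes> (s \<otimes> w)) ((s \<otimes> w) \<otimes> (t \<otimes> w))"
 proof (rule fraction_eqI)
  show "(a \<otimes> t \<oplus> b \<otimes> s) \<otimes> c \<otimes> (s \<otimes> w \<otimes> (t \<otimes> w)) = (a \<otimes> c \<otimes> (t \<otimes> w) \<oplus> b \<otimes> c \<otimes> (s \<otimes> w)) \<otimes> (s \<otimes> t \<otimes> w)"
   using a(1) b(1) c(1) d by algebra
 qed (use a b c d D_mult in auto)
 also have "\<dots> = x \<otimes>.A z \<oplus>.A y \<otimes>.A z" using a b c d D_mult by (simp add: A_mult A_add)
 finally show "(x \<oplus>.A y) \<otimes>.A z = x \<otimes>.A z \<oplus>.A y \<otimes>.A z" .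
qed

abbreviation mx :: "('a \<times> 'a) set set" where "mx \<equiv> localization_max R P"

lemma P_ideal: "ideal P R" by (rule primeideal.axioms(1)[OF prime])

lemma P_add: "x \<in> ideal_pow R P n ==> y \<in> ideal_pow R P n ==> x \<oplus> y \<in> ideal_pow R P n"
 by (rule additive_subgroup.a_closed[OF ideal.axioms(1)[OF ideal_pow_ideal[OF P_ideal]]])

lemma P_mult: "x \<in> ideal_pow R P n ==> y \<in> carrier R ==> x \<otimes> y \<in> ideal_pow R P n"
 by (rule ideal.I_r_closed[OF ideal_pow_ideal[OF P_ideal]])

lemma P_carrier: "x \<in> ideal_pow R P n ==> x \<in> carrier R"
 by (rule ideal.Icarr[OF ideal_pow_ideal[OF P_ideal]])

lemma fractions_ideal: "ideal {fr' a s | a s. a \<in> ideal_pow R P n \<and> s \<in> D} A" (is "ideal ?I A")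
 unfolding cring.ideal_iff_submodule[OF A_cring]
proof (rule module.submoduleI'[OF cring.ring_module_is_module[OF A_cring]])
 show "?I \<subseteq> carrier (ring_module A)" using P_carrier by (auto simp: ring_module_def)
 have "\<zero> \<in> ideal_pow R P n"
  by (rule additive_subgroup.zero_closed[OF ideal.axioms(1)[OF ideal_pow_ideal[OF P_ideal]]])
 then show "\<zero>\<^bsub>ring_module A\<^esub> \<in> ?I" using D_one by (auto simp: ring_module_def A_zero)
 show "x \<oplus>\<^bsub>ring_module A\<^esub> y \<in> ?I" if "x \<in> ?I" "y \<in> ?I" for x y
 proof -
  obtain a s b t where *: "x = fr' a s" "y = fr' b t" "a \<in> ideal_pow R P n" "b \<in> ideal_pow R P n" "s \<in> D" "t \<in> D"
   using \<open>x \<in> ?I\<close> \<open>y \<in> ?I\<close> by blast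
  have "x \<oplus>\<^bsub>ring_module A\<^esub> y = fr' (a \<otimes> t \<oplus> b \<otimes> s) (s \<otimes> t)"
   using * P_carrier by (simp add: ring_module_def A_add)
  moreover have "a \<otimes> t \<oplus> b \<otimes> s \<in> ideal_pow R P n" using * by (intro P_add P_mult) auto
  ultimately show ?thesis using D_mult *(5,6) by blast
 qed
 show "r \<odot>\<^bsub>ring_module A\<^esub> x \<in> ?I" if "r \<in> carrier A" "x \<in> ?I" for r x
 proof -
  obtain b t where b: "b \<in> carrier R" "t \<in> D" "r = fr' b t" using \<open>r \<in> carrier A\<close> by (rule A_carrierE)
  obtain a s where *: "x = fr' a s" "a \<in> ideal_pow R P n" "s \<in> D" using \<open>x \<in> ?I\<close> by blast
  have "r \<odot>\<^bsub>ring_module A\<^esub> x = fr' (a \<otimes> b) (t \<otimes> s)"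
   using * b P_carrier[OF *(2)] by (simp add: ring_module_def A_mult m_comm)
  moreover have "a \<otimes> b \<in> ideal_pow R P n" using * b by (intro P_mult) auto
  ultimately show ?thesis using D_mult[OF b(2) *(3)] by blast
 qed
qed

lemma mx_eq: "mx = {fr' a s | a s. a \<in> ideal_pow R P 1 \<and> s \<in> D}"
 by (simp add: localization_max_def ideal_prod_one[OF P_ideal])

lemma mx_ideal: "ideal mx A" unfolding mx_eq by (rule fractions_ideal)

text \<open>To show that a fraction with numerator in P^(n+1) lies in the power, its denominator is
  fixed and given to the second factor of each product. The induction then meets only sums of
  fractions with equal denominators.\<close>

lemma ideal_pow_mx: "ideal_pow A mx n = {fr' a s | a s. a \<in> ideal_pow R P n \<and> s \<in> D}"
proof (induction n)
 case 0
 show ?case using A_carrier by (simp add: set_eq_iff) blast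
next
 case (Suc n)
 let ?I = "\<lambda>n. {fr' a s | a s. a \<in> ideal_pow R P n \<and> s \<in> D}"
 show ?case
 proof
  show "ideal_pow A mx (Suc n) \<subseteq> ?I (Suc n)"
  proof
   fix x assume "x \<in> ideal_pow A mx (Suc n)"
   then have "x \<in> mx \<cdot>.A ?I n" using Suc by simp
   then show "x \<in> ?I (Suc n)"
   proof induction
    case (prod i j)
    obtain a s b t where *: "i = fr' a s" "j = fr' b t" "a \<in> ideal_pow R P 1" "b \<in> ideal_pow R P n" "s \<in> D" "t \<in> D"
     using prod unfolding mx_eq by blast
    have "i \<otimes>.A j = fr' (a \<otimes> b) (s \<otimes> t)" using * P_carrier[OF *(3)] P_carrier[OF *(4)] by (simp add: A_mult)
    moreover have "a \<otimes> b \<in> ideal_pow R P (Suc n)" using ideal_pow_mult_mem[OF P_ideal *(3,4)] by simp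
    ultimately show ?case using D_mult *(5,6) by blast
   next
    case (sum x y)
    then show ?case
     by (intro additive_subgroup.a_closed[OF ideal.axioms(1)[OF fractions_ideal]])
   qed
  qed
  show "?I (Suc n) \<subseteq> ideal_pow A mx (Suc n)"
  proof
   fix x assume "x \<in> ?I (Suc n)"
   then obtain a s where a: "x = fr' a s" "a \<in> P \<cdot>.R ideal_pow R P n" "s \<in> D" by auto
   have c: "i \<in> carrier R" if "i \<in> P \<cdot>.R ideal_pow R P n" for i using that P_carrier[of i "Suc n"] by simp
   from a(2) have "fr' a s \<in> mx \<cdot>.A ?I n"
   proof induction
    case (prod i j)
    have ij: "i \<in> carrier R" "j \<in> carrier R" using prod ideal.Icarr[OF P_ideal] P_carrier by auto
    have "fr' (i \<otimes> j) s = fr' i \<one> \<otimes>.A fr' j s" using ij a(3) D_one by (simp add: A_mult)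
    moreover have "fr' i \<one> \<in> mx" using prod D_one by (auto simp: localization_max_def)
    moreover have "fr' j s \<in> ?I n" using prod a(3) by blast
    ultimately show ?case by (simp add: ideal_prod.prod)
   next
    case (sum i j)
    have ij: "i \<in> carrier R" "j \<in> carrier R" using sum c by auto
    have sc: "s \<in> carrier R" using a(3) by blast
    have "fr' i s \<oplus>.A fr' j s = fr' (i \<otimes> s \<oplus> j \<otimes> s) (s \<otimes> s)" using ij a(3) by (simp add: A_add)
    also have "\<dots> = fr' (s \<otimes> (i \<oplus> j)) (s \<otimes> s)" using ij sc by (simp add: l_distr[symmetric] m_comm)
    also have "\<dots> = fr' (i \<oplus> j) s" using ij a(3) by (intro fraction_cancel) auto
    finally show ?case using ideal_prod.sum[OF sum(3,4)] by simp
   qed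
   then show "x \<in> ideal_pow A mx (Suc n)" using a(1) Suc by simp
  qed
 qed
qed

text \<open>The contraction of P^n \<open>R\<^sub>P\<close> to R is the symbolic power, which can be
  larger than P^n; hence the factor u.\<close>

lemma fraction_mem_ideal_pow:
 assumes a: "a \<in> carrier R" and s: "s \<in> D"
 shows "fr' a s \<in> ideal_pow A mx n \<longleftrightarrow> (\<exists>u\<in>D. u \<otimes> a \<in> ideal_pow R P n)"
proof
 assume "fr' a s \<in> ideal_pow A mx n"
 then obtain b t where b: "fr' a s = fr' b t" "b \<in> ideal_pow R P n" "t \<in> D" unfolding ideal_pow_mx by blast
 have bc: "b \<in> carrier R" using P_carrier[OF b(2)] .
 obtain u where u: "u \<in> D" "u \<otimes> (a \<otimes> t \<ominus> b \<otimes> s) = \<zero>" using b fraction_eq_iff[OF a s bc b(3)] by blast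
 have d: "s \<in> carrier R" "t \<in> carrier R" "u \<in> carrier R" using s b u by auto
 have "(u \<otimes> t) \<otimes> a = u \<otimes> (a \<otimes> t \<ominus> b \<otimes> s) \<oplus> b \<otimes> (u \<otimes> s)" using a bc d by algebra
 then have "(u \<otimes> t) \<otimes> a = b \<otimes> (u \<otimes> s)" using u bc d by simp
 then have "(u \<otimes> t) \<otimes> a \<in> ideal_pow R P n" using P_mult[OF b(2)] d by simp
 then show "\<exists>u\<in>D. u \<otimes> a \<in> ideal_pow R P n" using D_mult[OF u(1) b(3)] by blast
next
 assume "\<exists>u\<in>D. u \<otimes> a \<in> ideal_pow R P n"
 then obtain u where u: "u \<in> D" "u \<otimes> a \<in> ideal_pow R P n" by blast
 have "fr' a s = fr' (u \<otimes> a) (u \<otimes> s)" using fraction_cancel[OF a s u(1)] by simp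
 then show "fr' a s \<in> ideal_pow A mx n" unfolding ideal_pow_mx using u(2) D_mult[OF u(1) s] by blast
qed

end

section \<open>Adic completion\<close>

locale adic_completion = cring A for A :: "('b, 'l) ring_scheme" (structure) +
 fixes m :: "'b set"
 assumes m_ideal: "ideal m A"
begin

declare ideal_pow.simps [simp del]

abbreviation S :: "(nat => 'b set) ring" where "S \<equiv> completion A m"
abbreviation I :: "nat => 'b set" where "I n \<equiv> ideal_pow A m n"

lemma I_ideal: "ideal (I n) A" by (rule ideal_pow_ideal[OF m_ideal])

lemma I_Suc: "I (Suc n) \<subseteq> I n" by (rule ideal_pow_antimono[OF m_ideal]) simp

lemma Q_carrier: "u \<in> carrier (A Quot I n) \<longleftrightarrow> (\<exists>x\<in>carrier A. u = I n +> x)"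
 by (auto simp: FactRing_def A_RCOSETS_def')

lemma Q_ops:
 assumes "x \<in> carrier A" "y \<in> carrier A"
 shows "(I n +> x) \<oplus>\<^bsub>A Quot I n\<^esub> (I n +> y) = I n +> (x \<oplus> y)"
  "(I n +> x) \<otimes>\<^bsub>A Quot I n\<^esub> (I n +> y) = I n +> (x \<otimes> y)"
  "\<one>\<^bsub>A Quot I n\<^esub> = I n +> \<one>" "\<zero>\<^bsub>A Quot I n\<^esub> = I n +> \<zero>"
proof -
 interpret Q: ring_hom_ring A "A Quot I n" "(+>) (I n)"
  by (rule ideal.rcos_ring_hom_ring[OF I_ideal])
 show "(I n +> x) \<oplus>\<^bsub>A Quot I n\<^esub> (I n +> y) = I n +> (x \<oplus> y)"
  "(I n +> x) \<otimes>\<^bsub>A Quot I n\<^esub> (I n +> y) = I n +> (x \<otimes> y)"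
  "\<one>\<^bsub>A Quot I n\<^esub> = I n +> \<one>" "\<zero>\<^bsub>A Quot I n\<^esub> = I n +> \<zero>"
  using assms Q.hom_add Q.hom_mult Q.hom_one Q.hom_zero by simp_all
qed

lemma coset_eq_iff:
 assumes "x \<in> carrier A" "y \<in> carrier A"
 shows "I n +> x = I n +> y \<longleftrightarrow> x \<ominus> y \<in> I n"
 using quotient_eq_iff_same_a_r_cos[OF I_ideal assms] by simp

lemma coset_mem_iff:
 assumes "x \<in> carrier A" "y \<in> carrier A"
 shows "y \<in> I n +> x \<longleftrightarrow> y \<ominus> x \<in> I n"
proof
 assume "y \<in> I n +> x"
 then obtain i where i: "i \<in> I n" "y = i \<oplus> x" by (auto simp: a_r_coset_def')
 have ic: "i \<in> carrier A" by (rule ideal.Icarr[OF I_ideal i(1)])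
 have "y \<ominus> x = i" using i(2) ic assms by (simp add: a_minus_def a_assoc r_neg)
 then show "y \<ominus> x \<in> I n" using i by simp
next
 assume *: "y \<ominus> x \<in> I n"
 have "y = (y \<ominus> x) \<oplus> x" using assms by (simp add: a_minus_def a_assoc l_neg)
 then show "y \<in> I n +> x" using * by (auto simp: a_r_coset_def')
qed

lemma coset_subset_iff:
 assumes "x \<in> carrier A" "y \<in> carrier A"
 shows "I (Suc n) +> x \<subseteq> I n +> y \<longleftrightarrow> I n +> x = I n +> y"
proof
 assume s: "I (Suc n) +> x \<subseteq> I n +> y"
 have "x \<ominus> x \<in> I (Suc n)"
  using additive_subgroup.zero_closed[OF ideal.axioms(1)[OF I_ideal]] assms(1) by (simp add: a_minus_def r_neg)
 then have "x \<in> I (Suc n) +> x" using coset_mem_iff[OF assms(1,1)] by blast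
 then have "x \<in> I n +> y" using s by blast
 then show "I n +> x = I n +> y" using coset_mem_iff[OF assms(2,1)] coset_eq_iff[OF assms] by blast
next
 assume "I n +> x = I n +> y"
 moreover have "I (Suc n) +> x \<subseteq> I n +> x" using I_Suc[of n] by (auto simp: a_r_coset_def')
 ultimately show "I (Suc n) +> x \<subseteq> I n +> y" by simp
qed

text \<open>Any two consecutive entries have a common representative, because a coset of I^n that
  contains a coset of I^(n+1) is represented by each of its elements. Closure under the operations
  is then checked on representatives.\<close>

lemma S_carrier_iff:
 "f \<in> carrier S \<longleftrightarrow> (\<forall>n. \<exists>x\<in>carrier A. f n = I n +> x \<and> f (Suc n) = I (Suc n) +> x)"
proof
 assume f: "f \<in> carrier S"
 show "\<forall>n. \<exists>x\<in>carrier A. f n = I n +> x \<and> f (Suc n) = I (Suc n) +> x"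
 proof
  fix n
  have "f (Suc n) \<in> carrier (A Quot I (Suc n))" "f n \<in> carrier (A Quot I n)" and sub: "f (Suc n) \<subseteq> f n"
   using f by (simp_all add: completion_def)
  then obtain x y where "x \<in> carrier A" "f (Suc n) = I (Suc n) +> x" "y \<in> carrier A" "f n = I n +> y"
   unfolding Q_carrier by blast
  with sub show "\<exists>x\<in>carrier A. f n = I n +> x \<and> f (Suc n) = I (Suc n) +> x"
   using coset_subset_iff[of x y n] by auto
 qed
next
 assume *: "\<forall>n. \<exists>x\<in>carrier A. f n = I n +> x \<and> f (Suc n) = I (Suc n) +> x"
 have "f n \<in> carrier (A Quot I n)" for n using * Q_carrier by blast
 moreover have "f (Suc n) \<subseteq> f n" for n
 proof -
  obtain x where "x \<in> carrier A" "f n = I n +> x" "f (Suc n) = I (Suc n) +> x" using * by blast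
  then show ?thesis using coset_subset_iff[of x x n] by simp
 qed
 ultimately show "f \<in> carrier S" by (simp add: completion_def)
qed

lemma S_rep:
 assumes "f \<in> carrier S" shows "\<exists>x\<in>carrier A. \<forall>k\<le>n. f k = I k +> x"
proof (induction n)
 case 0
 obtain x where "x \<in> carrier A" "f 0 = I 0 +> x" using assms unfolding S_carrier_iff by blast
 then show ?case by auto
next
 case (Suc n)
 obtain y where y: "y \<in> carrier A" "f n = I n +> y" "f (Suc n) = I (Suc n) +> y" using assms S_carrier_iff by blast
 obtain x where x: "x \<in> carrier A" "!!k. k \<le> n ==> f k = I k +> x" using Suc by blast
 have "y \<ominus> x \<in> I n" using coset_eq_iff[OF y(1) x(1)] y(2) x(2)[of n] by auto
 then have "I k +> y = I k +> x" if "k \<le> n" for k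
  using coset_eq_iff[OF y(1) x(1)] ideal_pow_antimono[OF m_ideal that] by blast
 then show ?case using y x by (intro bexI[of _ y]) (auto simp: le_Suc_eq)
qed

lemma S_repE:
 assumes "f \<in> carrier S" obtains x where "x \<in> carrier A" "f n = I n +> x"
 using S_rep[OF assms, of n] by auto

lemma S_ops:
 "\<one>.S = (\<lambda>n. I n +> \<one>)" "\<zero>.S = (\<lambda>n. I n +> \<zero>)"
 "f \<oplus>.S g = (\<lambda>n. f n \<oplus>\<^bsub>A Quot I n\<^esub> g n)" "f \<otimes>.S g = (\<lambda>n. f n \<otimes>\<^bsub>A Quot I n\<^esub> g n)"
 using Q_ops(3,4)[OF zero_closed zero_closed] by (simp_all add: completion_def)

lemma S_closed:
 assumes f: "f \<in> carrier S" and g: "g \<in> carrier S"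
 shows "f \<oplus>.S g \<in> carrier S" "f \<otimes>.S g \<in> carrier S"
proof -
 have "\<exists>z\<in>carrier A. (f \<oplus>.S g) n = I n +> z \<and> (f \<oplus>.S g) (Suc n) = I (Suc n) +> z" for n
 proof -
  obtain x y where "x \<in> carrier A" "f n = I n +> x" "f (Suc n) = I (Suc n) +> x"
   "y \<in> carrier A" "g n = I n +> y" "g (Suc n) = I (Suc n) +> y" using f g unfolding S_carrier_iff by blast
  then show ?thesis by (intro bexI[of _ "x \<oplus> y"]) (simp_all add: S_ops Q_ops)
 qed
 then show "f \<oplus>.S g \<in> carrier S" unfolding S_carrier_iff by blast
 have "\<exists>z\<in>carrier A. (f \<otimes>.S g) n = I n +> z \<and> (f \<otimes>.S g) (Suc n) = I (Suc n) +> z" for n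
 proof -
  obtain x y where "x \<in> carrier A" "f n = I n +> x" "f (Suc n) = I (Suc n) +> x"
   "y \<in> carrier A" "g n = I n +> y" "g (Suc n) = I (Suc n) +> y" using f g unfolding S_carrier_iff by blast
  then show ?thesis by (intro bexI[of _ "x \<otimes> y"]) (simp_all add: S_ops Q_ops)
 qed
 then show "f \<otimes>.S g \<in> carrier S" unfolding S_carrier_iff by blast
qed

definition const :: "'b => nat => 'b set" where "const x = (\<lambda>n. I n +> x)"

lemma const_closed: "x \<in> carrier A ==> const x \<in> carrier S"
 unfolding S_carrier_iff const_def by blast

lemma S_cring: "cring S"
proof (rule cringI)
 have ex: "\<exists>x\<in>carrier A. f n = I n +> x" if "f \<in> carrier S" for f n using S_repE[OF that, of n] by blast
 show "abelian_group S"
 proof (rule abelian_groupI)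
  fix f g assume f: "f \<in> carrier S" and g: "g \<in> carrier S"
  show "f \<oplus>.S g \<in> carrier S" by (rule S_closed[OF f g])
  show "f \<oplus>.S g = g \<oplus>.S f"
  proof
   fix n obtain x y where "x \<in> carrier A" "f n = I n +> x" "y \<in> carrier A" "g n = I n +> y"
    using ex[OF f, of n] ex[OF g, of n] by blast
   then show "(f \<oplus>.S g) n = (g \<oplus>.S f) n" by (simp add: S_ops Q_ops a_comm)
  qed
  show "\<zero>.S \<oplus>.S f = f"
  proof
   fix n obtain x where "x \<in> carrier A" "f n = I n +> x" using ex[OF f, of n] by blast
   then show "(\<zero>.S \<oplus>.S f) n = f n" by (simp add: S_ops Q_ops)
  qed
  define h where "h n = I n +> (\<ominus> (SOME x. x \<in> carrier A \<and> f n = I n +> x))" for n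
  have hn: "h n = I n +> (\<ominus> x)" if x: "x \<in> carrier A" "f n = I n +> x" for n x
  proof -
   define z where "z = (SOME x. x \<in> carrier A \<and> f n = I n +> x)"
   have z: "z \<in> carrier A \<and> f n = I n +> z" unfolding z_def by (rule someI[of _ x]) (use x in simp)
   then have "x \<ominus> z \<in> I n" using coset_eq_iff[of x z n] x by simp
   moreover have "\<ominus> z \<ominus> (\<ominus> x) = x \<ominus> z" using z x(1) by algebra
   ultimately have "I n +> (\<ominus> z) = I n +> (\<ominus> x)" using coset_eq_iff[of "\<ominus> z" "\<ominus> x" n] z x(1) by simp
   then show ?thesis unfolding h_def z_def .
  qed
  have "h \<in> carrier S"
   unfolding S_carrier_iff
  proof
   fix n
   obtain x where "x \<in> carrier A" "f n = I n +> x" "f (Suc n) = I (Suc n) +> x" using f unfolding S_carrier_iff by blast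
   then show "\<exists>x\<in>carrier A. h n = I n +> x \<and> h (Suc n) = I (Suc n) +> x"
    using hn[of x n] hn[of x "Suc n"] by (intro bexI[of _ "\<ominus> x"]) auto
  qed
  moreover have "h \<oplus>.S f = \<zero>.S"
  proof
   fix n obtain x where "x \<in> carrier A" "f n = I n +> x" using ex[OF f, of n] by blast
   then show "(h \<oplus>.S f) n = \<zero>.S n" using hn[of x n] by (simp add: S_ops Q_ops l_neg)
  qed
  ultimately show "\<exists>h\<in>carrier S. h \<oplus>.S f = \<zero>.S" by blast
  fix h assume h: "h \<in> carrier S"
  show "f \<oplus>.S g \<oplus>.S h = f \<oplus>.S (g \<oplus>.S h)"
  proof
   fix n obtain x y z where "x \<in> carrier A" "f n = I n +> x" "y \<in> carrier A" "g n = I n +> y" "z \<in> carrier A" "h n = I n +> z"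
    using ex[OF f, of n] ex[OF g, of n] ex[OF h, of n] by blast
   then show "(f \<oplus>.S g \<oplus>.S h) n = (f \<oplus>.S (g \<oplus>.S h)) n" by (simp add: S_ops Q_ops a_assoc)
  qed
 qed (use const_closed[of \<zero>] in \<open>simp add: S_ops const_def\<close>)
 show "comm_monoid S"
 proof (rule comm_monoidI)
  fix f g assume f: "f \<in> carrier S" and g: "g \<in> carrier S"
  show "f \<otimes>.S g \<in> carrier S" by (rule S_closed[OF f g])
  show "f \<otimes>.S g = g \<otimes>.S f"
  proof
   fix n obtain x y where "x \<in> carrier A" "f n = I n +> x" "y \<in> carrier A" "g n = I n +> y"
    using ex[OF f, of n] ex[OF g, of n] by blast
   then show "(f \<otimes>.S g) n = (g \<otimes>.S f) n" by (simp add: S_ops Q_ops m_comm)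
  qed
  show "\<one>.S \<otimes>.S f = f"
  proof
   fix n obtain x where "x \<in> carrier A" "f n = I n +> x" using ex[OF f, of n] by blast
   then show "(\<one>.S \<otimes>.S f) n = f n" by (simp add: S_ops Q_ops)
  qed
  fix h assume h: "h \<in> carrier S"
  show "f \<otimes>.S g \<otimes>.S h = f \<otimes>.S (g \<otimes>.S h)"
  proof
   fix n obtain x y z where "x \<in> carrier A" "f n = I n +> x" "y \<in> carrier A" "g n = I n +> y" "z \<in> carrier A" "h n = I n +> z"
    using ex[OF f, of n] ex[OF g, of n] ex[OF h, of n] by blast
   then show "(f \<otimes>.S g \<otimes>.S h) n = (f \<otimes>.S (g \<otimes>.S h)) n" by (simp add: S_ops Q_ops m_assoc)
  qed
 qed (use const_closed[of \<one>] in \<open>simp add: S_ops const_def\<close>)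
 fix f g h assume f: "f \<in> carrier S" and g: "g \<in> carrier S" and h: "h \<in> carrier S"
 show "(f \<oplus>.S g) \<otimes>.S h = f \<otimes>.S h \<oplus>.S g \<otimes>.S h"
 proof
  fix n obtain x y z where "x \<in> carrier A" "f n = I n +> x" "y \<in> carrier A" "g n = I n +> y" "z \<in> carrier A" "h n = I n +> z"
   using ex[OF f, of n] ex[OF g, of n] ex[OF h, of n] by blast
  then show "((f \<oplus>.S g) \<otimes>.S h) n = (f \<otimes>.S h \<oplus>.S g \<otimes>.S h) n" by (simp add: S_ops Q_ops l_distr)
 qed
qed

lemma const_hom: "const \<in> ring_hom A S"
 by (rule ring_hom_memI) (auto simp: const_closed, auto simp: const_def S_ops Q_ops)

definition F :: "nat => (nat => 'b set) set" where "F n = {f \<in> carrier S. f n = I n +> \<zero>}"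

lemma coset_zero_iff: "x \<in> carrier A ==> I n +> x = I n +> \<zero> \<longleftrightarrow> x \<in> I n"
 by (simp add: coset_eq_iff a_minus_def)

lemma const_mem_F: "x \<in> carrier A ==> const x \<in> F n \<longleftrightarrow> x \<in> I n"
 by (simp add: F_def const_closed) (simp add: const_def coset_zero_iff)

lemma F_ideal: "ideal (F n) S"
 unfolding cring.ideal_iff_submodule[OF S_cring]
proof (rule module.submoduleI'[OF cring.ring_module_is_module[OF S_cring]])
 interpret S: cring S by (rule S_cring)
 show "F n \<subseteq> carrier (ring_module S)" by (auto simp: F_def ring_module_def)
 show "\<zero>\<^bsub>ring_module S\<^esub> \<in> F n" using S.zero_closed by (simp add: F_def ring_module_def) (simp add: S_ops)
 show "x \<oplus>\<^bsub>ring_module S\<^esub> y \<in> F n" if "x \<in> F n" "y \<in> F n" for x y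
 proof -
  have "(x \<oplus>.S y) n = I n +> \<zero>" using that by (simp add: F_def S_ops Q_ops)
  then show ?thesis using S_closed[of x y] that by (simp add: F_def ring_module_def)
 qed
 show "a \<odot>\<^bsub>ring_module S\<^esub> x \<in> F n" if a: "a \<in> carrier S" and x: "x \<in> F n" for a x
 proof -
  obtain z where z: "z \<in> carrier A" "a n = I n +> z" using a by (rule S_repE)
  have "(a \<otimes>.S x) n = I n +> \<zero>" using x z by (simp add: S_ops F_def Q_ops)
  then show ?thesis using S_closed(2)[OF a, of x] x by (simp add: F_def ring_module_def)
 qed
qed

lemma F_0: "F 0 = carrier S"
proof -
 have "f 0 = I 0 +> \<zero>" if "f \<in> carrier S" for f
 proof -
  obtain x where "x \<in> carrier A" "f 0 = I 0 +> x" using \<open>f \<in> carrier S\<close> by (rule S_repE)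
  then show ?thesis using coset_zero_iff[of x 0] by (simp add: ideal_pow.simps(1))
 qed
 then show ?thesis by (auto simp: F_def)
qed

lemma F_Suc: "F (Suc n) \<subseteq> F n"
proof
 fix f assume f: "f \<in> F (Suc n)"
 then obtain x where x: "x \<in> carrier A" "f n = I n +> x" "f (Suc n) = I (Suc n) +> x"
  unfolding F_def S_carrier_iff by blast
 then have "x \<in> I (Suc n)" using f coset_zero_iff[OF x(1), of "Suc n"] by (simp add: F_def)
 then have "x \<in> I n" using I_Suc by blast
 then show "f \<in> F n" using f x coset_zero_iff[OF x(1), of n] by (simp add: F_def)
qed

lemma F_sep: "(!!n. f \<in> F n) ==> f = \<zero>.S"
 by (auto simp: F_def S_ops)

lemma F_mult:
 assumes f: "f \<in> F k" and g: "g \<in> F n"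
 shows "f \<otimes>.S g \<in> F (k + n)"
proof -
 have fc: "f \<in> carrier S" and gc: "g \<in> carrier S" using f g by (auto simp: F_def)
 obtain x where x: "x \<in> carrier A" "!!i. i \<le> k + n ==> f i = I i +> x" using S_rep[OF fc] by blast
 obtain y where y: "y \<in> carrier A" "!!i. i \<le> k + n ==> g i = I i +> y" using S_rep[OF gc] by blast
 have "x \<in> I k" using f x(2)[of k] coset_zero_iff[OF x(1), of k] by (simp add: F_def)
 moreover have "y \<in> I n" using g y(2)[of n] coset_zero_iff[OF y(1), of n] by (simp add: F_def)
 ultimately have "x \<otimes> y \<in> I (k + n)" by (rule ideal_pow_mult_mem[OF m_ideal])
 then have "(f \<otimes>.S g) (k + n) = I (k + n) +> \<zero>"
  using x y coset_zero_iff[of "x \<otimes> y" "k + n"] by (simp add: S_ops Q_ops)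
 then show ?thesis using S_closed[OF fc gc] by (simp add: F_def)
qed

lemma S_minus:
 assumes f: "f \<in> carrier S" and g: "g \<in> carrier S" and x: "x \<in> carrier A" "f n = I n +> x"
  and y: "y \<in> carrier A" "g n = I n +> y"
 shows "(f \<ominus>.S g) n = I n +> (x \<ominus> y)"
proof -
 interpret S: cring S by (rule S_cring)
 have "f \<ominus>.S g \<in> carrier S" using f g by simp
 then obtain z where z: "z \<in> carrier A" "(f \<ominus>.S g) n = I n +> z" by (rule S_repE)
 have "(f \<ominus>.S g) \<oplus>.S g = f" using f g by (simp add: a_minus_def S.a_assoc S.l_neg)
 then have "((f \<ominus>.S g) \<oplus>.S g) n = f n" by simp
 then have "I n +> (z \<oplus> y) = I n +> x" using z x y by (simp add: S_ops(3) Q_ops)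
 then have "(z \<oplus> y) \<ominus> x \<in> I n" using coset_eq_iff[of "z \<oplus> y" x n] z x y by simp
 moreover have "(z \<oplus> y) \<ominus> x = z \<ominus> (x \<ominus> y)" using z(1) x(1) y(1) by algebra
 ultimately show ?thesis using coset_eq_iff[of z "x \<ominus> y" n] z x y by simp
qed

lemma F_diff_iff:
 assumes f: "f \<in> carrier S" and g: "g \<in> carrier S"
 shows "f \<ominus>.S g \<in> F n \<longleftrightarrow> f n = g n"
proof -
 interpret S: cring S by (rule S_cring)
 obtain x where x: "x \<in> carrier A" "f n = I n +> x" using f by (rule S_repE)
 obtain y where y: "y \<in> carrier A" "g n = I n +> y" using g by (rule S_repE)
 have "f \<ominus>.S g \<in> F n \<longleftrightarrow> I n +> (x \<ominus> y) = I n +> \<zero>"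
  using S_minus[OF f g x y] f g by (simp add: F_def)
 then show ?thesis using coset_zero_iff[of "x \<ominus> y" n] coset_eq_iff[of x y n] x y by simp
qed

lemma complete:
 assumes y: "!!n. y n \<in> carrier S" and d: "!!n. y (Suc n) \<ominus>.S y n \<in> F n"
 shows "\<exists>l\<in>carrier S. \<forall>n. l \<ominus>.S y n \<in> F n"
proof -
 \<comment> \<open>The n-th entry no longer changes after y n, so the limit is read off the
   diagonal.\<close>
 define l where "l n = y n n" for n
 have l: "l \<in> carrier S"
  unfolding S_carrier_iff
 proof
  fix n
  obtain x where x: "x \<in> carrier A" "y (Suc n) n = I n +> x" "y (Suc n) (Suc n) = I (Suc n) +> x"
   using y[of "Suc n"] unfolding S_carrier_iff by blast
  have "y (Suc n) n = y n n" using d[of n] F_diff_iff[OF y y] by blast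
  then show "\<exists>x\<in>carrier A. l n = I n +> x \<and> l (Suc n) = I (Suc n) +> x"
   using x by (auto simp: l_def)
 qed
 have "l \<ominus>.S y n \<in> F n" for n using F_diff_iff[OF l y] by (simp add: l_def)
 then show ?thesis using l by blast
qed

end

text \<open>The completion of \<open>R\<^sub>P\<close> with the map \<open>R \<rightarrow> R\<^sub>P \<rightarrow> S\<close>.\<close>

lemma (in ffin_ring) completed_localization_data:
 assumes P: "primeideal P R"
 shows "\<exists>q F. completion_data R (completed_localization R P) p q P F"
proof -
 interpret L: prime_localization R P by (rule prime_localization.intro[OF cring_axioms prime_localization_axioms.intro[OF P]])
 interpret C: adic_completion "localization R P" "localization_max R P"
  by (rule adic_completion.intro[OF L.A_cring adic_completion_axioms.intro[OF L.mx_ideal]])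
 interpret S: cring C.S by (rule C.S_cring)
 have S: "completed_localization R P = C.S" by (simp add: completed_localization_def)
 define q where "q r = C.const (fraction R P r \<one>)" for r
 have f1: "fraction R P r \<one> \<in> carrier (localization R P)" if "r \<in> carrier R" for r
  by (rule L.fraction_closed[OF that L.D_one])
 interpret c: ring_hom_cring "localization R P" C.S C.const
  by (rule ring_hom_cring.intro[OF L.A_cring C.S_cring ring_hom_cring_axioms.intro[OF C.const_hom]])
 have hom: "q \<in> ring_hom R C.S"
 proof (rule ring_hom_memI)
  fix x y assume xy: "x \<in> carrier R" "y \<in> carrier R"
  show "q x \<in> carrier C.S" using f1[OF xy(1)] by (simp add: q_def)
  show "q (x \<otimes> y) = q x \<otimes>\<^bsub>C.S\<^esub> q y"
   using xy L.A_mult[OF xy(1) L.D_one xy(2) L.D_one] c.hom_mult[OF f1[OF xy(1)] f1[OF xy(2)]] by (simp add: q_def)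
  show "q (x \<oplus> y) = q x \<oplus>\<^bsub>C.S\<^esub> q y"
   using xy L.A_add[OF xy(1) L.D_one xy(2) L.D_one] c.hom_add[OF f1[OF xy(1)] f1[OF xy(2)]] by (simp add: q_def)
 next
  show "q \<one> = \<one>\<^bsub>C.S\<^esub>" using c.hom_one by (simp add: q_def L.A_one)
 qed
 interpret q: ring_hom_cring R C.S q
  by (rule ring_hom_cring.intro[OF cring_axioms C.S_cring ring_hom_cring_axioms.intro[OF hom]])
 have "add_pow C.S n \<one>\<^bsub>C.S\<^esub> = q (add_pow R n \<one>)" for n :: nat
  by (induction n) simp_all
 then have pc: "add_pow C.S p \<one>\<^bsub>C.S\<^esub> = \<zero>\<^bsub>C.S\<^esub>" using p_char by simp
 have unitA: "fraction R P s \<one> \<otimes>\<^bsub>localization R P\<^esub> fraction R P \<one> s = \<one>\<^bsub>localization R P\<^esub>"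
  if s: "s \<in> carrier R - P" for s
 proof -
  have "fraction R P s \<one> \<otimes>\<^bsub>localization R P\<^esub> fraction R P \<one> s = fraction R P (s \<otimes> \<one>) (\<one> \<otimes> s)"
   using s L.D_one by (intro L.A_mult) auto
  also have "\<dots> = \<one>\<^bsub>localization R P\<^esub>"
   unfolding L.A_one using s L.D_one by (intro L.fraction_eqI) auto
  finally show ?thesis .
 qed
 have "completion_data R C.S p q P C.F"
 proof (rule completion_data.intro, goal_cases)
  case 4
  show ?case
  proof (rule completion_data_axioms.intro)
  show "primeideal P R" by (rule P)
  show "ideal (C.F n) C.S" "C.F 0 = carrier C.S" "C.F (Suc n) \<subseteq> C.F n" for n
   by (rule C.F_ideal C.F_0 C.F_Suc)+
  show "x = \<zero>\<^bsub>C.S\<^esub>" if "!!n. x \<in> C.F n" for x using that by (rule C.F_sep)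
  show "x \<otimes>\<^bsub>C.S\<^esub> y \<in> C.F (k + n)" if "x \<in> C.F k" "y \<in> C.F n" for x y k n using that by (rule C.F_mult)
  show "\<exists>l\<in>carrier C.S. \<forall>n. l \<ominus>\<^bsub>C.S\<^esub> w n \<in> C.F n"
   if "!!n. w n \<in> carrier C.S" "!!n. w (Suc n) \<ominus>\<^bsub>C.S\<^esub> w n \<in> C.F n" for w using that by (rule C.complete)
  show "\<exists>a\<in>carrier R. \<exists>s\<in>carrier R - P. q s \<otimes>\<^bsub>C.S\<^esub> x \<ominus>\<^bsub>C.S\<^esub> q a \<in> C.F n" if x: "x \<in> carrier C.S" for x n
  proof -
   \<comment> \<open>Density: modulo F n the element x is the class of a single fraction a / s, and
     there q s times x agrees with q a.\<close>
   obtain z where z: "z \<in> carrier (localization R P)" "x n = C.I n +>\<^bsub>localization R P\<^esub> z"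
    using x by (rule C.S_repE)
   obtain a s where a: "a \<in> carrier R" "s \<in> carrier R - P" "z = fraction R P a s"
    using z(1) by (rule L.A_carrierE)
   have sc: "s \<in> carrier R" using a by blast
   have "fraction R P s \<one> \<otimes>\<^bsub>localization R P\<^esub> z = fraction R P (s \<otimes> a) (\<one> \<otimes> s)"
    unfolding a(3) using a sc L.D_one by (intro L.A_mult) auto
   also have "\<dots> = fraction R P a \<one>" using a sc L.D_one by (intro L.fraction_eqI) (auto simp: m_comm)
   finally have "(q s \<otimes>\<^bsub>C.S\<^esub> x) n = q a n"
    using z C.Q_ops(2)[OF f1[OF sc] z(1), of n] by (simp add: q_def C.const_def C.S_ops)
   then have "q s \<otimes>\<^bsub>C.S\<^esub> x \<ominus>\<^bsub>C.S\<^esub> q a \<in> C.F n"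
    using C.F_diff_iff[of "q s \<otimes>\<^bsub>C.S\<^esub> x" "q a" n] x sc a by simp
   then show ?thesis using a by blast
  qed
  show "q r \<in> C.F n \<longleftrightarrow> (\<exists>s\<in>carrier R - P. s \<otimes> r \<in> ideal_pow R P n)" if r: "r \<in> carrier R" for r n
   unfolding q_def C.const_mem_F[OF f1[OF r]] by (rule L.fraction_mem_ideal_pow[OF r L.D_one])
  show "q s \<in> Units C.S" if s: "s \<in> carrier R - P" for s
  proof -
   have sc: "s \<in> carrier R" using s by blast
   have i: "fraction R P \<one> s \<in> carrier (localization R P)" using s by blast
   have "q s \<otimes>\<^bsub>C.S\<^esub> C.const (fraction R P \<one> s) = \<one>\<^bsub>C.S\<^esub>"
    unfolding q_def using c.hom_mult[OF f1[OF sc] i] unitA[OF s] c.hom_one by simp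
   moreover have "C.const (fraction R P \<one> s) \<in> carrier C.S" using i by simp
   ultimately show ?thesis using S.m_comm[of "q s"] sc unfolding Units_def by fastforce
  qed
  qed
 qed (rule ffin_ring_axioms q.ring_hom_cring_axioms
   char_ring.intro[OF C.S_cring char_ring_axioms.intro[OF p_prime pc]])+
 then show ?thesis unfolding S by blast
qed

theorem (in ffin_ring) CL_FFRT_imp_id_lower_factoring:
 assumes "CL_FFRT p R"
 shows "\<exists>e. (\<lambda>u. u) \<in> lower_factoring R p e"
proof (rule id_lower_factoring_of_local[OF noeth])
 fix P assume P: "primeideal P R"
 obtain q F where c: "completion_data R (completed_localization R P) p q P F"
  using completed_localization_data[OF P] by blast
 have "FFRT p (completed_localization R P)" using assms P by (simp add: CL_FFRT_def)
 then obtain e where "(\<lambda>u. u) \<in> lower_factoring (completed_localization R P) p e"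
  using completion_data.id_lower_factoring_of_FFRT[OF c] by blast
 then show "\<exists>e. \<not> lower_ideal e \<subseteq> P" using completion_data.lower_ideal_not_subset[OF c] by blast
qed

section \<open>A Cech-type complex indexed by lists\<close>

text \<open>Cochains of degree \<open>n\<close> are functions on all lists of length \<open>n\<close> with entries below \<open>t\<close>;
 neither alternation nor monotonicity is imposed, which makes the differential a simple
 recursion.\<close>

primrec cobd :: "('a, 'x, 'y) module_scheme => (nat => 'a) => nat list => (nat list => 'x) => 'x" where
 "cobd M y [] c = \<zero>.M"
| "cobd M y (j # l) c = y j \<odot>.M c l \<ominus>.M cobd M y l (\<lambda>m. c (j # m))"

definition idx :: "nat => nat => nat list set" where
 "idx t n = {l. length l = n \<and> set l \<subseteq> {..<t}}"

text \<open>The index lists of degree n - 1. There are none for n = 0, so that coboundaries of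
  degree 0 vanish without a case distinction.\<close>

definition pred_idx :: "nat => nat => nat list set" where
 "pred_idx t n = {l. Suc (length l) = n \<and> set l \<subseteq> {..<t}}"

lemma pred_idx_Suc[simp]: "pred_idx t (Suc n) = idx t n"
 by (auto simp: pred_idx_def idx_def)

lemma pred_idx_0[simp]: "pred_idx t 0 = {}"
 by (auto simp: pred_idx_def)

lemma finite_idx: "finite (idx t n)"
 using finite_lists_length_eq[of "{..<t}" n] by (simp add: idx_def conj_commute)

lemma finite_pred_idx: "finite (pred_idx t n)"
 by (cases n) (simp_all add: finite_idx)

lemma idx_Cons: "j # l \<in> idx t (Suc n) \<longleftrightarrow> j < t \<and> l \<in> idx t n"
 by (auto simp: idx_def)

lemma idx_0: "idx t 0 = {[]}" by (auto simp: idx_def)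

lemma idx_SucE:
 assumes "l \<in> idx t (Suc n)" obtains j m where "l = j # m" "j < t" "m \<in> idx t n"
 using assms by (cases l) (auto simp: idx_def)

context module
begin

lemma cobd_closed:
 assumes y: "!!j. y j \<in> carrier R"
 shows "l \<in> idx t n ==> (!!l. l \<in> pred_idx t n ==> c l \<in> carrier M) ==> cobd M y l c \<in> carrier M"
proof (induction l arbitrary: n c)
 case (Cons j l)
 obtain k where n: "n = Suc k" using Cons.prems(1) by (cases n) (auto simp: idx_def)
 have l: "j < t" "l \<in> idx t k" using Cons.prems(1) n idx_Cons by auto
 have "cobd M y l (\<lambda>m. c (j # m)) \<in> carrier M"
 proof (rule Cons.IH[OF l(2)])
  fix m assume "m \<in> pred_idx t k"
  then have "j # m \<in> idx t k" using l by (auto simp: pred_idx_def idx_def)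
  then show "c (j # m) \<in> carrier M" using Cons.prems(2) n by simp
 qed
 moreover have "c l \<in> carrier M" using Cons.prems(2)[of l] l n by simp
 ultimately show ?case using y by simp
qed simp

lemma cobd_cong:
 "l \<in> idx t n ==> (!!l. l \<in> pred_idx t n ==> c l = c' l) ==> cobd M y l c = cobd M y l c'"
proof (induction l arbitrary: n c c')
 case (Cons j l)
 obtain k where n: "n = Suc k" using Cons.prems(1) by (cases n) (auto simp: idx_def)
 have l: "j < t" "l \<in> idx t k" using Cons.prems(1) n idx_Cons by auto
 have "cobd M y l (\<lambda>m. c (j # m)) = cobd M y l (\<lambda>m. c' (j # m))"
 proof (rule Cons.IH[OF l(2)])
  fix m assume "m \<in> pred_idx t k"
  then have "j # m \<in> idx t k" using l by (auto simp: pred_idx_def idx_def)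
  then show "c (j # m) = c' (j # m)" using Cons.prems(2) n by simp
 qed
 moreover have "c l = c' l" using Cons.prems(2)[of l] l n by simp
 ultimately show ?case by simp
qed simp

lemma cobd_add:
 assumes y: "!!j. y j \<in> carrier R"
 shows "l \<in> idx t n ==> (!!l. l \<in> pred_idx t n ==> c l \<in> carrier M) ==> (!!l. l \<in> pred_idx t n ==> c' l \<in> carrier M) ==>
  cobd M y l (\<lambda>m. c m \<oplus>.M c' m) = cobd M y l c \<oplus>.M cobd M y l c'"
proof (induction l arbitrary: n c c')
 case (Cons j l)
 obtain k where n: "n = Suc k" using Cons.prems(1) by (cases n) (auto simp: idx_def)
 have l: "j < t" "l \<in> idx t k" using Cons.prems(1) n idx_Cons by auto
 have jm: "j # m \<in> idx t k" if "m \<in> pred_idx t k" for m using that l by (auto simp: pred_idx_def idx_def)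
 have cc: "c (j # m) \<in> carrier M" "c' (j # m) \<in> carrier M" if "m \<in> pred_idx t k" for m
  using jm[OF that] Cons.prems(2,3) n by auto
 have IH: "cobd M y l (\<lambda>m. c (j # m) \<oplus>.M c' (j # m)) = cobd M y l (\<lambda>m. c (j # m)) \<oplus>.M cobd M y l (\<lambda>m. c' (j # m))"
  by (rule Cons.IH[OF l(2)]) (use cc in auto)
 have *: "c l \<in> carrier M" "c' l \<in> carrier M" using Cons.prems(2,3)[of l] l n by auto
 have **: "cobd M y l (\<lambda>m. c (j # m)) \<in> carrier M" "cobd M y l (\<lambda>m. c' (j # m)) \<in> carrier M"
  using cobd_closed[OF y l(2)] cc by auto
 show ?case using * ** y[of j] by (simp add: IH smult_r_distr a_minus_def M.minus_add M.a_ac)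
qed simp

lemma cobd_smult:
 assumes y: "!!j. y j \<in> carrier R" and r: "r \<in> carrier R"
 shows "l \<in> idx t n ==> (!!l. l \<in> pred_idx t n ==> c l \<in> carrier M) ==>
  cobd M y l (\<lambda>m. r \<odot>.M c m) = r \<odot>.M cobd M y l c"
proof (induction l arbitrary: n c)
 case (Cons j l)
 obtain k where n: "n = Suc k" using Cons.prems(1) by (cases n) (auto simp: idx_def)
 have l: "j < t" "l \<in> idx t k" using Cons.prems(1) n idx_Cons by auto
 have jm: "j # m \<in> idx t k" if "m \<in> pred_idx t k" for m using that l by (auto simp: pred_idx_def idx_def)
 have cc: "c (j # m) \<in> carrier M" if "m \<in> pred_idx t k" for m
  using jm[OF that] Cons.prems(2) n by auto
 have IH: "cobd M y l (\<lambda>m. r \<odot>.M c (j # m)) = r \<odot>.M cobd M y l (\<lambda>m. c (j # m))"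
  by (rule Cons.IH[OF l(2)]) (use cc in auto)
 have *: "c l \<in> carrier M" using Cons.prems(2)[of l] l n by auto
 have **: "cobd M y l (\<lambda>m. c (j # m)) \<in> carrier M"
  using cobd_closed[OF y l(2)] cc by auto
 have "y j \<odot>.M (r \<odot>.M c l) = r \<odot>.M (y j \<odot>.M c l)"
  using * y[of j] r by (simp add: smult_assoc1[symmetric] R.m_comm)
 then show ?case using * ** y[of j] r by (simp add: IH smult_r_distr a_minus_def smult_r_minus)
qed (simp add: r)

text \<open>Applied to the maps of a resolution, to the transition maps of a presentation, and to
  homomorphisms between pushforwards.\<close>

lemma cobd_hom:
 assumes y: "!!j. y j \<in> carrier R" and N: "module R N" and h: "h \<in> mod_hom R M N"
 shows "l \<in> idx t n ==> (!!l. l \<in> pred_idx t n ==> c l \<in> carrier M) ==>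
  h (cobd M y l c) = cobd N y l (\<lambda>m. h (c m))"
proof (induction l arbitrary: n c)
 case Nil
 then show ?case using mod_hom_zero[OF h module_axioms N] by simp
next
 case (Cons j l)
 obtain k where n: "n = Suc k" using Cons.prems(1) by (cases n) (auto simp: idx_def)
 have l: "j < t" "l \<in> idx t k" using Cons.prems(1) n idx_Cons by auto
 have jm: "j # m \<in> idx t k" if "m \<in> pred_idx t k" for m using that l by (auto simp: pred_idx_def idx_def)
 have cc: "c (j # m) \<in> carrier M" if "m \<in> pred_idx t k" for m
  using jm[OF that] Cons.prems(2) n by auto
 have IH: "h (cobd M y l (\<lambda>m. c (j # m))) = cobd N y l (\<lambda>m. h (c (j # m)))"
  by (rule Cons.IH[OF l(2)]) (use cc in auto)
 have *: "c l \<in> carrier M" using Cons.prems(2)[of l] l n by auto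
 have **: "cobd M y l (\<lambda>m. c (j # m)) \<in> carrier M"
  using cobd_closed[OF y l(2)] cc by auto
 show ?case using * ** y[of j] mod_hom_minus[OF h module_axioms N, of "y j \<odot>.M c l"] mod_homD(3)[OF h]
  by (simp add: IH)
qed

lemma cobd_minus:
 assumes y: "!!j. y j \<in> carrier R"
  and l: "l \<in> idx t n" and c: "!!l. l \<in> pred_idx t n ==> c l \<in> carrier M" "!!l. l \<in> pred_idx t n ==> c' l \<in> carrier M"
 shows "cobd M y l (\<lambda>m. c m \<ominus>.M c' m) = cobd M y l c \<ominus>.M cobd M y l c'"
proof -
 have e: "x \<ominus>.M z = x \<oplus>.M (\<ominus> \<one>) \<odot>.M z" if "z \<in> carrier M" for x z
  using that by (simp add: smult_l_minus a_minus_def)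
 have "cobd M y l (\<lambda>m. c m \<ominus>.M c' m) = cobd M y l (\<lambda>m. c m \<oplus>.M (\<ominus> \<one>) \<odot>.M c' m)"
  by (rule cobd_cong[OF l]) (use c e in auto)
 also have "\<dots> = cobd M y l c \<oplus>.M cobd M y l (\<lambda>m. (\<ominus> \<one>) \<odot>.M c' m)"
  by (rule cobd_add[OF y l]) (use c in auto)
 also have "cobd M y l (\<lambda>m. (\<ominus> \<one>) \<odot>.M c' m) = (\<ominus> \<one>) \<odot>.M cobd M y l c'"
  by (rule cobd_smult[OF y _ l c(2)]) auto
 finally show ?thesis using e[OF cobd_closed[OF y l c(2)]] by simp
qed

lemma cobd_zero:
 assumes y: "!!j. y j \<in> carrier R" and l: "l \<in> idx t n"
 shows "cobd M y l (\<lambda>_. \<zero>.M) = \<zero>.M"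
 using cobd_smult[of y \<zero> l t n "\<lambda>_. \<zero>.M"] cobd_closed[of y l t n "\<lambda>_. \<zero>.M"] y l by simp

text \<open>Write D for the differential and K for the operation that prefixes j, taking c to m
  \<mapsto> c (j # m). The recursion says K D = y_j - D K. Hence K D D = y_j D - D (y_j - D K) = D D
  K, and the induction hypothesis applies.\<close>

lemma cobd_cobd:
 assumes y: "!!j. y j \<in> carrier R"
 shows "l \<in> idx t (Suc n) ==> (!!l. l \<in> pred_idx t n ==> c l \<in> carrier M) ==> cobd M y l (\<lambda>l. cobd M y l c) = \<zero>.M"
proof (induction l arbitrary: n c)
 case (Cons j l)
 have l: "j < t" "l \<in> idx t n" using Cons.prems(1) idx_Cons by auto
 show ?case
 proof (cases n)
  case 0
  then have "l = []" using l by (simp add: idx_0)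
  then show ?thesis using y by (simp add: a_minus_def)
 next
  case (Suc k)
  have jm: "j # m \<in> idx t k" if "m \<in> pred_idx t k" for m using that l by (auto simp: pred_idx_def idx_def)
  have cc: "c (j # m) \<in> carrier M" if "m \<in> pred_idx t k" for m
   using jm[OF that] Cons.prems(2) Suc by auto
  have c: "c m \<in> carrier M" if "m \<in> idx t k" for m using Cons.prems(2) that Suc by simp
  have l': "l \<in> idx t (Suc k)" using l Suc by simp
  have IH: "cobd M y l (\<lambda>m. cobd M y m (\<lambda>m. c (j # m))) = \<zero>.M"
   by (rule Cons.IH[OF l']) (use cc in auto)
  have dc: "cobd M y m (\<lambda>m. c (j # m)) \<in> carrier M" if "m \<in> idx t k" for m
   by (rule cobd_closed[OF y that]) (use cc in auto)
  have "cobd M y l (\<lambda>m. y j \<odot>.M c m \<ominus>.M cobd M y m (\<lambda>m. c (j # m))) =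
    cobd M y l (\<lambda>m. y j \<odot>.M c m) \<ominus>.M cobd M y l (\<lambda>m. cobd M y m (\<lambda>m. c (j # m)))"
   by (rule cobd_minus[OF y l']) (use c dc y in auto)
  also have "\<dots> = y j \<odot>.M cobd M y l c \<ominus>.M \<zero>.M"
   unfolding IH by (subst cobd_smult[OF y y l']) (use c in auto)
  finally have e: "cobd M y l (\<lambda>m. y j \<odot>.M c m \<ominus>.M cobd M y m (\<lambda>m. c (j # m))) = y j \<odot>.M cobd M y l c \<ominus>.M \<zero>.M" .
  have dl: "cobd M y l c \<in> carrier M" by (rule cobd_closed[OF y l']) (use c in auto)
  then have "y j \<odot>.M cobd M y l c \<in> carrier M" using y by simp
  then show ?thesis using e by (simp add: a_minus_def M.r_neg M.add.inv_one[folded a_inv_def])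
 qed
qed simp

end

primrec list_prod :: "('a, 'k) ring_scheme => (nat => 'a) => nat list => 'a" where
 "list_prod R z [] = \<one>.R"
| "list_prod R z (j # l) = z j \<otimes>.R list_prod R z l"

context module
begin

lemma list_prod_closed: "(!!j. z j \<in> carrier R) ==> list_prod R z l \<in> carrier R"
 by (induction l) auto

text \<open>Each term of the differential removes one entry j from the list and contributes the
  coefficient z_j y_j, whose factor z_j restores the one missing from the product over the shorter
  list.\<close>

lemma cobd_transition:
 assumes y: "!!j. y j \<in> carrier R" and z: "!!j. z j \<in> carrier R"
 shows "l \<in> idx t n ==> (!!l. l \<in> pred_idx t n ==> c l \<in> carrier M) ==>
  cobd M (\<lambda>j. z j \<otimes> y j) l (\<lambda>m. list_prod R z m \<odot>.M c m) = list_prod R z l \<odot>.M cobd M y l c"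
proof (induction l arbitrary: n c)
 case (Cons j l)
 obtain k where n: "n = Suc k" using Cons.prems(1) by (cases n) (auto simp: idx_def)
 have l: "j < t" "l \<in> idx t k" using Cons.prems(1) n idx_Cons by auto
 have jm: "j # m \<in> idx t k" if "m \<in> pred_idx t k" for m using that l by (auto simp: pred_idx_def idx_def)
 have cc: "c (j # m) \<in> carrier M" if "m \<in> pred_idx t k" for m
  using jm[OF that] Cons.prems(2) n by auto
 have zl: "list_prod R z m \<in> carrier R" for m by (rule list_prod_closed[OF z])
 have yz: "z j \<otimes> y j \<in> carrier R" for j using y z by simp
 have IH: "cobd M (\<lambda>j. z j \<otimes> y j) l (\<lambda>m. list_prod R z m \<odot>.M c (j # m)) = list_prod R z l \<odot>.M cobd M y l (\<lambda>m. c (j # m))"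
  by (rule Cons.IH[OF l(2)]) (use cc in auto)
 have *: "c l \<in> carrier M" using Cons.prems(2)[of l] l n by auto
 have **: "cobd M y l (\<lambda>m. c (j # m)) \<in> carrier M"
  using cobd_closed[OF y l(2)] cc by auto
 have "cobd M (\<lambda>j. z j \<otimes> y j) l (\<lambda>m. (z j \<otimes> list_prod R z m) \<odot>.M c (j # m)) =
   cobd M (\<lambda>j. z j \<otimes> y j) l (\<lambda>m. z j \<odot>.M (list_prod R z m \<odot>.M c (j # m)))"
  by (rule cobd_cong[OF l(2)]) (use cc z zl in \<open>auto simp: smult_assoc1\<close>)
 also have "\<dots> = z j \<odot>.M cobd M (\<lambda>j. z j \<otimes> y j) l (\<lambda>m. list_prod R z m \<odot>.M c (j # m))"
  by (rule cobd_smult[OF yz z l(2)]) (use cc zl in auto)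
 finally have e: "cobd M (\<lambda>j. z j \<otimes> y j) l (\<lambda>m. (z j \<otimes> list_prod R z m) \<odot>.M c (j # m)) =
   (z j \<otimes> list_prod R z l) \<odot>.M cobd M y l (\<lambda>m. c (j # m))"
  using ** z zl by (simp add: IH smult_assoc1)
 have "(z j \<otimes> y j) \<odot>.M (list_prod R z l \<odot>.M c l) = (z j \<otimes> list_prod R z l) \<odot>.M (y j \<odot>.M c l)"
  using * y[of j] z[of j] zl[of l] by (simp add: smult_assoc1[symmetric] R.m_ac)
 then show ?case using * ** y[of j] z[of j] zl[of l]
  by (simp add: e smult_r_distr a_minus_def smult_r_minus)
qed (simp add: list_prod_closed z)

end

section \<open>Presentations as colimits\<close>

text \<open>\<open>colim_pres R X N \<tau> Z B W V \<rho>\<close>: the subquotient \<open>W / V\<close> of \<open>N\<close> is the colimit of the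
 subquotients \<open>Z e / B e\<close> of the module of functions with values in \<open>X\<close>, along the maps
 \<open>c \<mapsto> \<tau> e e' \<cdot> c\<close>; the map from \<open>Z e\<close> to \<open>W / V\<close> is given by the relation \<open>\<rho> e\<close>.\<close>

definition colim_pres ::
 "('a, 'k) ring_scheme => ('a, 'x, 'y) module_scheme => ('a, 'n, 'w) module_scheme =>
  (nat => nat => 'i => 'a) => (nat => ('i => 'x) set) => (nat => ('i => 'x) set) =>
  'n set => 'n set => (nat => ('i => 'x) => 'n => bool) => bool" where
 "colim_pres R X N \<tau> Z B W V \<rho> \<longleftrightarrow>
   (\<forall>e c w. \<rho> e c w --> c \<in> Z e \<and> w \<in> W) \<and>
   (\<forall>e. \<forall>c\<in>Z e. \<exists>w. \<rho> e c w) \<and>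
   (\<forall>w\<in>W. \<exists>e c. \<rho> e c w) \<and>
   (\<forall>e c w c' w'. \<rho> e c w --> \<rho> e c' w' --> \<rho> e (\<lambda>i. c i \<oplus>.X c' i) (w \<oplus>.N w')) \<and>
   (\<forall>e c w. \<forall>r\<in>carrier R. \<rho> e c w --> \<rho> e (\<lambda>i. r \<odot>.X c i) (r \<odot>.N w)) \<and>
   (\<forall>e e' c w. e \<le> e' --> \<rho> e c w --> \<rho> e' (\<lambda>i. \<tau> e e' i \<odot>.X c i) w) \<and>
   (\<forall>e c w. \<rho> e c w --> (w \<in> V \<longleftrightarrow> (\<exists>e'\<ge>e. (\<lambda>i. \<tau> e e' i \<odot>.X c i) \<in> B e')))"

lemma colim_presD:
 assumes p: "colim_pres R X N \<tau> Z B W V \<rho>"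
 shows "\<rho> e c w ==> c \<in> Z e" "\<rho> e c w ==> w \<in> W"
  "c \<in> Z e ==> \<exists>w. \<rho> e c w" "w \<in> W ==> \<exists>e c. \<rho> e c w"
  "\<rho> e c w ==> \<rho> e c' w' ==> \<rho> e (\<lambda>i. c i \<oplus>.X c' i) (w \<oplus>.N w')"
  "r \<in> carrier R ==> \<rho> e c w ==> \<rho> e (\<lambda>i. r \<odot>.X c i) (r \<odot>.N w)"
  "e \<le> e' ==> \<rho> e c w ==> \<rho> e' (\<lambda>i. \<tau> e e' i \<odot>.X c i) w"
  "\<rho> e c w ==> w \<in> V \<longleftrightarrow> (\<exists>e'\<ge>e. (\<lambda>i. \<tau> e e' i \<odot>.X c i) \<in> B e')"
proof -
 note q = p[unfolded colim_pres_def]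
 show "\<rho> e c w ==> c \<in> Z e" "\<rho> e c w ==> w \<in> W" using conjunct1[OF q] by iprover+
 note q = conjunct2[OF q]
 show "c \<in> Z e ==> \<exists>w. \<rho> e c w" using conjunct1[OF q] by fast
 note q = conjunct2[OF q]
 show "w \<in> W ==> \<exists>e c. \<rho> e c w" using conjunct1[OF q] by (rule bspec)
 note q = conjunct2[OF q]
 show "\<rho> e c w ==> \<rho> e c' w' ==> \<rho> e (\<lambda>i. c i \<oplus>.X c' i) (w \<oplus>.N w')"
  using conjunct1[OF q] by iprover
 note q = conjunct2[OF q]
 show "r \<in> carrier R ==> \<rho> e c w ==> \<rho> e (\<lambda>i. r \<odot>.X c i) (r \<odot>.N w)"
  using conjunct1[OF q] by simp
 note q = conjunct2[OF q]
 show "e \<le> e' ==> \<rho> e c w ==> \<rho> e' (\<lambda>i. \<tau> e e' i \<odot>.X c i) w"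
  using conjunct1[OF q] by iprover
 show "\<rho> e c w ==> w \<in> V \<longleftrightarrow> (\<exists>e'\<ge>e. (\<lambda>i. \<tau> e e' i \<odot>.X c i) \<in> B e')"
  using conjunct2[OF q] by iprover
qed

lemma colim_presI:
 assumes "!!e c w. \<rho> e c w ==> c \<in> Z e" "!!e c w. \<rho> e c w ==> w \<in> W"
  "!!e c. c \<in> Z e ==> \<exists>w. \<rho> e c w" "!!w. w \<in> W ==> \<exists>e c. \<rho> e c w"
  "!!e c w c' w'. \<rho> e c w ==> \<rho> e c' w' ==> \<rho> e (\<lambda>i. c i \<oplus>.X c' i) (w \<oplus>.N w')"
  "!!e c w r. r \<in> carrier R ==> \<rho> e c w ==> \<rho> e (\<lambda>i. r \<odot>.X c i) (r \<odot>.N w)"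
  "!!e e' c w. e \<le> e' ==> \<rho> e c w ==> \<rho> e' (\<lambda>i. \<tau> e e' i \<odot>.X c i) w"
  "!!e c w. \<rho> e c w ==> w \<in> V ==> \<exists>e'\<ge>e. (\<lambda>i. \<tau> e e' i \<odot>.X c i) \<in> B e'"
  "!!e e' c w. \<rho> e c w ==> e \<le> e' ==> (\<lambda>i. \<tau> e e' i \<odot>.X c i) \<in> B e' ==> w \<in> V"
 shows "colim_pres R X N \<tau> Z B W V \<rho>"
 unfolding colim_pres_def
 apply (intro conjI allI ballI impI)
 subgoal by (rule assms(1))
 subgoal by (rule assms(2))
 subgoal by (rule assms(3))
 subgoal by (rule assms(4))
 subgoal by (rule assms(5))
 subgoal by (rule assms(6))
 subgoal by (rule assms(7))
 subgoal by (rule iffI, erule (1) assms(8), elim exE conjE, erule (2) assms(9))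
 done

text \<open>Injectivity extends to R the map s x^(k+r) + u \<mapsto> s x^k a, defined on the ideal
  generated by x^(k+r) and the annihilator of a, whose elements are the u; b is the value at 1.
  Since the map vanishes on the annihilator of a, everything that kills a kills b, which allows the
  generators of an ideal to be treated one after another.\<close>

lemma injective_division:
 fixes R :: "('a, 'k) ring_scheme" (structure) and M :: "('a, 'm) module"
 assumes noeth: "noetherian_ring R" and inj: "injective_module R M"
  and a: "a \<in> carrier M" and x: "x \<in> carrier R"
 shows "\<exists>b k. b \<in> carrier M \<and> (x [^] (k + r :: nat)) \<odot>.M b = (x [^] k) \<odot>.M a \<and>
  (\<forall>s\<in>carrier R. s \<odot>.M a = \<zero>.M --> s \<odot>.M b = \<zero>.M)"
proof -
 interpret module R M using inj by (simp add: injective_module_def)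
 interpret RM: module R "ring_module R" by (rule R.ring_module_is_module)
 define K where "K k = {s \<in> carrier R. (s \<otimes> x [^] k) \<odot>.M a = \<zero>.M}" for k :: nat
 have Ks: "submodule (K k) R (ring_module R)" for k
 proof (rule RM.submoduleI')
  show "s \<oplus>\<^bsub>ring_module R\<^esub> s' \<in> K k" if "s \<in> K k" "s' \<in> K k" for s s'
   using that a x by (simp add: K_def ring_module_def R.l_distr smult_l_distr)
  show "u \<odot>\<^bsub>ring_module R\<^esub> s \<in> K k" if "u \<in> carrier R" "s \<in> K k" for u s
   using that a x by (simp add: K_def ring_module_def R.m_assoc smult_assoc1)
 qed (use a x in \<open>auto simp: K_def ring_module_def\<close>)
 have K_mono: "K k \<subseteq> K (k + d)" for k d
 proof
  fix s assume s: "s \<in> K k"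
  have "s \<otimes> x [^] (k + d) = x [^] d \<otimes> (s \<otimes> x [^] k)"
   using s x by (simp add: K_def R.nat_pow_mult[symmetric] R.m_ac)
  then have "(s \<otimes> x [^] (k + d)) \<odot>.M a = x [^] d \<odot>.M ((s \<otimes> x [^] k) \<odot>.M a)"
   using s x a by (simp add: K_def smult_assoc1)
  then show "s \<in> K (k + d)" using s x by (simp add: K_def)
 qed
 obtain k where k: "!!j. K k \<subseteq> K j ==> K j = K k"
  using noeth_module_maximal[of R "ring_module R" 0 UNIV K, OF R.noeth_ring_module[OF noeth] UNIV_I Ks] by auto
 \<comment> \<open>This makes the map below well defined: if s x^(k+r) kills a, then already s x^k
   does.\<close>
 have Kr: "K (k + r) = K k" by (rule k[OF K_mono])
 define xr where "xr = x [^] (k + r)"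
 have xr: "xr \<in> carrier R" using x by (simp add: xr_def)
 have xk: "x [^] k \<in> carrier R" using x by simp
 define J where "J = {v. \<exists>s\<in>carrier R. \<exists>u\<in>carrier R. u \<odot>.M a = \<zero>.M \<and> v = s \<otimes> xr \<oplus> u}"
 have Jc: "J \<subseteq> carrier R" using xr by (auto simp: J_def)
 have JI: "s \<otimes> xr \<oplus> u \<in> J" if "s \<in> carrier R" "u \<in> carrier R" "u \<odot>.M a = \<zero>.M" for s u
  using that by (auto simp: J_def)
 have add_eq: "(s \<otimes> xr \<oplus> u) \<oplus> (s' \<otimes> xr \<oplus> u') = (s \<oplus> s') \<otimes> xr \<oplus> (u \<oplus> u')"
  if "s \<in> carrier R" "u \<in> carrier R" "s' \<in> carrier R" "u' \<in> carrier R" for s u s' u'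
  using that xr by algebra
 have mult_eq: "q \<otimes> (s \<otimes> xr \<oplus> u) = (q \<otimes> s) \<otimes> xr \<oplus> q \<otimes> u"
  if "s \<in> carrier R" "u \<in> carrier R" "q \<in> carrier R" for s u q
  using that xr by algebra
 define f where "f v = (THE w. \<exists>s\<in>carrier R. \<exists>u\<in>carrier R. u \<odot>.M a = \<zero>.M \<and> v = s \<otimes> xr \<oplus> u \<and>
  w = (s \<otimes> x [^] k) \<odot>.M a)" for v
 have f_eq: "f (s \<otimes> xr \<oplus> u) = (s \<otimes> x [^] k) \<odot>.M a"
  if s: "s \<in> carrier R" "u \<in> carrier R" "u \<odot>.M a = \<zero>.M" for s u
  unfolding f_def
 proof (rule the_equality)
  fix w assume "\<exists>s'\<in>carrier R. \<exists>u'\<in>carrier R. u' \<odot>.M a = \<zero>.M \<and> s \<otimes> xr \<oplus> u = s' \<otimes> xr \<oplus> u' \<and>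
   w = (s' \<otimes> x [^] k) \<odot>.M a"
  then obtain s' u' where s': "s' \<in> carrier R" "u' \<in> carrier R" "u' \<odot>.M a = \<zero>.M"
   "s \<otimes> xr \<oplus> u = s' \<otimes> xr \<oplus> u'" "w = (s' \<otimes> x [^] k) \<odot>.M a" by blast
  have "(s \<ominus> s') \<otimes> xr = (s \<otimes> xr \<oplus> u) \<ominus> s' \<otimes> xr \<ominus> u" using s(1,2) s'(1) xr by algebra
  also have "\<dots> = u' \<ominus> u" unfolding s'(4) using s(2) s'(1,2) xr by algebra
  finally have "(s \<ominus> s') \<otimes> xr = u' \<ominus> u" .
  then have "((s \<ominus> s') \<otimes> xr) \<odot>.M a = \<zero>.M"
   using s s' a by (simp add: a_minus_def smult_l_distr smult_l_minus)
  then have "s \<ominus> s' \<in> K (k + r)" using s s' by (simp add: K_def xr_def)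
  then have "s \<ominus> s' \<in> K k" by (simp add: Kr)
  then have "((s \<ominus> s') \<otimes> x [^] k) \<odot>.M a = \<zero>.M" by (simp add: K_def)
  moreover have "s' \<otimes> x [^] k = s \<otimes> x [^] k \<ominus> (s \<ominus> s') \<otimes> x [^] k" using s(1) s'(1) xk by algebra
  ultimately show "w = (s \<otimes> x [^] k) \<odot>.M a"
   using s s' a xk by (simp add: a_minus_def[of R "_ \<otimes> _"] smult_l_distr smult_l_minus)
 qed (use s in blast)
 let ?J = "(ring_module R)\<lparr>carrier := J\<rparr>"
 have "submodule J R (ring_module R)"
 proof (rule RM.submoduleI')
  show "\<zero>\<^bsub>ring_module R\<^esub> \<in> J" using JI[of \<zero> \<zero>] xr a by (simp add: ring_module_def)
  fix v v' assume v: "v \<in> J" "v' \<in> J"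
  obtain s u s' u' where *: "s \<in> carrier R" "u \<in> carrier R" "u \<odot>.M a = \<zero>.M" "v = s \<otimes> xr \<oplus> u"
   "s' \<in> carrier R" "u' \<in> carrier R" "u' \<odot>.M a = \<zero>.M" "v' = s' \<otimes> xr \<oplus> u'" using v by (auto simp: J_def)
  show "v \<oplus>\<^bsub>ring_module R\<^esub> v' \<in> J"
   using JI[of "s \<oplus> s'" "u \<oplus> u'"] * a add_eq[OF *(1,2,5,6)] by (simp add: ring_module_def smult_l_distr)
 next
  fix q v assume v: "v \<in> J" and q: "q \<in> carrier R"
  obtain s u where *: "s \<in> carrier R" "u \<in> carrier R" "u \<odot>.M a = \<zero>.M" "v = s \<otimes> xr \<oplus> u"
   using v by (auto simp: J_def)
  show "q \<odot>\<^bsub>ring_module R\<^esub> v \<in> J"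
   using JI[of "q \<otimes> s" "q \<otimes> u"] * a q mult_eq[OF *(1,2) q] by (simp add: ring_module_def smult_assoc1)
 qed (use Jc in \<open>simp add: ring_module_def\<close>)
 then have mJ: "module R ?J" by (rule submodule.submodule_is_module[OF _ RM.module_axioms])
 have f: "f \<in> mod_hom R ?J M"
  unfolding mod_hom_def
 proof (intro CollectI conjI ballI)
  show "f \<in> carrier ?J \<rightarrow> carrier M"
  proof
   fix v assume "v \<in> carrier ?J"
   then obtain s u where *: "s \<in> carrier R" "u \<in> carrier R" "u \<odot>.M a = \<zero>.M" "v = s \<otimes> xr \<oplus> u"
    by (auto simp: J_def)
   show "f v \<in> carrier M" unfolding *(4) f_eq[OF *(1-3)] using * xk a by simp
  qed
 next
  fix v v' assume v: "v \<in> carrier ?J" "v' \<in> carrier ?J"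
  obtain s u s' u' where *: "s \<in> carrier R" "u \<in> carrier R" "u \<odot>.M a = \<zero>.M" "v = s \<otimes> xr \<oplus> u"
   "s' \<in> carrier R" "u' \<in> carrier R" "u' \<odot>.M a = \<zero>.M" "v' = s' \<otimes> xr \<oplus> u'" using v by (auto simp: J_def)
  have "f (v \<oplus> v') = ((s \<oplus> s') \<otimes> x [^] k) \<odot>.M a"
   unfolding *(4,8) add_eq[OF *(1,2,5,6)] by (rule f_eq) (use * a in \<open>auto simp: smult_l_distr\<close>)
  then show "f (v \<oplus>.?J v') = f v \<oplus>.M f v'"
   unfolding *(4,8) f_eq[OF *(1-3)] f_eq[OF *(5-7)] using * xk a
   by (simp add: ring_module_def R.l_distr smult_l_distr)
 next
  fix q v assume v: "v \<in> carrier ?J" and q: "q \<in> carrier R"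
  obtain s u where *: "s \<in> carrier R" "u \<in> carrier R" "u \<odot>.M a = \<zero>.M" "v = s \<otimes> xr \<oplus> u"
   using v by (auto simp: J_def)
  have "f (q \<otimes> v) = ((q \<otimes> s) \<otimes> x [^] k) \<odot>.M a"
   unfolding *(4) mult_eq[OF *(1,2) q] by (rule f_eq) (use * a q in \<open>auto simp: smult_assoc1\<close>)
  then show "f (q \<odot>.?J v) = q \<odot>.M f v"
   unfolding *(4) f_eq[OF *(1-3)] using * xk a q
   by (simp add: ring_module_def R.m_assoc smult_assoc1)
 qed
 have "(\<lambda>v. v) \<in> mod_hom R ?J (ring_module R)" using Jc by (auto simp: mod_hom_def ring_module_def)
 with f mJ RM.module_axioms obtain g where g: "g \<in> mod_hom R (ring_module R) M" "\<forall>v\<in>carrier ?J. g v = f v"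
  using inj[unfolded injective_module_def, THEN conjunct2, rule_format, of ?J "ring_module R" "\<lambda>v. v" f] by auto
 have gs: "s \<odot>.M g \<one> = g s" if "s \<in> carrier R" for s
  using mod_homD(3)[OF g(1) that, of \<one>] that by (simp add: ring_module_def)
 show ?thesis
 proof (intro exI conjI ballI impI)
  show "g \<one> \<in> carrier M" using mod_homD(1)[OF g(1), of \<one>] by (simp add: ring_module_def)
  have "xr \<in> J" using JI[of \<one> \<zero>] xr a by simp
  then have "g xr = f xr" using g(2) by simp
  then show "x [^] (k + r) \<odot>.M g \<one> = x [^] k \<odot>.M a"
   using gs[OF xr] f_eq[of \<one> \<zero>] xr xk a by (simp add: xr_def)
 next
  fix s assume s: "s \<in> carrier R" "s \<odot>.M a = \<zero>.M"
  have "s \<in> J" using JI[of \<zero> s] xr s by simp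
  then have "g s = f s" using g(2) by simp
  then show "s \<odot>.M g \<one> = \<zero>.M" using gs[OF s(1)] f_eq[of \<zero> s] s xr xk a by simp
 qed
qed

lemma (in abelian_group) minus_eq_zeroD:
 assumes "a \<in> carrier G" "b \<in> carrier G" "a \<ominus> b = \<zero>" shows "a = b"
proof -
 have "a = (a \<ominus> b) \<oplus> b" using assms(1,2) by (simp add: a_minus_def a_assoc l_neg)
 then show ?thesis using assms by simp
qed

section \<open>Over injective modules, cocycles of positive degree become coboundaries at later
  levels\<close>

locale cech = char_ring +
 fixes x :: "nat => 'a" and t :: nat
 assumes x_closed: "!!j. x j \<in> carrier R" and noeth: "noetherian_ring R"
begin

definition ypow :: "nat => nat => 'a" where
 "ypow e j = fr e (x j)"

text \<open>The factor of \<open>cobd_transition\<close> for passing from the coefficients x_j^(p^e)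
  to x_j^(p^e'); it makes the levels into a direct system of complexes.\<close>

definition trans :: "nat => nat => nat list => 'a" where
 "trans e e' l = list_prod R (\<lambda>j. x j [^] (p ^ e' - p ^ e)) l"

lemma ypow_closed: "ypow e j \<in> carrier R" by (simp add: ypow_def x_closed)

lemma trans_closed: "trans e e' l \<in> carrier R"
 unfolding trans_def by (induction l) (auto simp: x_closed)

lemma trans_same: "trans e e l = \<one>"
 unfolding trans_def by (induction l) auto

lemma trans_trans:
 assumes "e \<le> e'" "e' \<le> e''"
 shows "trans e' e'' l \<otimes> trans e e' l = trans e e'' l"
proof (induction l)
 case (Cons j l)
 have "p ^ e \<le> p ^ e'" "p ^ e' \<le> p ^ e''" using assms p_pos by (auto intro!: power_increasing)
 then have "(p ^ e'' - p ^ e') + (p ^ e' - p ^ e) = p ^ e'' - p ^ e" by simp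
 then have e: "x j [^] (p ^ e'' - p ^ e) = x j [^] (p ^ e'' - p ^ e') \<otimes> x j [^] (p ^ e' - p ^ e)"
  using nat_pow_mult[OF x_closed, of j "p ^ e'' - p ^ e'" "p ^ e' - p ^ e"] by simp
 have c: "trans e e' l \<in> carrier R" "trans e' e'' l \<in> carrier R" "trans e e'' l \<in> carrier R" by (rule trans_closed)+
 have "trans e e'' (j # l) = x j [^] (p ^ e'' - p ^ e) \<otimes> trans e e'' l" by (simp add: trans_def)
 also have "\<dots> = (x j [^] (p ^ e'' - p ^ e') \<otimes> x j [^] (p ^ e' - p ^ e)) \<otimes> (trans e' e'' l \<otimes> trans e e' l)"
  unfolding e Cons.IH ..
 also have "\<dots> = (x j [^] (p ^ e'' - p ^ e') \<otimes> trans e' e'' l) \<otimes> (x j [^] (p ^ e' - p ^ e) \<otimes> trans e e' l)"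
  using c x_closed[of j] by (simp add: m_ac)
 finally show ?case by (simp add: trans_def)
qed (simp add: trans_def)

lemma trans_smult_trans:
 assumes "module R M" "e \<le> e'" "e' \<le> e''" "a \<in> carrier M"
 shows "trans e' e'' l \<odot>.M (trans e e' l \<odot>.M a) = trans e e'' l \<odot>.M a"
proof -
 interpret module R M by fact
 show ?thesis using assms(4) by (simp add: smult_assoc1[symmetric] trans_closed trans_trans[OF assms(2,3)])
qed

abbreviation D :: "('a, 'm, 'y) module_scheme => nat => nat list => (nat list => 'm) => 'm" where
 "D M e \<equiv> cobd M (ypow e)"

lemma cobd_trans:
 assumes M: "module R M" and e: "e \<le> e'" and l: "l \<in> idx t n"
  and c: "!!l. l \<in> pred_idx t n ==> c l \<in> carrier M"
 shows "D M e' l (\<lambda>m. trans e e' m \<odot>.M c m) = trans e e' l \<odot>.M D M e l c"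
proof -
 interpret module R M by fact
 have "p ^ e' = (p ^ e' - p ^ e) + p ^ e" using e p_pos by (simp add: power_increasing)
 then have "ypow e' j = x j [^] (p ^ e' - p ^ e) \<otimes> ypow e j" for j
  using nat_pow_mult[OF x_closed, of j "p ^ e' - p ^ e" "p ^ e"] by (simp add: ypow_def frob_def)
 then have "ypow e' = (\<lambda>j. x j [^] (p ^ e' - p ^ e) \<otimes> ypow e j)" by (rule ext)
 then show ?thesis
  using cobd_transition[OF ypow_closed[of e], of "\<lambda>j. x j [^] (p ^ e' - p ^ e)" l t n c] l c x_closed
  by (simp add: trans_def)
qed

text \<open>The values are confined to a subset Y, while the differential is computed in M. Syzygies
  of a resolution can thus be used as Y without becoming modules of their own.\<close>

definition cocycles :: "('a, 'm, 'y) module_scheme => 'm set => nat => nat => (nat list => 'm) set" where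
 "cocycles M Y n e = {c. (\<forall>l\<in>idx t n. c l \<in> Y) \<and> (\<forall>l\<in>idx t (Suc n). D M e l c = \<zero>.M)}"

definition coboundaries :: "('a, 'm, 'y) module_scheme => 'm set => nat => nat => (nat list => 'm) set" where
 "coboundaries M Y n e = {c. \<exists>b. (\<forall>l\<in>pred_idx t n. b l \<in> Y) \<and> (\<forall>l\<in>idx t n. c l = D M e l b)}"

text \<open>Induction over the generators. Let c' be the corrected cocycle and let g l be c' (s # l)
  divided by x_s^(p^e), up to a power of x_s. The cocycle condition at s # l expresses x_s^(p^e) c'
  l as the differential of m \<mapsto> c' (s # m), so c' - D g is killed by a power of x_s. As g is
  annihilated by whatever annihilates c' (s # _), the earlier generators keep their killing
  powers.\<close>

lemma cocycle_killed:
 fixes M :: "('a, 'm) module"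
 assumes inj: "injective_module R M" and c: "c \<in> cocycles M (carrier M) (Suc n) e"
 shows "s \<le> t ==> \<exists>b q. (\<forall>l\<in>idx t n. b l \<in> carrier M) \<and>
  (\<forall>l\<in>idx t (Suc n). \<forall>j<s. (x j [^] (q::nat)) \<odot>.M (c l \<ominus>.M D M e l b) = \<zero>.M)"
proof (induction s)
 case 0
 interpret module R M using inj by (simp add: injective_module_def)
 show ?case by (intro exI[of _ "\<lambda>_. \<zero>.M"]) simp
next
 case (Suc s)
 interpret module R M using inj by (simp add: injective_module_def)
 obtain b q where bq: "\<forall>l\<in>idx t n. b l \<in> carrier M"
  "\<forall>l\<in>idx t (Suc n). \<forall>j<s. (x j [^] (q::nat)) \<odot>.M (c l \<ominus>.M D M e l b) = \<zero>.M"
  using Suc.IH[OF Suc_leD[OF Suc.prems]] by (elim exE conjE)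
 then have b: "!!l. l \<in> idx t n ==> b l \<in> carrier M"
  and q: "!!l j. l \<in> idx t (Suc n) ==> j < s ==> (x j [^] q) \<odot>.M (c l \<ominus>.M D M e l b) = \<zero>.M"
  by simp_all
 have cc: "!!l. l \<in> idx t (Suc n) ==> c l \<in> carrier M"
  and Dc: "!!l. l \<in> idx t (Suc (Suc n)) ==> D M e l c = \<zero>.M"
  using c by (auto simp: cocycles_def)
 have Db: "D M e l b \<in> carrier M" if "l \<in> idx t (Suc n)" for l
  by (rule cobd_closed[OF ypow_closed that]) (simp add: b)
 define c' where "c' l = c l \<ominus>.M D M e l b" for l
 have c': "c' l \<in> carrier M" if "l \<in> idx t (Suc n)" for l using cc Db that by (simp add: c'_def)
 have Dc': "D M e l c' = \<zero>.M" if l: "l \<in> idx t (Suc (Suc n))" for l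
 proof -
  have "D M e l c' = D M e l c \<ominus>.M D M e l (\<lambda>l. D M e l b)"
   unfolding c'_def by (rule cobd_minus[OF ypow_closed l]) (simp_all add: cc Db)
  then show ?thesis using Dc[OF l] cobd_cobd[OF ypow_closed l, of b] b by (simp add: a_minus_def)
 qed
 define q0 where "q0 = p ^ e"
 have ys: "ypow e s = x s [^] q0" by (simp add: ypow_def frob_def q0_def)
 have sl: "s # l \<in> idx t (Suc n)" if "l \<in> idx t n" for l using that Suc.prems by (simp add: idx_Cons)
 have xc: "x j [^] (i::nat) \<in> carrier R" for i j using x_closed by simp
 have *: "\<forall>l\<in>idx t n. \<exists>b k. b \<in> carrier M \<and> (x s [^] (k + q0)) \<odot>.M b = (x s [^] k) \<odot>.M c' (s # l) \<and>
  (\<forall>r\<in>carrier R. r \<odot>.M c' (s # l) = \<zero>.M --> r \<odot>.M b = \<zero>.M)"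
  using injective_division[OF noeth inj c' x_closed, OF sl] by blast
 obtain g k0 where g: "!!l. l \<in> idx t n ==> g l \<in> carrier M"
  and gk: "!!l. l \<in> idx t n ==> (x s [^] (k0 l + q0)) \<odot>.M g l = (x s [^] (k0 l :: nat)) \<odot>.M c' (s # l)"
  and gann: "!!l r. l \<in> idx t n ==> r \<in> carrier R ==> r \<odot>.M c' (s # l) = \<zero>.M ==> r \<odot>.M g l = \<zero>.M"
  using bchoice[OF *] unfolding Ball_def by metis
 \<comment> \<open>One exponent for all of the finitely many index lists.\<close>
 define k where "k = Max (k0 ` idx t n)"
 have xs_g: "(x s [^] (k + q0)) \<odot>.M g l = (x s [^] k) \<odot>.M c' (s # l)" if l: "l \<in> idx t n" for l
 proof -
  have "k0 l \<le> k" unfolding k_def using l finite_idx by auto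
  then obtain d where d: "k = d + k0 l" by (metis add.commute le_Suc_ex)
  have "(x s [^] (k + q0)) \<odot>.M g l = x s [^] d \<odot>.M ((x s [^] (k0 l + q0)) \<odot>.M g l)"
   using g[OF l] xc x_closed by (simp add: d smult_assoc1[symmetric] nat_pow_mult add.assoc)
  also have "\<dots> = (x s [^] k) \<odot>.M c' (s # l)"
   unfolding gk[OF l] using c'[OF sl[OF l]] xc x_closed by (simp add: d smult_assoc1[symmetric] nat_pow_mult)
  finally show ?thesis .
 qed
 have Dg: "D M e l g \<in> carrier M" if "l \<in> idx t (Suc n)" for l
  by (rule cobd_closed[OF ypow_closed that]) (simp add: g)
 define q' where "q' = max q (k + q0)"
 have mono: "(x j [^] q') \<odot>.M v = \<zero>.M" if v: "v \<in> carrier M" "i \<le> q'" "(x j [^] i) \<odot>.M v = \<zero>.M" for j i v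
 proof -
  obtain d where "q' = d + i" using v(2) by (metis add.commute le_Suc_ex)
  then have "(x j [^] q') \<odot>.M v = x j [^] d \<odot>.M ((x j [^] i) \<odot>.M v)"
   using v(1) xc x_closed by (simp add: smult_assoc1[symmetric] nat_pow_mult)
  then show ?thesis using v(3) xc by simp
 qed
 show ?case
 proof (intro exI[of _ "\<lambda>l. b l \<oplus>.M g l"] exI[of _ q'] conjI ballI allI impI)
  fix l j assume l: "l \<in> idx t (Suc n)" and j: "j < Suc s"
  have "D M e l (\<lambda>l. b l \<oplus>.M g l) = D M e l b \<oplus>.M D M e l g"
   by (rule cobd_add[OF ypow_closed l]) (simp_all add: b g)
  then have e1: "c l \<ominus>.M D M e l (\<lambda>l. b l \<oplus>.M g l) = c' l \<ominus>.M D M e l g"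
   using Db[OF l] Dg[OF l] cc[OF l] by (simp add: c'_def a_minus_def M.minus_add M.a_ac)
  have vc: "c' l \<ominus>.M D M e l g \<in> carrier M" using c'[OF l] Dg[OF l] by simp
  have *: "r \<odot>.M (c' l \<ominus>.M D M e l g) = r \<odot>.M c' l \<ominus>.M D M e l (\<lambda>m. r \<odot>.M g m)" if r: "r \<in> carrier R" for r
   using c'[OF l] Dg[OF l] r cobd_smult[OF ypow_closed r l, of g] g
   by (simp add: a_minus_def smult_r_distr smult_r_minus)
  show "(x j [^] q') \<odot>.M (c l \<ominus>.M D M e l (\<lambda>l. b l \<oplus>.M g l)) = \<zero>.M"
  proof (cases "j = s")
   case True
   have "x s [^] (k + q0) \<odot>.M c' l = x s [^] k \<odot>.M (ypow e s \<odot>.M c' l)"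
    unfolding ys using c'[OF l] xc x_closed by (simp add: smult_assoc1[symmetric] nat_pow_mult)
   also have "ypow e s \<odot>.M c' l = D M e l (\<lambda>m. c' (s # m))"
   proof -
    have "D M e (s # l) c' = \<zero>.M" by (rule Dc') (use l Suc.prems in \<open>simp add: idx_Cons\<close>)
    moreover have "D M e l (\<lambda>m. c' (s # m)) \<in> carrier M"
     by (rule cobd_closed[OF ypow_closed l]) (simp add: c' sl)
    ultimately show ?thesis using c'[OF l] ypow_closed M.minus_eq_zeroD[of "ypow e s \<odot>.M c' l"] by simp
   qed
   also have "x s [^] k \<odot>.M D M e l (\<lambda>m. c' (s # m)) = D M e l (\<lambda>m. x s [^] k \<odot>.M c' (s # m))"
    by (rule cobd_smult[OF ypow_closed xc l, symmetric]) (simp add: c' sl)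
   also have "\<dots> = D M e l (\<lambda>m. x s [^] (k + q0) \<odot>.M g m)"
    by (rule cobd_cong[OF l]) (simp add: xs_g)
   finally have "x s [^] (k + q0) \<odot>.M (c' l \<ominus>.M D M e l g) = \<zero>.M"
    unfolding *[OF xc] using cobd_closed[OF ypow_closed l, of "\<lambda>m. x s [^] (k + q0) \<odot>.M g m"] g xc
    by (simp add: a_minus_def M.r_neg)
   then show ?thesis unfolding e1 True by (rule mono[OF vc, rotated]) (simp add: q'_def)
  next
   case False
   then have js: "j < s" using j by simp
   have kc: "x j [^] q \<odot>.M c' l = \<zero>.M" if "l \<in> idx t (Suc n)" for l
    using q[OF that js] by (simp add: c'_def)
   have "D M e l (\<lambda>m. x j [^] q \<odot>.M g m) = D M e l (\<lambda>m. \<zero> \<odot>.M g m)"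
    by (rule cobd_cong[OF l]) (simp add: gann[OF _ xc kc[OF sl]] g)
   also have "\<dots> = \<zero>.M" using cobd_smult[of "ypow e" \<zero> l t "Suc n" g] ypow_closed l g Dg[OF l] by simp
   finally have "x j [^] q \<odot>.M (c' l \<ominus>.M D M e l g) = \<zero>.M"
    unfolding *[OF xc] kc[OF l] by (simp add: a_minus_def)
   then show ?thesis unfolding e1 by (rule mono[OF vc, rotated]) (simp add: q'_def)
  qed
 qed (use b g in auto)
qed

text \<open>The error of the preceding lemma is killed by x_j^q for every j < t. In positive degree
  an index list has a first entry j, and the transition factor at this list contains a high power of
  x_j.\<close>

lemma cocycle_eventually_coboundary:
 fixes M :: "('a, 'm) module"
 assumes inj: "injective_module R M" and c: "c \<in> cocycles M (carrier M) (Suc n) e"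
 shows "\<exists>e'\<ge>e. \<exists>b. (\<forall>l\<in>idx t n. b l \<in> carrier M) \<and> (\<forall>l\<in>idx t (Suc n). trans e e' l \<odot>.M c l = D M e' l b)"
proof -
 interpret module R M using inj by (simp add: injective_module_def)
 obtain b q where bq: "\<forall>l\<in>idx t n. b l \<in> carrier M"
  "\<forall>l\<in>idx t (Suc n). \<forall>j<t. (x j [^] (q::nat)) \<odot>.M (c l \<ominus>.M D M e l b) = \<zero>.M"
  using cocycle_killed[OF inj c order_refl] by (elim exE conjE)
 then have b: "!!l. l \<in> idx t n ==> b l \<in> carrier M"
  and q: "!!l j. l \<in> idx t (Suc n) ==> j < t ==> (x j [^] q) \<odot>.M (c l \<ominus>.M D M e l b) = \<zero>.M"
  by simp_all
 have xc: "x j [^] (i::nat) \<in> carrier R" for i j using x_closed by simp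
 \<comment> \<open>From q + 1 <= p^q follows p^e' - p^e >= p^e q >= q, so x_j^(p^e' - p^e) is a
   multiple of x_j^q.\<close>
 define e' where "e' = e + q"
 have "2 ^ q \<le> p ^ q" using prime_ge_2_nat[OF p_prime] by (simp add: power_mono)
 then have "Suc q \<le> p ^ q" using less_exp[of q] by linarith
 then have "p ^ e * Suc q \<le> p ^ e'" by (simp only: e'_def power_add mult_le_mono2)
 moreover have "q \<le> p ^ e * q" using p_pos by simp
 ultimately have "p ^ e + q \<le> p ^ e'" by (simp only: mult_Suc_right)
 then have qe: "q \<le> p ^ e' - p ^ e" by simp
 have "trans e e' l \<odot>.M c l = D M e' l (\<lambda>m. trans e e' m \<odot>.M b m)" if l: "l \<in> idx t (Suc n)" for l
 proof -
  obtain j m where jm: "l = j # m" "j < t" using l by (rule idx_SucE)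
  have cl: "c l \<in> carrier M" using c l by (simp add: cocycles_def)
  have Db: "D M e l b \<in> carrier M" by (rule cobd_closed[OF ypow_closed l]) (simp add: b)
  define d where "d = (p ^ e' - p ^ e) - q"
  have "trans e e' l = (x j [^] d \<otimes> x j [^] q) \<otimes> trans e e' m"
   using nat_pow_mult[OF x_closed, of j d q] qe by (simp add: jm(1) trans_def d_def del: diff_diff_left)
  then have "trans e e' l = (trans e e' m \<otimes> x j [^] d) \<otimes> x j [^] q"
   using trans_closed xc by (simp add: m_ac)
  then have "trans e e' l \<odot>.M (c l \<ominus>.M D M e l b) = (trans e e' m \<otimes> x j [^] d) \<odot>.M (x j [^] q \<odot>.M (c l \<ominus>.M D M e l b))"
   using cl Db trans_closed xc by (simp add: smult_assoc1)
  also have "\<dots> = \<zero>.M" unfolding q[OF l jm(2)] using trans_closed xc by simp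
  finally have "trans e e' l \<odot>.M c l = trans e e' l \<odot>.M D M e l b"
   using cl Db trans_closed M.minus_eq_zeroD[of "trans e e' l \<odot>.M c l"]
   by (simp add: a_minus_def smult_r_distr smult_r_minus)
  also have "\<dots> = D M e' l (\<lambda>m. trans e e' m \<odot>.M b m)"
   by (rule cobd_trans[OF module_axioms _ l, symmetric]) (simp_all add: e'_def b)
  finally show ?thesis .
 qed
 moreover have "\<forall>l\<in>idx t n. trans e e' l \<odot>.M b l \<in> carrier M" using b trans_closed by simp
 moreover have "e \<le> e'" by (simp add: e'_def)
 ultimately show ?thesis by (intro exI[of _ e'] conjI exI[of _ "\<lambda>m. trans e e' m \<odot>.M b m"]) auto
qed

end

section \<open>Dimension shifting along an injective resolution\<close>

context cech
begin

text \<open>The cochains over d A that become trivial under the connecting map of 0 \<rightarrow>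
  ker d \<rightarrow> A \<rightarrow> d A \<rightarrow> 0: images of cocycles of A, up to boundaries
  over d A.\<close>

definition shift_boundaries ::
 "('a, 'm, 'y) module_scheme => ('a, 'n, 'z) module_scheme => ('m => 'n) => nat => nat => (nat list => 'n) set" where
 "shift_boundaries A A' d n e = {c. \<exists>a b. a \<in> cocycles A (carrier A) n e \<and>
   (\<forall>l\<in>pred_idx t n. b l \<in> d ` carrier A) \<and> (\<forall>l\<in>idx t n. c l = d (a l) \<oplus>.A' D A' e l b)}"

text \<open>The connecting isomorphism on colimits. A cocycle c of degree n + 1 with values in K =
  ker d becomes, as a cochain over the injective A, a coboundary D b at a later level; then d b is a
  cocycle of degree n over d A, and it represents the same class w.\<close>

lemma colim_pres_shift:
 fixes A :: "('a, 'm) module" and A' :: "('a, 'n) module" and N :: "('a, 'w) module"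
 assumes inj: "injective_module R A" and A': "module R A'" and d: "d \<in> mod_hom R A A'"
  and pres: "colim_pres R A' N trans (cocycles A' (d ` carrier A) n) (shift_boundaries A A' d n) W V \<rho>"
 defines "K \<equiv> {u \<in> carrier A. d u = \<zero>.A'}"
 shows "\<exists>\<rho>'. colim_pres R A N trans (cocycles A K (Suc n)) (coboundaries A K (Suc n)) W V \<rho>'"
proof -
 have A: "module R A" using inj by (simp add: injective_module_def)
 interpret A: module R A by fact
 interpret A': module R A' by fact
 note P = colim_presD[OF pres]
 note dc = mod_homD(1)[OF d] note da = mod_homD(2)[OF d] note ds = mod_homD(3)[OF d]
 have tc: "trans e f l \<in> carrier R" for e f l by (rule trans_closed)
 note yc = ypow_closed
 have Dd: "d (D A e l b) = D A' e l (\<lambda>m. d (b m))"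
  if "l \<in> idx t k" "!!m. m \<in> pred_idx t k ==> b m \<in> carrier A" for e l k b
  by (rule A.cobd_hom[OF yc A' d that])
 \<comment> \<open>The bounding cochain b exists only at some level f beyond e, so f is part of the
   data; c0 is d b and stands for w at that level.\<close>
 define wit where "wit e c f b c0 w \<longleftrightarrow> e \<le> f \<and> (\<forall>l\<in>idx t n. b l \<in> carrier A) \<and>
  (\<forall>l\<in>idx t (Suc n). trans e f l \<odot>.A c l = D A f l b) \<and> \<rho> f c0 w \<and> (\<forall>l\<in>idx t n. d (b l) = c0 l)"
  for e c f b c0 w
 have witI: "wit e c f b c0 w" if "e \<le> f" "!!l. l \<in> idx t n ==> b l \<in> carrier A"
  "!!l. l \<in> idx t (Suc n) ==> trans e f l \<odot>.A c l = D A f l b" "\<rho> f c0 w" "!!l. l \<in> idx t n ==> d (b l) = c0 l"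
  for e c f b c0 w using that by (simp add: wit_def)
 have wit1: "e \<le> f" and wit2: "!!l. l \<in> idx t n ==> b l \<in> carrier A"
  and wit3: "!!l. l \<in> idx t (Suc n) ==> trans e f l \<odot>.A c l = D A f l b" and wit4: "\<rho> f c0 w"
  and wit5: "!!l. l \<in> idx t n ==> d (b l) = c0 l" if "wit e c f b c0 w" for e c f b c0 w
  using that by (simp_all add: wit_def)
 have Zc: "c l \<in> carrier A" and Zd: "d (c l) = \<zero>.A'" if "c \<in> cocycles A K (Suc n) e" "l \<in> idx t (Suc n)" for c e l
  using that by (auto simp: cocycles_def K_def)
 have ZD: "D A e l c = \<zero>.A" if "c \<in> cocycles A K (Suc n) e" "l \<in> idx t (Suc (Suc n))" for c e l
  using that by (auto simp: cocycles_def)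
 have ZI: "c \<in> cocycles A K (Suc n) e" if "!!l. l \<in> idx t (Suc n) ==> c l \<in> carrier A"
  "!!l. l \<in> idx t (Suc n) ==> d (c l) = \<zero>.A'" "!!l. l \<in> idx t (Suc (Suc n)) ==> D A e l c = \<zero>.A" for c e
  using that by (auto simp: cocycles_def K_def)
 \<comment> \<open>Witnesses can be moved to later levels. This provides a common level for adding
   two of them and for comparing with a given transition.\<close>
 have raise: "wit e c g (\<lambda>l. trans f g l \<odot>.A b l) (\<lambda>l. trans f g l \<odot>.A' c0 l) w"
  if c: "c \<in> cocycles A K (Suc n) e" and w: "wit e c f b c0 w" and g: "f \<le> g" for e c f b c0 w g
 proof (rule witI)
  show "e \<le> g" using wit1[OF w] g by simp
  show "trans f g l \<odot>.A b l \<in> carrier A" if "l \<in> idx t n" for l using wit2[OF w that] tc by simp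
  show "trans e g l \<odot>.A c l = D A g l (\<lambda>l. trans f g l \<odot>.A b l)" if l: "l \<in> idx t (Suc n)" for l
  proof -
   have "D A g l (\<lambda>l. trans f g l \<odot>.A b l) = trans f g l \<odot>.A D A f l b"
    by (rule cobd_trans[OF A g l]) (simp add: wit2[OF w])
   also have "\<dots> = trans e g l \<odot>.A c l"
    unfolding wit3[OF w l, symmetric] by (rule trans_smult_trans[OF A wit1[OF w] g Zc[OF c l]])
   finally show ?thesis ..
  qed
  show "\<rho> g (\<lambda>l. trans f g l \<odot>.A' c0 l) w" by (rule P(7)[OF g wit4[OF w]])
  show "d (trans f g l \<odot>.A b l) = trans f g l \<odot>.A' c0 l" if "l \<in> idx t n" for l
   using wit2[OF w that] wit5[OF w that] ds tc by simp
 qed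
 define \<rho>' where "\<rho>' e c w \<longleftrightarrow> c \<in> cocycles A K (Suc n) e \<and> (\<exists>f b c0. wit e c f b c0 w)" for e c w
 have rhoI: "\<rho>' e c w" if "c \<in> cocycles A K (Suc n) e" "wit e c f b c0 w" for e c w f b c0
  using that unfolding \<rho>'_def by iprover
 have rhoZ: "c \<in> cocycles A K (Suc n) e" if "\<rho>' e c w" for e c w using that by (simp add: \<rho>'_def)
 have rhoE: "\<exists>f b c0. f0 \<le> f \<and> wit e c f b c0 w" if r: "\<rho>' e c w" for e c w f0
 proof -
  obtain f b c0 where w: "wit e c f b c0 w" using r unfolding \<rho>'_def by iprover
  have "wit e c (max f f0) (\<lambda>l. trans f (max f f0) l \<odot>.A b l) (\<lambda>l. trans f (max f f0) l \<odot>.A' c0 l) w"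
   by (rule raise[OF rhoZ[OF r] w max.cobounded1])
  moreover have "f0 \<le> max f f0" by simp
  ultimately show ?thesis by iprover
 qed
 have "colim_pres R A N trans (cocycles A K (Suc n)) (coboundaries A K (Suc n)) W V \<rho>'"
 proof (rule colim_presI)
  fix e c w assume r: "\<rho>' e c w"
  show "c \<in> cocycles A K (Suc n) e" by (rule rhoZ[OF r])
  obtain f b c0 where w: "wit e c f b c0 w" using rhoE[OF r] by iprover
  show "w \<in> W" by (rule P(2)[OF wit4[OF w]])
 next
  fix e c assume c: "c \<in> cocycles A K (Suc n) e"
  have "c \<in> cocycles A (carrier A) (Suc n) e" using c by (auto simp: cocycles_def K_def)
  from cocycle_eventually_coboundary[OF inj this] obtain f b where f: "e \<le> f"
   and b: "\<forall>l\<in>idx t n. b l \<in> carrier A" and cb: "\<forall>l\<in>idx t (Suc n). trans e f l \<odot>.A c l = D A f l b"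
   by (elim exE conjE)
  have "D A' f l (\<lambda>m. d (b m)) = \<zero>.A'" if l: "l \<in> idx t (Suc n)" for l
  proof -
   have "D A' f l (\<lambda>m. d (b m)) = d (D A f l b)" by (rule Dd[OF l, symmetric]) (use b in simp)
   also have "\<dots> = d (trans e f l \<odot>.A c l)" using cb l by simp
   finally show ?thesis using Zc[OF c l] Zd[OF c l] ds tc by simp
  qed
  then have "(\<lambda>l. d (b l)) \<in> cocycles A' (d ` carrier A) n f" using b by (simp add: cocycles_def)
  from P(3)[OF this] obtain w where "\<rho> f (\<lambda>l. d (b l)) w" ..
  with f b cb have "wit e c f b (\<lambda>l. d (b l)) w" by (simp add: wit_def)
  then show "\<exists>w. \<rho>' e c w" using rhoI[OF c] by iprover
 next
  fix w assume "w \<in> W"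
  from P(4)[OF this] obtain e c0 where r: "\<rho> e c0 w" by (elim exE)
  have c0: "c0 \<in> cocycles A' (d ` carrier A) n e" by (rule P(1)[OF r])
  then have "\<forall>l\<in>idx t n. \<exists>b. b \<in> carrier A \<and> d b = c0 l" by (simp add: cocycles_def image_iff Bex_def eq_commute)
  from bchoice[OF this] obtain b where b: "!!l. l \<in> idx t n ==> b l \<in> carrier A" "!!l. l \<in> idx t n ==> d (b l) = c0 l"
   by auto
  \<comment> \<open>The inverse direction of the connecting map: c0 lifts to b over A, and D b has
    values in K since c0 is a cocycle.\<close>
  have "(\<lambda>l. D A e l b) \<in> cocycles A K (Suc n) e"
  proof (rule ZI)
   fix l assume l: "l \<in> idx t (Suc n)"
   show "D A e l b \<in> carrier A" by (rule A.cobd_closed[OF yc l]) (simp add: b)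
   have "d (D A e l b) = D A' e l (\<lambda>m. d (b m))" by (rule Dd[OF l]) (simp add: b)
   also have "\<dots> = D A' e l c0" by (rule A'.cobd_cong[OF l]) (simp add: b)
   also have "\<dots> = \<zero>.A'" using c0 l by (simp add: cocycles_def)
   finally show "d (D A e l b) = \<zero>.A'" .
  next
   fix l assume l: "l \<in> idx t (Suc (Suc n))"
   show "D A e l (\<lambda>l. D A e l b) = \<zero>.A" by (rule A.cobd_cobd[OF yc l]) (simp add: b)
  qed
  moreover have "wit e (\<lambda>l. D A e l b) e b c0 w"
  proof (rule witI)
   fix l assume l: "l \<in> idx t (Suc n)"
   have "D A e l b \<in> carrier A" by (rule A.cobd_closed[OF yc l]) (simp add: b)
   then show "trans e e l \<odot>.A D A e l b = D A e l b" by (simp add: trans_same)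
  qed (use b r in simp_all)
  ultimately have "\<rho>' e (\<lambda>l. D A e l b) w" by (rule rhoI)
  then show "\<exists>e c. \<rho>' e c w" by iprover
 next
  fix e c1 w1 c2 w2 assume r1: "\<rho>' e c1 w1" and r2: "\<rho>' e c2 w2"
  obtain f1 b1 a1 where w1: "wit e c1 f1 b1 a1 w1" using rhoE[OF r1] by iprover
  obtain f b2 a2 where f: "f1 \<le> f" and w2: "wit e c2 f b2 a2 w2" using rhoE[OF r2] by iprover
  obtain b1 a1 where w1: "wit e c1 f b1 a1 w1" using raise[OF rhoZ[OF r1] w1 f] by iprover
  note c1 = rhoZ[OF r1] note c2 = rhoZ[OF r2]
  have "(\<lambda>l. c1 l \<oplus>.A c2 l) \<in> cocycles A K (Suc n) e"
  proof (rule ZI)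
   fix l assume l: "l \<in> idx t (Suc n)"
   show "c1 l \<oplus>.A c2 l \<in> carrier A" "d (c1 l \<oplus>.A c2 l) = \<zero>.A'"
    using Zc[OF c1 l] Zc[OF c2 l] Zd[OF c1 l] Zd[OF c2 l] da by simp_all
  next
   fix l assume l: "l \<in> idx t (Suc (Suc n))"
   have "D A e l (\<lambda>l. c1 l \<oplus>.A c2 l) = D A e l c1 \<oplus>.A D A e l c2"
    by (rule A.cobd_add[OF yc l]) (simp_all add: Zc[OF c1] Zc[OF c2])
   then show "D A e l (\<lambda>l. c1 l \<oplus>.A c2 l) = \<zero>.A" using ZD[OF c1 l] ZD[OF c2 l] by simp
  qed
  moreover have "wit e (\<lambda>l. c1 l \<oplus>.A c2 l) f (\<lambda>l. b1 l \<oplus>.A b2 l) (\<lambda>l. a1 l \<oplus>.A' a2 l) (w1 \<oplus>.N w2)"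
  proof (rule witI)
   show "e \<le> f" by (rule wit1[OF w1])
   show "\<rho> f (\<lambda>l. a1 l \<oplus>.A' a2 l) (w1 \<oplus>.N w2)" by (rule P(5)[OF wit4[OF w1] wit4[OF w2]])
   fix l assume l: "l \<in> idx t n"
   show "b1 l \<oplus>.A b2 l \<in> carrier A" "d (b1 l \<oplus>.A b2 l) = a1 l \<oplus>.A' a2 l"
    using wit2[OF w1 l] wit2[OF w2 l] wit5[OF w1 l] wit5[OF w2 l] da by simp_all
  next
   fix l assume l: "l \<in> idx t (Suc n)"
   have "D A f l (\<lambda>l. b1 l \<oplus>.A b2 l) = D A f l b1 \<oplus>.A D A f l b2"
    by (rule A.cobd_add[OF yc l]) (simp_all add: wit2[OF w1] wit2[OF w2])
   then show "trans e f l \<odot>.A (c1 l \<oplus>.A c2 l) = D A f l (\<lambda>l. b1 l \<oplus>.A b2 l)"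
    using wit3[OF w1 l] wit3[OF w2 l] Zc[OF c1 l] Zc[OF c2 l] tc by (simp add: A.smult_r_distr)
  qed
  ultimately show "\<rho>' e (\<lambda>l. c1 l \<oplus>.A c2 l) (w1 \<oplus>.N w2)" by (rule rhoI)
 next
  fix e c w r assume q: "r \<in> carrier R" and r: "\<rho>' e c w"
  obtain f b a where w: "wit e c f b a w" using rhoE[OF r] by iprover
  note c = rhoZ[OF r]
  have "(\<lambda>l. r \<odot>.A c l) \<in> cocycles A K (Suc n) e"
  proof (rule ZI)
   fix l assume l: "l \<in> idx t (Suc n)"
   show "r \<odot>.A c l \<in> carrier A" "d (r \<odot>.A c l) = \<zero>.A'"
    using Zc[OF c l] Zd[OF c l] ds q by simp_all
  next
   fix l assume l: "l \<in> idx t (Suc (Suc n))"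
   have "D A e l (\<lambda>l. r \<odot>.A c l) = r \<odot>.A D A e l c"
    by (rule A.cobd_smult[OF yc q l]) (simp_all add: Zc[OF c])
   then show "D A e l (\<lambda>l. r \<odot>.A c l) = \<zero>.A" using ZD[OF c l] q by simp
  qed
  moreover have "wit e (\<lambda>l. r \<odot>.A c l) f (\<lambda>l. r \<odot>.A b l) (\<lambda>l. r \<odot>.A' a l) (r \<odot>.N w)"
  proof (rule witI)
   show "e \<le> f" by (rule wit1[OF w])
   show "\<rho> f (\<lambda>l. r \<odot>.A' a l) (r \<odot>.N w)" by (rule P(6)[OF q wit4[OF w]])
   fix l assume l: "l \<in> idx t n"
   show "r \<odot>.A b l \<in> carrier A" "d (r \<odot>.A b l) = r \<odot>.A' a l"
    using wit2[OF w l] wit5[OF w l] ds q by simp_all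
  next
   fix l assume l: "l \<in> idx t (Suc n)"
   have "D A f l (\<lambda>l. r \<odot>.A b l) = r \<odot>.A (trans e f l \<odot>.A c l)"
    unfolding wit3[OF w l] by (rule A.cobd_smult[OF yc q l]) (simp_all add: wit2[OF w])
   then show "trans e f l \<odot>.A (r \<odot>.A c l) = D A f l (\<lambda>l. r \<odot>.A b l)"
    using Zc[OF c l] tc[of e f l] q by (simp add: A.smult_assoc1[symmetric] m_comm)
  qed
  ultimately show "\<rho>' e (\<lambda>l. r \<odot>.A c l) (r \<odot>.N w)" by (rule rhoI)
 next
  fix e e' c w assume e: "e \<le> e'" and r: "\<rho>' e c w"
  obtain f b a where f: "e' \<le> f" and w: "wit e c f b a w" using rhoE[OF r] by iprover
  note c = rhoZ[OF r]
  have "(\<lambda>l. trans e e' l \<odot>.A c l) \<in> cocycles A K (Suc n) e'"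
  proof (rule ZI)
   fix l assume l: "l \<in> idx t (Suc n)"
   show "trans e e' l \<odot>.A c l \<in> carrier A" "d (trans e e' l \<odot>.A c l) = \<zero>.A'"
    using Zc[OF c l] Zd[OF c l] ds tc by simp_all
  next
   fix l assume l: "l \<in> idx t (Suc (Suc n))"
   have "D A e' l (\<lambda>l. trans e e' l \<odot>.A c l) = trans e e' l \<odot>.A D A e l c"
    by (rule cobd_trans[OF A e l]) (simp_all add: Zc[OF c])
   then show "D A e' l (\<lambda>l. trans e e' l \<odot>.A c l) = \<zero>.A" using ZD[OF c l] tc by simp
  qed
  moreover have "wit e' (\<lambda>l. trans e e' l \<odot>.A c l) f b a w"
  proof (rule witI)
   fix l assume l: "l \<in> idx t (Suc n)"
   show "trans e' f l \<odot>.A (trans e e' l \<odot>.A c l) = D A f l b"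
    unfolding wit3[OF w l, symmetric] by (rule trans_smult_trans[OF A e f Zc[OF c l]])
  qed (use f wit2[OF w] wit4[OF w] wit5[OF w] in simp_all)
  ultimately show "\<rho>' e' (\<lambda>l. trans e e' l \<odot>.A c l) w" by (rule rhoI)
 next
  fix e c w assume r: "\<rho>' e c w" and wV: "w \<in> V"
  obtain f b c0 where w: "wit e c f b c0 w" using rhoE[OF r] by iprover
  note c = rhoZ[OF r]
  from P(8)[OF wit4[OF w]] wV obtain g where g: "f \<le> g"
   and *: "(\<lambda>l. trans f g l \<odot>.A' c0 l) \<in> shift_boundaries A A' d n g" by auto
  define bg where "bg l = trans f g l \<odot>.A b l" for l
  define cg where "cg l = trans f g l \<odot>.A' c0 l" for l
  have wg: "wit e c g bg cg w" unfolding bg_def cg_def by (rule raise[OF c w g])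
  from * obtain a h' where a: "a \<in> cocycles A (carrier A) n g"
   and h': "\<forall>l\<in>pred_idx t n. h' l \<in> d ` carrier A"
   and ch: "\<forall>l\<in>idx t n. trans f g l \<odot>.A' c0 l = d (a l) \<oplus>.A' D A' g l h'"
   unfolding shift_boundaries_def by (elim CollectE exE conjE)
  from h' have "\<forall>l\<in>pred_idx t n. \<exists>h. h \<in> carrier A \<and> d h = h' l" by (simp add: image_iff Bex_def eq_commute)
  from bchoice[OF this] obtain h where h: "!!l. l \<in> pred_idx t n ==> h l \<in> carrier A"
   "!!l. l \<in> pred_idx t n ==> d (h l) = h' l" by auto
  have ac: "a l \<in> carrier A" if "l \<in> idx t n" for l using a that by (simp add: cocycles_def)
  have Dh: "D A g l h \<in> carrier A" if "l \<in> idx t n" for l by (rule A.cobd_closed[OF yc that]) (simp add: h)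
  have dDh: "d (D A g l h) = D A' g l h'" if l: "l \<in> idx t n" for l
  proof -
   have "d (D A g l h) = D A' g l (\<lambda>m. d (h m))" by (rule Dd[OF l]) (simp add: h)
   also have "\<dots> = D A' g l h'" by (rule A'.cobd_cong[OF l]) (simp add: h)
   finally show ?thesis .
  qed
  \<comment> \<open>A cocycle of A with the same image under d as the bounding cochain bg. The
    difference of bg and v therefore has values in K, and it has the same coboundary as bg.\<close>
  define v where "v l = a l \<oplus>.A D A g l h" for l
  have vc: "v l \<in> carrier A" and dv: "d (v l) = d (bg l)" if l: "l \<in> idx t n" for l
  proof -
   show "v l \<in> carrier A" using ac[OF l] Dh[OF l] by (simp add: v_def)
   have "d (bg l) = trans f g l \<odot>.A' c0 l" using wit5[OF wg l] by (simp add: cg_def)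
   then show "d (v l) = d (bg l)" using ac[OF l] Dh[OF l] dDh[OF l] ch l da by (simp add: v_def)
  qed
  have Dv: "D A g l v = \<zero>.A" if l: "l \<in> idx t (Suc n)" for l
  proof -
   have "D A g l v = D A g l a \<oplus>.A D A g l (\<lambda>m. D A g m h)"
    unfolding v_def by (rule A.cobd_add[OF yc l]) (simp_all add: ac Dh)
   moreover have "D A g l (\<lambda>m. D A g m h) = \<zero>.A" by (rule A.cobd_cobd[OF yc l]) (simp add: h)
   moreover have "D A g l a = \<zero>.A" using a l by (simp add: cocycles_def)
   ultimately show ?thesis by simp
  qed
  have "(\<lambda>l. trans e g l \<odot>.A c l) \<in> coboundaries A K (Suc n) g"
   unfolding coboundaries_def pred_idx_Suc
  proof (intro CollectI exI[of _ "\<lambda>l. bg l \<ominus>.A v l"] conjI ballI)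
   fix l assume l: "l \<in> idx t n"
   show "bg l \<ominus>.A v l \<in> K"
    using wit2[OF wg l] vc[OF l] dv[OF l] mod_hom_minus[OF d A A'] dc by (simp add: K_def a_minus_def A'.M.r_neg)
  next
   fix l assume l: "l \<in> idx t (Suc n)"
   have "D A g l (\<lambda>l. bg l \<ominus>.A v l) = D A g l bg \<ominus>.A D A g l v"
    by (rule A.cobd_minus[OF yc l]) (simp_all add: wit2[OF wg] vc)
   then show "trans e g l \<odot>.A c l = D A g l (\<lambda>l. bg l \<ominus>.A v l)"
    using wit3[OF wg l] Dv[OF l] A.smult_closed[OF tc Zc[OF c l], of e g l] by (simp add: a_minus_def)
  qed
  then show "\<exists>g\<ge>e. (\<lambda>l. trans e g l \<odot>.A c l) \<in> coboundaries A K (Suc n) g" using wit1[OF wg] by iprover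
 next
  fix e e' c w assume r: "\<rho>' e c w" and e: "e \<le> e'"
   and B: "(\<lambda>l. trans e e' l \<odot>.A c l) \<in> coboundaries A K (Suc n) e'"
  note c = rhoZ[OF r]
  obtain m where m: "\<forall>l\<in>idx t n. m l \<in> K" and cm: "\<forall>l\<in>idx t (Suc n). trans e e' l \<odot>.A c l = D A e' l m"
   using B unfolding coboundaries_def pred_idx_Suc by (elim CollectE exE conjE)
  have mA: "m l \<in> carrier A" and dm: "d (m l) = \<zero>.A'" if "l \<in> idx t n" for l using m that by (auto simp: K_def)
  obtain f b c0 where f: "e' \<le> f" and w: "wit e c f b c0 w" using rhoE[OF r] by iprover
  \<comment> \<open>Both b and the pushed m bound the pushed c at level f, so their difference is a
    cocycle of A; d kills m, so its image is still c0.\<close>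
  define a where "a l = b l \<ominus>.A trans e' f l \<odot>.A m l" for l
  have ac: "a l \<in> carrier A" if "l \<in> idx t n" for l using wit2[OF w that] mA[OF that] tc by (simp add: a_def)
  have "a \<in> cocycles A (carrier A) n f"
   unfolding cocycles_def
  proof (intro CollectI conjI ballI)
   fix l assume l: "l \<in> idx t (Suc n)"
   have "D A f l a = D A f l b \<ominus>.A D A f l (\<lambda>l. trans e' f l \<odot>.A m l)"
    unfolding a_def by (rule A.cobd_minus[OF yc l]) (simp_all add: wit2[OF w] mA tc)
   also have "D A f l (\<lambda>l. trans e' f l \<odot>.A m l) = trans e' f l \<odot>.A D A e' l m"
    by (rule cobd_trans[OF A f l]) (simp add: mA)
   also have "\<dots> = trans e' f l \<odot>.A (trans e e' l \<odot>.A c l)" using cm l by simp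
   also have "\<dots> = trans e f l \<odot>.A c l" by (rule trans_smult_trans[OF A e f Zc[OF c l]])
   also have "D A f l b = trans e f l \<odot>.A c l" by (rule wit3[OF w l, symmetric])
   finally show "D A f l a = \<zero>.A" using Zc[OF c l] tc by (simp add: a_minus_def A.M.r_neg)
  qed (rule ac)
  have "(\<lambda>l. trans f f l \<odot>.A' c0 l) \<in> shift_boundaries A A' d n f"
   unfolding shift_boundaries_def
  proof (intro CollectI exI[of _ a] exI[of _ "\<lambda>_. \<zero>.A'"] conjI ballI)
   show "a \<in> cocycles A (carrier A) n f" by fact
   show "\<zero>.A' \<in> d ` carrier A" using mod_hom_zero[OF d A A'] by (metis A.M.zero_closed image_eqI)
   fix l assume l: "l \<in> idx t n"
   have "d (a l) = d (b l) \<ominus>.A' d (trans e' f l \<odot>.A m l)"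
    unfolding a_def using wit2[OF w l] mA[OF l] tc by (simp add: mod_hom_minus[OF d A A'])
   then have "d (a l) = d (b l)" using mA[OF l] dm[OF l] ds tc dc[OF wit2[OF w l]] by (simp add: a_minus_def)
   then show "trans f f l \<odot>.A' c0 l = d (a l) \<oplus>.A' D A' f l (\<lambda>_. \<zero>.A')"
    using A'.cobd_zero[OF yc l] wit5[OF w l, symmetric] dc[OF wit2[OF w l]] by (simp add: trans_same)
  qed
  then show "w \<in> V" using P(8)[OF wit4[OF w]] by blast
 qed
 then show ?thesis by iprover
qed

end

text \<open>Boundaries matter only through what eventually becomes a boundary, so they may be
  replaced level by level as long as this notion agrees on \<open>Z\<close>.\<close>

lemma colim_pres_change_boundaries:
 assumes pres: "colim_pres R X N \<tau> Z B W V \<rho>"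
  and B: "!!e c. c \<in> Z e ==>
   (\<exists>e'\<ge>e. (\<lambda>i. \<tau> e e' i \<odot>.X c i) \<in> B e') \<longleftrightarrow> (\<exists>e'\<ge>e. (\<lambda>i. \<tau> e e' i \<odot>.X c i) \<in> B' e')"
 shows "colim_pres R X N \<tau> Z B' W V \<rho>"
proof -
 note P = colim_presD[OF pres]
 show ?thesis
 proof (rule colim_presI)
  show "w \<in> V" if "\<rho> e c w" "e \<le> e'" "(\<lambda>i. \<tau> e e' i \<odot>.X c i) \<in> B' e'" for e e' c w
   using P(8)[OF that(1)] B[OF P(1)[OF that(1)]] that(2,3) by auto
  show "\<exists>e'\<ge>e. (\<lambda>i. \<tau> e e' i \<odot>.X c i) \<in> B' e'" if "\<rho> e c w" "w \<in> V" for e c w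
   using P(8)[OF that(1)] B[OF P(1)[OF that(1)]] that(2) by simp
 qed (fact P)+
qed

section \<open>Torsion and degree zero\<close>

context cech
begin

definition torsion :: "('a, 'm, 'y) module_scheme => 'm set" where
 "torsion M = {u \<in> carrier M. \<exists>e. \<forall>j<t. ypow e j \<odot>.M u = \<zero>.M}"

lemma ypow_kills_mono:
 assumes M: "module R M" and u: "u \<in> carrier M" "ypow e j \<odot>.M u = \<zero>.M" and e: "e \<le> e'"
 shows "ypow e' j \<odot>.M u = \<zero>.M"
proof -
 interpret module R M by fact
 have "ypow e' j = fr (e' - e) (ypow e j)" using fr_add_exp[OF x_closed, of "e' - e" e] e by (simp add: ypow_def)
 then obtain y where "y \<in> carrier R" "ypow e' j = y \<otimes> ypow e j" using fr_multiple[OF ypow_closed] by metis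
 then show ?thesis using u ypow_closed by (simp add: smult_assoc1)
qed

text \<open>Powers of the ideal and p^e-th powers of its generators define the same torsion:
  x_j^(p^n) lies in I^n because n <= p^n, and conversely an annihilator that contains powers of all
  generators contains a power of I, as R is Noetherian.\<close>

lemma torsion_module_eq:
 fixes M :: "('a, 'm) module"
 assumes M: "module R M"
 shows "carrier (torsion_module R (Idl (x ` {..<t})) M) = torsion M"
proof -
 interpret module R M by fact
 let ?I = "Idl (x ` {..<t})"
 have xs: "x ` {..<t} \<subseteq> carrier R" using x_closed by auto
 note I = genideal_ideal[OF xs]
 have "(\<exists>n. \<forall>a\<in>ideal_pow R ?I n. a \<odot>.M u = \<zero>.M) \<longleftrightarrow> (\<exists>e. \<forall>j<t. ypow e j \<odot>.M u = \<zero>.M)"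
  if u: "u \<in> carrier M" for u
 proof
  assume "\<exists>n. \<forall>a\<in>ideal_pow R ?I n. a \<odot>.M u = \<zero>.M"
  then obtain n where n: "!!a. a \<in> ideal_pow R ?I n ==> a \<odot>.M u = \<zero>.M" by blast
  have "2 ^ n \<le> p ^ n" using prime_ge_2_nat[OF p_prime] by (simp add: power_mono)
  then have le: "n \<le> p ^ n" using less_exp[of n] by linarith
  have "ypow n j \<odot>.M u = \<zero>.M" if j: "j < t" for j
  proof -
   have "x j \<in> ?I" using genideal_self[OF xs] j by auto
   then have "x j [^] (p ^ n) \<in> ideal_pow R ?I (p ^ n)" by (rule power_mem_ideal_pow[OF I])
   then have "ypow n j \<in> ideal_pow R ?I n" using ideal_pow_antimono[OF I le] by (auto simp: ypow_def frob_def)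
   then show ?thesis by (rule n)
  qed
  then show "\<exists>e. \<forall>j<t. ypow e j \<odot>.M u = \<zero>.M" by blast
 next
  assume "\<exists>e. \<forall>j<t. ypow e j \<odot>.M u = \<zero>.M"
  then obtain e where e: "!!j. j < t ==> ypow e j \<odot>.M u = \<zero>.M" by blast
  interpret RM: module R "ring_module R" by (rule ring_module_is_module)
  define K where "K = {r \<in> carrier R. r \<odot>.M u = \<zero>.M}"
  have "submodule K R (ring_module R)"
   by (rule RM.submoduleI') (use u in \<open>auto simp: K_def ring_module_def smult_l_distr smult_assoc1\<close>)
  then have "ideal K R" by (simp add: ideal_iff_submodule)
  moreover have "\<exists>k::nat. y [^] k \<in> K" if y: "y \<in> x ` {..<t}" for y
  proof -
   obtain j where j: "j < t" "y = x j" using y by auto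
   have "y [^] (p ^ e) \<in> K" using e[OF j(1)] x_closed[of j] j by (simp add: K_def ypow_def frob_def)
   then show ?thesis ..
  qed
  ultimately obtain n where "ideal_pow R ?I n \<subseteq> K" using ideal_pow_subset_of_nilpotent[OF noeth xs] by blast
  then show "\<exists>n. \<forall>a\<in>ideal_pow R ?I n. a \<odot>.M u = \<zero>.M" by (auto simp: K_def)
 qed
 then show ?thesis by (auto simp: torsion_module_def torsion_def)
qed

text \<open>A cochain of degree 0 is its single value c [], a cocycle if every x_j^(p^e) with j < t
  kills it, and the transition factor at [] is 1. The colimit is thus an increasing union inside Y.
  The boundaries are left open because they differ in the two applications.\<close>

lemma colim_pres_degree_0:
 fixes M :: "('a, 'm) module"
 assumes M: "module R M" and Y: "submodule Y R M"
  and B: "!!e c. c \<in> cocycles M Y 0 e ==>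
   c [] \<in> V \<longleftrightarrow> (\<exists>e'\<ge>e. (\<lambda>l. trans e e' l \<odot>.M c l) \<in> B e')"
 shows "colim_pres R M M trans (cocycles M Y 0) B (Y \<inter> torsion M) V
  (\<lambda>e c w. c \<in> cocycles M Y 0 e \<and> w = c [])"
proof -
 interpret module R M by fact
 have Yc: "y \<in> carrier M" if "y \<in> Y" for y by (rule submodule_simps(1)[OF Y that])
 have cocyc: "c \<in> cocycles M Y 0 e \<longleftrightarrow> c [] \<in> Y \<and> (\<forall>j<t. ypow e j \<odot>.M c [] = \<zero>.M)" for c e
 proof -
  have e2: "idx t (Suc 0) = (\<lambda>j. [j]) ` {..<t}" by (auto simp: idx_def length_Suc_conv)
  have "D M e [j] c = ypow e j \<odot>.M c []" if "c [] \<in> Y" for j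
   using Yc[OF that] ypow_closed by (simp add: a_minus_def)
  then show ?thesis unfolding cocycles_def e2 by (auto simp: idx_0 simp del: cobd.simps)
 qed
 have tr: "trans e e' [] = \<one>" for e e' by (simp add: trans_def)
 have one: "trans e e' [] \<odot>.M y = y" if "y \<in> Y" for y e e' using Yc[OF that] by (simp add: tr)
 show ?thesis
 proof (rule colim_presI)
  show "w \<in> Y \<inter> torsion M" if "c \<in> cocycles M Y 0 e \<and> w = c []" for e c w
   using that Yc by (auto simp: cocyc torsion_def)
  show "\<exists>e c. c \<in> cocycles M Y 0 e \<and> w = c []" if "w \<in> Y \<inter> torsion M" for w
  proof -
   obtain e where "\<forall>j<t. ypow e j \<odot>.M w = \<zero>.M" using \<open>w \<in> Y \<inter> torsion M\<close> by (auto simp: torsion_def)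
   then show ?thesis using \<open>w \<in> Y \<inter> torsion M\<close> by (intro exI[of _ e] exI[of _ "\<lambda>_. w"]) (simp add: cocyc)
  qed
  show "(\<lambda>i. c i \<oplus>.M c' i) \<in> cocycles M Y 0 e \<and> w \<oplus>.M w' = c [] \<oplus>.M c' []"
   if "c \<in> cocycles M Y 0 e \<and> w = c []" "c' \<in> cocycles M Y 0 e \<and> w' = c' []" for e c c' w w'
   using that Yc ypow_closed by (simp add: cocyc submodule_simps(3)[OF Y] smult_r_distr)
  show "(\<lambda>i. r \<odot>.M c i) \<in> cocycles M Y 0 e \<and> r \<odot>.M w = r \<odot>.M c []"
   if r: "r \<in> carrier R" and c: "c \<in> cocycles M Y 0 e \<and> w = c []" for e c w r
  proof -
   have c0: "c [] \<in> Y" using c by (simp add: cocyc)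
   have "ypow e j \<odot>.M (r \<odot>.M c []) = r \<odot>.M (ypow e j \<odot>.M c [])" for j
    using r Yc[OF c0] ypow_closed[of e j] by (simp add: smult_assoc1[symmetric] m_comm)
   then show ?thesis using c r submodule_simps(4)[OF Y r c0] by (simp add: cocyc)
  qed
  show "(\<lambda>i. trans e e' i \<odot>.M c i) \<in> cocycles M Y 0 e' \<and> w = trans e e' [] \<odot>.M c []"
   if "e \<le> e'" "c \<in> cocycles M Y 0 e \<and> w = c []" for e e' c w
   using that one ypow_kills_mono[OF M Yc _ that(1)] by (auto simp: cocyc)
  show "\<exists>e'\<ge>e. (\<lambda>i. trans e e' i \<odot>.M c i) \<in> B e'" if "c \<in> cocycles M Y 0 e \<and> w = c []" "w \<in> V" for e c w
   using B[of c e] that by simp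
  show "w \<in> V" if "c \<in> cocycles M Y 0 e \<and> w = c []" "e \<le> e'" "(\<lambda>i. trans e e' i \<odot>.M c i) \<in> B e'" for e e' c w
   using B[of c e] that by auto
 qed simp_all
qed

lemma mod_hom_image_submodule:
 "module R A ==> module R A' ==> d \<in> mod_hom R A A' ==> submodule (d ` carrier A) R A'"
 using submodule_image[OF _ _ _ module.carrier_is_submodule] by blast

text \<open>The base of the dimension shifting: for n = 0 the shift boundaries are the images of
  torsion elements of A. For injective A the quotient of the torsion of d A by them is the first
  local cohomology of ker d.\<close>

lemma colim_pres_shift_0:
 fixes A :: "('a, 'm) module" and A' :: "('a, 'n) module"
 assumes A: "module R A" and A': "module R A'" and d: "d \<in> mod_hom R A A'"
 shows "\<exists>\<rho>. colim_pres R A' A' trans (cocycles A' (d ` carrier A) 0) (shift_boundaries A A' d 0)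
  (d ` carrier A \<inter> torsion A') (d ` torsion A) \<rho>"
proof -
 interpret A: module R A by fact
 interpret A': module R A' by fact
 have tr: "trans e e' [] = \<one>" for e e' by (simp add: trans_def)
 have cocyc: "a \<in> cocycles A (carrier A) 0 e \<longleftrightarrow> a [] \<in> carrier A \<and> (\<forall>j<t. ypow e j \<odot>.A a [] = \<zero>.A)" for a e
 proof -
  have e2: "idx t (Suc 0) = (\<lambda>j. [j]) ` {..<t}" by (auto simp: idx_def length_Suc_conv)
  have "D A e [j] a = ypow e j \<odot>.A a []" if "a [] \<in> carrier A" for j
   using that ypow_closed by (simp add: a_minus_def)
  then show ?thesis unfolding cocycles_def e2 by (auto simp: idx_0 simp del: cobd.simps)
 qed
 have "c [] \<in> d ` torsion A \<longleftrightarrow> (\<exists>e'\<ge>e. (\<lambda>l. trans e e' l \<odot>.A' c l) \<in> shift_boundaries A A' d 0 e')"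
  if c: "c \<in> cocycles A' (d ` carrier A) 0 e" for e c
 proof -
  have c0: "c [] \<in> carrier A'" using c mod_homD(1)[OF d] by (auto simp: cocycles_def idx_0)
  have sb: "(\<lambda>l. trans e e' l \<odot>.A' c l) \<in> shift_boundaries A A' d 0 e' \<longleftrightarrow>
    (\<exists>a. a [] \<in> carrier A \<and> (\<forall>j<t. ypow e' j \<odot>.A a [] = \<zero>.A) \<and> c [] = d (a []))" for e'
   using c0 mod_homD(1)[OF d] by (auto simp: shift_boundaries_def idx_0 tr cocyc)
  show ?thesis
  proof
   assume "c [] \<in> d ` torsion A"
   then obtain u f where u: "u \<in> carrier A" "c [] = d u" "\<forall>j<t. ypow f j \<odot>.A u = \<zero>.A"
    by (auto simp: torsion_def)
   have "\<forall>j<t. ypow (max e f) j \<odot>.A u = \<zero>.A" using u ypow_kills_mono[OF A u(1) _ max.cobounded2] by simp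
   then show "\<exists>e'\<ge>e. (\<lambda>l. trans e e' l \<odot>.A' c l) \<in> shift_boundaries A A' d 0 e'"
    using u by (intro exI[of _ "max e f"] conjI iffD2[OF sb] exI[of _ "\<lambda>_. u"]) simp_all
  next
   assume "\<exists>e'\<ge>e. (\<lambda>l. trans e e' l \<odot>.A' c l) \<in> shift_boundaries A A' d 0 e'"
   then obtain e' where "(\<lambda>l. trans e e' l \<odot>.A' c l) \<in> shift_boundaries A A' d 0 e'" by iprover
   from this[THEN iffD1[OF sb]] show "c [] \<in> d ` torsion A" by (auto simp: torsion_def)
  qed
 qed
 then show ?thesis
  by (intro exI) (rule colim_pres_degree_0[OF A' mod_hom_image_submodule[OF A A' d]])
qed

text \<open>In positive degree a cocycle of the injective A is eventually a coboundary, so its image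
  under d contributes nothing beyond the coboundaries over d A.\<close>

lemma coboundaries_shift_boundaries:
 fixes A :: "('a, 'm) module" and A' :: "('a, 'n) module"
 assumes inj: "injective_module R A" and A': "module R A'" and d: "d \<in> mod_hom R A A'"
  and c: "c \<in> cocycles A' (d ` carrier A) (Suc n) e"
 shows "(\<exists>e'\<ge>e. (\<lambda>l. trans e e' l \<odot>.A' c l) \<in> coboundaries A' (d ` carrier A) (Suc n) e') \<longleftrightarrow>
  (\<exists>e'\<ge>e. (\<lambda>l. trans e e' l \<odot>.A' c l) \<in> shift_boundaries A A' d (Suc n) e')"
proof -
 have A: "module R A" using inj by (simp add: injective_module_def)
 interpret A: module R A by fact
 interpret A': module R A' by fact
 note Y = A'.submodule_simps[OF mod_hom_image_submodule[OF A A' d]]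
 note yc = ypow_closed
 have cc: "c l \<in> carrier A'" if "l \<in> idx t (Suc n)" for l
  by (rule Y(1)) (use c that in \<open>simp add: cocycles_def\<close>)
 show ?thesis
 proof
  assume "\<exists>e'\<ge>e. (\<lambda>l. trans e e' l \<odot>.A' c l) \<in> coboundaries A' (d ` carrier A) (Suc n) e'"
  then obtain e' b where e: "e \<le> e'" and b: "\<forall>l\<in>idx t n. b l \<in> d ` carrier A"
   and cb: "\<forall>l\<in>idx t (Suc n). trans e e' l \<odot>.A' c l = D A' e' l b"
   unfolding coboundaries_def pred_idx_Suc by (elim exE conjE CollectE)
  have "(\<lambda>l. trans e e' l \<odot>.A' c l) \<in> shift_boundaries A A' d (Suc n) e'"
   unfolding shift_boundaries_def pred_idx_Suc
  proof (intro CollectI exI[of _ "\<lambda>_. \<zero>.A"] exI[of _ b] conjI ballI)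
   show "(\<lambda>_. \<zero>.A) \<in> cocycles A (carrier A) (Suc n) e'" by (simp add: cocycles_def A.cobd_zero[OF yc])
   fix l assume l: "l \<in> idx t (Suc n)"
   have "D A' e' l b \<in> carrier A'" by (rule A'.cobd_closed[OF yc l]) (use b Y(1) in simp)
   then show "trans e e' l \<odot>.A' c l = d \<zero>.A \<oplus>.A' D A' e' l b"
    using cb l mod_hom_zero[OF d A A'] by simp
  qed (use b in simp)
  then show "\<exists>e'\<ge>e. (\<lambda>l. trans e e' l \<odot>.A' c l) \<in> shift_boundaries A A' d (Suc n) e'" using e by iprover
 next
  assume "\<exists>e'\<ge>e. (\<lambda>l. trans e e' l \<odot>.A' c l) \<in> shift_boundaries A A' d (Suc n) e'"
  then obtain e' a b where e: "e \<le> e'" and a: "a \<in> cocycles A (carrier A) (Suc n) e'"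
   and b: "\<forall>l\<in>idx t n. b l \<in> d ` carrier A"
   and cb: "\<forall>l\<in>idx t (Suc n). trans e e' l \<odot>.A' c l = d (a l) \<oplus>.A' D A' e' l b"
   unfolding shift_boundaries_def pred_idx_Suc by (elim exE conjE CollectE)
  from cocycle_eventually_coboundary[OF inj a] obtain f g where f: "e' \<le> f"
   and g: "\<forall>l\<in>idx t n. g l \<in> carrier A" and ag: "\<forall>l\<in>idx t (Suc n). trans e' f l \<odot>.A a l = D A f l g"
   by (elim exE conjE)
  have tc: "trans e f l \<in> carrier R" for e f l by (rule trans_closed)
  have bc: "b l \<in> carrier A'" if "l \<in> idx t n" for l using b that Y(1) by simp
  have "(\<lambda>l. trans e f l \<odot>.A' c l) \<in> coboundaries A' (d ` carrier A) (Suc n) f"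
   unfolding coboundaries_def pred_idx_Suc
  proof (intro CollectI exI[of _ "\<lambda>l. d (g l) \<oplus>.A' trans e' f l \<odot>.A' b l"] conjI ballI)
   fix l assume l: "l \<in> idx t n"
   show "d (g l) \<oplus>.A' trans e' f l \<odot>.A' b l \<in> d ` carrier A"
    by (rule Y(3)[OF imageI Y(4)[OF tc]]) (use g b l in simp_all)
  next
   fix l assume l: "l \<in> idx t (Suc n)"
   have al: "a l \<in> carrier A" using a l by (simp add: cocycles_def)
   have Db: "D A' e' l b \<in> carrier A'" by (rule A'.cobd_closed[OF yc l]) (simp add: bc)
   have "trans e f l \<odot>.A' c l = trans e' f l \<odot>.A' (trans e e' l \<odot>.A' c l)"
    by (rule trans_smult_trans[OF A' e f cc[OF l], symmetric])
   also have "\<dots> = trans e' f l \<odot>.A' d (a l) \<oplus>.A' trans e' f l \<odot>.A' D A' e' l b"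
    using cb l al Db tc mod_homD(1)[OF d] by (simp add: A'.smult_r_distr)
   also have "trans e' f l \<odot>.A' d (a l) = d (D A f l g)"
    using bspec[OF ag l, symmetric] al tc mod_homD(3)[OF d] by simp
   also have "d (D A f l g) = D A' f l (\<lambda>m. d (g m))"
    by (rule A.cobd_hom[OF yc A' d l]) (use g in simp)
   also have "trans e' f l \<odot>.A' D A' e' l b = D A' f l (\<lambda>m. trans e' f m \<odot>.A' b m)"
    by (rule cobd_trans[OF A' f l, symmetric]) (simp add: bc)
   also have "D A' f l (\<lambda>m. d (g m)) \<oplus>.A' D A' f l (\<lambda>m. trans e' f m \<odot>.A' b m) =
     D A' f l (\<lambda>l. d (g l) \<oplus>.A' trans e' f l \<odot>.A' b l)"
    by (rule A'.cobd_add[OF yc l, symmetric]) (use g bc tc mod_homD(1)[OF d] in simp_all)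
   finally show "trans e f l \<odot>.A' c l = D A' f l (\<lambda>l. d (g l) \<oplus>.A' trans e' f l \<odot>.A' b l)" .
  qed
  moreover have "e \<le> f" using e f by simp
  ultimately show "\<exists>e'\<ge>e. (\<lambda>l. trans e e' l \<odot>.A' c l) \<in> coboundaries A' (d ` carrier A) (Suc n) e'" by iprover
 qed
qed

text \<open>Induction on n with k arbitrary: degree n + 2 on the syzygy K k is shifted to degree n +
  1 on K (k + 1). The sum n + k, and with it the presented subquotient, stays the same up to the
  expected index.\<close>

lemma colim_pres_resolution_Suc:
 fixes E :: "nat => ('a, 'm) module"
 assumes inj: "!!k. injective_module R (E k)" and d: "!!k. d k \<in> mod_hom R (E k) (E (Suc k))"
  and exact: "!!k. d k ` carrier (E k) = {u \<in> carrier (E (Suc k)). d (Suc k) u = \<zero>\<^bsub>E (Suc (Suc k))\<^esub>}"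
 defines "K \<equiv> \<lambda>k. {u \<in> carrier (E k). d k u = \<zero>\<^bsub>E (Suc k)\<^esub>}"
 shows "\<exists>\<rho>. colim_pres R (E k) (E (Suc (n + k))) trans (cocycles (E k) (K k) (Suc n))
  (coboundaries (E k) (K k) (Suc n)) (K (Suc (n + k)) \<inter> torsion (E (Suc (n + k))))
  (d (n + k) ` torsion (E (n + k))) \<rho>"
proof (induction n arbitrary: k)
 have M: "module R (E k)" for k using inj[of k] by (simp add: injective_module_def)
 have ex: "K (Suc k) = d k ` carrier (E k)" for k by (simp add: K_def exact)
 {
  case 0
  from colim_pres_shift_0[OF M M d, of k] obtain \<rho> where
   "colim_pres R (E (Suc k)) (E (Suc k)) trans (cocycles (E (Suc k)) (d k ` carrier (E k)) 0)
   (shift_boundaries (E k) (E (Suc k)) (d k) 0) (d k ` carrier (E k) \<inter> torsion (E (Suc k))) (d k ` torsion (E k)) \<rho>" ..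
  from colim_pres_shift[OF inj M d this] show ?case unfolding add_0 ex unfolding K_def .
 next
  case (Suc n)
  from Suc.IH[of "Suc k"] obtain \<rho> where
   "colim_pres R (E (Suc k)) (E (Suc (n + Suc k))) trans (cocycles (E (Suc k)) (d k ` carrier (E k)) (Suc n))
   (coboundaries (E (Suc k)) (d k ` carrier (E k)) (Suc n)) (K (Suc (n + Suc k)) \<inter> torsion (E (Suc (n + Suc k))))
   (d (n + Suc k) ` torsion (E (n + Suc k))) \<rho>" unfolding ex ..
  from colim_pres_shift[OF inj M d colim_pres_change_boundaries[OF this coboundaries_shift_boundaries[OF inj M d]]]
  show ?case by (simp add: K_def)
 }
qed

end

section \<open>From a resolution to a model of local cohomology\<close>

context module
begin

lemma quotient_coset_simps:
 assumes V: "submodule V R M"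
 shows "w \<in> carrier M ==> w' \<in> carrier M ==> (V +>.M w) <+>.M (V +>.M w') = V +>.M (w \<oplus>.M w')"
  "w \<in> carrier M ==> r \<in> carrier R ==> (\<Union>x\<in>V +>.M w. V +>.M (r \<odot>.M x)) = V +>.M (r \<odot>.M w)"
  "w \<in> carrier M ==> V +>.M w = V \<longleftrightarrow> w \<in> V"
proof -
 interpret V: abelian_subgroup V M
  by (rule abelian_subgroupI3[OF additive_subgroupI M.abelian_group_axioms])
   (rule submodule.axioms(1)[OF V])
 show "w \<in> carrier M ==> w' \<in> carrier M ==> (V +>.M w) <+>.M (V +>.M w') = V +>.M (w \<oplus>.M w')"
  by (rule V.a_rcos_sum)
 show eq: "V +>.M w = V \<longleftrightarrow> w \<in> V" if "w \<in> carrier M" for w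
  using V.a_rcos_self[OF that] V.a_rcos_const[of w] by auto
 show "(\<Union>x\<in>V +>.M w. V +>.M (r \<odot>.M x)) = V +>.M (r \<odot>.M w)"
  if w: "w \<in> carrier M" and r: "r \<in> carrier R"
 proof -
  have "V +>.M (r \<odot>.M x) = V +>.M (r \<odot>.M w)" if x: "x \<in> V +>.M w" for x
  proof -
   obtain v where v: "v \<in> V" "x = v \<oplus>.M w" using x by (auto simp: a_r_coset_def')
   have "r \<odot>.M x = r \<odot>.M v \<oplus>.M r \<odot>.M w"
    using v w r submodule_simps(1)[OF V] by (simp add: smult_r_distr)
   moreover have "r \<odot>.M v \<in> V" by (rule submodule_simps(4)[OF V r v(1)])
   ultimately have "r \<odot>.M x \<in> V +>.M (r \<odot>.M w)" by (auto simp: a_r_coset_def')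
   then show ?thesis using V.a_repr_independence'[of "r \<odot>.M x" "r \<odot>.M w"] w r by simp
  qed
  moreover have "w \<in> V +>.M w" by (rule V.a_rcos_self[OF w])
  ultimately show ?thesis by blast
 qed
qed

end

context cech
begin

lemma torsion_submodule:
 assumes M: "module R M"
 shows "submodule (torsion M) R M"
proof -
 interpret module R M by fact
 show ?thesis
 proof (rule submoduleI')
  show "\<zero>.M \<in> torsion M" using ypow_closed by (simp add: torsion_def)
  show "u \<oplus>.M v \<in> torsion M" if uv: "u \<in> torsion M" "v \<in> torsion M" for u v
  proof -
   obtain e f where u: "u \<in> carrier M" "\<forall>j<t. ypow e j \<odot>.M u = \<zero>.M"
    and v: "v \<in> carrier M" "\<forall>j<t. ypow f j \<odot>.M v = \<zero>.M" using uv by (auto simp: torsion_def)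
   have "\<forall>j<t. ypow (max e f) j \<odot>.M (u \<oplus>.M v) = \<zero>.M"
    using u v ypow_kills_mono[OF M u(1) _ max.cobounded1] ypow_kills_mono[OF M v(1) _ max.cobounded2]
    by (simp add: smult_r_distr ypow_closed)
   then show ?thesis using u(1) v(1) by (auto simp: torsion_def)
  qed
  show "r \<odot>.M u \<in> torsion M" if r: "r \<in> carrier R" and u: "u \<in> torsion M" for r u
  proof -
   obtain e where u: "u \<in> carrier M" "\<forall>j<t. ypow e j \<odot>.M u = \<zero>.M" using u by (auto simp: torsion_def)
   have "ypow e j \<odot>.M (r \<odot>.M u) = r \<odot>.M (ypow e j \<odot>.M u)" for j
    using u(1) r ypow_closed[of e j] by (simp add: smult_assoc1[symmetric] m_comm)
   then have "\<forall>j<t. ypow e j \<odot>.M (r \<odot>.M u) = \<zero>.M" using u r by simp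
   then show ?thesis using u r by (auto simp: torsion_def)
  qed
 qed (auto simp: torsion_def)
qed

text \<open>Transport of structure: values in the image of the augmentation are pulled back to M,
  and classes modulo V are identified with elements of H through h.\<close>

lemma colim_pres_quotient:
 fixes M :: "('a, 'm) module" and A :: "('a, 'n) module" and G :: "('a, 'g) module" and H :: "('a, 'e) module"
 assumes M: "module R M" and A: "module R A" and G: "module R G" and H: "module R H"
  and \<epsilon>: "\<epsilon> \<in> mod_hom R M A" and inj: "inj_on \<epsilon> (carrier M)"
  and pres: "colim_pres R A G trans (cocycles A (\<epsilon> ` carrier M) n) (coboundaries A (\<epsilon> ` carrier M) n) W V \<rho>"
  and V: "submodule V R G" and W: "W \<subseteq> carrier G"
  and h: "h \<in> mod_hom R H (quotient_module (G\<lparr>carrier := W\<rparr>) V)"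
  and bij: "bij_betw h (carrier H) (carrier (quotient_module (G\<lparr>carrier := W\<rparr>) V))"
 shows "\<exists>\<rho>'. colim_pres R M H trans (cocycles M (carrier M) n) (coboundaries M (carrier M) n) (carrier H) {\<zero>.H} \<rho>'"
proof -
 interpret M: module R M by fact
 interpret A: module R A by fact
 interpret G: module R G by fact
 interpret H: module R H by fact
 note P = colim_presD[OF pres]
 note \<epsilon>c = mod_homD(1)[OF \<epsilon>] and \<epsilon>a = mod_homD(2)[OF \<epsilon>] and \<epsilon>s = mod_homD(3)[OF \<epsilon>]
 note tc = trans_closed and yc = ypow_closed
 have \<epsilon>D: "\<epsilon> (D M e l b) = D A e l (\<lambda>m. \<epsilon> (b m))"
  if "l \<in> idx t k" "!!m. m \<in> pred_idx t k ==> b m \<in> carrier M" for e l k b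
  by (rule M.cobd_hom[OF yc A \<epsilon> that])
 let ?Q = "quotient_module (G\<lparr>carrier := W\<rparr>) V"
 have cos: "V +>\<^bsub>G\<lparr>carrier := W\<rparr>\<^esub> w = V +>.G w" for w by (simp add: a_r_coset_def r_coset_def)
 have Qc: "carrier ?Q = (\<lambda>w. V +>.G w) ` W"
  unfolding quotient_module_def A_RCOSETS_def' cos by auto
 have Qa: "X \<oplus>.?Q Y = X <+>.G Y" for X Y by (simp add: quotient_module_def set_add_def set_mult_def)
 have Qs: "r \<odot>.?Q X = (\<Union>x\<in>X. V +>.G (r \<odot>.G x))" for r X by (simp add: quotient_module_def cos)
 note q = G.quotient_coset_simps[OF V]
 have Wc: "w \<in> carrier G" if "w \<in> W" for w using W that by auto
 have hs: "h (r \<odot>.H y) = V +>.G (r \<odot>.G w)" if "r \<in> carrier R" "y \<in> carrier H" "w \<in> W" "h y = V +>.G w" for r y w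
  using mod_homD(3)[OF h that(1,2)] unfolding that(4) Qs q(2)[OF Wc[OF that(3)] that(1)] .
 have ha: "h (y \<oplus>.H y') = V +>.G (w \<oplus>.G w')"
  if "y \<in> carrier H" "w \<in> W" "h y = V +>.G w" "y' \<in> carrier H" "w' \<in> W" "h y' = V +>.G w'" for y y' w w'
  using mod_homD(2)[OF h that(1,4)] unfolding that(3,6) Qa q(1)[OF Wc[OF that(2)] Wc[OF that(5)]] .
 have h_ex: "\<exists>y\<in>carrier H. h y = V +>.G w" if "w \<in> W" for w
  using bij that unfolding bij_betw_def Qc by (metis (mono_tags, lifting) imageE image_eqI)
 have hW: "\<exists>w\<in>W. h y = V +>.G w" if "y \<in> carrier H" for y
  using mod_homD(1)[OF h that] unfolding Qc by auto
 have h0: "h \<zero>.H = V"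
 proof -
  obtain w where w: "w \<in> W" "h \<zero>.H = V +>.G w" using hW[OF H.M.zero_closed] by blast
  have "h (\<zero> \<odot>.H \<zero>.H) = V +>.G (\<zero> \<odot>.G w)" by (rule hs) (use w in auto)
  then show ?thesis using Wc[OF w(1)] q(3)[of "\<zero>.G"] G.submodule_simps(2)[OF V] by simp
 qed
 have hV: "y = \<zero>.H \<longleftrightarrow> w \<in> V" if y: "y \<in> carrier H" "w \<in> W" "h y = V +>.G w" for y w
 proof -
  have "inj_on h (carrier H)" using bij by (rule bij_betw_imp_inj_on)
  then have "y = \<zero>.H \<longleftrightarrow> h y = V" using inj_on_eq_iff[of h "carrier H" y "\<zero>.H"] y(1) h0 by auto
  then show ?thesis using q(3)[OF Wc[OF y(2)]] y(3) by simp
 qed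
 define rel where "rel e c c0 w y \<longleftrightarrow> (\<forall>l\<in>idx t n. c l \<in> carrier M \<and> \<epsilon> (c l) = c0 l) \<and> \<rho> e c0 w \<and>
  y \<in> carrier H \<and> h y = V +>.G w" for e c c0 w y
 have rel1: "!!l. l \<in> idx t n ==> c l \<in> carrier M" and rel2: "!!l. l \<in> idx t n ==> \<epsilon> (c l) = c0 l"
  and rel3: "\<rho> e c0 w" and rel4: "y \<in> carrier H" and rel5: "h y = V +>.G w" if "rel e c c0 w y" for e c c0 w y
  using that by (simp_all add: rel_def)
 have relI: "rel e c c0 w y" if "!!l. l \<in> idx t n ==> c l \<in> carrier M" "!!l. l \<in> idx t n ==> \<epsilon> (c l) = c0 l"
  "\<rho> e c0 w" "y \<in> carrier H" "h y = V +>.G w" for e c c0 w y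
  using that by (simp add: rel_def)
 have relW: "w \<in> W" if "rel e c c0 w y" for e c c0 w y by (rule P(2)[OF rel3[OF that]])
 have "colim_pres R M H trans (cocycles M (carrier M) n) (coboundaries M (carrier M) n) (carrier H) {\<zero>.H}
  (\<lambda>e c y. \<exists>c0 w. rel e c c0 w y)"
 proof (rule colim_presI)
  fix e c y assume "\<exists>c0 w. rel e c c0 w y"
  then obtain c0 w where r: "rel e c c0 w y" by iprover
  show "y \<in> carrier H" by (rule rel4[OF r])
  show "c \<in> cocycles M (carrier M) n e"
   unfolding cocycles_def
  proof (intro CollectI conjI ballI rel1[OF r])
   fix l assume l: "l \<in> idx t (Suc n)"
   have Dc: "D M e l c \<in> carrier M" by (rule M.cobd_closed[OF yc l]) (simp add: rel1[OF r])
   have "\<epsilon> (D M e l c) = D A e l (\<lambda>m. \<epsilon> (c m))" by (rule \<epsilon>D[OF l]) (simp add: rel1[OF r])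
   also have "\<dots> = D A e l c0" by (rule A.cobd_cong[OF l]) (simp add: rel2[OF r])
   also have "\<dots> = \<zero>.A" using P(1)[OF rel3[OF r]] l by (simp add: cocycles_def)
   also have "\<dots> = \<epsilon> \<zero>.M" by (rule mod_hom_zero[OF \<epsilon> M A, symmetric])
   finally show "D M e l c = \<zero>.M" using inj_onD[OF inj _ Dc M.M.zero_closed] by simp
  qed
 next
  fix e c assume c: "c \<in> cocycles M (carrier M) n e"
  have cc: "c l \<in> carrier M" if "l \<in> idx t n" for l using c that by (simp add: cocycles_def)
  have "(\<lambda>l. \<epsilon> (c l)) \<in> cocycles A (\<epsilon> ` carrier M) n e"
   unfolding cocycles_def
  proof (intro CollectI conjI ballI imageI cc)
   fix l assume l: "l \<in> idx t (Suc n)"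
   have "D A e l (\<lambda>m. \<epsilon> (c m)) = \<epsilon> (D M e l c)" by (rule \<epsilon>D[OF l, symmetric]) (simp add: cc)
   then show "D A e l (\<lambda>l. \<epsilon> (c l)) = \<zero>.A" using c l mod_hom_zero[OF \<epsilon> M A] by (simp add: cocycles_def)
  qed
  from P(3)[OF this] obtain w where w: "\<rho> e (\<lambda>l. \<epsilon> (c l)) w" ..
  obtain y where "y \<in> carrier H" "h y = V +>.G w" using h_ex[OF P(2)[OF w]] ..
  then have "rel e c (\<lambda>l. \<epsilon> (c l)) w y" using cc w by (simp add: rel_def)
  then show "\<exists>y c0 w. rel e c c0 w y" by iprover
 next
  fix y assume y: "y \<in> carrier H"
  obtain w where w: "w \<in> W" "h y = V +>.G w" using hW[OF y] ..
  from P(4)[OF w(1)] obtain e c0 where r: "\<rho> e c0 w" by (elim exE)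
  have "\<forall>l\<in>idx t n. \<exists>b. b \<in> carrier M \<and> \<epsilon> b = c0 l"
   using P(1)[OF r] by (simp add: cocycles_def image_iff Bex_def eq_commute)
  from bchoice[OF this] obtain c where "\<forall>l\<in>idx t n. c l \<in> carrier M \<and> \<epsilon> (c l) = c0 l" ..
  then have "rel e c c0 w y" using r y w by (simp add: rel_def)
  then show "\<exists>e c c0 w. rel e c c0 w y" by iprover
 next
  fix e c y c' y' assume "\<exists>c0 w. rel e c c0 w y" "\<exists>c0 w. rel e c' c0 w y'"
  then obtain c0 w c0' w' where r: "rel e c c0 w y" "rel e c' c0' w' y'" by iprover
  have "rel e (\<lambda>i. c i \<oplus>.M c' i) (\<lambda>i. c0 i \<oplus>.A c0' i) (w \<oplus>.G w') (y \<oplus>.H y')"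
  proof (rule relI)
   show "\<rho> e (\<lambda>i. c0 i \<oplus>.A c0' i) (w \<oplus>.G w')" by (rule P(5)[OF rel3[OF r(1)] rel3[OF r(2)]])
   show "h (y \<oplus>.H y') = V +>.G (w \<oplus>.G w')"
    by (rule ha[OF rel4[OF r(1)] relW[OF r(1)] rel5[OF r(1)] rel4[OF r(2)] relW[OF r(2)] rel5[OF r(2)]])
  qed (use rel1[OF r(1)] rel1[OF r(2)] rel2[OF r(1)] rel2[OF r(2)] \<epsilon>a rel4[OF r(1)] rel4[OF r(2)] in simp_all)
  then show "\<exists>c0 w. rel e (\<lambda>i. c i \<oplus>.M c' i) c0 w (y \<oplus>.H y')" by iprover
 next
  fix e c y s assume s: "s \<in> carrier R" and "\<exists>c0 w. rel e c c0 w y"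
  then obtain c0 w where r: "rel e c c0 w y" by iprover
  have "rel e (\<lambda>i. s \<odot>.M c i) (\<lambda>i. s \<odot>.A c0 i) (s \<odot>.G w) (s \<odot>.H y)"
  proof (rule relI)
   show "\<rho> e (\<lambda>i. s \<odot>.A c0 i) (s \<odot>.G w)" by (rule P(6)[OF s rel3[OF r]])
   show "h (s \<odot>.H y) = V +>.G (s \<odot>.G w)" by (rule hs[OF s rel4[OF r] relW[OF r] rel5[OF r]])
  qed (use rel1[OF r] rel2[OF r] \<epsilon>s rel4[OF r] s in simp_all)
  then show "\<exists>c0 w. rel e (\<lambda>i. s \<odot>.M c i) c0 w (s \<odot>.H y)" by iprover
 next
  fix e e' c y assume e: "e \<le> e'" and "\<exists>c0 w. rel e c c0 w y"
  then obtain c0 w where r: "rel e c c0 w y" by iprover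
  have "rel e' (\<lambda>i. trans e e' i \<odot>.M c i) (\<lambda>i. trans e e' i \<odot>.A c0 i) w y"
  proof (rule relI)
   show "\<rho> e' (\<lambda>i. trans e e' i \<odot>.A c0 i) w" by (rule P(7)[OF e rel3[OF r]])
  qed (use rel1[OF r] rel2[OF r] \<epsilon>s rel4[OF r] rel5[OF r] tc in simp_all)
  then show "\<exists>c0 w. rel e' (\<lambda>i. trans e e' i \<odot>.M c i) c0 w y" by iprover
 next
  fix e c y assume "\<exists>c0 w. rel e c c0 w y" and y: "y \<in> {\<zero>.H}"
  then obtain c0 w where r: "rel e c c0 w y" by iprover
  have "w \<in> V" using hV[OF rel4[OF r] relW[OF r] rel5[OF r]] y by simp
  with P(8)[OF rel3[OF r]] obtain e' where e: "e \<le> e'"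
   and "(\<lambda>i. trans e e' i \<odot>.A c0 i) \<in> coboundaries A (\<epsilon> ` carrier M) n e'" by auto
  then obtain k where k: "\<forall>l\<in>pred_idx t n. k l \<in> \<epsilon> ` carrier M"
   and kc: "\<forall>l\<in>idx t n. trans e e' l \<odot>.A c0 l = D A e' l k"
   unfolding coboundaries_def by (elim CollectE exE conjE)
  have "\<forall>l\<in>pred_idx t n. \<exists>b. b \<in> carrier M \<and> \<epsilon> b = k l"
   using k by (simp add: image_iff Bex_def eq_commute)
  from bchoice[OF this] obtain b where b: "\<forall>l\<in>pred_idx t n. b l \<in> carrier M \<and> \<epsilon> (b l) = k l" ..
  have "(\<lambda>i. trans e e' i \<odot>.M c i) \<in> coboundaries M (carrier M) n e'"
   unfolding coboundaries_def
  proof (intro CollectI exI[of _ b] conjI ballI)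
   fix l assume l: "l \<in> idx t n"
   have Db: "D M e' l b \<in> carrier M" by (rule M.cobd_closed[OF yc l]) (simp add: b)
   have "\<epsilon> (D M e' l b) = D A e' l (\<lambda>m. \<epsilon> (b m))" by (rule \<epsilon>D[OF l]) (simp add: b)
   also have "\<dots> = D A e' l k" by (rule A.cobd_cong[OF l]) (simp add: b)
   also have "\<dots> = \<epsilon> (trans e e' l \<odot>.M c l)" using kc l rel1[OF r l] rel2[OF r l] \<epsilon>s tc by simp
   finally show "trans e e' l \<odot>.M c l = D M e' l b"
    using inj_onD[OF inj _ Db] rel1[OF r l] tc by simp
  qed (use b in simp)
  then show "\<exists>e'\<ge>e. (\<lambda>i. trans e e' i \<odot>.M c i) \<in> coboundaries M (carrier M) n e'" using e by iprover
 next
  fix e e' c y assume "\<exists>c0 w. rel e c c0 w y" and e: "e \<le> e'"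
   and B: "(\<lambda>i. trans e e' i \<odot>.M c i) \<in> coboundaries M (carrier M) n e'"
  then obtain c0 w where r: "rel e c c0 w y" by iprover
  obtain b where b: "\<forall>l\<in>pred_idx t n. b l \<in> carrier M"
   and bc: "\<forall>l\<in>idx t n. trans e e' l \<odot>.M c l = D M e' l b"
   using B unfolding coboundaries_def by (elim CollectE exE conjE)
  have "(\<lambda>i. trans e e' i \<odot>.A c0 i) \<in> coboundaries A (\<epsilon> ` carrier M) n e'"
   unfolding coboundaries_def
  proof (intro CollectI exI[of _ "\<lambda>l. \<epsilon> (b l)"] conjI ballI imageI)
   fix l assume l: "l \<in> idx t n"
   have "trans e e' l \<odot>.A c0 l = \<epsilon> (trans e e' l \<odot>.M c l)" using rel1[OF r l] rel2[OF r l] \<epsilon>s tc by simp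
   also have "\<dots> = \<epsilon> (D M e' l b)" using bc l by simp
   also have "\<dots> = D A e' l (\<lambda>m. \<epsilon> (b m))" by (rule \<epsilon>D[OF l]) (simp add: b)
   finally show "trans e e' l \<odot>.A c0 l = D A e' l (\<lambda>m. \<epsilon> (b m))" .
  qed (use b in simp)
  then have "w \<in> V" using P(8)[OF rel3[OF r]] e by blast
  then show "y \<in> {\<zero>.H}" using hV[OF rel4[OF r] relW[OF r] rel5[OF r]] by simp
 qed
 then show ?thesis by iprover
qed

text \<open>The resolution survives only in the relation \<rho>; levels, cocycles, coboundaries and
  transition factors involve M alone. This is what makes the description iterable.\<close>

theorem colim_pres_local_cohomology:
 fixes M :: "('a, 'm) module" and H :: "('a, 'e) module"
 assumes lc: "local_cohomology R (Idl (x ` {..<t})) n M H"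
 shows "\<exists>\<rho>. colim_pres R M H trans (cocycles M (carrier M) n) (coboundaries M (carrier M) n) (carrier H) {\<zero>.H} \<rho>"
proof -
 let ?I = "Idl (x ` {..<t})"
 obtain \<epsilon> and E :: "nat => ('a, 'e) module" and d where H: "module R H"
  and res: "injective_resolution R M \<epsilon> E d" and iso: "mod_iso R H (cohomology (\<lambda>n. torsion_module R ?I (E n)) d n)"
  using lc unfolding local_cohomology_def by (elim exE conjE)
 have M: "module R M" and inj: "!!k. injective_module R (E k)" and \<epsilon>: "\<epsilon> \<in> mod_hom R M (E 0)"
  and d: "!!k. d k \<in> mod_hom R (E k) (E (Suc k))" and \<epsilon>inj: "inj_on \<epsilon> (carrier M)"
  and \<epsilon>im: "\<epsilon> ` carrier M = a_kernel (E 0) (E 1) (d 0)"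
  and ex: "!!k. d k ` carrier (E k) = a_kernel (E (Suc k)) (E (Suc (Suc k))) (d (Suc k))"
  using res by (simp_all add: injective_resolution_def)
 have E: "module R (E k)" for k using inj[of k] by (simp add: injective_module_def)
 define K where "K k = {u \<in> carrier (E k). d k u = \<zero>\<^bsub>E (Suc k)\<^esub>}" for k
 have tE: "torsion_module R ?I (E k) = (E k)\<lparr>carrier := torsion (E k)\<rparr>" for k
  using torsion_module_eq[OF E, of k] by (simp add: torsion_module_def)
 define V where "V = (case n of 0 => {\<zero>\<^bsub>E 0\<^esub>} | Suc j => d j ` torsion (E j))"
 have tc: "torsion (E k) \<subseteq> carrier (E k)" for k by (auto simp: torsion_def)
 have coh: "cohomology (\<lambda>n. torsion_module R ?I (E n)) d n =
   quotient_module ((E n)\<lparr>carrier := K n \<inter> torsion (E n)\<rparr>) V"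
 proof -
  have "{u \<in> torsion (E n). d n u = \<zero>\<^bsub>E (Suc n)\<^esub>} = K n \<inter> torsion (E n)"
   using tc[of n] by (auto simp: K_def)
  then show ?thesis by (cases n) (simp_all add: cohomology_def tE a_kernel_def' V_def)
 qed
 have eK: "\<epsilon> ` carrier M = K 0" by (simp add: \<epsilon>im a_kernel_def' K_def)
 have "\<exists>\<rho>. colim_pres R (E 0) (E n) trans (cocycles (E 0) (K 0) n) (coboundaries (E 0) (K 0) n) (K n \<inter> torsion (E n)) V \<rho>"
 proof (cases n)
  case 0
  interpret E0: module R "E 0" by (rule E)
  have "c [] \<in> {\<zero>\<^bsub>E 0\<^esub>} \<longleftrightarrow> (\<exists>e'\<ge>e. (\<lambda>l. trans e e' l \<odot>\<^bsub>E 0\<^esub> c l) \<in> coboundaries (E 0) (K 0) 0 e')"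
   if c: "c \<in> cocycles (E 0) (K 0) 0 e" for c e
  proof -
   have "c [] \<in> carrier (E 0)" using c by (simp add: cocycles_def K_def idx_0)
   then show ?thesis by (auto simp: coboundaries_def idx_0 trans_def)
  qed
  then show ?thesis
   unfolding 0 V_def nat.case
   by (intro exI) (rule colim_pres_degree_0[OF E mod_hom_image_submodule[OF M E \<epsilon>, unfolded eK]])
 next
  case (Suc j)
  have "d k ` carrier (E k) = {u \<in> carrier (E (Suc k)). d (Suc k) u = \<zero>\<^bsub>E (Suc (Suc k))\<^esub>}" for k
   by (simp add: ex a_kernel_def')
  from colim_pres_resolution_Suc[where E = E and d = d and k = 0 and n = j, OF inj d this]
  show ?thesis by (simp add: Suc V_def K_def)
 qed
 then obtain \<rho> where
  "colim_pres R (E 0) (E n) trans (cocycles (E 0) (\<epsilon> ` carrier M) n) (coboundaries (E 0) (\<epsilon> ` carrier M) n) (K n \<inter> torsion (E n)) V \<rho>"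
  unfolding eK ..
 moreover have "submodule V R (E n)"
 proof (cases n)
  case 0
  interpret E0: module R "E 0" by (rule E)
  show ?thesis unfolding 0 V_def nat.case by (rule E0.submoduleI') auto
 next
  case (Suc j)
  let ?T = "(E j)\<lparr>carrier := torsion (E j)\<rparr>"
  have "d j \<in> mod_hom R ?T (E (Suc j))" using d[of j] tc[of j] by (auto simp: mod_hom_def Pi_iff subset_iff)
  from mod_hom_image_submodule[OF submodule.submodule_is_module[OF torsion_submodule[OF E] E] E this]
  show ?thesis by (simp add: Suc V_def)
 qed
 moreover have "K n \<inter> torsion (E n) \<subseteq> carrier (E n)" using tc by auto
 moreover obtain h where "h \<in> mod_hom R H (quotient_module ((E n)\<lparr>carrier := K n \<inter> torsion (E n)\<rparr>) V)"
  "bij_betw h (carrier H) (carrier (quotient_module ((E n)\<lparr>carrier := K n \<inter> torsion (E n)\<rparr>) V))"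
  using iso unfolding coh mod_iso_def by blast
 ultimately show ?thesis by (rule colim_pres_quotient[OF M E E H \<epsilon> \<epsilon>inj])
qed

end

lemma uniform_level:
 fixes f :: nat
 assumes "finite S" "!!s. s \<in> S ==> \<exists>e\<ge>f. Q s e" "!!s e e'. Q s e ==> e \<le> e' ==> Q s e'"
 shows "\<exists>e\<ge>f. \<forall>s\<in>S. Q s e"
 using assms(1,2)
proof (induction S rule: finite_induct)
 case empty
 then show ?case by auto
next
 case (insert s S)
 obtain e where e: "e \<ge> f" "\<forall>s\<in>S. Q s e" using insert.IH insert.prems by (metis insertCI)
 obtain e' where e': "e' \<ge> f" "Q s e'" using insert.prems by auto
 have "\<forall>s\<in>insert s S. Q s (max e e')" using e e' assms(3) by (metis insert_iff max.cobounded1 max.cobounded2)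
 then show ?case using e(1) by (intro exI[of _ "max e e'"]) auto
qed

section \<open>Colimit presentations that are stable under maps between pushforwards\<close>

context char_ring
begin

lemma power_module_minus:
 assumes f: "f \<in> carrier (power_module R p e X)" and g: "g \<in> carrier (power_module R p e X)"
 shows "f \<ominus>\<^bsub>power_module R p e X\<^esub> g = (\<lambda>i. f i \<ominus> g i)"
proof -
 interpret PM: module R "power_module R p e X" by (rule power_module_module)
 have "f \<ominus>\<^bsub>power_module R p e X\<^esub> g = f \<oplus>\<^bsub>power_module R p e X\<^esub> (\<ominus> \<one>) \<odot>\<^bsub>power_module R p e X\<^esub> g"
  using g by (simp add: a_minus_def PM.smult_l_minus)
 then show ?thesis
  using power_module_closed[OF f] power_module_closed[OF g] by (simp add: power_module_simps a_minus_def fr_minus l_minus)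
qed

text \<open>The exponent p^e moves from the coefficients of the differential to the module
  structure, and the coefficients x_j that remain are the same at all levels.\<close>

lemma cobd_power_module:
 "cobd (power_module R p 0 X) (\<lambda>j. fr e (x j)) l c = cobd (power_module R p e X) x l c" if "!!j. x j \<in> carrier R"
 using that by (induction l arbitrary: c) (simp_all add: a_minus_def a_inv_def power_module_def m_inv_def)

lemma frob_hom_power_module:
 assumes \<phi>: "\<phi> \<in> frob_hom R p e e'"
 shows "(\<lambda>z i. \<phi> (z i)) \<in> mod_hom R (power_module R p e X) (power_module R p e' X)"
 unfolding mod_hom_def
proof (intro CollectI conjI ballI)
 show "(\<lambda>z i. \<phi> (z i)) \<in> carrier (power_module R p e X) \<rightarrow> carrier (power_module R p e' X)"
  using frob_homD(1)[OF \<phi>] frob_hom_zero[OF \<phi>] by (auto simp: power_module_simps)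
 fix z assume z: "z \<in> carrier (power_module R p e X)"
 note zc = power_module_closed[OF z]
 show "(\<lambda>i. \<phi> ((r \<odot>\<^bsub>power_module R p e X\<^esub> z) i)) = r \<odot>\<^bsub>power_module R p e' X\<^esub> (\<lambda>i. \<phi> (z i))"
  if "r \<in> carrier R" for r using zc that frob_homD(3)[OF \<phi>] by (simp add: power_module_simps)
 fix z' assume z': "z' \<in> carrier (power_module R p e X)"
 show "(\<lambda>i. \<phi> ((z \<oplus>\<^bsub>power_module R p e X\<^esub> z') i)) = (\<lambda>i. \<phi> (z i)) \<oplus>\<^bsub>power_module R p e' X\<^esub> (\<lambda>i. \<phi> (z' i))"
  using zc power_module_closed[OF z'] frob_homD(2)[OF \<phi>] by (simp add: power_module_simps)
qed

end

text \<open>Stability is demanded under homomorphisms between any two levels in either direction,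
  whereas the transition factors \<tau> only have to respect B. The subsets \<open>Z e\<close> and
  \<open>B e\<close> are submodules for the ordinary action of R, hence also for the action through
  F^e_*R. Lists serve as indices so that an iteration can concatenate them.\<close>

locale frob_pres = char_ring R p for R :: "('a, 'k) ring_scheme" (structure) and p +
 fixes X :: "nat list set" and Z B :: "nat => (nat list => 'a) set" and \<tau> :: "nat => nat => nat list => 'a"
  and M :: "('a, 'm) module" and \<rho> :: "nat => (nat list => 'a) => 'm => bool"
 assumes fin: "finite X" and M_module: "module R M"
  and Z_submodule: "submodule (Z e) R (power_module R p 0 X)"
  and B_submodule: "submodule (B e) R (power_module R p 0 X)"
  and Z_frob: "\<phi> \<in> frob_hom R p e e' ==> z \<in> Z e ==> (\<lambda>i. \<phi> (z i)) \<in> Z e'"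
  and B_frob: "\<phi> \<in> frob_hom R p e e' ==> z \<in> B e ==> (\<lambda>i. \<phi> (z i)) \<in> B e'"
  and \<tau>_closed: "\<tau> e e' i \<in> carrier R"
  and \<tau>_same: "\<tau> e e i = \<one>"
  and \<tau>_\<tau>: "e \<le> e' ==> e' \<le> e'' ==> \<tau> e' e'' i \<otimes> \<tau> e e' i = \<tau> e e'' i"
  and B_\<tau>: "e \<le> e' ==> z \<in> B e ==> (\<lambda>i. \<tau> e e' i \<otimes> z i) \<in> B e'"
  and pres: "colim_pres R (ring_module R) M \<tau> Z B (carrier M) {\<zero>.M} \<rho>"
begin

sublocale M: module R M by (rule M_module)

abbreviation PM where "PM \<equiv> power_module R p 0 X"

sublocale PM: module R PM by (rule power_module_module)

lemmas PM_simps = power_module_simps[where e = 0 and X = X]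

lemma ring_module_simps [simp]: "add (ring_module R) = add R" "smult (ring_module R) = monoid.mult R"
 by (simp_all add: ring_module_def)

lemmas \<rho>D = colim_presD[OF pres, unfolded ring_module_simps]

lemma Z_PM: "z \<in> Z e ==> z \<in> carrier PM" by (rule PM.submodule_simps(1)[OF Z_submodule])

lemma \<rho>_PM: "\<rho> e z u ==> z \<in> carrier PM" by (rule Z_PM[OF \<rho>D(1)])

lemma \<rho>_smult: "r \<in> carrier R ==> \<rho> e z u ==> \<rho> e (r \<odot>.PM z) (r \<odot>.M u)"
 using \<rho>D(6)[of r e z u] by (simp add: PM_simps)

lemma \<rho>_add: "\<rho> e z u ==> \<rho> e z' u' ==> \<rho> e (z \<oplus>.PM z') (u \<oplus>.M u')"
 using \<rho>D(5)[of e z u z' u'] by (simp add: PM_simps)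

lemma \<rho>_minus: "\<rho> e z u ==> \<rho> e z' u' ==> \<rho> e (z \<ominus>.PM z') (u \<ominus>.M u')"
 using \<rho>_add[of e z u "(\<ominus> \<one>) \<odot>.PM z'" "(\<ominus> \<one>) \<odot>.M u'"] \<rho>_smult[of "\<ominus> \<one>" e z' u'] \<rho>_PM[of e z' u'] \<rho>D(2)[of e z' u']
 by (simp add: M.smult_l_minus PM.smult_l_minus a_minus_def)

lemma \<rho>_zero: "\<rho> e \<zero>.PM \<zero>.M"
proof -
 obtain u where u: "\<rho> e \<zero>.PM u" using \<rho>D(3)[OF PM.submodule_simps(2)[OF Z_submodule]] ..
 show ?thesis using \<rho>_smult[OF zero_closed u] \<rho>D(2)[OF u] by simp
qed

lemma \<rho>_B: "\<rho> e z u ==> z \<in> B e ==> u = \<zero>.M"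
 using \<rho>D(8)[of e z u] power_module_closed[OF \<rho>_PM, of e z u] by (auto simp: \<tau>_same)

definition push :: "nat => nat => (nat list => 'a) => nat list => 'a" where
 "push e e' z = (\<lambda>i. \<tau> e e' i \<otimes> z i)"

lemma push_hom: "push e e' \<in> mod_hom R PM PM"
 unfolding mod_hom_def
proof (intro CollectI conjI ballI)
 show "push e e' \<in> carrier PM \<rightarrow> carrier PM" using \<tau>_closed by (auto simp: push_def PM_simps)
 fix z assume z: "z \<in> carrier PM"
 note zc = power_module_closed[OF z]
 show "push e e' (r \<odot>.PM z) = r \<odot>.PM push e e' z" if "r \<in> carrier R" for r
  using zc that \<tau>_closed by (simp add: push_def PM_simps m_lcomm)
 fix z' assume z': "z' \<in> carrier PM"
 show "push e e' (z \<oplus>.PM z') = push e e' z \<oplus>.PM push e e' z'"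
  using zc power_module_closed[OF z'] \<tau>_closed by (simp add: push_def PM_simps r_distr)
qed

lemma push_B: "e \<le> e' ==> z \<in> B e ==> push e e' z \<in> B e'"
 unfolding push_def by (rule B_\<tau>)

lemma push_\<rho>: "e \<le> e' ==> \<rho> e z u ==> \<rho> e' (push e e' z) u"
 unfolding push_def by (rule \<rho>D(7))

lemma push_push: "e \<le> e' ==> e' \<le> e'' ==> z \<in> carrier PM ==> push e' e'' (push e e' z) = push e e'' z"
 unfolding push_def using \<tau>_closed power_module_closed[of z 0 X]
 by (simp add: m_assoc[symmetric] \<tau>_\<tau>)

lemma \<rho>_zero_push: "\<rho> e z \<zero>.M ==> \<exists>e'\<ge>e. push e e' z \<in> B e'"
 using \<rho>D(8)[of e z "\<zero>.M"] by (simp add: push_def)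

text \<open>Once an element has entered B it stays there at later levels, so finitely many elements
  can be handled at the maximum of their levels.\<close>

lemma \<rho>_zero_push_uniform:
 assumes S: "finite S" and z: "!!s. s \<in> S ==> \<rho> e (z s) \<zero>.M"
 shows "\<exists>f\<ge>e. \<forall>s\<in>S. push e f (z s) \<in> B f"
proof -
 have "\<exists>f\<ge>e. \<forall>s\<in>S. e \<le> f \<and> z s \<in> carrier PM \<and> push e f (z s) \<in> B f"
 proof (rule uniform_level[OF S])
  fix s assume "s \<in> S"
  then show "\<exists>f\<ge>e. e \<le> f \<and> z s \<in> carrier PM \<and> push e f (z s) \<in> B f"
   using \<rho>_zero_push[OF z] \<rho>_PM[OF z] by blast
 next
  fix s f f' assume *: "e \<le> f \<and> z s \<in> carrier PM \<and> push e f (z s) \<in> B f" and f: "f \<le> f'"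
  have "push f f' (push e f (z s)) \<in> B f'" by (rule push_B[OF f]) (use * in simp)
  then show "e \<le> f' \<and> z s \<in> carrier PM \<and> push e f' (z s) \<in> B f'" using * f push_push[of e f f' "z s"] by simp
 qed
 then show ?thesis by blast
qed

lemma \<rho>_lift_uniform:
 assumes S: "finite S" and u: "!!s. s \<in> S ==> u s \<in> carrier M"
 shows "\<exists>f\<ge>e. \<exists>z. \<forall>s\<in>S. \<rho> f (z s) (u s)"
proof -
 have "\<exists>f\<ge>e. \<forall>s\<in>S. \<exists>z. \<rho> f z (u s)"
 proof (rule uniform_level[OF S])
  fix s assume "s \<in> S"
  from \<rho>D(4)[OF u[OF this]] obtain f z where "\<rho> f z (u s)" by (elim exE)
  then have "\<rho> (max e f) (push f (max e f) z) (u s)" by (rule push_\<rho>[rotated]) simp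
  then show "\<exists>f\<ge>e. \<exists>z. \<rho> f z (u s)" using max.cobounded1 by blast
 next
  fix s f f' assume "\<exists>z. \<rho> f z (u s)" "f \<le> f'"
  then show "\<exists>z. \<rho> f' z (u s)" using push_\<rho> by blast
 qed
 then obtain f where "f \<ge> e" "\<forall>s\<in>S. \<exists>z. \<rho> f z (u s)" by blast
 then show ?thesis using bchoice[of S "\<lambda>s z. \<rho> f z (u s)"] by blast
qed

lemma \<rho>_cobd:
 assumes y: "!!j. y j \<in> carrier R"
 shows "l \<in> idx t n ==> (!!l. l \<in> pred_idx t n ==> \<rho> e (z l) (u l)) ==> \<rho> e (cobd PM y l z) (cobd M y l u)"
proof (induction l arbitrary: n z u)
 case Nil
 show ?case by (simp add: \<rho>_zero)
next
 case (Cons j l)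
 obtain k where n: "n = Suc k" using Cons.prems(1) by (cases n) (auto simp: idx_def)
 have l: "j < t" "l \<in> idx t k" using Cons.prems(1) n idx_Cons by auto
 have jm: "j # m \<in> idx t k" if "m \<in> pred_idx t k" for m using that l by (auto simp: pred_idx_def idx_def)
 have "\<rho> e (cobd PM y l (\<lambda>m. z (j # m))) (cobd M y l (\<lambda>m. u (j # m)))"
  by (rule Cons.IH[OF l(2)]) (use jm Cons.prems(2) n in simp)
 moreover have "\<rho> e (y j \<odot>.PM z l) (y j \<odot>.M u l)" by (rule \<rho>_smult[OF y]) (use Cons.prems(2) l n in simp)
 ultimately show ?case unfolding cobd.simps by (rule \<rho>_minus[rotated])
qed

end

section \<open>Applying one more local cohomology functor\<close>

locale frob_pres_cech = frob_pres R p X Z B \<tau> M \<rho> + cech R p x t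
 for R :: "('a, 'k) ring_scheme" (structure) and p X Z B \<tau> and M :: "('a, 'm) module" and \<rho> x t +
 fixes n :: nat and H :: "('a, 'e) module" and \<sigma> :: "nat => (nat list => 'm) => 'e => bool"
 assumes H_module: "module R H"
  and presH: "colim_pres R M H trans (cocycles M (carrier M) n) (coboundaries M (carrier M) n) (carrier H) {\<zero>.H} \<sigma>"
begin

lemmas \<sigma>D = colim_presD[OF presH]

text \<open>A cochain with values in functions on \<open>X\<close> is encoded as a function on concatenations.\<close>

definition X' where "X' = {l @ m | l m. l \<in> idx t n \<and> m \<in> X}"

definition slice :: "(nat list => 'a) => nat list => nat list => 'a" where
 "slice z l = (\<lambda>m. z (l @ m))"

definition pack :: "(nat list => nat list => 'a) => nat list => 'a" where
 "pack c = (\<lambda>i. if take n i \<in> idx t n then c (take n i) (drop n i) else \<zero>)"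

text \<open>The cocycle condition is imposed modulo \<open>B e\<close> at level e itself, not merely
  in the colimit. This form is preserved by maps between levels; a cochain whose differential
  vanishes only in the colimit is represented at a later level.\<close>

definition Z' where
 "Z' e = {z \<in> carrier (power_module R p 0 X'). (\<forall>l\<in>idx t n. slice z l \<in> Z e) \<and>
  (\<forall>l\<in>idx t (Suc n). D PM e l (slice z) \<in> B e)}"

definition B' where
 "B' e = {z \<in> carrier (power_module R p 0 X'). \<exists>b. (\<forall>l\<in>pred_idx t n. b l \<in> Z e) \<and>
  (\<forall>l\<in>idx t n. slice z l \<ominus>.PM D PM e l b \<in> B e)}"

definition \<tau>' where "\<tau>' e e' i = trans e e' (take n i) \<otimes> \<tau> e e' (drop n i)"

definition \<rho>' where "\<rho>' e z h \<longleftrightarrow> z \<in> Z' e \<and> (\<exists>c. \<sigma> e c h \<and> (\<forall>l\<in>idx t n. \<rho> e (slice z l) (c l)))"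

abbreviation PM' where "PM' \<equiv> power_module R p 0 X'"

sublocale PM': module R PM' by (rule power_module_module)

sublocale H: module R H by (rule H_module)

lemma finite_X': "finite X'"
proof -
 have "X' = (\<lambda>(l, m). l @ m) ` (idx t n \<times> X)" by (auto simp: X'_def)
 then show ?thesis using fin finite_idx by simp
qed

lemma PM_smult: "r \<in> carrier R ==> r \<odot>.PM z = (\<lambda>i. r \<otimes> z i)"
 by (simp add: PM_simps)

lemma append_X': "l \<in> idx t n ==> l @ m \<in> X' \<longleftrightarrow> m \<in> X"
 by (auto simp: X'_def idx_def)

lemma slice_PM: "z \<in> carrier PM' ==> l \<in> idx t n ==> slice z l \<in> carrier PM"
 by (simp add: power_module_simps slice_def append_X')

lemma slice_add: "slice (z \<oplus>.PM' z') = (\<lambda>l. slice z l \<oplus>.PM slice z' l)"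
 by (simp add: slice_def power_module_simps fun_eq_iff)

lemma slice_smult: "slice (r \<odot>.PM' z) = (\<lambda>l. r \<odot>.PM slice z l)"
 by (simp add: slice_def power_module_simps fun_eq_iff)

lemma slice_zero: "slice \<zero>.PM' = (\<lambda>_. \<zero>.PM)"
 by (simp add: slice_def power_module_simps fun_eq_iff)

lemma slice_pack: "l \<in> idx t n ==> slice (pack c) l = c l"
 by (auto simp: slice_def pack_def idx_def)

lemma pack_PM':
 assumes c: "!!l. l \<in> idx t n ==> c l \<in> carrier PM"
 shows "pack c \<in> carrier PM'"
 unfolding power_module_simps
proof (intro conjI ballI allI impI)
 show "pack c i \<in> carrier R" for i using power_module_closed[OF c] by (simp add: pack_def)
 show "pack c i = \<zero>" if i: "i \<notin> X'" for i
 proof (cases "take n i \<in> idx t n")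
  case True
  have "drop n i \<notin> X" using append_X'[OF True, of "drop n i"] i by simp
  then show ?thesis using c[OF True] by (simp add: pack_def power_module_simps)
 qed (simp add: pack_def)
qed

lemma D_closed: "l \<in> idx t k ==> (!!l. l \<in> pred_idx t k ==> c l \<in> carrier PM) ==> D PM e l c \<in> carrier PM"
 by (rule PM.cobd_closed[OF ypow_closed])

lemma Z'_PM: "z \<in> Z' e ==> z \<in> carrier PM'" and Z'_slice: "z \<in> Z' e ==> l \<in> idx t n ==> slice z l \<in> Z e"
 and Z'_D: "z \<in> Z' e ==> l \<in> idx t (Suc n) ==> D PM e l (slice z) \<in> B e"
 by (simp_all add: Z'_def)

lemmas Z_simps = PM.submodule_simps[OF Z_submodule]
lemmas B_simps = PM.submodule_simps[OF B_submodule]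

lemma Z'_submodule: "submodule (Z' e) R PM'"
proof (rule PM'.submoduleI')
 have "D PM e l (slice \<zero>.PM') \<in> B e" if "l \<in> idx t (Suc n)" for l
  unfolding slice_zero using PM.cobd_zero[OF ypow_closed that] B_simps(2) by simp
 then show "\<zero>.PM' \<in> Z' e" using Z_simps(2) by (simp add: Z'_def slice_zero)
next
 fix z z' assume z: "z \<in> Z' e" and z': "z' \<in> Z' e"
 have "D PM e l (slice (z \<oplus>.PM' z')) \<in> B e" if l: "l \<in> idx t (Suc n)" for l
  unfolding slice_add
  by (subst PM.cobd_add[OF ypow_closed l])
   (use B_simps(3)[OF Z'_D[OF z l] Z'_D[OF z' l]] slice_PM[OF Z'_PM[OF z]] slice_PM[OF Z'_PM[OF z']] in simp_all)
 then show "z \<oplus>.PM' z' \<in> Z' e"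
  using Z_simps(3)[OF Z'_slice[OF z] Z'_slice[OF z']] Z'_PM[OF z] Z'_PM[OF z'] by (simp add: Z'_def slice_add)
next
 fix r z assume r: "r \<in> carrier R" and z: "z \<in> Z' e"
 have "D PM e l (slice (r \<odot>.PM' z)) \<in> B e" if l: "l \<in> idx t (Suc n)" for l
  unfolding slice_smult
  by (subst PM.cobd_smult[OF ypow_closed r l])
   (use B_simps(4)[OF r Z'_D[OF z l]] slice_PM[OF Z'_PM[OF z]] in simp_all)
 then show "r \<odot>.PM' z \<in> Z' e"
  using Z_simps(4)[OF r Z'_slice[OF z]] Z'_PM[OF z] r by (simp add: Z'_def slice_smult)
qed (auto simp: Z'_def)

lemma B'E:
 assumes "z \<in> B' e"
 obtains b where "!!l. l \<in> pred_idx t n ==> b l \<in> Z e"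
  "!!l. l \<in> idx t n ==> slice z l \<ominus>.PM D PM e l b \<in> B e"
 using assms by (auto simp: B'_def)

lemma B'I:
 assumes "z \<in> carrier PM'" "!!l. l \<in> pred_idx t n ==> b l \<in> Z e"
  "!!l. l \<in> idx t n ==> slice z l \<ominus>.PM D PM e l b \<in> B e"
 shows "z \<in> B' e"
 using assms by (auto simp: B'_def)

lemma B'_submodule: "submodule (B' e) R PM'"
proof (rule PM'.submoduleI')
 show "\<zero>.PM' \<in> B' e"
 proof (rule B'I)
  show "\<zero>.PM \<in> Z e" by (rule Z_simps(2))
  show "slice \<zero>.PM' l \<ominus>.PM D PM e l (\<lambda>_. \<zero>.PM) \<in> B e" if "l \<in> idx t n" for l
   using PM.cobd_zero[OF ypow_closed that] B_simps(2) by (simp add: slice_zero a_minus_def PM.M.r_neg)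
 qed simp
next
 fix z z' assume z: "z \<in> B' e" and z': "z' \<in> B' e"
 have c: "z \<in> carrier PM'" "z' \<in> carrier PM'" using z z' by (simp_all add: B'_def)
 obtain b where b: "!!l. l \<in> pred_idx t n ==> b l \<in> Z e"
  "!!l. l \<in> idx t n ==> slice z l \<ominus>.PM D PM e l b \<in> B e" using z by (rule B'E) blast
 obtain b' where b': "!!l. l \<in> pred_idx t n ==> b' l \<in> Z e"
  "!!l. l \<in> idx t n ==> slice z' l \<ominus>.PM D PM e l b' \<in> B e" using z' by (rule B'E) blast
 show "z \<oplus>.PM' z' \<in> B' e"
 proof (rule B'I)
  show "b l \<oplus>.PM b' l \<in> Z e" if "l \<in> pred_idx t n" for l by (rule Z_simps(3)[OF b(1)[OF that] b'(1)[OF that]])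
  fix l assume l: "l \<in> idx t n"
  have "D PM e l (\<lambda>l. b l \<oplus>.PM b' l) = D PM e l b \<oplus>.PM D PM e l b'"
   by (rule PM.cobd_add[OF ypow_closed l]) (auto intro: Z_PM b b')
  moreover have "D PM e l b \<in> carrier PM" "D PM e l b' \<in> carrier PM"
   by (rule D_closed[OF l], auto intro: Z_PM b b')+
  ultimately have "slice (z \<oplus>.PM' z') l \<ominus>.PM D PM e l (\<lambda>l. b l \<oplus>.PM b' l) =
    (slice z l \<ominus>.PM D PM e l b) \<oplus>.PM (slice z' l \<ominus>.PM D PM e l b')"
   using slice_PM[OF c(1) l] slice_PM[OF c(2) l] by (simp add: slice_add a_minus_def PM.M.minus_add PM.M.a_ac)
  then show "slice (z \<oplus>.PM' z') l \<ominus>.PM D PM e l (\<lambda>l. b l \<oplus>.PM b' l) \<in> B e"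
   using B_simps(3)[OF b(2)[OF l] b'(2)[OF l]] by simp
 qed (use c in simp)
next
 fix r z assume r: "r \<in> carrier R" and z: "z \<in> B' e"
 have c: "z \<in> carrier PM'" using z by (simp add: B'_def)
 obtain b where b: "!!l. l \<in> pred_idx t n ==> b l \<in> Z e"
  "!!l. l \<in> idx t n ==> slice z l \<ominus>.PM D PM e l b \<in> B e" using z by (rule B'E) blast
 show "r \<odot>.PM' z \<in> B' e"
 proof (rule B'I)
  show "r \<odot>.PM b l \<in> Z e" if "l \<in> pred_idx t n" for l by (rule Z_simps(4)[OF r b(1)[OF that]])
  fix l assume l: "l \<in> idx t n"
  have "D PM e l (\<lambda>l. r \<odot>.PM b l) = r \<odot>.PM D PM e l b"
   by (rule PM.cobd_smult[OF ypow_closed r l]) (auto intro: Z_PM b)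
  moreover have "D PM e l b \<in> carrier PM" by (rule D_closed[OF l]) (auto intro: Z_PM b)
  ultimately have "slice (r \<odot>.PM' z) l \<ominus>.PM D PM e l (\<lambda>l. r \<odot>.PM b l) = r \<odot>.PM (slice z l \<ominus>.PM D PM e l b)"
   using slice_PM[OF c l] r by (simp add: slice_smult a_minus_def PM.smult_r_distr PM.smult_r_minus)
  then show "slice (r \<odot>.PM' z) l \<ominus>.PM D PM e l (\<lambda>l. r \<odot>.PM b l) \<in> B e"
   using B_simps(4)[OF r b(2)[OF l]] by simp
 qed (use c r in simp)
qed (auto simp: B'_def)

text \<open>Over F^e_*R and F^e'_*R the two differentials have the same coefficients x_j, so the
  linear map \<phi> commutes with them.\<close>

lemma D_frob:
 assumes \<phi>: "\<phi> \<in> frob_hom R p e e'" and l: "l \<in> idx t k" and c: "!!l. l \<in> pred_idx t k ==> c l \<in> carrier PM"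
 shows "D PM e' l (\<lambda>l i. \<phi> (c l i)) = (\<lambda>i. \<phi> (D PM e l c i))"
proof -
 interpret PMe: module R "power_module R p e X" by (rule power_module_module)
 have "ypow f = (\<lambda>j. fr f (x j))" for f by (rule ext) (rule ypow_def)
 then have D: "D PM f l c = cobd (power_module R p f X) x l c" for f c
  by (simp only:) (rule cobd_power_module[OF x_closed])
 have "(\<lambda>i. \<phi> (cobd (power_module R p e X) x l c i)) = cobd (power_module R p e' X) x l (\<lambda>l i. \<phi> (c l i))"
  by (rule PMe.cobd_hom[OF x_closed power_module_module frob_hom_power_module[OF \<phi>] l])
   (use c in \<open>simp add: power_module_simps\<close>)
 then show ?thesis unfolding D ..
qed

lemma frob_minus:
 assumes \<phi>: "\<phi> \<in> frob_hom R p e e'" and z: "z \<in> carrier PM" "z' \<in> carrier PM"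
 shows "(\<lambda>i. \<phi> (z i)) \<ominus>.PM (\<lambda>i. \<phi> (z' i)) = (\<lambda>i. \<phi> ((z \<ominus>.PM z') i))"
proof -
 have *: "(\<lambda>i. \<phi> (u i)) \<in> carrier PM" if "u \<in> carrier PM" for u
  using that frob_homD(1)[OF \<phi>] frob_hom_zero[OF \<phi>] by (simp add: power_module_simps)
 show ?thesis
  using power_module_closed[OF z(1)] power_module_closed[OF z(2)] frob_hom_minus[OF \<phi>]
  by (simp add: power_module_minus[OF *[OF z(1)] *[OF z(2)]] power_module_minus[OF z])
qed

lemma Z'_frob:
 assumes \<phi>: "\<phi> \<in> frob_hom R p e e'" and z: "z \<in> Z' e"
 shows "(\<lambda>i. \<phi> (z i)) \<in> Z' e'"
proof -
 have s: "slice (\<lambda>i. \<phi> (z i)) = (\<lambda>l i. \<phi> (slice z l i))" by (simp add: slice_def fun_eq_iff)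
 have "(\<lambda>i. \<phi> (z i)) \<in> carrier PM'"
  using Z'_PM[OF z] frob_homD(1)[OF \<phi>] frob_hom_zero[OF \<phi>] by (simp add: power_module_simps)
 moreover have "D PM e' l (slice (\<lambda>i. \<phi> (z i))) \<in> B e'" if l: "l \<in> idx t (Suc n)" for l
  unfolding s by (subst D_frob[OF \<phi> l]) (use B_frob[OF \<phi> Z'_D[OF z l]] slice_PM[OF Z'_PM[OF z]] in simp_all)
 ultimately show ?thesis using Z_frob[OF \<phi> Z'_slice[OF z]] by (simp add: Z'_def s)
qed

lemma B'_frob:
 assumes \<phi>: "\<phi> \<in> frob_hom R p e e'" and z: "z \<in> B' e"
 shows "(\<lambda>i. \<phi> (z i)) \<in> B' e'"
proof -
 have c: "z \<in> carrier PM'" using z by (simp add: B'_def)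
 obtain b where b: "!!l. l \<in> pred_idx t n ==> b l \<in> Z e"
  "!!l. l \<in> idx t n ==> slice z l \<ominus>.PM D PM e l b \<in> B e" using z by (rule B'E) blast
 show ?thesis
 proof (rule B'I)
  show "(\<lambda>i. \<phi> (z i)) \<in> carrier PM'"
   using c frob_homD(1)[OF \<phi>] frob_hom_zero[OF \<phi>] by (simp add: power_module_simps)
  show "(\<lambda>i. \<phi> (b l i)) \<in> Z e'" if "l \<in> pred_idx t n" for l by (rule Z_frob[OF \<phi> b(1)[OF that]])
  fix l assume l: "l \<in> idx t n"
  have D: "D PM e l b \<in> carrier PM" by (rule D_closed[OF l]) (auto intro: Z_PM b)
  have "D PM e' l (\<lambda>l i. \<phi> (b l i)) = (\<lambda>i. \<phi> (D PM e l b i))"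
   by (rule D_frob[OF \<phi> l]) (auto intro: Z_PM b)
  then have "slice (\<lambda>i. \<phi> (z i)) l \<ominus>.PM D PM e' l (\<lambda>l i. \<phi> (b l i)) = (\<lambda>i. \<phi> ((slice z l \<ominus>.PM D PM e l b) i))"
   using frob_minus[OF \<phi> slice_PM[OF c l] D] by (simp add: slice_def)
  then show "slice (\<lambda>i. \<phi> (z i)) l \<ominus>.PM D PM e' l (\<lambda>l i. \<phi> (b l i)) \<in> B e'"
   using B_frob[OF \<phi> b(2)[OF l]] by simp
 qed
qed

lemma \<tau>'_closed: "\<tau>' e e' i \<in> carrier R" using \<tau>_closed trans_closed by (simp add: \<tau>'_def)

lemma \<tau>'_same: "\<tau>' e e i = \<one>" by (simp add: \<tau>'_def trans_same \<tau>_same)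

lemma \<tau>'_\<tau>':
 assumes "e \<le> e'" "e' \<le> e''"
 shows "\<tau>' e' e'' i \<otimes> \<tau>' e e' i = \<tau>' e e'' i"
proof -
 have c: "trans e e' (take n i) \<in> carrier R" "trans e' e'' (take n i) \<in> carrier R"
  "\<tau> e e' (drop n i) \<in> carrier R" "\<tau> e' e'' (drop n i) \<in> carrier R" by (rule trans_closed \<tau>_closed)+
 have "\<tau>' e' e'' i \<otimes> \<tau>' e e' i =
   (trans e' e'' (take n i) \<otimes> trans e e' (take n i)) \<otimes> (\<tau> e' e'' (drop n i) \<otimes> \<tau> e e' (drop n i))"
  unfolding \<tau>'_def using c by (simp add: m_ac)
 then show ?thesis unfolding \<tau>'_def by (simp add: trans_trans[OF assms] \<tau>_\<tau>[OF assms])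
qed

definition push' where "push' e e' z = (\<lambda>i. \<tau>' e e' i \<otimes> z i)"

lemma push'_PM: "z \<in> carrier PM' ==> push' e e' z \<in> carrier PM'"
 using \<tau>'_closed by (simp add: push'_def power_module_simps)

lemma slice_push':
 assumes z: "z \<in> carrier PM'" and l: "l \<in> idx t n"
 shows "slice (push' e e' z) l = trans e e' l \<odot>.PM push e e' (slice z l)"
proof -
 have "length l = n" using l by (simp add: idx_def)
 then show ?thesis
  using trans_closed \<tau>_closed power_module_closed[OF z]
  by (simp add: slice_def push'_def push_def PM_smult \<tau>'_def m_assoc)
qed

lemma D_push:
 assumes e: "e \<le> e'" and l: "l \<in> idx t k" and c: "!!l. l \<in> pred_idx t k ==> c l \<in> carrier PM"
 shows "D PM e' l (\<lambda>l. trans e e' l \<odot>.PM push e e' (c l)) = trans e e' l \<odot>.PM push e e' (D PM e l c)"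
proof -
 have "D PM e' l (\<lambda>l. trans e e' l \<odot>.PM push e e' (c l)) = trans e e' l \<odot>.PM D PM e l (\<lambda>l. push e e' (c l))"
  by (rule cobd_trans[OF PM.module_axioms e l]) (use c mod_homD(1)[OF push_hom] in simp)
 also have "D PM e l (\<lambda>l. push e e' (c l)) = push e e' (D PM e l c)"
  by (rule PM.cobd_hom[OF ypow_closed PM.module_axioms push_hom l, symmetric]) (rule c)
 finally show ?thesis .
qed

lemma D_slice_push':
 assumes e: "e \<le> e'" and z: "z \<in> carrier PM'" and l: "l \<in> idx t (Suc n)"
 shows "D PM e' l (slice (push' e e' z)) = trans e e' l \<odot>.PM push e e' (D PM e l (slice z))"
proof -
 have "D PM e' l (slice (push' e e' z)) = D PM e' l (\<lambda>l. trans e e' l \<odot>.PM push e e' (slice z l))"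
  by (rule PM.cobd_cong[OF l]) (simp add: slice_push'[OF z])
 then show ?thesis using D_push[OF e l, of "slice z"] slice_PM[OF z] by simp
qed

lemma \<rho>_trans: "e \<le> e' ==> \<rho> e z u ==> \<rho> e' (trans e e' l \<odot>.PM push e e' z) (trans e e' l \<odot>.M u)"
 by (rule \<rho>_smult[OF trans_closed push_\<rho>])

end

context frob_pres_cech
begin

lemma trans_push_minus:
 assumes "z \<in> carrier PM" "z' \<in> carrier PM"
 shows "trans e e' l \<odot>.PM push e e' z \<ominus>.PM trans e e' l \<odot>.PM push e e' z' =
  trans e e' l \<odot>.PM push e e' (z \<ominus>.PM z')"
 unfolding mod_hom_minus[OF push_hom PM.module_axioms PM.module_axioms assms]
 using mod_homD(1)[OF push_hom] assms trans_closed
 by (simp add: a_minus_def PM.smult_r_distr PM.smult_r_minus)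

lemma B'_\<tau>':
 assumes e: "e \<le> e'" and z: "z \<in> B' e"
 shows "(\<lambda>i. \<tau>' e e' i \<otimes> z i) \<in> B' e'"
 unfolding push'_def[symmetric]
proof -
 have c: "z \<in> carrier PM'" using z by (simp add: B'_def)
 obtain b where b: "!!l. l \<in> pred_idx t n ==> b l \<in> Z e"
  "!!l. l \<in> idx t n ==> slice z l \<ominus>.PM D PM e l b \<in> B e" using z by (rule B'E) blast
 show "push' e e' z \<in> B' e'"
 proof (rule B'I)
  show "trans e e' l \<odot>.PM push e e' (b l) \<in> Z e'" if lp: "l \<in> pred_idx t n" for l
  proof -
   obtain u where "\<rho> e (b l) u" using \<rho>D(3)[OF b(1)[OF lp]] ..
   from \<rho>D(1)[OF \<rho>_trans[OF e this]] show ?thesis .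
  qed
  fix l assume l: "l \<in> idx t n"
  have D: "D PM e l b \<in> carrier PM" by (rule D_closed[OF l]) (auto intro: Z_PM b)
  have "D PM e' l (\<lambda>l. trans e e' l \<odot>.PM push e e' (b l)) = trans e e' l \<odot>.PM push e e' (D PM e l b)"
   by (rule D_push[OF e l]) (auto intro: Z_PM b)
  then have "slice (push' e e' z) l \<ominus>.PM D PM e' l (\<lambda>l. trans e e' l \<odot>.PM push e e' (b l)) =
    trans e e' l \<odot>.PM push e e' (slice z l \<ominus>.PM D PM e l b)"
   using slice_PM[OF c l] D by (simp add: slice_push'[OF c l] trans_push_minus)
  then show "slice (push' e e' z) l \<ominus>.PM D PM e' l (\<lambda>l. trans e e' l \<odot>.PM push e e' (b l)) \<in> B e'"
   using B_simps(4)[OF trans_closed push_B[OF e b(2)[OF l]]] by simp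
 qed (rule push'_PM[OF c])
qed

lemma \<sigma>_carrier: "\<sigma> e c h ==> l \<in> idx t n ==> c l \<in> carrier M"
 using \<sigma>D(1)[of e c h] by (simp add: cocycles_def)

lemma \<rho>_D_slice:
 assumes "!!l. l \<in> idx t n ==> \<rho> e (slice z l) (c l)" "l \<in> idx t (Suc n)"
 shows "\<rho> e (D PM e l (slice z)) (D M e l c)"
 by (rule \<rho>_cobd[OF ypow_closed assms(2)]) (simp add: assms(1))

lemma \<rho>'_total:
 assumes z: "z \<in> Z' e"
 shows "\<exists>h. \<rho>' e z h"
proof -
 have "\<forall>l\<in>idx t n. \<exists>u. \<rho> e (slice z l) u" using \<rho>D(3)[OF Z'_slice[OF z]] by blast
 from bchoice[OF this] obtain c where c: "!!l. l \<in> idx t n ==> \<rho> e (slice z l) (c l)" by blast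
 have "c \<in> cocycles M (carrier M) n e"
  using \<rho>D(2)[OF c] \<rho>_B[OF \<rho>_D_slice[OF c] Z'_D[OF z]] by (simp add: cocycles_def)
 from \<sigma>D(3)[OF this] obtain h where "\<sigma> e c h" ..
 then show ?thesis using z c unfolding \<rho>'_def by blast
qed

text \<open>Two changes of level: at f the finitely many values of a cocycle over M have lifts, and
  at g the differentials of these lifts, which vanish in M, have entered B.\<close>

lemma \<rho>'_surj:
 assumes h: "h \<in> carrier H"
 shows "\<exists>e z. \<rho>' e z h"
proof -
 from \<sigma>D(4)[OF h] obtain e c where ec: "\<sigma> e c h" by (elim exE)
 obtain f \<zeta> where f: "e \<le> f" and \<zeta>: "!!l. l \<in> idx t n ==> \<rho> f (\<zeta> l) (c l)"
  using \<rho>_lift_uniform[where e = e and S = "idx t n" and u = c, OF finite_idx \<sigma>_carrier[OF ec]] by blast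
 define c' where "c' l = trans e f l \<odot>.M c l" for l
 have c': "\<sigma> f c' h" unfolding c'_def by (rule \<sigma>D(7)[OF f ec])
 define \<zeta>' where "\<zeta>' l = trans e f l \<odot>.PM \<zeta> l" for l
 have \<zeta>': "\<rho> f (\<zeta>' l) (c' l)" if "l \<in> idx t n" for l
  unfolding \<zeta>'_def c'_def by (rule \<rho>_smult[OF trans_closed \<zeta>[OF that]])
 have "\<rho> f (D PM f l \<zeta>') \<zero>.M" if l: "l \<in> idx t (Suc n)" for l
 proof -
  have "D M f l c' = \<zero>.M" using \<sigma>D(1)[OF c'] l by (simp add: cocycles_def)
  moreover have "\<rho> f (D PM f l \<zeta>') (D M f l c')" by (rule \<rho>_cobd[OF ypow_closed l]) (simp add: \<zeta>')
  ultimately show ?thesis by simp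
 qed
 from \<rho>_zero_push_uniform[where S = "idx t (Suc n)" and z = "\<lambda>l. D PM f l \<zeta>'", OF finite_idx this] obtain g where g: "f \<le> g"
  and B: "!!l. l \<in> idx t (Suc n) ==> push f g (D PM f l \<zeta>') \<in> B g" by blast
 define z where "z = pack (\<lambda>l. trans f g l \<odot>.PM push f g (\<zeta>' l))"
 have zl: "slice z l = trans f g l \<odot>.PM push f g (\<zeta>' l)" if "l \<in> idx t n" for l
  unfolding z_def by (rule slice_pack[OF that])
 have \<rho>z: "\<rho> g (slice z l) (trans f g l \<odot>.M c' l)" if "l \<in> idx t n" for l
  unfolding zl[OF that] by (rule \<rho>_trans[OF g \<zeta>'[OF that]])
 have "z \<in> Z' g"
  unfolding Z'_def
 proof (intro CollectI conjI ballI)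
  show "z \<in> carrier PM'" unfolding z_def by (rule pack_PM') (rule \<rho>_PM[OF \<rho>_trans[OF g \<zeta>']])
  show "slice z l \<in> Z g" if "l \<in> idx t n" for l by (rule \<rho>D(1)[OF \<rho>z[OF that]])
  fix l assume l: "l \<in> idx t (Suc n)"
  have "D PM g l (slice z) = D PM g l (\<lambda>l. trans f g l \<odot>.PM push f g (\<zeta>' l))"
   by (rule PM.cobd_cong[OF l]) (simp add: zl)
  also have "\<dots> = trans f g l \<odot>.PM push f g (D PM f l \<zeta>')"
   by (rule D_push[OF g l]) (simp add: \<rho>_PM[OF \<zeta>'])
  finally show "D PM g l (slice z) \<in> B g" using B_simps(4)[OF trans_closed B[OF l]] by simp
 qed
 moreover have "\<sigma> g (\<lambda>l. trans f g l \<odot>.M c' l) h" by (rule \<sigma>D(7)[OF g c'])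
 ultimately have "\<rho>' g z h" using \<rho>z unfolding \<rho>'_def by blast
 then show ?thesis by blast
qed

lemma \<rho>'_push':
 assumes e: "e \<le> e'" and r: "\<rho>' e z h"
 shows "\<rho>' e' (push' e e' z) h"
proof -
 obtain c where c: "\<sigma> e c h" "!!l. l \<in> idx t n ==> \<rho> e (slice z l) (c l)" and z: "z \<in> Z' e"
  using r unfolding \<rho>'_def by blast
 note zc = Z'_PM[OF z]
 have \<rho>z: "\<rho> e' (slice (push' e e' z) l) (trans e e' l \<odot>.M c l)" if "l \<in> idx t n" for l
  unfolding slice_push'[OF zc that] by (rule \<rho>_trans[OF e c(2)[OF that]])
 have "push' e e' z \<in> Z' e'"
  unfolding Z'_def
 proof (intro CollectI conjI ballI)
  show "push' e e' z \<in> carrier PM'" by (rule push'_PM[OF zc])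
  show "slice (push' e e' z) l \<in> Z e'" if "l \<in> idx t n" for l by (rule \<rho>D(1)[OF \<rho>z[OF that]])
  show "D PM e' l (slice (push' e e' z)) \<in> B e'" if l: "l \<in> idx t (Suc n)" for l
   unfolding D_slice_push'[OF e zc l] by (rule B_simps(4)[OF trans_closed push_B[OF e Z'_D[OF z l]]])
 qed
 moreover have "\<sigma> e' (\<lambda>l. trans e e' l \<odot>.M c l) h" by (rule \<sigma>D(7)[OF e c(1)])
 ultimately show ?thesis using \<rho>z unfolding \<rho>'_def by blast
qed

text \<open>Three changes of level: at e1 the cocycle over M becomes a coboundary, at f the bounding
  cochain lifts, and at g the discrepancy \<delta>, which vanishes in M, has entered B.\<close>

lemma \<rho>'_zero_iff_1:
 assumes r: "\<rho>' e z \<zero>.H"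
 shows "\<exists>e'\<ge>e. push' e e' z \<in> B' e'"
proof -
 obtain c where c: "\<sigma> e c \<zero>.H" "!!l. l \<in> idx t n ==> \<rho> e (slice z l) (c l)" and z: "z \<in> Z' e"
  using r unfolding \<rho>'_def by blast
 note zc = Z'_PM[OF z]
 from \<sigma>D(8)[OF c(1)] obtain e1 where e1: "e \<le> e1"
  and "(\<lambda>l. trans e e1 l \<odot>.M c l) \<in> coboundaries M (carrier M) n e1" by blast
 then obtain b where b: "!!l. l \<in> pred_idx t n ==> b l \<in> carrier M"
  and cb: "!!l. l \<in> idx t n ==> trans e e1 l \<odot>.M c l = D M e1 l b"
  unfolding coboundaries_def by blast
 obtain f \<beta> where f: "e1 \<le> f" and \<beta>: "!!l. l \<in> pred_idx t n ==> \<rho> f (\<beta> l) (b l)"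
  using \<rho>_lift_uniform[where e = e1 and S = "pred_idx t n" and u = b, OF finite_pred_idx b] by blast
 have ef: "e \<le> f" using e1 f by simp
 define \<beta>' where "\<beta>' l = trans e1 f l \<odot>.PM \<beta> l" for l
 have \<beta>': "\<rho> f (\<beta>' l) (trans e1 f l \<odot>.M b l)" if "l \<in> pred_idx t n" for l
  unfolding \<beta>'_def by (rule \<rho>_smult[OF trans_closed \<beta>[OF that]])
 define \<delta> where "\<delta> l = slice (push' e f z) l \<ominus>.PM D PM f l \<beta>'" for l
 have sz: "slice (push' e f z) l \<in> carrier PM" if "l \<in> idx t n" for l by (rule slice_PM[OF push'_PM[OF zc] that])
 have D\<beta>: "D PM f l \<beta>' \<in> carrier PM" if "l \<in> idx t n" for l by (rule D_closed[OF that]) (rule \<rho>_PM[OF \<beta>'])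
 have "\<rho> f (\<delta> l) \<zero>.M" if l: "l \<in> idx t n" for l
 proof -
  have cl: "c l \<in> carrier M" by (rule \<rho>D(2)[OF c(2)[OF l]])
  have "\<rho> f (D PM f l \<beta>') (D M f l (\<lambda>l. trans e1 f l \<odot>.M b l))"
   by (rule \<rho>_cobd[OF ypow_closed l]) (rule \<beta>')
  also have "D M f l (\<lambda>l. trans e1 f l \<odot>.M b l) = trans e1 f l \<odot>.M D M e1 l b"
   by (rule cobd_trans[OF M_module f l b])
  also have "\<dots> = trans e f l \<odot>.M c l"
   unfolding cb[OF l, symmetric] by (rule trans_smult_trans[OF M_module e1 f cl])
  finally have "\<rho> f (D PM f l \<beta>') (trans e f l \<odot>.M c l)" .
  moreover have "\<rho> f (slice (push' e f z) l) (trans e f l \<odot>.M c l)"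
   unfolding slice_push'[OF zc l] by (rule \<rho>_trans[OF ef c(2)[OF l]])
  ultimately have "\<rho> f (\<delta> l) (trans e f l \<odot>.M c l \<ominus>.M trans e f l \<odot>.M c l)"
   unfolding \<delta>_def by (rule \<rho>_minus[rotated])
  then show ?thesis using cl trans_closed by (simp add: a_minus_def M.M.r_neg)
 qed
 from \<rho>_zero_push_uniform[where S = "idx t n" and z = \<delta>, OF finite_idx this] obtain g where g: "f \<le> g"
  and B: "!!l. l \<in> idx t n ==> push f g (\<delta> l) \<in> B g" by blast
 have "push' e g z = push' f g (push' e f z)"
  using \<tau>'_\<tau>'[OF ef g] \<tau>'_closed power_module_closed[OF zc] by (simp add: push'_def m_assoc[symmetric])
 moreover have "push' f g (push' e f z) \<in> B' g"
 proof (rule B'I)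
  show "push' f g (push' e f z) \<in> carrier PM'" by (intro push'_PM zc)
  show "trans f g l \<odot>.PM push f g (\<beta>' l) \<in> Z g" if "l \<in> pred_idx t n" for l
   by (rule \<rho>D(1)[OF \<rho>_trans[OF g \<beta>'[OF that]]])
  fix l assume l: "l \<in> idx t n"
  have "D PM g l (\<lambda>l. trans f g l \<odot>.PM push f g (\<beta>' l)) = trans f g l \<odot>.PM push f g (D PM f l \<beta>')"
   by (rule D_push[OF g l]) (rule \<rho>_PM[OF \<beta>'])
  then have "slice (push' f g (push' e f z)) l \<ominus>.PM D PM g l (\<lambda>l. trans f g l \<odot>.PM push f g (\<beta>' l)) =
    trans f g l \<odot>.PM push f g (\<delta> l)"
   using sz[OF l] D\<beta>[OF l] by (simp add: \<delta>_def slice_push'[OF push'_PM[OF zc] l] trans_push_minus)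
  then show "slice (push' f g (push' e f z)) l \<ominus>.PM D PM g l (\<lambda>l. trans f g l \<odot>.PM push f g (\<beta>' l)) \<in> B g"
   using B_simps(4)[OF trans_closed B[OF l]] by simp
 qed
 moreover have "e \<le> g" using ef g by simp
 ultimately show ?thesis by auto
qed

lemma \<rho>'_zero_iff_2:
 assumes r: "\<rho>' e z h" and e: "e \<le> e'" and B: "push' e e' z \<in> B' e'"
 shows "h = \<zero>.H"
proof -
 obtain c where c: "\<sigma> e c h" "!!l. l \<in> idx t n ==> \<rho> e (slice z l) (c l)" and z: "z \<in> Z' e"
  using r unfolding \<rho>'_def by blast
 note zc = Z'_PM[OF z]
 obtain b where b: "!!l. l \<in> pred_idx t n ==> b l \<in> Z e'"
  "!!l. l \<in> idx t n ==> slice (push' e e' z) l \<ominus>.PM D PM e' l b \<in> B e'" using B by (rule B'E) blast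
 have "\<forall>l\<in>pred_idx t n. \<exists>u. \<rho> e' (b l) u" using \<rho>D(3)[OF b(1)] by blast
 from bchoice[OF this] obtain \<beta> where \<beta>: "!!l. l \<in> pred_idx t n ==> \<rho> e' (b l) (\<beta> l)" by blast
 have "trans e e' l \<odot>.M c l = D M e' l \<beta>" if l: "l \<in> idx t n" for l
 proof -
  have "\<rho> e' (slice (push' e e' z) l) (trans e e' l \<odot>.M c l)"
   unfolding slice_push'[OF zc l] by (rule \<rho>_trans[OF e c(2)[OF l]])
  moreover have "\<rho> e' (D PM e' l b) (D M e' l \<beta>)" by (rule \<rho>_cobd[OF ypow_closed l \<beta>])
  ultimately have "\<rho> e' (slice (push' e e' z) l \<ominus>.PM D PM e' l b) (trans e e' l \<odot>.M c l \<ominus>.M D M e' l \<beta>)"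
   by (rule \<rho>_minus)
  from \<rho>_B[OF this b(2)[OF l]] show ?thesis
   using M.M.minus_eq_zeroD[of "trans e e' l \<odot>.M c l" "D M e' l \<beta>"] \<rho>D(2)[OF c(2)[OF l]] trans_closed
    M.cobd_closed[OF ypow_closed l \<rho>D(2)[OF \<beta>]] by simp
 qed
 then have "(\<lambda>l. trans e e' l \<odot>.M c l) \<in> coboundaries M (carrier M) n e'"
  unfolding coboundaries_def using \<rho>D(2)[OF \<beta>] by blast
 then show ?thesis using \<sigma>D(8)[OF c(1)] e by blast
qed

theorem frob_pres_H: "frob_pres R p X' Z' B' \<tau>' H \<rho>'"
proof (intro frob_pres.intro frob_pres_axioms.intro)
 show "char_ring R p" by (rule char_ring_axioms)
 show "colim_pres R (ring_module R) H \<tau>' Z' B' (carrier H) {\<zero>.H} \<rho>'"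
 proof (rule colim_presI, unfold ring_module_simps)
  fix e z h assume r: "\<rho>' e z h"
  show "z \<in> Z' e" using r by (simp add: \<rho>'_def)
  show "h \<in> carrier H" using r \<sigma>D(2) unfolding \<rho>'_def by blast
 next
  show "\<exists>h. \<rho>' e z h" if "z \<in> Z' e" for e z by (rule \<rho>'_total[OF that])
  show "\<exists>e z. \<rho>' e z h" if "h \<in> carrier H" for h by (rule \<rho>'_surj[OF that])
  show "\<rho>' e' (\<lambda>i. \<tau>' e e' i \<otimes> z i) h" if "e \<le> e'" "\<rho>' e z h" for e e' z h
   using \<rho>'_push'[OF that] by (simp add: push'_def)
  show "\<exists>e'\<ge>e. (\<lambda>i. \<tau>' e e' i \<otimes> z i) \<in> B' e'" if "\<rho>' e z h" "h \<in> {\<zero>.H}" for e z h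
   using \<rho>'_zero_iff_1[of e z] that by (simp add: push'_def)
  show "h \<in> {\<zero>.H}" if "\<rho>' e z h" "e \<le> e'" "(\<lambda>i. \<tau>' e e' i \<otimes> z i) \<in> B' e'" for e e' z h
   using \<rho>'_zero_iff_2[OF that(1,2)] that(3) by (simp add: push'_def)
 next
  fix e z h z' h' assume "\<rho>' e z h" "\<rho>' e z' h'"
  then obtain c c' where c: "\<sigma> e c h" "!!l. l \<in> idx t n ==> \<rho> e (slice z l) (c l)" and z: "z \<in> Z' e"
   and c': "\<sigma> e c' h'" "!!l. l \<in> idx t n ==> \<rho> e (slice z' l) (c' l)" and z': "z' \<in> Z' e"
   unfolding \<rho>'_def by blast
  have "\<rho>' e (z \<oplus>.PM' z') (h \<oplus>.H h')"
   unfolding \<rho>'_def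
  proof (intro conjI exI ballI)
   show "z \<oplus>.PM' z' \<in> Z' e" by (rule PM'.submodule_simps(3)[OF Z'_submodule z z'])
   show "\<sigma> e (\<lambda>l. c l \<oplus>.M c' l) (h \<oplus>.H h')" by (rule \<sigma>D(5)[OF c(1) c'(1)])
   show "\<rho> e (slice (z \<oplus>.PM' z') l) (c l \<oplus>.M c' l)" if "l \<in> idx t n" for l
    unfolding slice_add by (rule \<rho>_add[OF c(2)[OF that] c'(2)[OF that]])
  qed
  then show "\<rho>' e (\<lambda>i. z i \<oplus> z' i) (h \<oplus>.H h')" by (simp add: power_module_simps)
 next
  fix e z h r assume r: "r \<in> carrier R" and "\<rho>' e z h"
  then obtain c where c: "\<sigma> e c h" "!!l. l \<in> idx t n ==> \<rho> e (slice z l) (c l)" and z: "z \<in> Z' e"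
   unfolding \<rho>'_def by blast
  have "\<rho>' e (r \<odot>.PM' z) (r \<odot>.H h)"
   unfolding \<rho>'_def
  proof (intro conjI exI ballI)
   show "r \<odot>.PM' z \<in> Z' e" by (rule PM'.submodule_simps(4)[OF Z'_submodule r z])
   show "\<sigma> e (\<lambda>l. r \<odot>.M c l) (r \<odot>.H h)" by (rule \<sigma>D(6)[OF r c(1)])
   show "\<rho> e (slice (r \<odot>.PM' z) l) (r \<odot>.M c l)" if "l \<in> idx t n" for l
    unfolding slice_smult by (rule \<rho>_smult[OF r c(2)[OF that]])
  qed
  then show "\<rho>' e (\<lambda>i. r \<otimes> z i) (r \<odot>.H h)" using r by (simp add: power_module_simps)
 qed
qed (fact finite_X' H_module Z'_submodule B'_submodule Z'_frob B'_frob \<tau>'_closed \<tau>'_same \<tau>'_\<tau>' B'_\<tau>')+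

end

section \<open>Associated primes at finite levels\<close>

context frob_pres
begin

text \<open>Here c ranges over all functions and not only over \<open>Z e\<close>: the set of primes
  may grow, but it remains finite at each level and is still governed by the descent to lower
  levels.\<close>

definition ann_prime :: "nat => 'a set => bool" where
 "ann_prime e P \<longleftrightarrow> (\<exists>c\<in>carrier PM. P = {r \<in> carrier R. (\<lambda>i. fr e r \<otimes> c i) \<in> B e})"

text \<open>P is finitely generated, so at some level g all of P kills the representative c' modulo
  \<open>B g\<close>; nothing else does, since elements of \<open>B g\<close> are zero in M.\<close>

lemma associated_prime_level:
 assumes noeth: "noetherian_ring R" and P: "P \<in> associated_primes R M"
 shows "\<exists>e. ann_prime e P"
proof -
 interpret noetherian_ring R by fact
 interpret P: primeideal P R using P by (simp add: associated_primes_def)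
 obtain w where w: "w \<in> carrier M" "P = {r \<in> carrier R. r \<odot>.M w = \<zero>.M}"
  using P by (auto simp: associated_primes_def)
 obtain e c where c: "\<rho> e c w" using \<rho>D(4)[OF w(1)] by (elim exE)
 obtain A where A: "A \<subseteq> carrier R" "finite A" "P = Idl A" using finetely_gen[OF P.ideal_axioms] by blast
 have AP: "A \<subseteq> P" using genideal_self[OF A(1)] A(3) by simp
 have "\<rho> e (r \<odot>.PM c) \<zero>.M" if r: "r \<in> A" for r
 proof -
  have rP: "r \<in> P" using AP r by (rule subsetD)
  then have 0: "r \<odot>.M w = \<zero>.M" using w(2) by blast
  show ?thesis using \<rho>_smult[OF P.Icarr[OF rP] c] unfolding 0 .
 qed
 from \<rho>_zero_push_uniform[where S = A and z = "\<lambda>r. r \<odot>.PM c", OF A(2) this] obtain g where g: "e \<le> g"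
  and gA: "!!r. r \<in> A ==> push e g (r \<odot>.PM c) \<in> B g" by blast
 define c' where "c' = push e g c"
 have c': "\<rho> g c' w" unfolding c'_def by (rule push_\<rho>[OF g c])
 note B_simps = PM.submodule_simps[OF B_submodule]
 define J where "J = {r \<in> carrier R. r \<odot>.PM c' \<in> B g}"
 interpret RM: module R "ring_module R" by (rule ring_module_is_module)
 have "submodule J R (ring_module R)"
 proof (rule RM.submoduleI')
  note cc = \<rho>_PM[OF c']
  show "\<zero>\<^bsub>ring_module R\<^esub> \<in> J" using B_simps(2) cc by (simp add: J_def ring_module_def)
  show "r \<oplus>\<^bsub>ring_module R\<^esub> s \<in> J" if "r \<in> J" "s \<in> J" for r s
   using that cc B_simps(3) by (simp add: J_def PM.smult_l_distr)
  show "r \<odot>\<^bsub>ring_module R\<^esub> s \<in> J" if "r \<in> carrier R" "s \<in> J" for r s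
   using that cc B_simps(4) by (simp add: J_def PM.smult_assoc1)
 qed (auto simp: J_def ring_module_def)
 then have J: "ideal J R" by (simp add: ideal_iff_submodule)
 have "r \<in> J" if "r \<in> A" for r
 proof -
  have r: "r \<in> carrier R" using A(1) that by (rule subsetD)
  show ?thesis using gA[OF that] mod_homD(3)[OF push_hom r \<rho>_PM[OF c], of e g] r by (simp add: J_def c'_def)
 qed
 then have PJ: "P \<subseteq> J" unfolding A(3) by (intro genideal_minimal[OF J]) auto
 have JP: "r \<in> P" if "r \<in> J" for r
 proof -
  have r: "r \<in> carrier R" "r \<odot>.PM c' \<in> B g" using that by (simp_all add: J_def)
  show ?thesis using \<rho>_B[OF \<rho>_smult[OF r(1) c'] r(2)] w(2) r(1) by blast
 qed
 \<comment> \<open>Primality makes the annihilators for the ordinary action and for the action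
   through F^g_*R coincide.\<close>
 have fr_P: "fr g r \<in> P \<longleftrightarrow> r \<in> P" if r: "r \<in> carrier R" for r
 proof
  assume "r \<in> P"
  moreover obtain y where "y \<in> carrier R" "fr g r = y \<otimes> r" using fr_multiple[OF r] by blast
  ultimately show "fr g r \<in> P" using P.I_l_closed by simp
 next
  assume "fr g r \<in> P"
  then show "r \<in> P" using prime_pow_notin[OF P.primeideal_axioms r] by (auto simp: frob_def)
 qed
 have "P = {r \<in> carrier R. (\<lambda>i. fr g r \<otimes> c' i) \<in> B g}"
 proof -
  have "(\<lambda>i. fr g r \<otimes> c' i) \<in> B g \<longleftrightarrow> r \<in> P" if r: "r \<in> carrier R" for r
  proof -
   have "(\<lambda>i. fr g r \<otimes> c' i) \<in> B g \<longleftrightarrow> fr g r \<in> J" using r by (simp add: J_def PM_simps)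
   also have "\<dots> \<longleftrightarrow> fr g r \<in> P" using PJ JP by blast
   finally show ?thesis using fr_P[OF r] by simp
  qed
  then show ?thesis using P.Icarr by blast
 qed
 then show ?thesis unfolding ann_prime_def using \<rho>_PM[OF c'] by blast
qed

text \<open>Let the identity be a sum of composites g h through lower levels, and let P be the
  annihilator of c. Then P kills each h(c). If no h(c) had annihilator exactly P, each would be
  killed by some s outside P, and so would g(h(c)); the product of these s would lie outside P and
  kill c.\<close>

lemma ann_prime_descend:
 assumes P: "primeideal P R" and Pe: "ann_prime e P" and id: "(\<lambda>u. u) \<in> lower_factoring R p e"
 shows "\<exists>e'<e. ann_prime e' P"
proof (rule ccontr)
 assume neg: "\<not> ?thesis"
 interpret P: primeideal P R by fact
 note B_simps = PM.submodule_simps[OF B_submodule]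
 obtain c where c: "c \<in> carrier PM" and Pc: "P = {r \<in> carrier R. (\<lambda>i. fr e r \<otimes> c i) \<in> B e}"
  using Pe by (auto simp: ann_prime_def)
 note ci = power_module_closed[OF c]
 have scale: "(\<lambda>i. fr e r \<otimes> z i) \<in> B e" if "r \<in> carrier R" "z \<in> B e" for r z
  using B_simps(4)[of "fr e r" z e] that by (simp add: PM_simps)
 \<comment> \<open>Proved for every map that factors through lower levels, by induction over its
   summands; the identity then gives the contradiction.\<close>
 have "\<exists>r\<in>carrier R - P. (\<lambda>i. fr e r \<otimes> f (c i)) \<in> B e" if "f \<in> lower_factoring R p e" for f
  using that
 proof (induction rule: lower_factoring.induct)
  case (zero f)
  then have "(\<lambda>i. fr e \<one> \<otimes> f (c i)) = \<zero>.PM" using ci by (simp add: PM_simps)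
  then show ?case using B_simps(2) prime_one_notin[OF P] by (intro bexI[of _ \<one>]) simp_all
 next
  case (add_comp f' e' h g f)
  obtain r where r: "r \<in> carrier R" "r \<notin> P" "(\<lambda>i. fr e r \<otimes> f' (c i)) \<in> B e" using add_comp.IH by blast
  note f'c = frob_homD(1)[OF lower_factoring_frob_hom[OF add_comp.hyps(1)]]
  note h = frob_homD[OF add_comp.hyps(3)] and g = frob_homD[OF add_comp.hyps(4)]
  have hc: "(\<lambda>i. h (c i)) \<in> carrier PM" using c h(1) frob_hom_zero[OF add_comp.hyps(3)] by (simp add: PM_simps)
  have "s \<in> {s \<in> carrier R. (\<lambda>i. fr e' s \<otimes> h (c i)) \<in> B e'}" if s: "s \<in> P" for s
  proof -
   have sc: "s \<in> carrier R" "(\<lambda>i. fr e s \<otimes> c i) \<in> B e" using s Pc by blast+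
   from B_frob[OF add_comp.hyps(3) sc(2)] show ?thesis using sc(1) h(3)[OF sc(1) ci] by simp
  qed
  moreover have "P \<noteq> {s \<in> carrier R. (\<lambda>i. fr e' s \<otimes> h (c i)) \<in> B e'}"
  proof
   assume "P = {s \<in> carrier R. (\<lambda>i. fr e' s \<otimes> h (c i)) \<in> B e'}"
   with hc have "ann_prime e' P" unfolding ann_prime_def by (intro bexI[of _ "\<lambda>i. h (c i)"])
   then show False using neg add_comp.hyps(2) by blast
  qed
  ultimately obtain s where s: "s \<in> carrier R" "s \<notin> P" "(\<lambda>i. fr e' s \<otimes> h (c i)) \<in> B e'" by blast
  have gs: "(\<lambda>i. fr e s \<otimes> g (h (c i))) \<in> B e"
   using B_frob[OF add_comp.hyps(4) s(3)] g(3)[OF s(1) h(1)[OF ci]] by simp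
  have "(\<lambda>i. fr e (r \<otimes> s) \<otimes> f (c i)) = (\<lambda>i. fr e s \<otimes> (fr e r \<otimes> f' (c i))) \<oplus>.PM (\<lambda>i. fr e r \<otimes> (fr e s \<otimes> g (h (c i))))"
   unfolding PM_simps
  proof (rule ext)
   fix i
   have k: "f' (c i) \<in> carrier R" "g (h (c i)) \<in> carrier R" "fr e r \<in> carrier R" "fr e s \<in> carrier R"
    using f'c g(1) h(1) ci r(1) s(1) by simp_all
   show "fr e (r \<otimes> s) \<otimes> f (c i) = fr e s \<otimes> (fr e r \<otimes> f' (c i)) \<oplus> fr e r \<otimes> (fr e s \<otimes> g (h (c i)))"
    unfolding add_comp.hyps(5)[OF ci] fr_mult[OF r(1) s(1)] using k by algebra
  qed
  then have "(\<lambda>i. fr e (r \<otimes> s) \<otimes> f (c i)) \<in> B e"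
   using B_simps(3)[OF scale[OF s(1) r(3)] scale[OF r(1) gs]] by simp
  moreover have "r \<otimes> s \<in> carrier R - P" using r(1,2) s(1,2) by (intro prime_mult_notin[OF P]) simp_all
  ultimately show ?case by blast
 qed
 from this[OF id] show False using Pc by blast
qed

end

lemma (in ffin_ring) finite_associated_primes:
 assumes pres: "frob_pres R p X Z B \<tau> M \<rho>" and id: "(\<lambda>u. u) \<in> lower_factoring R p e0"
 shows "finite (associated_primes R M)"
proof -
 interpret frob_pres R p X Z B \<tau> M \<rho> by (rule pres)
 define \<A> where "\<A> e = {P. primeideal P R \<and> ann_prime e P}" for e
 have fin\<A>: "finite (\<A> e)" for e
 proof -
  interpret PMe: module R "power_module R p e X" by (rule power_module_module)
  note B_simps = PM.submodule_simps[OF B_submodule]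
  have cc: "carrier (power_module R p e X) = carrier PM" by (simp add: power_module_def)
  have "submodule (B e) R (power_module R p e X)"
  proof (rule PMe.submoduleI')
   show "B e \<subseteq> carrier (power_module R p e X)" using B_simps(1) cc by blast
   show "r \<odot>\<^bsub>power_module R p e X\<^esub> z \<in> B e" if "r \<in> carrier R" "z \<in> B e" for r z
    using B_simps(4)[of "fr e r" z e] that by (simp add: power_module_simps)
  qed (use B_simps(2,3) in \<open>simp_all add: power_module_simps\<close>)
  from PMe.finite_primes_colon[OF noeth_power_module[OF fin] this]
  show ?thesis by (simp add: \<A>_def ann_prime_def power_module_simps(4) cc)
 qed
 have descend: "ann_prime e P ==> \<exists>e'<e0. ann_prime e' P" if P: "primeideal P R" for P e
 proof (induction e rule: less_induct)
  case (less e)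
  show ?case
  proof (cases "e < e0")
   case False
   then have "(\<lambda>u. u) \<in> lower_factoring R p e" using id_lower_factoring_mono[OF id] by simp
   from ann_prime_descend[OF P less.prems this] show ?thesis using less.IH by blast
  qed (use less.prems in blast)
 qed
 have "associated_primes R M \<subseteq> (\<Union>e<e0. \<A> e)"
 proof
  fix P assume P: "P \<in> associated_primes R M"
  then have pP: "primeideal P R" by (simp add: associated_primes_def)
  from associated_prime_level[OF noeth P] obtain e where "ann_prime e P" ..
  from descend[OF pP this] show "P \<in> (\<Union>e<e0. \<A> e)" using pP by (auto simp: \<A>_def)
 qed
 then show ?thesis using fin\<A> finite_subset by blast
qed

text \<open>The base of the iteration: a constant system with one coordinate, indexed by the empty
  list as the neutral element of concatenation.\<close>

lemma (in char_ring) frob_pres_ring_module: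
 fixes H :: "('a, 'e) module"
 assumes H: "module R H" and iso: "mod_iso R H (ring_module R)"
 shows "\<exists>\<rho>. frob_pres R p {[]} (\<lambda>_. carrier (power_module R p 0 {[]})) (\<lambda>_. {\<zero>\<^bsub>power_module R p 0 {[]}\<^esub>})
  (\<lambda>_ _ _. \<one>) H \<rho>"
proof -
 interpret H: module R H by fact
 let ?PM = "power_module R p 0 {[]} :: ('a, nat list => 'a) module"
 interpret PM: module R ?PM by (rule power_module_module)
 obtain h where h: "h \<in> mod_hom R H (ring_module R)" and bij: "bij_betw h (carrier H) (carrier (ring_module R))"
  using iso by (auto simp: mod_iso_def)
 note hD = mod_homD[OF h]
 have sm: "z \<in> carrier ?PM \<longleftrightarrow> z [] \<in> carrier R \<and> (\<forall>i. i \<noteq> [] --> z i = \<zero>)" for z by (auto simp: power_module_simps)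
 have h0: "h u = \<zero> \<longleftrightarrow> u = \<zero>.H" if "u \<in> carrier H" for u
  using mod_hom_zero[OF h H ring_module_is_module] inj_on_eq_iff[OF bij_betw_imp_inj_on[OF bij] that H.M.zero_closed]
  by (simp add: ring_module_def)
 have "colim_pres R (ring_module R) H (\<lambda>_ _ _. \<one>) (\<lambda>_. carrier ?PM) (\<lambda>_. {\<zero>.?PM}) (carrier H) {\<zero>.H}
  (\<lambda>e z u. z \<in> carrier ?PM \<and> u \<in> carrier H \<and> h u = z [])"
 proof (rule colim_presI)
  show "\<exists>u. z \<in> carrier ?PM \<and> u \<in> carrier H \<and> h u = z []" if "z \<in> carrier ?PM" for z
  proof -
   have "z [] \<in> h ` carrier H" using bij \<open>z \<in> carrier ?PM\<close> by (simp add: bij_betw_def ring_module_def sm)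
   then show ?thesis using \<open>z \<in> carrier ?PM\<close> by auto
  qed
  show "\<exists>(e::nat) z. z \<in> carrier ?PM \<and> u \<in> carrier H \<and> h u = z []" if "u \<in> carrier H" for u
   using that hD(1)[OF that] by (intro exI[of _ "0::nat"] exI[of _ "\<lambda>i. if i = [] then h u else \<zero>"]) (simp add: sm ring_module_def)
  show "(\<lambda>i. z i \<oplus>\<^bsub>ring_module R\<^esub> z' i) \<in> carrier ?PM \<and> u \<oplus>.H u' \<in> carrier H \<and>
    h (u \<oplus>.H u') = z [] \<oplus>\<^bsub>ring_module R\<^esub> z' []"
   if "z \<in> carrier ?PM \<and> u \<in> carrier H \<and> h u = z []" "z' \<in> carrier ?PM \<and> u' \<in> carrier H \<and> h u' = z' []" for z u z' u'
   using that hD(2) by (simp add: sm ring_module_def)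
  show "(\<lambda>i. r \<odot>\<^bsub>ring_module R\<^esub> z i) \<in> carrier ?PM \<and> r \<odot>.H u \<in> carrier H \<and> h (r \<odot>.H u) = r \<odot>\<^bsub>ring_module R\<^esub> z []"
   if "r \<in> carrier R" "z \<in> carrier ?PM \<and> u \<in> carrier H \<and> h u = z []" for z u r
   using that hD(3) by (simp add: sm ring_module_def)
  show "(\<lambda>i. \<one> \<odot>\<^bsub>ring_module R\<^esub> z i) \<in> carrier ?PM \<and> u \<in> carrier H \<and> h u = \<one> \<odot>\<^bsub>ring_module R\<^esub> z []"
   if "z \<in> carrier ?PM \<and> u \<in> carrier H \<and> h u = z []" for z u
   using that by (simp add: sm ring_module_def)
  show "\<exists>e'\<ge>e. (\<lambda>i. \<one> \<odot>\<^bsub>ring_module R\<^esub> z i) \<in> {\<zero>.?PM}"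
   if "z \<in> carrier ?PM \<and> u \<in> carrier H \<and> h u = z []" "u \<in> {\<zero>.H}" for e :: nat and z u
  proof -
   have "z i = \<zero>" for i using that h0[of u] by (cases "i = []") (auto simp: sm)
   then show ?thesis by (auto simp: power_module_simps ring_module_def fun_eq_iff)
  qed
  show "u \<in> {\<zero>.H}" if "z \<in> carrier ?PM \<and> u \<in> carrier H \<and> h u = z []"
   "(\<lambda>i. \<one> \<odot>\<^bsub>ring_module R\<^esub> z i) \<in> {\<zero>.?PM}" for z u
  proof -
   have "\<one> \<otimes> z [] = \<zero>" using that(2) by (simp add: power_module_simps ring_module_def fun_eq_iff)
   then show ?thesis using that(1) h0[of u] by (simp add: sm)
  qed
 qed simp_all
 moreover have "submodule (carrier ?PM) R ?PM" "submodule {\<zero>.?PM} R ?PM"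
  by (rule PM.submoduleI'; simp)+
 ultimately have "frob_pres R p {[]} (\<lambda>_. carrier ?PM) (\<lambda>_. {\<zero>.?PM}) (\<lambda>_ _ _. \<one>) H
  (\<lambda>e z u. z \<in> carrier ?PM \<and> u \<in> carrier H \<and> h u = z [])"
  using frob_hom_zero frob_homD(1)
  by (intro frob_pres.intro frob_pres_axioms.intro char_ring_axioms H) (auto simp: power_module_simps)
 then show ?thesis by iprover
qed

lemma (in ffin_ring) iterated_local_cohomology_frob_pres:
 fixes H :: "('a, 'e) module"
 shows "\<forall>(I, i) \<in> set Is. ideal I R ==> iterated_local_cohomology R Is H ==> \<exists>X Z B \<tau> \<rho>. frob_pres R p X Z B \<tau> H \<rho>"
proof (induction Is arbitrary: H)
 case Nil
 then have "module R H" "mod_iso R H (ring_module R)" by simp_all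
 from frob_pres_ring_module[OF this] show ?case by iprover
next
 case (Cons Ii Is)
 obtain I i where Ii: "Ii = (I, i)" by (cases Ii)
 interpret noetherian_ring R by (rule noeth)
 obtain M :: "('a, 'e) module" where M: "iterated_local_cohomology R Is M" and lc: "local_cohomology R I i M H"
  using Cons.prems by (auto simp: Ii)
 obtain X Z B \<tau> \<rho> where "frob_pres R p X Z B \<tau> M \<rho>" using Cons.IH[OF _ M] Cons.prems by auto
 then interpret frob_pres R p X Z B \<tau> M \<rho> .
 obtain A where A: "A \<subseteq> carrier R" "finite A" "I = Idl A" using finetely_gen[of I] Cons.prems by (auto simp: Ii)
 obtain xs where xs: "set xs = A" using finite_list[OF A(2)] ..
 \<comment> \<open>A finite list of generators, padded by zero to a total sequence in R; only the
   indices below its length enter the ideal.\<close>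
 define x where "x j = (if j < length xs then xs ! j else \<zero>)" for j
 have "x ` {..<length xs} = set xs" by (auto simp: x_def set_conv_nth)
 then have xI: "Idl (x ` {..<length xs}) = I" using xs A(3) by simp
 have "xs ! j \<in> carrier R" if "j < length xs" for j using nth_mem[OF that] xs A(1) by blast
 then have xc: "x j \<in> carrier R" for j by (simp add: x_def)
 interpret cech R p x "length xs" by (intro cech.intro cech_axioms.intro char_ring_axioms xc noeth)
 obtain \<sigma> where \<sigma>: "colim_pres R M H trans (cocycles M (carrier M) i) (coboundaries M (carrier M) i) (carrier H) {\<zero>.H} \<sigma>"
  using colim_pres_local_cohomology[of i M H] lc unfolding xI by iprover
 have mH: "module R H" using lc by (simp add: local_cohomology_def)
 interpret frob_pres_cech R p X Z B \<tau> M \<rho> x "length xs" i H \<sigma>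
  by (intro frob_pres_cech.intro frob_pres_cech_axioms.intro frob_pres_axioms cech_axioms mH \<sigma>)
 show ?case by (intro exI) (rule frob_pres_H)
qed

theorem corollary6p8:
  fixes R :: "('a, 'k) ring_scheme"
    and p :: nat
    and Is :: "('a set \<times> nat) list"
    and H :: "('a, 'e) module"
  assumes "normalization_semidom_class.prime p"
    and "cring R"
    and "has_char R p"
    and "CL_FFRT p R"
    and "\<forall>(I, i) \<in> set Is. ideal I R"
    and "iterated_local_cohomology R Is H"
  shows "finite (associated_primes R H)"
proof -
 interpret cring R by fact
 interpret ffin_ring R p
  using assms(1,3,4) by unfold_locales (simp_all add: has_char_def CL_FFRT_def)
 show ?thesis
  using iterated_local_cohomology_frob_pres[OF assms(5,6)] CL_FFRT_imp_id_lower_factoring[OF assms(4)]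
   finite_associated_primes by blast
qed

end
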